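(* Let $0<\alpha<1$, $-1<\mu<0$. Assume that $u^0\equiv 0$ and that $f$ satisfies Assumption (A) with exponent $\mu$ (see context). Let $u_h$ be the solution of the spatially semidiscrete problem ($\mathrm{P}_h$), and $\tilde u_h^n$ the solution of the GLBE scheme, both described in the context. Then there is a constant $c>0$, independent of $\tau$, $n$ and $h$, such that $$\|u_h(t_n)-\tilde u_h^n\|\le c\left(t_n^{\alpha+\mu-1}\tau+t_n^{\alpha-2}\tau^{2+\mu}\right),\qquad 1\le n\le N.$$
   Context: $\Omega\subset\mathbb{R}^d$, $d\in\{1,2\}$; $T>0$; $\|\cdot\|$ and $(\cdot,\cdot)$ denote the norm and inner product of $L^2(\Omega)$. Caputo derivative: ${^C}D_t^{\alpha}u(t)=\frac{1}{\Gamma(1-\alpha)}\int_0^t(t-s)^{-\alpha}u'(s)\,\mathrm{d}s$. The continuous problem is ${^C}D_t^{\alpha}u-\Delta u=f$ in $\Omega\times(0,T]$, $u=0$ on $\partial\Omega$, $u(x,0)=u^0(x)$. Sector: for $\theta\in(\pi/2,\pi)$, $\Sigma_\theta=\{z\in\mathbb{C}\setminus\{0\}:|\arg z|<\theta\}$. Assumption (A) with exponent $\mu$, $-1<\mu<0$: $f\in L^1(0,T;L^2(\Omega))$, and its Laplace transform in time $\hat f(x,s)=\int_0^\infty e^{-st}f(x,t)\,\mathrm{d}t$ ($f$ being understood as given for all $t>0$) is analytic in $\Sigma_\theta$ (as an $L^2(\Omega)$-valued function, after continuation) for a fixed $\theta\in(\pi/2,\pi)$ and satisfies $\|\hat f(s)\|\le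 c_f|s|^{-\mu-1}$ for $s\in\Sigma_\theta$. Space discretization: $\mathcal{T}_h$ is a regular triangulation of $\Omega$ into $d$-simplexes with maximal diameter $h$; $X_h\subset H_0^1(\Omega)$ is the space of continuous piecewise linear functions on $\mathcal{T}_h$; $P_h:L^2(\Omega)\to X_h$ is the $L^2$-projection; $\Delta_h:X_h\to X_h$ is defined by $-(\Delta_h\varphi,\psi)=(\nabla\varphi,\nabla\psi)$ for all $\varphi,\psi\in X_h$. Problem ($\mathrm{P}_h$): ${^C}D_t^{\alpha}u_h(t)-\Delta_hu_h(t)=f_h(t)$ for $t>0$, with $u_h(0)=P_hu^0$ and $f_h=P_hf$. Time grid: $\tau=T/N$, $t_n=n\tau$, $0\le n\le N$. GLBE scheme: let $F_h(t)=\int_0^tf_h(\xi)\,\mathrm{d}\xi$, $F_h^n=F_h(t_n)$, and let $\sigma_j$ be the coefficients in $\sum_{j=0}^\infty\sigma_j\xi^j=(1-\xi)^{\alpha}$. With $\tilde U_h^0=0$, for $1\le n\le N$ find $\tilde U_h^n\in X_h$ and $\tilde u_h^n\in X_h$ with $$\tau^{-\alpha}\sum_{j=0}^n\sigma_j\tilde U_h^{n-j}=\Delta_h\tilde U_h^n+F_h^n+\frac{t_n^{1-\alpha}}{\Gamma(2-\alpha)}u_h(0),\qquad \tilde u_h^n=\tau^{-1}\big(\tilde U_h^n-\tilde U_h^{n-1}\big).$$ *)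

theory Defs
  imports "HOL-Analysis.Analysis"
begin

section \<open>The Lebesgue space on a domain\<close>

text \<open>
  The library has no type of classes of square-integrable functions. Elements of
  \<open>L\<^sup>2(\<Omega>)\<close> are represented by functions; equality in \<open>L\<^sup>2(\<Omega>)\<close> is equality
  almost everywhere on \<open>\<Omega>\<close>.
\<close>

definition L2 :: "'a::euclidean_space set \<Rightarrow> ('a \<Rightarrow> 'b::euclidean_space) set" where
  "L2 \<Omega> = {g \<in> borel_measurable (lebesgue_on \<Omega>).
              integrable (lebesgue_on \<Omega>) (\<lambda>x. (norm (g x))\<^sup>2)}"

definition l2_inner :: "'a::euclidean_space set \<Rightarrow> ('a \<Rightarrow> 'b::euclidean_space) \<Rightarrow> ('a \<Rightarrow> 'b) \<Rightarrow> real" where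
  "l2_inner \<Omega> g k = (LINT x|lebesgue_on \<Omega>. g x \<bullet> k x)"

definition l2_norm :: "'a::euclidean_space set \<Rightarrow> ('a \<Rightarrow> 'b::euclidean_space) \<Rightarrow> real" where
  "l2_norm \<Omega> g = sqrt (LINT x|lebesgue_on \<Omega>. (norm (g x))\<^sup>2)"

text \<open>
  \<open>L\<^sup>1(I; L\<^sup>2(\<Omega>))\<close>. Every Bochner integrable function from \<open>I\<close> to \<open>L\<^sup>2(\<Omega>)\<close> has a
  representative that is jointly measurable in \<open>(t, x)\<close>, so joint measurability is no restriction.
\<close>

definition L1_L2 :: "real set \<Rightarrow> 'a::euclidean_space set \<Rightarrow> (real \<Rightarrow> 'a \<Rightarrow> real) set" where
  "L1_L2 I \<Omega> = {f. (\<lambda>(t, x). f t x) \<in> borel_measurable (lebesgue_on I \<Otimes>\<^sub>M lebesgue_on \<Omega>) \<and>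
                    (AE t in lebesgue_on I. f t \<in> L2 \<Omega>) \<and>
                    integrable (lebesgue_on I) (\<lambda>t. l2_norm \<Omega> (f t))}"

section \<open>The assumption on the source term\<close>

definition sector :: "real \<Rightarrow> complex set" where
  "sector \<theta> = {z. z \<noteq> 0 \<and> \<bar>Arg z\<bar> < \<theta>}"

text \<open>Complex differentiability with respect to the norm of \<open>L\<^sup>2(\<Omega>)\<close> on an open set \<open>S\<close>.\<close>

definition L2_analytic_on ::
    "'a::euclidean_space set \<Rightarrow> (complex \<Rightarrow> 'a \<Rightarrow> complex) \<Rightarrow> complex set \<Rightarrow> bool" where
  "L2_analytic_on \<Omega> G S \<longleftrightarrow>
     (\<forall>s\<in>S. G s \<in> L2 \<Omega> \<and>
        (\<exists>D\<in>L2 \<Omega>. ((\<lambda>w. l2_norm \<Omega> (\<lambda>x. (G w x - G s x) / (w - s) - D x)) \<longlongrightarrow> 0) (at s)))"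

definition laplace :: "(real \<Rightarrow> 'a \<Rightarrow> real) \<Rightarrow> complex \<Rightarrow> 'a \<Rightarrow> complex" where
  "laplace f s x = (LINT t|lebesgue_on {0<..}. exp (- s * of_real t) * of_real (f t x))"

text \<open>
  \<open>G\<close> is the analytic continuation to the sector of the Laplace transform of \<open>f\<close>, the latter being
  absolutely convergent in \<open>L\<^sup>2(\<Omega>)\<close> in some right half plane.
\<close>

definition assumption_A ::
    "'a::euclidean_space set \<Rightarrow> real \<Rightarrow> real \<Rightarrow> real \<Rightarrow> real \<Rightarrow> (real \<Rightarrow> 'a \<Rightarrow> real) \<Rightarrow> bool" where
  "assumption_A \<Omega> T \<mu> \<theta> c\<^sub>f f \<longleftrightarrow>
     f \<in> L1_L2 {0<..<T} \<Omega> \<and>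
     (\<exists>\<omega>\<ge>0. \<exists>G.
        (\<lambda>t x. exp (- \<omega> * t) * f t x) \<in> L1_L2 {0<..} \<Omega> \<and>
        (\<forall>s. Re s > \<omega> \<longrightarrow> (AE x in lebesgue_on \<Omega>. G s x = laplace f s x)) \<and>
        L2_analytic_on \<Omega> G (sector \<theta>) \<and>
        (\<forall>s\<in>sector \<theta>. l2_norm \<Omega> (G s) \<le> c\<^sub>f * cmod s powr (- \<mu> - 1)))"

section \<open>Finite elements\<close>

text \<open>
  The library predicate \<^const>\<open>triangulation\<close> says that there are finitely many simplices and that two
  of them meet in a common face. Regularity of a family of triangulations is shape regularity: the
  ratio of the diameter of a simplex to the radius of some ball inside it is bounded by a number
  \<open>\<kappa>\<close> common to the family.
\<close>

definition regular_triangulation ::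
    "real \<Rightarrow> 'a::euclidean_space set \<Rightarrow> real \<Rightarrow> 'a set set \<Rightarrow> bool" where
  "regular_triangulation \<kappa> \<Omega> h \<T> \<longleftrightarrow>
     triangulation \<T> \<and> (\<forall>K\<in>\<T>. int DIM('a) simplex K) \<and> \<Union>\<T> = closure \<Omega> \<and>
     h = Max (diameter ` \<T>) \<and>
     (\<forall>K\<in>\<T>. \<exists>x r. 0 < r \<and> cball x r \<subseteq> K \<and> diameter K \<le> \<kappa> * r)"

text \<open>The gradient; on continuous piecewise linear functions it is defined almost everywhere.\<close>

definition grad :: "('a::euclidean_space \<Rightarrow> real) \<Rightarrow> 'a \<Rightarrow> 'a" where
  "grad v x = (THE D. GDERIV v x :> D)"

primrec Ck :: "nat \<Rightarrow> ('a::euclidean_space \<Rightarrow> real) \<Rightarrow> bool" where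
  "Ck 0 v \<longleftrightarrow> continuous_on UNIV v"
| "Ck (Suc k) v \<longleftrightarrow> v differentiable_on UNIV \<and>
     (\<forall>b\<in>Basis. Ck k (\<lambda>x. frechet_derivative v (at x) b))"

definition test_functions :: "'a::euclidean_space set \<Rightarrow> ('a \<Rightarrow> real) set" where
  "test_functions \<Omega> = {\<phi>. (\<forall>k. Ck k \<phi>) \<and> (\<exists>K. compact K \<and> K \<subseteq> \<Omega> \<and> (\<forall>x. x \<notin> K \<longrightarrow> \<phi> x = 0))}"

text \<open>
  \<open>H\<^sub>0\<^sup>1(\<Omega>)\<close> as the closure of the test functions in the norm of \<open>H\<^sup>1(\<Omega>)\<close>; the function \<open>g\<close>
  below is then the weak gradient of \<open>v\<close>.
\<close>

definition H10 :: "'a::euclidean_space set \<Rightarrow> ('a \<Rightarrow> real) set" where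
  "H10 \<Omega> = {v \<in> L2 \<Omega>. \<exists>\<phi>. \<exists>g\<in>L2 \<Omega>. (\<forall>k. \<phi> k \<in> test_functions \<Omega>) \<and>
              (\<lambda>k::nat. l2_norm \<Omega> (\<lambda>x. \<phi> k x - v x)) \<longlonglongrightarrow> 0 \<and>
              (\<lambda>k. l2_norm \<Omega> (\<lambda>x. grad (\<phi> k) x - g x)) \<longlonglongrightarrow> 0}"

text \<open>
  Finite element functions live on \<open>closure \<Omega>\<close>; they are set to zero elsewhere, so that equality
  of two of them is equality as HOL functions.
\<close>

definition Xh :: "'a::euclidean_space set \<Rightarrow> 'a set set \<Rightarrow> ('a \<Rightarrow> real) set" where
  "Xh \<Omega> \<T> = {v \<in> H10 \<Omega>. continuous_on (closure \<Omega>) v \<and>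
                (\<forall>K\<in>\<T>. \<exists>a b. \<forall>x\<in>K. v x = a \<bullet> x + b) \<and>
                (\<forall>x. x \<notin> closure \<Omega> \<longrightarrow> v x = 0)}"

definition Ph :: "'a::euclidean_space set \<Rightarrow> 'a set set \<Rightarrow> ('a \<Rightarrow> real) \<Rightarrow> 'a \<Rightarrow> real" where
  "Ph \<Omega> \<T> g = (THE v. v \<in> Xh \<Omega> \<T> \<and> (\<forall>\<psi>\<in>Xh \<Omega> \<T>. l2_inner \<Omega> v \<psi> = l2_inner \<Omega> g \<psi>))"

definition Laph :: "'a::euclidean_space set \<Rightarrow> 'a set set \<Rightarrow> ('a \<Rightarrow> real) \<Rightarrow> 'a \<Rightarrow> real" where
  "Laph \<Omega> \<T> \<phi> = (THE v. v \<in> Xh \<Omega> \<T> \<and>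
     (\<forall>\<psi>\<in>Xh \<Omega> \<T>. - l2_inner \<Omega> v \<psi> = l2_inner \<Omega> (grad \<phi>) (grad \<psi>)))"

section \<open>The semidiscrete problem\<close>

definition caputo :: "real \<Rightarrow> (real \<Rightarrow> real) \<Rightarrow> real \<Rightarrow> real" where
  "caputo \<alpha> g t = 1 / Gamma (1 - \<alpha>) *
     (LINT s|lebesgue_on {0<..<t}. (t - s) powr (- \<alpha>) * deriv g s)"

text \<open>
  The problem read literally: \<open>u\<close> is absolutely continuous in time, and the equation holds
  for almost every \<open>t > 0\<close> (the source term is given only up to null sets of times).
\<close>

definition Ph_classical ::
    "'a::euclidean_space set \<Rightarrow> 'a set set \<Rightarrow> real \<Rightarrow> (real \<Rightarrow> 'a \<Rightarrow> real) \<Rightarrow> ('a \<Rightarrow> real) \<Rightarrow>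
     (real \<Rightarrow> 'a \<Rightarrow> real) \<Rightarrow> bool" where
  "Ph_classical \<Omega> \<T> \<alpha> f u0 u \<longleftrightarrow>
     (\<forall>t\<ge>0. u t \<in> Xh \<Omega> \<T>) \<and> u 0 = Ph \<Omega> \<T> u0 \<and>
     (\<forall>x. \<forall>t>0. integrable (lebesgue_on {0<..<t}) (deriv (\<lambda>s. u s x)) \<and>
        u t x = u 0 x + (LINT s|lebesgue_on {0<..<t}. deriv (\<lambda>s. u s x) s)) \<and>
     (AE t in lebesgue_on {0<..}. \<forall>x.
        caputo \<alpha> (\<lambda>s. u s x) t - Laph \<Omega> \<T> (u t) x = Ph \<Omega> \<T> (f t) x)"

definition time_integral :: "(real \<Rightarrow> 'a \<Rightarrow> real) \<Rightarrow> real \<Rightarrow> 'a \<Rightarrow> real" where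
  "time_integral g t x = (LINT s|lebesgue_on {0<..<t}. g s x)"

text \<open>
  Under Assumption (A) the solution in general behaves like \<open>t powr (\<alpha> + \<mu>)\<close> as \<open>t \<rightarrow> 0\<close>. For
  \<open>\<alpha> + \<mu> \<le> 0\<close> its time derivative is not integrable at \<open>0\<close>, and neither the Caputo
  integral nor the initial condition makes sense literally. The problem is then understood in
  time-integrated form, which is the equation that the GLBE scheme discretizes: with \<open>U\<close> the time
  integral of \<open>u\<close> and \<open>F\<^sub>h\<close> that of \<open>f\<^sub>h\<close>, the function \<open>U\<close> is to satisfy
  \<open>D\<^sup>\<alpha>U - \<Delta>\<^sub>h U = F\<^sub>h + t powr (1 - \<alpha>) / \<Gamma>(2 - \<alpha>) * u\<^sub>h(0)\<close>.
  It results from integrating the equation of \<^term>\<open>Ph_classical\<close> over \<open>(0, t)\<close>.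
\<close>

definition Ph_integrated ::
    "'a::euclidean_space set \<Rightarrow> 'a set set \<Rightarrow> real \<Rightarrow> (real \<Rightarrow> 'a \<Rightarrow> real) \<Rightarrow> ('a \<Rightarrow> real) \<Rightarrow>
     (real \<Rightarrow> 'a \<Rightarrow> real) \<Rightarrow> bool" where
  "Ph_integrated \<Omega> \<T> \<alpha> f u0 u \<longleftrightarrow>
     (\<forall>t\<ge>0. u t \<in> Xh \<Omega> \<T>) \<and> u 0 = Ph \<Omega> \<T> u0 \<and>
     (\<forall>x. continuous_on {0<..} (\<lambda>t. u t x)) \<and>
     (\<forall>x. \<forall>t>0. integrable (lebesgue_on {0<..<t}) (\<lambda>s. u s x)) \<and>
     (\<forall>t>0. \<forall>x.
        caputo \<alpha> (\<lambda>s. time_integral u s x) t - Laph \<Omega> \<T> (time_integral u t) x =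
          time_integral (\<lambda>s. Ph \<Omega> \<T> (f s)) t x + t powr (1 - \<alpha>) / Gamma (2 - \<alpha>) * u 0 x)"

definition Ph_solution ::
    "'a::euclidean_space set \<Rightarrow> 'a set set \<Rightarrow> real \<Rightarrow> (real \<Rightarrow> 'a \<Rightarrow> real) \<Rightarrow> ('a \<Rightarrow> real) \<Rightarrow>
     (real \<Rightarrow> 'a \<Rightarrow> real) \<Rightarrow> bool" where
  "Ph_solution \<Omega> \<T> \<alpha> f u0 u \<longleftrightarrow> Ph_classical \<Omega> \<T> \<alpha> f u0 u \<or> Ph_integrated \<Omega> \<T> \<alpha> f u0 u"

section \<open>The GLBE scheme\<close>

definition glbe_weight :: "real \<Rightarrow> nat \<Rightarrow> real" where
  "glbe_weight \<alpha> j = (-1) ^ j * (\<alpha> gchoose j)"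

lemma glbe_weight_sums:
  assumes "\<bar>\<xi>\<bar> < 1"
  shows "(\<lambda>j. glbe_weight \<alpha> j * \<xi> ^ j) sums ((1 - \<xi>) powr \<alpha>)"
proof -
  have "(\<lambda>j. (\<alpha> gchoose j) * (- \<xi>) ^ j) sums ((1 + (- \<xi>)) powr \<alpha>)"
    by (rule gen_binomial_real) (use assms in simp)
  moreover have "(\<alpha> gchoose j) * (- \<xi>) ^ j = glbe_weight \<alpha> j * \<xi> ^ j" for j
    unfolding glbe_weight_def by (subst power_minus) simp
  ultimately show ?thesis by simp
qed

text \<open>\<open>U\<close> and \<open>u\<close> are the sequences written with a tilde on paper; \<open>u 0\<close> is not used.\<close>

definition glbe_scheme ::
    "'a::euclidean_space set \<Rightarrow> 'a set set \<Rightarrow> real \<Rightarrow> real \<Rightarrow> nat \<Rightarrow> (real \<Rightarrow> 'a \<Rightarrow> real) \<Rightarrow>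
     ('a \<Rightarrow> real) \<Rightarrow> (nat \<Rightarrow> 'a \<Rightarrow> real) \<Rightarrow> (nat \<Rightarrow> 'a \<Rightarrow> real) \<Rightarrow> bool" where
  "glbe_scheme \<Omega> \<T> \<alpha> T N f u0 U u \<longleftrightarrow>
     (let \<tau> = T / real N in
      U 0 = (\<lambda>x. 0) \<and>
      (\<forall>n\<in>{1..N}. U n \<in> Xh \<Omega> \<T> \<and> u n \<in> Xh \<Omega> \<T> \<and>
        (\<forall>x. \<tau> powr (- \<alpha>) * (\<Sum>j=0..n. glbe_weight \<alpha> j * U (n - j) x) =
               Laph \<Omega> \<T> (U n) x + time_integral (\<lambda>s. Ph \<Omega> \<T> (f s)) (real n * \<tau>) x
               + (real n * \<tau>) powr (1 - \<alpha>) / Gamma (2 - \<alpha>) * Ph \<Omega> \<T> u0 x) \<and>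
        (\<forall>x. u n x = (U n x - U (n - 1) x) / \<tau>)))"

end

theory Submission
  imports Defs "HOL-Complex_Analysis.Complex_Analysis" "HOL-Real_Asymp.Real_Asymp"
begin

text \<open>
  The error is bounded by a multiple of \<open>t powr (\<alpha> + \<mu> - 1) * \<tau>\<close>. The
  proof compares both problems with the same family of ordinary differential equations.

  The discrete Laplacian has an orthonormal basis of eigenfunctions
  (\<open>discrete_laplacian_eigenbasis\<close>). In it the semidiscrete problem becomes a scalar
  Volterra equation for each eigenvalue \<open>l \<ge> 0\<close>, with Laplace symbol \<open>z
  powr \<alpha> + l\<close>, and the scheme becomes a recurrence with generating function
  \<open>((1 - \<xi>) / \<tau>) powr \<alpha> + l\<close>. Both are inverted by one formula,
  \<open>stieltjes_resolvent\<close>: the reciprocal of \<open>s powr \<alpha> + l\<close> is the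
  integral of \<open>kap \<alpha> l x / (exp x + s)\<close> over the real line, with a nonnegative
  density. For the Laplace variable \<open>s = z\<close> it exhibits the solution as a
  superposition of the solutions of \<open>v' + exp x * v = g\<close>
  (\<open>volterra_solution\<close>); for \<open>s = (1 - \<xi>) / \<tau>\<close> it exhibits the
  discrete solution as the same superposition of their backward Euler approximations
  (\<open>mode_step_superposition\<close>). The error is therefore a weighted integral of errors
  of the backward Euler method.

  These are controlled by the regularity of the source. Assumption (A) allows the Laplace
  transform to be inverted along two rays in the left half plane. Hence the source tested with a
  function \<open>\<phi>\<close> is, up to a null set of times, a differentiable function that is
  bounded with its derivative by multiples of \<open>t powr \<mu>\<close> and \<open>t powr (\<mu>
  - 1)\<close>, linearly in the norm of \<open>\<phi>\<close>
  (\<open>inverse_laplace_sectorial\<close>, \<open>tested_source\<close>). For such sources the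
  error of backward Euler at time \<open>t\<close> is at most a multiple of \<open>\<tau> * t powr
  \<mu> * (1 + exp x * t) powr (- \<gamma>)\<close> for every \<open>\<gamma>\<close> in
  \<open>[0, 1)\<close>, uniformly in the stiffness \<open>exp x\<close>
  (\<open>mode_error\<close>).

  Independence of the mesh comes from duality (\<open>superposition_norm_le\<close>). The square
  of the norm of the error \<open>e\<close> is the integral over \<open>x\<close> of backward
  Euler errors for the source tested with \<open>\<psi> x\<close>, the sum of the functions
  \<open>b\<close> weighted by the error coefficient times \<open>kap \<alpha> l x\<close>, where
  \<open>b\<close> runs through the basis and \<open>l\<close> is its eigenvalue. Since \<open>kap
  \<alpha> l x\<close> is at most a multiple of \<open>exp ((1 - \<alpha>) x)\<close>, whatever
  \<open>l\<close>, the norm of \<open>\<psi> x\<close> is at most a multiple of \<open>exp ((1 -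
  \<alpha>) x)\<close> times the norm of \<open>e\<close>. The remaining integral of \<open>exp
  ((1 - \<alpha>) x) * (1 + exp x * t) powr (- \<gamma>)\<close> equals a constant times \<open>t
  powr (\<alpha> - 1)\<close> when \<open>1 - \<alpha> < \<gamma>\<close>.
\<close>

section \<open>Finite-dimensional spaces of functions\<close>

text \<open>
  A space of real functions that is determined by its values on a finite set \<open>P\<close> is
  finite-dimensional. This covers a finite element space, whose elements are determined by their
  values at the vertices, and it avoids a separate notion of dimension.
\<close>

locale inner_product_functions =
  fixes V :: "('x \<Rightarrow> real) set" and ip :: "('x \<Rightarrow> real) \<Rightarrow> ('x \<Rightarrow> real) \<Rightarrow> real"
    and P :: "'x set"
  assumes zero_mem: "(\<lambda>x. 0) \<in> V"
    and combination_mem: "\<And>v w c. v \<in> V \<Longrightarrow> w \<in> V \<Longrightarrow> (\<lambda>x. v x + c * w x) \<in> V"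
    and ip_sym: "\<And>v w. v \<in> V \<Longrightarrow> w \<in> V \<Longrightarrow> ip v w = ip w v"
    and ip_left: "\<And>u v w c. u \<in> V \<Longrightarrow> v \<in> V \<Longrightarrow> w \<in> V \<Longrightarrow>
                    ip (\<lambda>x. u x + c * v x) w = ip u w + c * ip v w"
    and ip_nonneg: "\<And>v. v \<in> V \<Longrightarrow> ip v v \<ge> 0"
    and ip_definite: "\<And>v. v \<in> V \<Longrightarrow> ip v v = 0 \<Longrightarrow> v = (\<lambda>x. 0)"
    and finite_points: "finite P"
    and points_separate: "\<And>v. v \<in> V \<Longrightarrow> (\<And>p. p \<in> P \<Longrightarrow> v p = 0) \<Longrightarrow> v = (\<lambda>x. 0)"

definition bilinear_form_on :: "('x \<Rightarrow> real) set \<Rightarrow> (('x \<Rightarrow> real) \<Rightarrow> ('x \<Rightarrow> real) \<Rightarrow> real) \<Rightarrow> bool" where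
  "bilinear_form_on V a \<longleftrightarrow>
     (\<forall>u\<in>V. \<forall>v\<in>V. \<forall>w\<in>V. \<forall>c. a (\<lambda>x. u x + c * v x) w = a u w + c * a v w) \<and>
     (\<forall>v\<in>V. \<forall>w\<in>V. a v w = a w v)"

lemma bilinear_left:
  "bilinear_form_on V a \<Longrightarrow> u \<in> V \<Longrightarrow> v \<in> V \<Longrightarrow> w \<in> V \<Longrightarrow>
     a (\<lambda>x. u x + c * v x) w = a u w + c * a v w"
  unfolding bilinear_form_on_def by simp

lemma bilinear_sym: "bilinear_form_on V a \<Longrightarrow> v \<in> V \<Longrightarrow> w \<in> V \<Longrightarrow> a v w = a w v"
  unfolding bilinear_form_on_def by simp

definition onb :: "('x \<Rightarrow> real) set \<Rightarrow> (('x \<Rightarrow> real) \<Rightarrow> ('x \<Rightarrow> real) \<Rightarrow> real) \<Rightarrow> ('x \<Rightarrow> real) set \<Rightarrow> bool" where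
  "onb V ip B \<longleftrightarrow> finite B \<and> B \<subseteq> V \<and> (\<forall>b\<in>B. \<forall>b'\<in>B. ip b b' = of_bool (b = b')) \<and>
     (\<forall>v\<in>V. v = (\<lambda>x. \<Sum>b\<in>B. ip v b * b x))"

lemma onb_expand: "onb V ip B \<Longrightarrow> v \<in> V \<Longrightarrow> (\<lambda>x. \<Sum>b\<in>B. ip v b * b x) = v"
  unfolding onb_def by auto

context inner_product_functions begin

lemma sum_mem:
  assumes "finite I" "\<And>i. i \<in> I \<Longrightarrow> f i \<in> V"
  shows "(\<lambda>x. \<Sum>i\<in>I. c i * f i x) \<in> V"
  using assms
proof (induction I rule: finite_induct)
  case empty
  then show ?case using zero_mem by simp
next
  case (insert i I)
  have "(\<lambda>x. (\<Sum>i\<in>I. c i * f i x) + c i * f i x) \<in> V"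
    using insert by (intro combination_mem) auto
  then show ?case using insert by (simp add: add.commute)
qed

lemma scale_mem: "v \<in> V \<Longrightarrow> (\<lambda>x. c * v x) \<in> V"
  using combination_mem[OF zero_mem, of v c] by simp

lemma form_zero:
  assumes "bilinear_form_on V a" "w \<in> V"
  shows "a (\<lambda>x. 0) w = 0"
  using bilinear_left[OF assms(1) zero_mem zero_mem assms(2), of 1] by simp

lemma form_scale:
  assumes "bilinear_form_on V a" "v \<in> V" "w \<in> V"
  shows "a (\<lambda>x. c * v x) w = c * a v w"
proof -
  have "a (\<lambda>x. 0 + c * v x) w = a (\<lambda>x. 0) w + c * a v w"
    using bilinear_left[OF assms(1) zero_mem assms(2,3), of c] .
  then show ?thesis using form_zero[OF assms(1,3)] by simp
qed

lemma form_sum: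
  assumes "bilinear_form_on V a" "finite I" "\<And>i. i \<in> I \<Longrightarrow> f i \<in> V" "w \<in> V"
  shows "a (\<lambda>x. \<Sum>i\<in>I. c i * f i x) w = (\<Sum>i\<in>I. c i * a (f i) w)"
  using assms(2,3)
proof (induction I rule: finite_induct)
  case empty
  then show ?case using form_zero[OF assms(1,4)] by simp
next
  case (insert i I)
  have "a (\<lambda>x. (\<Sum>i\<in>I. c i * f i x) + c i * f i x) w
          = a (\<lambda>x. \<Sum>i\<in>I. c i * f i x) w + c i * a (f i) w"
    using bilinear_left[OF assms(1) sum_mem[of I f c], of "f i" w "c i"] insert assms by auto
  then show ?case using insert by (simp add: add.commute)
qed

lemma form_sum_right:
  assumes "bilinear_form_on V a" "finite I" "\<And>i. i \<in> I \<Longrightarrow> f i \<in> V" "w \<in> V"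
  shows "a w (\<lambda>x. \<Sum>i\<in>I. c i * f i x) = (\<Sum>i\<in>I. c i * a w (f i))"
proof -
  have "a w (\<lambda>x. \<Sum>i\<in>I. c i * f i x) = a (\<lambda>x. \<Sum>i\<in>I. c i * f i x) w"
    using bilinear_sym[OF assms(1,4) sum_mem[of I f c]] assms by auto
  also have "\<dots> = (\<Sum>i\<in>I. c i * a (f i) w)"
    using form_sum[OF assms] .
  also have "\<dots> = (\<Sum>i\<in>I. c i * a w (f i))"
    by (intro sum.cong refl) (metis assms(1,3,4) bilinear_sym)
  finally show ?thesis .
qed

lemma bilinear_ip: "bilinear_form_on V ip"
  unfolding bilinear_form_on_def by (simp add: ip_left ip_sym)

lemma form_square:
  assumes a: "bilinear_form_on V a" and "v \<in> V" "w \<in> V"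
  shows "a (\<lambda>x. v x + c * w x) (\<lambda>x. v x + c * w x) = a v v + 2 * c * a v w + c\<^sup>2 * a w w"
proof -
  have m: "(\<lambda>x. v x + c * w x) \<in> V" using combination_mem assms by blast
  have "a (\<lambda>x. v x + c * w x) (\<lambda>x. v x + c * w x)
      = a (\<lambda>x. v x + c * w x) v + c * a (\<lambda>x. v x + c * w x) w"
  proof -
    have "a (\<lambda>x. v x + c * w x) (\<lambda>x. v x + c * w x) = a v (\<lambda>x. v x + c * w x) + c * a w (\<lambda>x. v x + c * w x)"
      using bilinear_left[OF a assms(2,3) m, of c] .
    then show ?thesis using bilinear_sym[OF a assms(2) m] bilinear_sym[OF a assms(3) m] by simp
  qed
  also have "\<dots> = a v v + c * a w v + c * (a v w + c * a w w)"
    using bilinear_left[OF a assms(2,3,2)] bilinear_left[OF a assms(2,3,3)] by simp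
  also have "a w v = a v w" using bilinear_sym a assms by blast
  finally show ?thesis by (simp add: power2_eq_square algebra_simps)
qed

lemma onb_ip:
  assumes "onb V ip B" "v \<in> V" "w \<in> V"
  shows "ip v w = (\<Sum>b\<in>B. ip v b * ip w b)"
proof -
  have "ip v w = ip (\<lambda>x. \<Sum>b\<in>B. ip v b * b x) w"
    using onb_expand[OF assms(1,2)] by simp
  also have "\<dots> = (\<Sum>b\<in>B. ip v b * ip b w)"
    using assms unfolding onb_def by (intro form_sum[OF bilinear_ip]) auto
  also have "\<dots> = (\<Sum>b\<in>B. ip v b * ip w b)"
    using assms unfolding onb_def by (intro sum.cong) (auto intro: ip_sym)
  finally show ?thesis .
qed

end

text \<open>
  Induction on the set of points. The functions that vanish at a point \<open>p\<close> form a
  space determined by the remaining points, hence have an orthonormal basis. It misses at most one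
  dimension, because every function is a multiple of a fixed one that does not vanish at
  \<open>p\<close>, up to a function vanishing there; one Gram-Schmidt step supplies the missing
  vector.
\<close>

lemma exists_onb_aux:
  assumes "finite P"
  shows "inner_product_functions V ip P \<Longrightarrow> \<exists>B. onb V ip B"
  using assms
proof (induction P arbitrary: V rule: finite_induct)
  case empty
  interpret inner_product_functions V ip "{}" by fact
  have "V \<subseteq> {\<lambda>x. 0}"
  proof
    fix v assume "v \<in> V"
    then have "v = (\<lambda>x. 0)" by (rule points_separate) simp
    then show "v \<in> {\<lambda>x. 0}" by simp
  qed
  then have "onb V ip {}" unfolding onb_def by auto
  then show ?case by blast
next
  case (insert p P)
  interpret inner_product_functions V ip "insert p P" by fact
  define V' where "V' = {v\<in>V. v p = 0}"
  interpret V': inner_product_functions V' ip P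
  proof unfold_locales
    show "v = (\<lambda>x. 0)" if "v \<in> V'" "\<And>q. q \<in> P \<Longrightarrow> v q = 0" for v
      using that points_separate[of v] unfolding V'_def by blast
    show "(\<lambda>x. 0) \<in> V'" using zero_mem by (simp add: V'_def)
    show "(\<lambda>x. v x + c * w x) \<in> V'" if "v \<in> V'" "w \<in> V'" for v w c
      using combination_mem[of v w c] that by (simp add: V'_def)
    show "ip v w = ip w v" if "v \<in> V'" "w \<in> V'" for v w
      using ip_sym[of v w] that by (simp add: V'_def)
    show "ip (\<lambda>x. u x + c * v x) w = ip u w + c * ip v w"
      if "u \<in> V'" "v \<in> V'" "w \<in> V'" for u v w c
      using ip_left[of u v w c] that by (simp add: V'_def)
    show "ip v v \<ge> 0" if "v \<in> V'" for v using ip_nonneg[of v] that by (simp add: V'_def)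
    show "v = (\<lambda>x. 0)" if "v \<in> V'" "ip v v = 0" for v
      using ip_definite[of v] that by (simp add: V'_def)
    show "finite P" using finite_points by simp
  qed
  from insert.IH[OF V'.inner_product_functions_axioms] obtain B where B: "onb V' ip B" by blast
  have BV: "B \<subseteq> V'" "B \<subseteq> V" "finite B" and
    Bo: "\<And>b b'. b \<in> B \<Longrightarrow> b' \<in> B \<Longrightarrow> ip b b' = of_bool (b = b')" and
    Bs: "\<And>v. v \<in> V' \<Longrightarrow> v = (\<lambda>x. \<Sum>b\<in>B. ip v b * b x)"
    using B unfolding onb_def V'_def by auto
  show ?case
  proof (cases "V' = V")
    case True
    then show ?thesis using B by auto
  next
    case False
    then obtain u where u: "u \<in> V" "u p \<noteq> 0" unfolding V'_def by blast
    define s where "s = (\<lambda>x. \<Sum>b\<in>B. ip u b * b x)"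
    define u' where "u' = (\<lambda>x. u x + (-1) * s x)"
    have s: "s \<in> V" unfolding s_def using BV by (intro sum_mem) auto
    have u'V: "u' \<in> V" unfolding u'_def by (intro combination_mem u s)
    have "s p = 0" unfolding s_def using BV unfolding V'_def by (intro sum.neutral) auto
    then have u'p: "u' p \<noteq> 0" using u by (simp add: u'_def)
    have u'o: "ip u' b = 0" if "b \<in> B" for b
    proof -
      have "ip u' b = ip u b + (-1) * ip s b"
        unfolding u'_def using that BV by (intro ip_left u s) auto
      also have "ip s b = (\<Sum>b'\<in>B. ip u b' * ip b' b)"
        unfolding s_def using that BV by (intro form_sum[OF bilinear_ip]) auto
      also have "\<dots> = (\<Sum>b'\<in>B. if b' = b then ip u b' else 0)"
        using Bo that by (intro sum.cong) auto
      also have "\<dots> = ip u b" using that BV by simp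
      finally show ?thesis by simp
    qed
    have "ip u' u' \<noteq> 0" using ip_definite[OF u'V] u'p by auto
    then have pos: "ip u' u' > 0" using ip_nonneg[OF u'V] by linarith
    define e where "e = (\<lambda>x. (1 / sqrt (ip u' u')) * u' x)"
    have e: "e \<in> V" unfolding e_def by (intro scale_mem u'V)
    have ee: "ip e e = 1"
    proof -
      have "ip e e = (1 / sqrt (ip u' u')) * ip u' e"
        unfolding e_def by (rule form_scale[OF bilinear_ip]) (use u'V e in \<open>auto simp: e_def\<close>)
      also have "ip u' e = ip e u'" by (intro ip_sym u'V e)
      also have "\<dots> = (1 / sqrt (ip u' u')) * ip u' u'"
        unfolding e_def by (rule form_scale[OF bilinear_ip]) (use u'V in auto)
      finally show ?thesis using pos by (simp add: field_simps)
    qed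
    have eo: "ip e b = 0" "ip b e = 0" if "b \<in> B" for b
    proof -
      have "ip e b = (1 / sqrt (ip u' u')) * ip u' b"
        unfolding e_def by (rule form_scale[OF bilinear_ip]) (use u'V that BV in auto)
      then show "ip e b = 0" using u'o that by simp
      then show "ip b e = 0" using ip_sym[OF e] that BV by auto
    qed
    have "ip b b \<noteq> 0" if "b \<in> B" for b using Bo that by auto
    then have eB: "e \<notin> B" using eo by auto
    have ep: "e p \<noteq> 0" using u'p pos by (simp add: e_def)
    have "onb V ip (insert e B)"
      unfolding onb_def
    proof (intro conjI ballI)
      show "finite (insert e B)" "insert e B \<subseteq> V" using BV e by auto
      show "ip b b' = of_bool (b = b')" if "b \<in> insert e B" "b' \<in> insert e B" for b b'
        using that Bo ee eo eB by auto
      fix v assume v: "v \<in> V"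
      define w where "w = (\<lambda>x. v x + (- v p / e p) * e x)"
      have wV: "w \<in> V" unfolding w_def by (intro combination_mem v e)
      have w: "w \<in> V'" unfolding V'_def using wV ep by (auto simp: w_def)
      have v_eq: "v = (\<lambda>x. w x + (v p / e p) * e x)" by (auto simp: w_def)
      have vb: "ip v b = ip w b" if "b \<in> B" for b
      proof -
        have "ip v b = ip w b + (v p / e p) * ip e b"
          by (subst v_eq, rule ip_left) (use wV e that BV in auto)
        then show ?thesis using eo that by simp
      qed
      have "ip w e = ip (\<lambda>x. \<Sum>b\<in>B. ip w b * b x) e" using Bs[OF w] by simp
      also have "\<dots> = (\<Sum>b\<in>B. ip w b * ip b e)"
        using BV e by (intro form_sum[OF bilinear_ip]) auto
      also have "\<dots> = 0" using eo by simp
      finally have we: "ip w e = 0" .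
      have "ip v e = ip w e + (v p / e p) * ip e e"
        by (subst v_eq, rule ip_left) (use wV e in auto)
      then have ve: "ip v e = v p / e p" using ee we by simp
      have "v x = (\<Sum>b\<in>insert e B. ip v b * b x)" for x
      proof -
        have "w x = (\<Sum>b\<in>B. ip w b * b x)" using Bs[OF w] by meson
        then show ?thesis using fun_cong[OF v_eq, of x] BV eB ve vb by simp
      qed
      then show "v = (\<lambda>x. \<Sum>b\<in>insert e B. ip v b * b x)" by blast
    qed
    then show ?thesis by blast
  qed
qed

context inner_product_functions begin

lemma exists_onb: "\<exists>B. onb V ip B"
  using exists_onb_aux finite_points inner_product_functions_axioms by blast

text \<open>
  The representation theorem of Riesz for the inner product that sums over the points. It turns
  coefficients with respect to a basis into finite combinations of point values, for which the
  differential equations are given.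
\<close>

lemma functional_eq_point_values:
  assumes l: "\<And>u v c. u \<in> V \<Longrightarrow> v \<in> V \<Longrightarrow> l (\<lambda>x. u x + c * v x) = l u + c * (l v :: real)"
  obtains w where "\<And>v. v \<in> V \<Longrightarrow> l v = (\<Sum>p\<in>P. w p * v p)"
proof -
  define pp where "pp = (\<lambda>v w :: 'x \<Rightarrow> real. \<Sum>p\<in>P. v p * w p)"
  \<comment> \<open>The values at the points separate the elements of \<open>V\<close>, so this
  form is definite as well.\<close>
  interpret pp: inner_product_functions V pp P
  proof unfold_locales
    show "v = (\<lambda>x. 0)" if "v \<in> V" "pp v v = 0" for v
    proof (rule points_separate[OF that(1)])
      have "\<forall>p\<in>P. v p * v p = 0"
        using that(2) finite_points unfolding pp_def by (subst (asm) sum_nonneg_eq_0_iff) auto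
      then show "\<And>p. p \<in> P \<Longrightarrow> v p = 0" by simp
    qed
    show "pp v w = pp w v" for v w
      unfolding pp_def by (intro sum.cong) auto
    show "pp (\<lambda>x. u x + c * v x) w = pp u w + c * pp v w" for u v w c
      unfolding pp_def sum_distrib_left by (simp add: algebra_simps sum.distrib)
    show "pp v v \<ge> 0" for v
      unfolding pp_def by (intro sum_nonneg) auto
  qed (rule zero_mem combination_mem finite_points points_separate; assumption)+
  obtain B where B: "onb V pp B" using pp.exists_onb by blast
  define a where "a = (\<lambda>v w :: 'x \<Rightarrow> real. l v)"
  have lsum: "l (\<lambda>x. \<Sum>b\<in>C. c b * b x) = (\<Sum>b\<in>C. c b * l b)" if "finite C" "C \<subseteq> V" for c C
    using that
  proof (induction C rule: finite_induct)
    case empty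
    have "l (\<lambda>x. 0 + 1 * 0) = l (\<lambda>x. 0) + 1 * l (\<lambda>x. 0)" by (intro l zero_mem)
    then show ?case by simp
  next
    case (insert i I)
    have "l (\<lambda>x. (\<Sum>i\<in>I. c i * i x) + c i * i x) = l (\<lambda>x. \<Sum>i\<in>I. c i * i x) + c i * l i"
      using insert by (intro l sum_mem) auto
    then show ?case using insert by (simp add: add.commute)
  qed
  define w where "w = (\<lambda>p. \<Sum>b\<in>B. l b * b p)"
  show ?thesis
  proof
    fix v assume v: "v \<in> V"
    have "l v = l (\<lambda>x. \<Sum>b\<in>B. pp v b * b x)" using onb_expand[OF B v] by simp
    also have "\<dots> = (\<Sum>b\<in>B. pp v b * l b)" using B unfolding onb_def by (intro lsum) auto
    also have "\<dots> = (\<Sum>p\<in>P. w p * v p)"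
      unfolding pp_def w_def sum_distrib_right sum_distrib_left
      by (subst sum.swap) (simp add: mult_ac)
    finally show "l v = (\<Sum>p\<in>P. w p * v p)" .
  qed
qed

text \<open>
  Bessel's inequality for each element of the basis, summed over the basis: the double sum of
  squared inner products is at most the size of the basis, and by Parseval it is the number of
  orthonormal vectors.
\<close>

lemma orthonormal_card_le:
  assumes B: "onb V ip B" and "finite C" "C \<subseteq> V"
    and C: "\<And>c c'. c \<in> C \<Longrightarrow> c' \<in> C \<Longrightarrow> ip c c' = of_bool (c = c')"
  shows "card C \<le> card B"
proof -
  have BV: "B \<subseteq> V" "finite B" and Bo: "\<And>b. b \<in> B \<Longrightarrow> ip b b = 1"
    using B unfolding onb_def by auto
  have bessel: "(\<Sum>c\<in>C. (ip e c)\<^sup>2) \<le> ip e e" if e: "e \<in> V" for e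
  proof -
    define s where "s = (\<lambda>x. \<Sum>c\<in>C. ip e c * c x)"
    have s: "s \<in> V" unfolding s_def using assms by (intro sum_mem) auto
    have sc: "ip s c = ip e c" if "c \<in> C" for c
    proof -
      have "ip s c = (\<Sum>c'\<in>C. ip e c' * ip c' c)"
        unfolding s_def using assms that by (intro form_sum[OF bilinear_ip]) auto
      also have "\<dots> = (\<Sum>c'\<in>C. if c' = c then ip e c' else 0)"
        using C that by (intro sum.cong) auto
      finally show ?thesis using that assms by simp
    qed
    have es: "ip e s = (\<Sum>c\<in>C. (ip e c)\<^sup>2)"
      unfolding s_def using form_sum_right[OF bilinear_ip \<open>finite C\<close>, of "\<lambda>c. c" e "\<lambda>c. ip e c"] assms e
      by (auto simp: power2_eq_square)
    have ss: "ip s s = (\<Sum>c\<in>C. (ip e c)\<^sup>2)"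
    proof -
      have "ip s s = (\<Sum>c\<in>C. ip e c * ip s c)"
        using form_sum_right[OF bilinear_ip \<open>finite C\<close>, of "\<lambda>c. c" s "\<lambda>c. ip e c"] assms s
        by (auto simp: s_def)
      then show ?thesis using sc by (simp add: power2_eq_square)
    qed
    have "0 \<le> ip (\<lambda>x. e x + (-1) * s x) (\<lambda>x. e x + (-1) * s x)"
      by (intro ip_nonneg combination_mem e s)
    also have "\<dots> = ip e e + 2 * (-1) * ip e s + (-1)\<^sup>2 * ip s s"
      by (rule form_square[OF bilinear_ip e s])
    finally show ?thesis using es ss by simp
  qed
  have "real (card C) = (\<Sum>c\<in>C. ip c c)" using C by simp
  also have "\<dots> = (\<Sum>c\<in>C. \<Sum>b\<in>B. ip c b * ip c b)"
    using assms by (intro sum.cong refl onb_ip[OF B]) auto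
  also have "\<dots> = (\<Sum>b\<in>B. \<Sum>c\<in>C. (ip b c)\<^sup>2)"
  proof (subst sum.swap, intro sum.cong refl)
    fix b c assume "b \<in> B" "c \<in> C"
    then have "ip c b = ip b c" using assms BV by (intro ip_sym) auto
    then show "ip c b * ip c b = (ip b c)\<^sup>2" by (simp add: power2_eq_square)
  qed
  also have "\<dots> \<le> (\<Sum>b\<in>B. ip b b)" using BV by (intro sum_mono bessel) auto
  also have "\<dots> = real (card B)" using Bo by simp
  finally show ?thesis by simp
qed

text \<open>
  In coordinates with respect to an orthonormal basis the unit sphere of \<open>W\<close> is
  compact, and the quadratic form is continuous on it.
\<close>

lemma rayleigh_minimizer:
  assumes a: "bilinear_form_on V a" and "finite C" "C \<subseteq> V"
    and W: "W = {v\<in>V. \<forall>c\<in>C. ip v c = 0}" and ne: "w0 \<in> W" "w0 \<noteq> (\<lambda>x. 0)"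
  obtains v where "v \<in> W" "ip v v = 1" "\<And>w. w \<in> W \<Longrightarrow> a v v * ip w w \<le> a w w"
proof -
  obtain B where B: "onb V ip B" using exists_onb by blast
  have BV: "B \<subseteq> V" "finite B" and Bs: "\<And>v. v \<in> V \<Longrightarrow> v = (\<lambda>x. \<Sum>b\<in>B. ip v b * b x)"
    and Bo: "\<And>b b'. b \<in> B \<Longrightarrow> b' \<in> B \<Longrightarrow> ip b b' = of_bool (b = b')"
    using B unfolding onb_def by auto
  define vec where "vec = (\<lambda>(t :: ('x \<Rightarrow> real) \<Rightarrow> real) x. \<Sum>b\<in>B. t b * b x)"
  have vec: "vec t \<in> V" for t unfolding vec_def using BV by (intro sum_mem) auto
  have form_vec: "a' (vec t) w = (\<Sum>b\<in>B. t b * a' b w)" if "bilinear_form_on V a'" "w \<in> V" for a' t w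
    unfolding vec_def using BV that by (intro form_sum) auto
  have form_vec2: "a' (vec t) (vec t) = (\<Sum>b\<in>B. t b * (\<Sum>b'\<in>B. t b' * a' b b'))"
    if "bilinear_form_on V a'" for a' t
  proof -
    have "a' b (vec t) = (\<Sum>b'\<in>B. t b' * a' b b')" if "b \<in> B" for b
      unfolding vec_def using BV that \<open>bilinear_form_on V a'\<close>
      by (intro form_sum_right[of a' B "\<lambda>b. b"]) auto
    then show ?thesis using form_vec[OF that vec] by simp
  qed
  have ip_vec: "ip (vec t) (vec t) = (\<Sum>b\<in>B. (t b)\<^sup>2)" for t
  proof -
    have "(\<Sum>b'\<in>B. t b' * ip b b') = t b" if "b \<in> B" for b
    proof -
      have "(\<Sum>b'\<in>B. t b' * ip b b') = (\<Sum>b'\<in>B. if b' = b then t b' else 0)"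
        using Bo that by (intro sum.cong) auto
      then show ?thesis using that BV by simp
    qed
    then show ?thesis using form_vec2[OF bilinear_ip] by (simp add: power2_eq_square)
  qed
  \<comment> \<open>Coordinates are functions on the whole type; those off the basis are fixed
  to 0, so that Tychonoff gives compactness.\<close>
  define Box where "Box = (PiE UNIV (\<lambda>b. if b \<in> B then {-1..1} else {0}) :: (('x \<Rightarrow> real) \<Rightarrow> real) set)"
  define S where "S = Box \<inter> {t. ip (vec t) (vec t) = 1} \<inter> (\<Inter>c\<in>C. {t. ip (vec t) c = 0})"
  have coord: "continuous_on UNIV (\<lambda>t::('x \<Rightarrow> real) \<Rightarrow> real. t b)" for b
    by (rule continuous_on_product_coordinates)
  have "compactin (product_topology (\<lambda>i. euclidean) UNIV) Box"
    unfolding Box_def compactin_PiE by (auto simp: compactin_euclidean_iff)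
  then have "compact Box" unfolding euclidean_product_topology by (simp add: compactin_euclidean_iff)
  moreover have "closed {t. ip (vec t) (vec t) = 1}"
    unfolding form_vec2[OF bilinear_ip]
    by (intro closed_Collect_eq continuous_intros coord)
  moreover have "closed (\<Inter>c\<in>C. {t. ip (vec t) c = 0})"
  proof (intro closed_INT ballI)
    fix c assume "c \<in> C"
    then have "c \<in> V" using assms by auto
    then show "closed {t. ip (vec t) c = 0}"
      unfolding form_vec[OF bilinear_ip \<open>c \<in> V\<close>] by (intro closed_Collect_eq continuous_intros coord)
  qed
  ultimately have "compact S" unfolding S_def by (intro compact_Int_closed) auto
  have in_S: "(\<lambda>b. if b \<in> B then ip v b else 0) \<in> S" "vec (\<lambda>b. if b \<in> B then ip v b else 0) = v"
    if "v \<in> W" "ip v v = 1" for v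
  proof -
    have v: "v \<in> V" using that W by auto
    have "vec (\<lambda>b. if b \<in> B then ip v b else 0) = (\<lambda>x. \<Sum>b\<in>B. ip v b * b x)"
      unfolding vec_def by (intro ext sum.cong) auto
    also have "\<dots> = v" using Bs[OF v] by simp
    finally show eq: "vec (\<lambda>b. if b \<in> B then ip v b else 0) = v" .
    have "(\<Sum>b\<in>B. (ip v b)\<^sup>2) = 1"
      using onb_ip[OF B v v] that by (simp add: power2_eq_square)
    then have "(ip v b)\<^sup>2 \<le> 1" if "b \<in> B" for b
      using member_le_sum[of b B "\<lambda>b. (ip v b)\<^sup>2"] that BV by auto
    then have "\<bar>ip v b\<bar> \<le> 1" if "b \<in> B" for b
      using that by (simp add: abs_square_le_1)
    then have "(\<lambda>b. if b \<in> B then ip v b else 0) \<in> Box"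
      unfolding Box_def by (auto simp: abs_le_iff minus_le_iff)
    then show "(\<lambda>b. if b \<in> B then ip v b else 0) \<in> S"
      unfolding S_def using eq that W by auto
  qed
  have normalize: "\<exists>u\<in>W. ip u u = 1 \<and> a w w = ip w w * a u u" if "w \<in> W" "w \<noteq> (\<lambda>x. 0)" for w
  proof -
    have w: "w \<in> V" using that W by auto
    have "ip w w \<noteq> 0" using ip_definite w that by blast
    then have pos: "ip w w > 0" using ip_nonneg[OF w] by linarith
    define s where "s = 1 / sqrt (ip w w)"
    have ss: "s * s = 1 / ip w w" using pos by (simp add: s_def)
    have sq: "a' (\<lambda>x. s * w x) (\<lambda>x. s * w x) = s * s * a' w w" if a': "bilinear_form_on V a'" for a'
    proof -
      have "a' (\<lambda>x. s * w x) (\<lambda>x. s * w x) = s * a' w (\<lambda>x. s * w x)"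
        by (intro form_scale a' w scale_mem)
      also have "a' w (\<lambda>x. s * w x) = a' (\<lambda>x. s * w x) w"
        using a' w scale_mem[OF w] unfolding bilinear_form_on_def by blast
      also have "\<dots> = s * a' w w" by (intro form_scale a' w)
      finally show ?thesis by simp
    qed
    show ?thesis
    proof (intro bexI conjI)
      show "ip (\<lambda>x. s * w x) (\<lambda>x. s * w x) = 1"
        using sq[OF bilinear_ip] ss pos by simp
      show "a w w = ip w w * a (\<lambda>x. s * w x) (\<lambda>x. s * w x)"
        using sq[OF a] ss pos by simp
      have "ip (\<lambda>x. s * w x) c = 0" if "c \<in> C" for c
        using form_scale[OF bilinear_ip w, of c s] that assms \<open>w \<in> W\<close> by auto
      then show "(\<lambda>x. s * w x) \<in> W" using W scale_mem[OF w] by auto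
    qed
  qed
  have "S \<noteq> {}" using normalize[OF ne] in_S by blast
  moreover have "continuous_on S (\<lambda>t. a (vec t) (vec t))"
    unfolding form_vec2[OF a]
    by (intro continuous_intros continuous_on_subset[OF coord]) auto
  ultimately obtain t where t: "t \<in> S" "\<And>t'. t' \<in> S \<Longrightarrow> a (vec t) (vec t) \<le> a (vec t') (vec t')"
    using continuous_attains_inf[OF \<open>compact S\<close>, of "\<lambda>t. a (vec t) (vec t)"] by blast
  show ?thesis
  proof
    show "vec t \<in> W" "ip (vec t) (vec t) = 1" using t(1) vec W unfolding S_def by auto
    fix w assume w: "w \<in> W"
    show "a (vec t) (vec t) * ip w w \<le> a w w"
    proof (cases "w = (\<lambda>x. 0)")
      case True
      then show ?thesis
        using form_zero[OF a] form_zero[OF bilinear_ip] zero_mem by simp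
    next
      case False
      from normalize[OF w False] obtain u where u: "u \<in> W" "ip u u = 1" "a w w = ip w w * a u u"
        by blast
      have "a (vec t) (vec t) \<le> a u u" using t(2)[OF in_S(1)[OF u(1,2)]] in_S(2)[OF u(1,2)] by simp
      moreover have "ip w w \<ge> 0" using w W ip_nonneg by auto
      ultimately have "ip w w * a (vec t) (vec t) \<le> ip w w * a u u" by (rule mult_left_mono)
      then show ?thesis using u(3) by (simp add: mult.commute)
    qed
  qed
qed

definition eigenfamily :: "(('x \<Rightarrow> real) \<Rightarrow> ('x \<Rightarrow> real) \<Rightarrow> real) \<Rightarrow> ('x \<Rightarrow> real) set \<Rightarrow> bool" where
  "eigenfamily a C \<longleftrightarrow> finite C \<and> C \<subseteq> V \<and> (\<forall>c\<in>C. \<forall>c'\<in>C. ip c c' = of_bool (c = c')) \<and>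
     (\<forall>c\<in>C. \<forall>v\<in>V. a c v = a c c * ip c v)"

text \<open>
  A minimizer of the Rayleigh quotient on the orthogonal complement of the eigenvectors found so
  far is a further eigenvector: the quotient is stationary in every direction of the complement,
  and the remaining directions are eigenvectors.
\<close>

lemma extend_eigenfamily:
  assumes a: "bilinear_form_on V a" and C: "eigenfamily a C"
    and w0: "w0 \<in> V" "\<And>c. c \<in> C \<Longrightarrow> ip w0 c = 0" "w0 \<noteq> (\<lambda>x. 0)"
  obtains v where "v \<notin> C" "eigenfamily a (insert v C)"
proof -
  define W where "W = {v\<in>V. \<forall>c\<in>C. ip v c = 0}"
  have CV: "finite C" "C \<subseteq> V" and Co: "\<And>c c'. c \<in> C \<Longrightarrow> c' \<in> C \<Longrightarrow> ip c c' = of_bool (c = c')"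
    and Ce: "\<And>c v. c \<in> C \<Longrightarrow> v \<in> V \<Longrightarrow> a c v = a c c * ip c v"
    using C unfolding eigenfamily_def by auto
  have "w0 \<in> W" using w0 unfolding W_def by auto
  then obtain v where v: "v \<in> W" "ip v v = 1" and min: "\<And>w. w \<in> W \<Longrightarrow> a v v * ip w w \<le> a w w"
    using rayleigh_minimizer[OF a CV W_def _ w0(3)] by blast
  have vV: "v \<in> V" using v unfolding W_def by auto
  have vc: "ip v c = 0" if "c \<in> C" for c using v that unfolding W_def by auto
  have eigW: "a v w = a v v * ip v w" if w: "w \<in> W" for w
  proof -
    have wV: "w \<in> V" using w unfolding W_def by auto
    define p where "p = a v w - a v v * ip v w"
    define q where "q = a w w - a v v * ip w w"
    have ineq: "0 \<le> 2 * t * p + t\<^sup>2 * q" for t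
    proof -
      have "ip (\<lambda>x. v x + t * w x) c = 0" if "c \<in> C" for c
        using ip_left[OF vV wV, of c t] that CV v w unfolding W_def by auto
      then have "(\<lambda>x. v x + t * w x) \<in> W"
        unfolding W_def using combination_mem[OF vV wV] by auto
      from min[OF this] show ?thesis
        unfolding form_square[OF a vV wV] form_square[OF bilinear_ip vV wV]
        using v(2) by (simp add: p_def q_def algebra_simps)
    qed
    have "p = 0"
    proof (rule ccontr)
      assume "p \<noteq> 0"
      \<comment> \<open>With this step the linear term beats the quadratic one, so a nonzero
      first variation contradicts minimality.\<close>
      define t where "t = - p / (\<bar>q\<bar> + 1)"
      have "2 * t * p + t\<^sup>2 * q \<le> 2 * t * p + t\<^sup>2 * (\<bar>q\<bar> + 1)"
        by (intro add_left_mono mult_left_mono) auto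
      also have "\<dots> = - p\<^sup>2 / (\<bar>q\<bar> + 1)"
      proof -
        define m where "m = \<bar>q\<bar> + 1"
        have "m > 0" unfolding m_def by simp
        then show ?thesis unfolding t_def m_def[symmetric] by (simp add: field_simps power2_eq_square)
      qed
      also have "\<dots> < 0" using \<open>p \<noteq> 0\<close> by (simp add: divide_less_0_iff)
      finally show False using ineq[of t] by simp
    qed
    then show ?thesis by (simp add: p_def)
  qed
  have eig: "a v z = a v v * ip v z" if z: "z \<in> V" for z
  proof -
    define s where "s = (\<lambda>x. \<Sum>c\<in>C. ip z c * c x)"
    have s: "s \<in> V" unfolding s_def using CV by (intro sum_mem) auto
    define w where "w = (\<lambda>x. z x + (-1) * s x)"
    have wV: "w \<in> V" unfolding w_def by (intro combination_mem z s)
    have "ip w c = 0" if "c \<in> C" for c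
    proof -
      have "ip w c = ip z c + (-1) * ip s c"
        unfolding w_def using that CV by (intro ip_left z s) auto
      also have "ip s c = (\<Sum>c'\<in>C. ip z c' * ip c' c)"
        unfolding s_def using that CV by (intro form_sum[OF bilinear_ip]) auto
      also have "\<dots> = (\<Sum>c'\<in>C. if c' = c then ip z c' else 0)"
        using Co that by (intro sum.cong) auto
      finally show ?thesis using that CV by simp
    qed
    then have w: "w \<in> W" unfolding W_def using wV by auto
    have z_eq: "z = (\<lambda>x. w x + 1 * s x)" by (auto simp: w_def)
    have split: "a' v z = a' v w + a' v s" if a': "bilinear_form_on V a'" for a'
    proof -
      have "a' z v = a' w v + 1 * a' s v"
        using bilinear_left[OF a' wV s vV, of 1] z_eq by simp
      then show ?thesis using bilinear_sym[OF a' vV] wV s z by simp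
    qed
    have "ip v s = (\<Sum>c\<in>C. ip z c * ip v c)"
      unfolding s_def using form_sum_right[OF bilinear_ip CV(1), of "\<lambda>c. c" v "\<lambda>c. ip z c"] CV vV by auto
    then have "ip v s = 0" using vc by simp
    moreover have "a v s = (\<Sum>c\<in>C. ip z c * a v c)"
      unfolding s_def using form_sum_right[OF a CV(1), of "\<lambda>c. c" v "\<lambda>c. ip z c"] CV vV by auto
    moreover have "a v c = 0" if "c \<in> C" for c
    proof -
      have "a v c = a c v" using bilinear_sym[OF a vV, of c] that CV by auto
      also have "\<dots> = a c c * ip c v" using Ce[OF that vV] by simp
      also have "ip c v = ip v c" using ip_sym[OF vV, of c] that CV by auto
      finally show ?thesis using vc that by simp
    qed
    ultimately show ?thesis using split[OF a] split[OF bilinear_ip] eigW[OF w] by simp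
  qed
  show ?thesis
  proof
    show "v \<notin> C" using vc v(2) by auto
    show "eigenfamily a (insert v C)"
      unfolding eigenfamily_def
    proof (intro conjI ballI)
      show "finite (insert v C)" "insert v C \<subseteq> V" using CV vV by auto
      show "ip c c' = of_bool (c = c')" if "c \<in> insert v C" "c' \<in> insert v C" for c c'
        using that Co vc v(2) ip_sym[OF vV, of c] CV by (cases "c = v"; cases "c' = v") auto
      show "a c z = a c c * ip c z" if "c \<in> insert v C" "z \<in> V" for c z
        using that Ce eig by auto
    qed
  qed
qed

text \<open>
  A maximal orthonormal family of eigenvectors spans, since otherwise it could be extended;
  families cannot grow beyond the size of an orthonormal basis.
\<close>

theorem exists_eigenbasis:
  assumes a: "bilinear_form_on V a"
  obtains C where "onb V ip C" "\<And>c v. c \<in> C \<Longrightarrow> v \<in> V \<Longrightarrow> a c v = a c c * ip c v"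
proof -
  obtain B where B: "onb V ip B" using exists_onb by blast
  have "eigenfamily a {}" unfolding eigenfamily_def by auto
  moreover have "\<forall>C. eigenfamily a C \<longrightarrow> card C < Suc (card B)"
    using orthonormal_card_le[OF B] unfolding eigenfamily_def by (simp add: less_Suc_eq_le)
  ultimately have "\<exists>C. eigenfamily a C \<and> (\<forall>C'. eigenfamily a C' \<longrightarrow> card C' \<le> card C)"
    by (rule ex_has_greatest_nat)
  then obtain C where C: "eigenfamily a C" and max: "\<And>C'. eigenfamily a C' \<Longrightarrow> card C' \<le> card C"
    by auto
  have CV: "finite C" "C \<subseteq> V" and Co: "\<And>c c'. c \<in> C \<Longrightarrow> c' \<in> C \<Longrightarrow> ip c c' = of_bool (c = c')"
    using C unfolding eigenfamily_def by auto
  have "v = (\<lambda>x. \<Sum>c\<in>C. ip v c * c x)" if v: "v \<in> V" for v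
  proof -
    define s where "s = (\<lambda>x. \<Sum>c\<in>C. ip v c * c x)"
    have s: "s \<in> V" unfolding s_def using CV by (intro sum_mem) auto
    define w where "w = (\<lambda>x. v x + (-1) * s x)"
    have wV: "w \<in> V" unfolding w_def by (intro combination_mem v s)
    have wc: "ip w c = 0" if "c \<in> C" for c
    proof -
      have "ip w c = ip v c + (-1) * ip s c"
        unfolding w_def using that CV by (intro ip_left v s) auto
      also have "ip s c = (\<Sum>c'\<in>C. ip v c' * ip c' c)"
        unfolding s_def using that CV by (intro form_sum[OF bilinear_ip]) auto
      also have "\<dots> = (\<Sum>c'\<in>C. if c' = c then ip v c' else 0)"
        using Co that by (intro sum.cong) auto
      finally show ?thesis using that CV by simp
    qed
    have "w = (\<lambda>x. 0)"
    proof (rule ccontr)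
      assume "w \<noteq> (\<lambda>x. 0)"
      obtain v' where "v' \<notin> C" "eigenfamily a (insert v' C)"
        by (rule extend_eigenfamily[OF a C wV]) (use wc \<open>w \<noteq> (\<lambda>x. 0)\<close> in auto)
      with max[of "insert v' C"] CV show False by simp
    qed
    then have "w x = 0" for x by simp
    then show ?thesis unfolding w_def s_def by (intro ext) (simp add: eq_neg_iff_add_eq_0)
  qed
  then have "onb V ip C" unfolding onb_def using CV Co by auto
  moreover have "a c v = a c c * ip c v" if "c \<in> C" "v \<in> V" for c v
    using C that unfolding eigenfamily_def by simp
  ultimately show ?thesis by (rule that)
qed

end

section \<open>Cauchy's formula in a strip\<close>

lemma integrable_exp_minus_abs:
  fixes d :: real assumes "d > 0"
  shows "integrable lborel (\<lambda>x::real. exp (- d * \<bar>x\<bar>))"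
proof -
  have "(\<lambda>x. exp (- d * x)) absolutely_integrable_on {0..}"
    using assms by (intro nonnegative_absolutely_integrable_1 integrable_on_exp_minus_to_infinity) auto
  then have "integrable lebesgue (\<lambda>x. indicator {0..} x *\<^sub>R exp (- d * x))"
    unfolding set_integrable_def .
  then have 1: "integrable lborel (\<lambda>x. indicator {0..} x *\<^sub>R exp (- d * x))"
    by (subst (asm) integrable_completion) auto
  have 2: "integrable lborel (\<lambda>x. indicator {0..} (0 + (-1) * x) *\<^sub>R exp (- d * (0 + (-1) * x)))"
    by (rule lborel_integrable_real_affine[OF 1]) simp
  show ?thesis
  proof (rule Bochner_Integration.integrable_bound[OF Bochner_Integration.integrable_add[OF 1 2]])
    show "AE x in lborel. norm (exp (- d * \<bar>x\<bar>))
       \<le> norm (indicat_real {0..} x *\<^sub>R exp (- d * x) + indicat_real {0..} (0 + - 1 * x) *\<^sub>R exp (- d * (0 + - 1 * x)))"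
      by (intro AE_I2) (auto simp: indicator_def abs_if)
  qed auto
qed

lemma integrable_bound_exp_minus_abs:
  fixes f :: "real \<Rightarrow> 'b :: {banach, second_countable_topology}"
  assumes "f \<in> borel_measurable lborel" "d > 0" "\<And>x. norm (f x) \<le> C * exp (- d * \<bar>x\<bar>)"
  shows "integrable lborel f"
proof (rule Bochner_Integration.integrable_bound)
  show "integrable lborel (\<lambda>x. C * exp (- d * \<bar>x\<bar>))"
    using integrable_exp_minus_abs[OF assms(2)] by simp
  have "norm (f x) \<le> norm (C * exp (- d * \<bar>x\<bar>))" for x
    using assms(3)[of x] unfolding real_norm_def by linarith
  then show "AE x in lborel. norm (f x) \<le> norm (C * exp (- d * \<bar>x\<bar>))"
    by (intro AE_I2)
qed (use assms in auto)

text \<open>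
  The distance of a point on a ray from the positive half-axis is comparable with the sum of the
  two moduli, with a constant that depends on the angle alone.
\<close>

lemma cmod_diff_ge_sin_half:
  fixes r s p :: real
  assumes "r \<ge> 0" "s \<ge> 0"
  shows "cmod (of_real r * cis p - of_real s) \<ge> \<bar>sin (p / 2)\<bar> * (r + s)"
proof (rule power2_le_imp_le)
  have s2: "(sin (p/2))\<^sup>2 = (1 - cos p) / 2"
    using cos_double_sin[of "p/2"] by simp
  have "(cmod (of_real r * cis p - of_real s))\<^sup>2 = (r * cos p - s)\<^sup>2 + (r * sin p)\<^sup>2"
    by (simp add: cmod_power2)
  also have "\<dots> = r\<^sup>2 * ((cos p)\<^sup>2 + (sin p)\<^sup>2) - 2 * r * s * cos p + s\<^sup>2"
    by (simp only: power2_eq_square) (simp only: algebra_simps)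
  also have "\<dots> = r\<^sup>2 - 2 * r * s * cos p + s\<^sup>2"
    by (simp only: sin_cos_squared_add2)
  finally have 1: "(cmod (of_real r * cis p - of_real s))\<^sup>2 = r\<^sup>2 - 2 * r * s * cos p + s\<^sup>2" .
  have poly: "r\<^sup>2 - 2 * r * s * c + s\<^sup>2 - (1 - c) / 2 * (r + s)\<^sup>2 = (1 + c) / 2 * (r - s)\<^sup>2" for c :: real
    by (simp add: power2_sum power2_diff diff_divide_distrib add_divide_distrib algebra_simps)
  have eq2: "r\<^sup>2 - 2 * r * s * cos p + s\<^sup>2 - (1 - cos p) / 2 * (r + s)\<^sup>2 = (1 + cos p) / 2 * (r - s)\<^sup>2"
    by (rule poly)
  have "(1 + cos p) / 2 * (r - s)\<^sup>2 \<ge> 0"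
  proof (rule mult_nonneg_nonneg)
    have "1 + (- 1) \<le> 1 + cos p" by (rule add_left_mono[OF cos_ge_minus_one])
    then show "0 \<le> (1 + cos p) / 2" by (intro divide_nonneg_pos) auto
  qed simp
  with eq2 have "(1 - cos p) / 2 * (r + s)\<^sup>2 \<le> r\<^sup>2 - 2 * r * s * cos p + s\<^sup>2" by linarith
  then show "(\<bar>sin (p / 2)\<bar> * (r + s))\<^sup>2 \<le> (cmod (of_real r * cis p - of_real s))\<^sup>2"
    unfolding 1 by (simp only: power_mult_distrib s2 power2_abs)
qed simp

lemma has_contour_integral_horizontal:
  assumes "a < b" "((\<lambda>x. f (Complex x c)) has_integral I) {a..b}"
  shows "(f has_contour_integral I) (linepath (Complex a c) (Complex b c))"
proof -
  have "((\<lambda>x. f (Complex ((b - a) *\<^sub>R x + a) c)) has_integral (I /\<^sub>R (b - a) ^ DIM(real)))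
          (cbox ((a - a) /\<^sub>R (b - a)) ((b - a) /\<^sub>R (b - a)))"
    using has_integral_affinity'[of "\<lambda>x. f (Complex x c)" I a b "b - a" a] assms by simp
  then have "((\<lambda>x. f (Complex ((b - a) * x + a) c)) has_integral (I /\<^sub>R (b - a))) {0..1}"
    using assms(1) by simp
  then have "((\<lambda>x. f (Complex ((b - a) * x + a) c) * of_real (b - a)) has_integral
               (I /\<^sub>R (b - a)) * of_real (b - a)) {0..1}"
    by (rule has_integral_mult_left)
  moreover have "(I /\<^sub>R (b - a)) * of_real (b - a) = I"
    using assms(1) by (simp add: scaleR_conv_of_real)
  moreover have "Complex ((b - a) * x + a) c = linepath (Complex a c) (Complex b c) x" for x
    by (simp add: linepath_def complex_eq_iff algebra_simps)
  moreover have "of_real (b - a) = Complex b c - Complex a c" by (simp add: complex_eq_iff)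
  ultimately show ?thesis
    unfolding has_contour_integral_linepath by simp
qed

text \<open>
  When the vertical sides are pushed to infinity only the horizontal integrals survive, provided
  the integrand decays.
\<close>

lemma contour_integral_rectpath:
  assumes ab: "a < b" "c < d"
    and h: "continuous_on (path_image (rectpath (Complex a c) (Complex b d))) h"
    and B: "\<And>x. x \<in> {c..d} \<Longrightarrow> norm (h (Complex a x)) \<le> B" "\<And>x. x \<in> {c..d} \<Longrightarrow> norm (h (Complex b x)) \<le> B"
  shows "norm (contour_integral (rectpath (Complex a c) (Complex b d)) h -
           (integral {a..b} (\<lambda>x. h (Complex x c)) - integral {a..b} (\<lambda>x. h (Complex x d)))) \<le> 2 * (d - c) * B"
proof -
  let ?R = "{z. Re z \<in> {a, b} \<and> Im z \<in> {c..d}} \<union> {z. Im z \<in> {c, d} \<and> Re z \<in> {a..b}}"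
  have im: "path_image (rectpath (Complex a c) (Complex b d)) = ?R"
    using ab by (subst path_image_rectpath) auto
  have h': "continuous_on ?R h" using h unfolding im .
  have "0 \<le> B" using B(1)[of c] ab norm_ge_zero[of "h (Complex a c)"] by (smt (verit) atLeastAtMost_iff)
  have bt: "closed_segment (Complex a y) (Complex b y) = {z. Im z = y \<and> Re z \<in> {a..b}}" for y
    using ab by (subst closed_segment_same_Im) (auto simp: closed_segment_eq_real_ivl)
  have lr: "closed_segment (Complex x c) (Complex x d) = {z. Re z = x \<and> Im z \<in> {c..d}}" for x
    using ab by (subst closed_segment_same_Re) (auto simp: closed_segment_eq_real_ivl)
  have seg: "continuous_on (closed_segment (Complex a d) (Complex b d)) h"
            "continuous_on (closed_segment (Complex a c) (Complex a d)) h"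
    by (rule continuous_on_subset[OF h'], auto simp: bt lr)+
  have I1: "h contour_integrable_on linepath (Complex a c) (Complex b c)"
           "h contour_integrable_on linepath (Complex a d) (Complex b d)"
    by (intro contour_integrable_continuous_linepath continuous_on_subset[OF h']; auto simp: bt)+
  have I2: "h contour_integrable_on linepath (Complex b c) (Complex b d)"
           "h contour_integrable_on linepath (Complex a c) (Complex a d)"
    by (intro contour_integrable_continuous_linepath continuous_on_subset[OF h']; auto simp: lr)+
  have I3: "h contour_integrable_on linepath (Complex b d) (Complex a d)"
           "h contour_integrable_on linepath (Complex a d) (Complex a c)"
    by (intro contour_integrable_continuous_linepath continuous_on_subset[OF h'];
        subst closed_segment_commute; auto simp: bt lr)+
  have hor: "contour_integral (linepath (Complex a y) (Complex b y)) h = integral {a..b} (\<lambda>x. h (Complex x y))"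
    if "y = c \<or> y = d" for y
  proof -
    have "continuous_on {a..b} (\<lambda>x. h (Complex x y))"
      using that ab
      by (intro continuous_on_compose2[OF h'] continuous_intros) (auto simp: Complex_eq intro!: continuous_intros)
    then have "((\<lambda>x. h (Complex x y)) has_integral integral {a..b} (\<lambda>x. h (Complex x y))) {a..b}"
      using integrable_continuous_real by blast
    from has_contour_integral_horizontal[OF ab(1) this] show ?thesis
      by (rule contour_integral_unique)
  qed
  have "contour_integral (rectpath (Complex a c) (Complex b d)) h =
      contour_integral (linepath (Complex a c) (Complex b c)) h +
      (contour_integral (linepath (Complex b c) (Complex b d)) h +
       (contour_integral (linepath (Complex b d) (Complex a d)) h +
        contour_integral (linepath (Complex a d) (Complex a c)) h))"
    unfolding rectpath_def Let_def using I1 I2 I3 by (simp add: contour_integrable_joinI)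
  also have "contour_integral (linepath (Complex b d) (Complex a d)) h =
     - contour_integral (linepath (Complex a d) (Complex b d)) h"
    by (rule contour_integral_reverse_linepath, subst closed_segment_commute, rule seg(1))
  also have "contour_integral (linepath (Complex a d) (Complex a c)) h =
     - contour_integral (linepath (Complex a c) (Complex a d)) h"
    by (rule contour_integral_reverse_linepath, subst closed_segment_commute, rule seg(2))
  finally have "contour_integral (rectpath (Complex a c) (Complex b d)) h -
           (integral {a..b} (\<lambda>x. h (Complex x c)) - integral {a..b} (\<lambda>x. h (Complex x d)))
      = contour_integral (linepath (Complex b c) (Complex b d)) h -
        contour_integral (linepath (Complex a c) (Complex a d)) h"
    using hor by simp
  also have "norm \<dots> \<le> norm (contour_integral (linepath (Complex b c) (Complex b d)) h) +
        norm (contour_integral (linepath (Complex a c) (Complex a d)) h)"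
    by (rule norm_triangle_ineq4)
  also have "\<dots> \<le> B * norm (Complex b d - Complex b c) + B * norm (Complex a d - Complex a c)"
  proof (intro add_mono contour_integral_bound_linepath I2 \<open>0 \<le> B\<close>)
    show "norm (h z) \<le> B" if "z \<in> closed_segment (Complex b c) (Complex b d)" for z
      using B(2)[of "Im z"] that unfolding lr by (cases z) auto
    show "norm (h z) \<le> B" if "z \<in> closed_segment (Complex a c) (Complex a d)" for z
      using B(1)[of "Im z"] that unfolding lr by (cases z) auto
  qed
  also have "\<dots> = 2 * (d - c) * B"
    using ab by (simp add: cmod_def)
  finally show ?thesis .
qed

lemma exp_eq_real_in_strip:
  assumes "\<bar>Im w\<bar> < 2 * pi" "s > 0" "exp w = of_real s"
  shows "w = of_real (ln s)"
proof -
  have "exp w = exp (of_real (ln s))" using assms by (simp add: exp_of_real)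
  then obtain n where n: "w = of_real (ln s) + (of_int (2 * n) * pi) * \<i>"
    unfolding exp_eq by blast
  then have "Im w = 2 * of_int n * pi" by simp
  then have "\<bar>of_int n * (2 * pi)\<bar> < 1 * (2 * pi)" using assms(1) by simp
  then have "\<bar>real_of_int n\<bar> < 1"
    unfolding abs_mult by (simp add: mult_less_cancel_right)
  then have "n = 0" by linarith
  then show ?thesis using n by simp
qed

text \<open>
  With \<open>w = ln z\<close> a sector becomes a strip and the rays bounding it become horizontal
  lines. The integrand \<open>H\<close> is the Cauchy kernel of the sector in this variable; its
  only pole in the strip is \<open>ln s\<close>, with residue \<open>\<Psi> (ln s)\<close>, since
  \<open>exp w / (exp w - s)\<close> has residue 1 there. The bound with \<open>0 < b < 1\<close>
  makes \<open>H\<close> decay exponentially in both directions.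

  This one formula gives both the Stieltjes representation of the fractional resolvent and the
  inversion of the Laplace transform of the source.
\<close>

theorem cauchy_formula_strip:
  fixes \<Psi> :: "complex \<Rightarrow> complex"
  assumes holo: "\<Psi> holomorphic_on {w. \<bar>Im w\<bar> < \<theta>}"
    and p: "0 < p" "p \<le> pi" "p < \<theta>" and b: "0 < b" "b < 1"
    and bound: "\<And>w. \<bar>Im w\<bar> \<le> p \<Longrightarrow> norm (\<Psi> w) \<le> C * exp (- b * Re w)" and s: "s > 0"
  defines "H \<equiv> (\<lambda>w. \<Psi> w * exp w / (exp w - of_real s))"
  shows "integrable lborel (\<lambda>x. H (Complex x (- p)))" (is ?i1)
    and "integrable lborel (\<lambda>x. H (Complex x p))" (is ?i2)
    and "(LBINT x. H (Complex x (- p))) - (LBINT x. H (Complex x p)) = 2 * pi * \<i> * \<Psi> (of_real (ln s))"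
proof -
  define S where "S = {w. \<bar>Im w\<bar> < min \<theta> (2 * pi)}"
  have S_eq: "S = {w. Im w < min \<theta> (2 * pi)} \<inter> {w. - min \<theta> (2 * pi) < Im w}"
    unfolding S_def by auto
  have "open S" unfolding S_eq by (intro open_Int open_Collect_less continuous_intros)
  have "convex S" unfolding S_eq
    by (intro convex_Int convex_halfspace_Im_lt convex_halfspace_Im_gt)
  define z where "z = complex_of_real (ln s)"
  have zS: "z \<in> S" using p unfolding S_def z_def by auto
  have nz: "exp w - of_real s \<noteq> 0" if "w \<in> S" "w \<noteq> z" for w
    using exp_eq_real_in_strip[of w s] that s unfolding S_def z_def by auto
  have holoS: "\<Psi> holomorphic_on S" using holo by (rule holomorphic_on_subset) (auto simp: S_def)
  have Hholo: "H holomorphic_on S - {z}"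
    unfolding H_def using nz
    by (intro holomorphic_intros holomorphic_on_subset[OF holoS]) auto
  have Hcont: "continuous_on (S - {z}) H" by (rule holomorphic_on_imp_continuous_on[OF Hholo])
  have C0: "C \<ge> 0"
    using bound[of 0] p norm_ge_zero[of "\<Psi> 0"] by (simp del: norm_ge_zero)
  have sp: "sin (p / 2) > 0" using p by (intro sin_gt_zero) auto
  \<comment> \<open>Towards minus infinity the factor \<open>exp w\<close> wins over the growth
  of \<open>\<Psi>\<close>, at rate \<open>1 - b\<close>; towards plus infinity
  \<open>\<Psi>\<close> decays at rate \<open>b\<close>.\<close>
  define d where "d = min b (1 - b)"
  have d: "d > 0" using b by (simp add: d_def)
  define K where "K = C / sin (p / 2) * (1 + 1 / s)"
  have expx: "exp (Complex x y) = of_real (exp x) * cis y" for x y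
    by (simp add: exp_eq_polar)
  have Hb: "norm (H (Complex x q)) \<le> K * exp (- d * \<bar>x\<bar>)" if q: "\<bar>q\<bar> = p" for x q
  proof -
    have sq: "\<bar>sin (q / 2)\<bar> = sin (p / 2)"
      using q sp by (cases "q \<ge> 0") (auto simp: abs_if split: if_splits)
    have den: "cmod (exp (Complex x q) - of_real s) \<ge> sin (p / 2) * (exp x + s)"
      using cmod_diff_ge_sin_half[of "exp x" s q] s unfolding expx sq by simp
    have "0 < sin (p / 2) * (exp x + s)" using sp s by (simp add: add_pos_pos)
    have "norm (H (Complex x q)) = norm (\<Psi> (Complex x q)) * exp x / cmod (exp (Complex x q) - of_real s)"
      by (simp add: H_def norm_mult norm_divide)
    also have "\<dots> \<le> (C * exp (- b * x)) * exp x / (sin (p / 2) * (exp x + s))"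
      using bound[of "Complex x q"] q den \<open>0 < sin (p / 2) * (exp x + s)\<close> C0
      by (intro frac_le mult_right_mono mult_nonneg_nonneg) auto
    also have "\<dots> = C / sin (p / 2) * (exp (- b * x) * (exp x / (exp x + s)))"
      by simp
    also have "\<dots> \<le> C / sin (p / 2) * ((1 + 1 / s) * exp (- d * \<bar>x\<bar>))"
    proof (intro mult_left_mono)
     show "exp (- b * x) * (exp x / (exp x + s)) \<le> (1 + 1 / s) * exp (- d * \<bar>x\<bar>)"
     proof (cases "x \<ge> 0")
      case True
      have "exp (- b * x) * (exp x / (exp x + s)) \<le> exp (- b * x) * 1"
        using s by (intro mult_left_mono) (auto simp: divide_le_eq add_pos_pos)
      also have "\<dots> \<le> exp (- d * \<bar>x\<bar>)" using True by (simp add: d_def mult_right_mono)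
      also have "\<dots> \<le> (1 + 1 / s) * exp (- d * \<bar>x\<bar>)" using s by (simp add: algebra_simps)
      finally show ?thesis .
    next
      case False
      have "exp (- b * x) * (exp x / (exp x + s)) \<le> exp (- b * x) * (exp x / s)"
        using s by (intro mult_left_mono divide_left_mono) (auto simp: add_pos_pos)
      also have "\<dots> = 1 / s * exp ((1 - b) * x)"
        by (simp add: exp_add[symmetric] algebra_simps)
      also have "\<dots> \<le> 1 / s * exp (- d * \<bar>x\<bar>)"
      proof (intro mult_left_mono)
        have "(1 - b) * x \<le> d * x" using False by (intro mult_right_mono_neg) (auto simp: d_def)
        then show "exp ((1 - b) * x) \<le> exp (- d * \<bar>x\<bar>)" using False by simp
      qed (use s in auto)
      also have "\<dots> \<le> (1 + 1 / s) * exp (- d * \<bar>x\<bar>)" by (simp add: algebra_simps)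
      finally show ?thesis .
     qed
    qed (use C0 sp in auto)
    finally show ?thesis unfolding K_def by (simp only: mult.assoc)
  qed
  have contq: "continuous_on UNIV (\<lambda>x. H (Complex x q))" if q: "\<bar>q\<bar> = p" for q
  proof (rule continuous_on_compose2[OF Hcont])
    show "continuous_on UNIV (\<lambda>x. Complex x q)" by (intro continuous_intros)
    have "Complex x q \<in> S" for x using p q by (auto simp: S_def)
    moreover have "Complex x q \<noteq> z" for x using p q by (auto simp: z_def complex_eq_iff)
    ultimately show "range (\<lambda>x. Complex x q) \<subseteq> S - {z}" by auto
  qed
  have measq: "(\<lambda>x. H (Complex x q)) \<in> borel_measurable borel" if q: "\<bar>q\<bar> = p" for q
    by (rule borel_measurable_continuous_onI[OF contq[OF q]])
  have intq: "integrable lborel (\<lambda>x. H (Complex x q))" if q: "\<bar>q\<bar> = p" for q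
    using Hb[OF q] measq[OF q] d by (intro integrable_bound_exp_minus_abs[of _ d K]) auto
  show ?i1 ?i2 using intq p by auto
  have lim: "(\<lambda>n::nat. integral {- real n..real n} (\<lambda>x. H (Complex x q))) \<longlonglongrightarrow> (LBINT x. H (Complex x q))"
    if q: "\<bar>q\<bar> = p" for q
  proof -
    have "(\<lambda>n::nat. LBINT x. indicator {- real n..real n} x *\<^sub>R H (Complex x q)) \<longlonglongrightarrow> (LBINT x. H (Complex x q))"
    proof (rule integral_dominated_convergence[where w = "\<lambda>x. norm (H (Complex x q))"])
      show "integrable lborel (\<lambda>x. norm (H (Complex x q)))" using intq[OF q] by simp
      show "AE x in lborel. (\<lambda>n. indicator {- real n..real n} x *\<^sub>R H (Complex x q)) \<longlonglongrightarrow> H (Complex x q)"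
      proof (intro AE_I2 tendsto_eventually)
        fix x :: real
        obtain m :: nat where "\<bar>x\<bar> \<le> m" using real_arch_simple by blast
        then show "\<forall>\<^sub>F n in sequentially. indicator {- real n..real n} x *\<^sub>R H (Complex x q) = H (Complex x q)"
          by (intro eventually_sequentiallyI[of m]) (auto simp: indicator_def abs_le_iff)
      qed
    qed (use measq[OF q] in \<open>auto simp: indicator_def\<close>)
    moreover have "(LBINT x. indicator {- real n..real n} x *\<^sub>R H (Complex x q)) = integral {- real n..real n} (\<lambda>x. H (Complex x q))" for n
      using set_borel_integral_eq_integral(2)[of "{- real n..real n}" "\<lambda>x. H (Complex x q)"]
        borel_integrable_atLeastAtMost'[OF continuous_on_subset[OF contq[OF q]]]
      unfolding set_lebesgue_integral_def by auto
    ultimately show ?thesis by simp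
  qed
  \<comment> \<open>residue\<close>
  have res: "residue H z = \<Psi> z"
  proof (rule residue_simple'[OF \<open>open S\<close> zS Hholo])
    have ez: "exp z = of_real s" using s by (simp add: z_def exp_of_real)
    have "((\<lambda>w. (exp w - exp z) / (w - z)) \<longlongrightarrow> exp z) (at z)"
      using DERIV_exp[of z] unfolding has_field_derivative_iff by simp
    moreover have "isCont \<Psi> z" using holoS zS \<open>open S\<close>
      by (metis holomorphic_on_imp_continuous_on continuous_on_eq_continuous_at)
    then have "(\<Psi> \<longlongrightarrow> \<Psi> z) (at z)" by (simp add: isCont_def)
    moreover have "(exp \<longlongrightarrow> exp z) (at z)" using isCont_exp by (auto simp: isCont_def)
    ultimately have "((\<lambda>w. \<Psi> w * exp w / ((exp w - exp z) / (w - z))) \<longlongrightarrow> \<Psi> z * exp z / exp z) (at z)"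
      by (intro tendsto_intros) auto
    then show "((\<lambda>w. H w * (w - z)) \<longlongrightarrow> \<Psi> z) (at z)" unfolding H_def ez using s by simp
  qed
  have Hv: "(\<lambda>n::nat. contour_integral (rectpath (Complex (- real n) (- p)) (Complex n p)) H)
     \<longlonglongrightarrow> 2 * pi * \<i> * \<Psi> z"
  proof (rule tendsto_eventually, rule eventually_sequentiallyI)
    fix n :: nat assume n: "n \<ge> nat \<lceil>\<bar>ln s\<bar>\<rceil> + 1"
    then have n': "\<bar>ln s\<bar> < n" by linarith
    let ?g = "rectpath (Complex (- real n) (- p)) (Complex n p)"
    have zb: "z \<in> box (Complex (- real n) (- p)) (Complex n p)"
      using n' p by (auto simp: in_box_complex_iff z_def)
    have pi_sub: "path_image ?g \<subseteq> cbox (Complex (- real n) (- p)) (Complex n p)"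
      using p by (intro path_image_rectpath_subset_cbox) auto
    have cS: "cbox (Complex (- real n) (- p)) (Complex n p) \<subseteq> S"
      using p by (auto simp: in_cbox_complex_iff S_def)
    have "z \<notin> path_image ?g"
      using zb p by (subst path_image_rectpath_cbox_minus_box) auto
    then have "contour_integral ?g H = 2 * pi * \<i> * (\<Sum>q\<in>{z}. winding_number ?g q * residue H q)"
      using pi_sub cS \<open>open S\<close> \<open>convex S\<close> Hholo p
      by (intro Residue_theorem[of S "{z}" H ?g])
         (auto intro!: convex_connected winding_number_rectpath_outside)
    also have "\<dots> = 2 * pi * \<i> * \<Psi> z" using winding_number_rectpath[OF zb] res by simp
    finally show "contour_integral ?g H = 2 * pi * \<i> * \<Psi> z" .
  qed
  define B where "B = (\<lambda>n::nat. 2 * C * exp (- b * n) + 2 * C / s * exp ((b - 1) * n))"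
  have B0: "(\<lambda>n. 2 * (p - (- p)) * B n) \<longlonglongrightarrow> 0"
  proof -
    have "(\<lambda>n::nat. exp (- c * n)) \<longlonglongrightarrow> 0" if "c > 0" for c :: real
      using that by real_asymp
    from this[of b] this[of "1 - b"] have "(\<lambda>n::nat. exp (- b * n)) \<longlonglongrightarrow> 0" "(\<lambda>n::nat. exp ((b - 1) * n)) \<longlonglongrightarrow> 0"
      using b by auto
    then have "(\<lambda>n. 2 * (p - (- p)) * B n) \<longlonglongrightarrow> 2 * (p - (- p)) * (2 * C * 0 + 2 * C / s * 0)"
      unfolding B_def by (intro tendsto_intros)
    then show ?thesis by simp
  qed
  have "(\<lambda>n::nat. contour_integral (rectpath (Complex (- real n) (- p)) (Complex n p)) H -
       (integral {- real n..real n} (\<lambda>x. H (Complex x (- p))) - integral {- real n..real n} (\<lambda>x. H (Complex x p)))) \<longlonglongrightarrow> 0"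
  proof (rule Lim_null_comparison[OF _ B0])
    have expn: "exp n \<ge> 2 * s \<and> exp n \<ge> 2 / s" if n: "n \<ge> nat \<lceil>2 * s\<rceil> + nat \<lceil>2 / s\<rceil>" for n :: nat
    proof -
      have "real n \<ge> 2 * s" "real n \<ge> 2 / s" using n s by linarith+
      moreover have "exp (real n) \<ge> real n" using exp_ge_add_one_self[of "real n"] by linarith
      ultimately show ?thesis by linarith
    qed
    show "\<forall>\<^sub>F n::nat in sequentially. norm (contour_integral (rectpath (Complex (- real n) (- p)) (Complex n p)) H -
       (integral {- real n..real n} (\<lambda>x. H (Complex x (- p))) - integral {- real n..real n} (\<lambda>x. H (Complex x p)))) \<le> 2 * (p - (- p)) * B n"
    proof (intro eventually_sequentiallyI)
      fix n :: nat assume n: "n \<ge> nat \<lceil>2 * s\<rceil> + nat \<lceil>2 / s\<rceil> + nat \<lceil>\<bar>ln s\<bar>\<rceil> + 1"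
      then have n': "\<bar>ln s\<bar> < n" "n \<ge> nat \<lceil>2 * s\<rceil> + nat \<lceil>2 / s\<rceil>" by linarith+
      have en: "exp n \<ge> 2 * s" "exp n \<ge> 2 / s"
        using expn[OF n'(2)] by auto
      show "norm (contour_integral (rectpath (Complex (- real n) (- p)) (Complex n p)) H -
       (integral {- real n..real n} (\<lambda>x. H (Complex x (- p))) - integral {- real n..real n} (\<lambda>x. H (Complex x p)))) \<le> 2 * (p - (- p)) * B n"
      proof (rule contour_integral_rectpath)
        show "- real n < real n" "- p < p" using p n' by auto
        have zb: "z \<in> box (Complex (- real n) (- p)) (Complex n p)"
          using n' p by (auto simp: in_box_complex_iff z_def)
        have "path_image (rectpath (Complex (- real n) (- p)) (Complex n p)) \<subseteq> cbox (Complex (- real n) (- p)) (Complex n p)"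
          using p by (intro path_image_rectpath_subset_cbox) auto
        moreover have "cbox (Complex (- real n) (- p)) (Complex n p) \<subseteq> S"
          using p by (auto simp: in_cbox_complex_iff S_def)
        moreover have "z \<notin> path_image (rectpath (Complex (- real n) (- p)) (Complex n p))"
          using zb p by (subst path_image_rectpath_cbox_minus_box) auto
        ultimately show "continuous_on (path_image (rectpath (Complex (- real n) (- p)) (Complex n p))) H"
          by (intro continuous_on_subset[OF Hcont]) auto
        fix y assume y: "y \<in> {- p..p}"
        have b1: "norm (\<Psi> (Complex x y)) \<le> C * exp (- b * x)" for x
          using bound[of "Complex x y"] y by (auto simp: abs_le_iff)
        have nH: "norm (H (Complex x y)) = norm (\<Psi> (Complex x y)) * exp x / cmod (exp (Complex x y) - of_real s)" for x
          by (simp add: H_def norm_mult norm_divide)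
        have tri: "cmod (exp (Complex x y) - of_real s) \<ge> \<bar>exp x - s\<bar>" for x
          using norm_triangle_ineq3[of "exp (Complex x y)" "of_real s"] s by simp
        show "norm (H (Complex (real n) y)) \<le> B n"
        proof -
          have "cmod (exp (Complex n y) - of_real s) \<ge> exp n / 2" using tri[of n] en by linarith
          then have "norm (H (Complex n y)) \<le> (C * exp (- b * n)) * exp n / (exp n / 2)"
            unfolding nH using b1 C0 by (intro frac_le mult_right_mono mult_nonneg_nonneg) auto
          also have "\<dots> = 2 * C * exp (- b * n)" by simp
          also have "\<dots> \<le> B n" unfolding B_def using C0 s by simp
          finally show ?thesis .
        qed
        show "norm (H (Complex (- real n) y)) \<le> B n"
        proof -
          have "exp (- real n) \<le> s / 2" using en(2) s by (simp add: exp_minus field_simps)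
          then have "cmod (exp (Complex (- real n) y) - of_real s) \<ge> s / 2" using tri[of "- real n"] by linarith
          then have "norm (H (Complex (- real n) y)) \<le> (C * exp (- b * (- real n))) * exp (- real n) / (s / 2)"
            unfolding nH using b1[of "- real n"] C0 s by (intro frac_le mult_right_mono mult_nonneg_nonneg) auto
          also have "\<dots> = 2 * C / s * (exp (- b * (- real n)) * exp (- real n))" by simp
          also have "exp (- b * (- real n)) * exp (- real n) = exp ((b - 1) * n)"
            by (simp add: exp_add[symmetric] algebra_simps)
          also have "2 * C / s * exp ((b - 1) * n) \<le> B n" unfolding B_def using C0 by simp
          finally show ?thesis .
        qed
      qed
    qed
  qed
  from tendsto_diff[OF Hv this]
  have "(\<lambda>n::nat. integral {- real n..real n} (\<lambda>x. H (Complex x (- p))) - integral {- real n..real n} (\<lambda>x. H (Complex x p)))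
     \<longlonglongrightarrow> 2 * pi * \<i> * \<Psi> z" by simp
  moreover have "(\<lambda>n::nat. integral {- real n..real n} (\<lambda>x. H (Complex x (- p))) - integral {- real n..real n} (\<lambda>x. H (Complex x p)))
     \<longlonglongrightarrow> (LBINT x. H (Complex x (- p))) - (LBINT x. H (Complex x p))"
    using p by (intro tendsto_diff lim) auto
  ultimately show "(LBINT x. H (Complex x (- p))) - (LBINT x. H (Complex x p)) = 2 * pi * \<i> * \<Psi> (of_real (ln s))"
    unfolding z_def by (rule LIMSEQ_unique[rotated])
qed

section \<open>Uniqueness of the Laplace transform\<close>

text \<open>
  Only the values at \<open>\<sigma> + k\<close>, \<open>k = 1, 2, ...\<close>, are used: with
  \<open>m t = exp (- \<sigma> t) W t\<close> they say that \<open>m\<close> is orthogonal to all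
  positive powers of \<open>exp (- t)\<close>, hence by Weierstrass to \<open>exp (- t)\<close>
  times any continuous function of it. Continuous approximations of the sign of \<open>m\<close>
  then show that \<open>m\<close> is zero.
\<close>

lemma laplace_transform_unique:
  fixes W :: "real \<Rightarrow> real"
  assumes int: "integrable lebesgue (\<lambda>t. indicator {0<..} t * (exp (- \<sigma> * t) * W t))"
    and zero: "\<And>z. z > \<sigma> \<Longrightarrow> (LINT t|lebesgue. indicator {0<..} t * (exp (- z * t) * W t)) = 0"
  shows "AE t in lebesgue. t > 0 \<longrightarrow> W t = 0"
proof -
  have cm: "g \<in> borel_measurable lebesgue" if "continuous_on UNIV g" for g :: "real \<Rightarrow> real"
    using borel_measurable_continuous_onI[OF that] by (intro measurable_completion) simp
  define m where "m = (\<lambda>t. indicator {0<..} t * (exp (- \<sigma> * t) * W t))"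
  have m: "integrable lebesgue m" using int unfolding m_def .
  have m0: "m t = 0" if "t \<le> 0" for t using that by (simp add: m_def)
  have intb: "integrable lebesgue (\<lambda>t. g t * m t)"
    if g: "g \<in> borel_measurable lebesgue" "\<And>t. t > 0 \<Longrightarrow> \<bar>g t\<bar> \<le> B" for g B
  proof (rule Bochner_Integration.integrable_bound)
    show "integrable lebesgue (\<lambda>t. B * m t)" using m by simp
    show "(\<lambda>t. g t * m t) \<in> borel_measurable lebesgue" using g m by auto
    have "\<bar>g t * m t\<bar> \<le> \<bar>B * m t\<bar>" for t
    proof (cases "t > 0")
      case True
      have "\<bar>g t\<bar> \<le> \<bar>B\<bar>" using g(2)[OF True] by linarith
      then show ?thesis by (simp add: abs_mult mult_right_mono)
    qed (simp add: m0)
    then show "AE t in lebesgue. norm (g t * m t) \<le> norm (B * m t)" by (intro AE_I2) simp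
  qed
  have expm: "exp (- t * real k) = exp (- t) ^ k" for t k
    by (simp add: exp_of_nat2_mult[symmetric] mult.commute)
  have pow: "integrable lebesgue (\<lambda>t. exp (- t) ^ Suc k * m t) \<and> (LINT t|lebesgue. exp (- t) ^ Suc k * m t) = 0" for k
  proof
    show "integrable lebesgue (\<lambda>t. exp (- t) ^ Suc k * m t)"
      by (rule intb[of _ 1]) (auto simp: power_le_one abs_mult mult_le_one intro!: cm continuous_intros simp del: power_Suc)
    have "exp (- t) ^ Suc k * m t = indicator {0<..} t * (exp (- (\<sigma> + real (Suc k)) * t) * W t)" for t
    proof -
      have "exp (- (\<sigma> + real (Suc k)) * t) = exp (- t * real (Suc k)) * exp (- \<sigma> * t)"
        unfolding exp_add[symmetric] by (simp add: algebra_simps)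
      then show ?thesis unfolding expm m_def by simp
    qed
    then show "(LINT t|lebesgue. exp (- t) ^ Suc k * m t) = 0"
      using zero[of "\<sigma> + real (Suc k)"] by simp
  qed
  have cont0: "(LINT t|lebesgue. \<phi> (exp (- t)) * (exp (- t) * m t)) = 0"
    if \<phi>: "continuous_on UNIV \<phi>" for \<phi> :: "real \<Rightarrow> real"
  proof -
    have M: "integrable lebesgue (\<lambda>t. exp (- t) * m t)" using pow[of 0] by simp
    define A where "A = (LINT t|lebesgue. \<bar>exp (- t) * m t\<bar>)"
    have A0: "A \<ge> 0" unfolding A_def by simp
    have "bounded (\<phi> ` {0..1})"
      by (intro compact_imp_bounded compact_continuous_image continuous_on_subset[OF \<phi>]) auto
    then obtain B where "\<forall>y\<in>\<phi> ` {0..1}. \<bar>y\<bar> \<le> B" unfolding bounded_iff real_norm_def by blast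
    then have B: "\<And>x. x \<in> {0..1} \<Longrightarrow> \<bar>\<phi> x\<bar> \<le> B" by blast
    have meas\<phi>: "(\<lambda>t. \<phi> (exp (- t))) \<in> borel_measurable lebesgue"
      by (intro cm continuous_on_compose2[OF \<phi>] continuous_intros) auto
    have I\<phi>: "integrable lebesgue (\<lambda>t. \<phi> (exp (- t)) * (exp (- t) * m t))"
    proof -
      have "integrable lebesgue (\<lambda>t. (\<phi> (exp (- t)) * exp (- t)) * m t)"
      proof (rule intb)
        show "(\<lambda>t. \<phi> (exp (- t)) * exp (- t)) \<in> borel_measurable lebesgue"
          by (intro borel_measurable_times meas\<phi> cm continuous_intros)
        fix t :: real assume "t > 0"
        then have "\<bar>\<phi> (exp (- t))\<bar> * exp (- t) \<le> B * 1"
          using B[of "exp (- t)"] by (intro mult_mono) auto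
        then show "\<bar>\<phi> (exp (- t)) * exp (- t)\<bar> \<le> B" by (simp add: abs_mult)
      qed
      then show ?thesis by (simp add: mult.assoc)
    qed
    have "\<bar>LINT t|lebesgue. \<phi> (exp (- t)) * (exp (- t) * m t)\<bar> \<le> e * A" if "e > 0" for e
    proof -
      obtain p where p: "real_polynomial_function p" "\<And>x. x \<in> {0..1} \<Longrightarrow> \<bar>\<phi> x - p x\<bar> < e"
        using Stone_Weierstrass_real_polynomial_function[of "{0..1::real}" \<phi> e] \<open>e > 0\<close>
          continuous_on_subset[OF \<phi>] by auto
      then obtain a n where an: "p = (\<lambda>x. \<Sum>i\<le>n. a i * x ^ i)"
        using real_polynomial_function_iff_sum by auto
      have peq: "p (exp (- t)) * (exp (- t) * m t) = (\<Sum>i\<le>n. a i * (exp (- t) ^ Suc i * m t))" for t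
        unfolding an sum_distrib_right by (intro sum.cong) auto
      have Ip: "integrable lebesgue (\<lambda>t. p (exp (- t)) * (exp (- t) * m t))"
        unfolding peq using pow by (intro Bochner_Integration.integrable_sum integrable_mult_right) auto
      have "(LINT t|lebesgue. p (exp (- t)) * (exp (- t) * m t)) = 0"
        unfolding peq using pow by (subst Bochner_Integration.integral_sum) auto
      then have "(LINT t|lebesgue. \<phi> (exp (- t)) * (exp (- t) * m t)) =
          (LINT t|lebesgue. \<phi> (exp (- t)) * (exp (- t) * m t) - p (exp (- t)) * (exp (- t) * m t))"
        using I\<phi> Ip by simp
      also have "\<bar>\<dots>\<bar> \<le> (LINT t|lebesgue. e * \<bar>exp (- t) * m t\<bar>)"
        unfolding real_norm_def[symmetric]
      proof (rule order_trans[OF integral_norm_bound], rule integral_mono)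
        show "norm (\<phi> (exp (- t)) * (exp (- t) * m t) - p (exp (- t)) * (exp (- t) * m t)) \<le> e * norm (exp (- t) * m t)" for t
        proof (cases "t > 0")
          case True
          have "\<bar>\<phi> (exp (- t)) - p (exp (- t))\<bar> \<le> e" using p(2)[of "exp (- t)"] True by simp
          then have "\<bar>\<phi> (exp (- t)) - p (exp (- t))\<bar> * \<bar>exp (- t) * m t\<bar> \<le> e * \<bar>exp (- t) * m t\<bar>"
            by (rule mult_right_mono) simp
          then show ?thesis unfolding abs_mult[symmetric] real_norm_def by (simp add: algebra_simps)
        qed (simp add: m0)
      qed (use I\<phi> Ip M in auto)
      also have "\<dots> = e * A" unfolding A_def by simp
      finally show ?thesis .
    qed
    note le = this
    have "(\<lambda>n. 1 / real (Suc n) * A) \<longlonglongrightarrow> 0 * A"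
      by (intro tendsto_intros LIMSEQ_Suc[OF lim_1_over_n])
    moreover have "\<bar>LINT t|lebesgue. \<phi> (exp (- t)) * (exp (- t) * m t)\<bar> \<le> 1 / real (Suc n) * A" for n
      by (rule le) simp
    ultimately have "\<bar>LINT t|lebesgue. \<phi> (exp (- t)) * (exp (- t) * m t)\<bar> \<le> 0 * A"
      by (intro LIMSEQ_le_const) auto
    then show ?thesis by simp
  qed
  have "AE t in lebesgue. t < R \<longrightarrow> m t = 0" for R :: real
  proof -
    have "(\<lambda>t. sgn (m t)) \<in> borel_measurable (lebesgue_on UNIV)" using m by simp
    then have "(\<lambda>t. sgn (m t)) measurable_on UNIV"
      by (subst measurable_on_iff_borel_measurable) auto
    then obtain N G where N: "negligible N" and G: "\<And>n. continuous_on UNIV (G n)"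
      and lim: "\<And>t. t \<notin> N \<Longrightarrow> (\<lambda>n. G n t) \<longlonglongrightarrow> sgn (m t)"
      unfolding measurable_on_def by auto
    define cl where "cl = (\<lambda>x::real. max (-1) (min 1 x))"
    \<comment> \<open>The test functions are functions of \<open>x = exp (- t)\<close>. They
    vanish below \<open>exp (- R)\<close>, so the logarithm is taken only away from 0, and they
    converge to a positive weight times the sign of \<open>m\<close>.\<close>
    define \<phi> where "\<phi> = (\<lambda>n x. cl (G n (- ln (max x (exp (- R))))) * max 0 (x - exp (- R)))"
    have ccl: "continuous_on UNIV cl" unfolding cl_def by (intro continuous_intros)
    have "continuous_on UNIV (\<phi> n)" for n
      unfolding \<phi>_def
      by (intro continuous_intros continuous_on_compose2[OF ccl] continuous_on_compose2[OF G[of n]])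
         (auto simp: max_def)
    then have z: "(LINT t|lebesgue. \<phi> n (exp (- t)) * (exp (- t) * m t)) = 0" for n by (rule cont0)
    have \<phi>meas: "(\<lambda>t. \<phi> n (exp (- t))) \<in> borel_measurable lebesgue" for n
      by (intro cm continuous_on_compose2[OF \<open>\<And>n. continuous_on UNIV (\<phi> n)\<close>] continuous_intros) auto
    have M: "integrable lebesgue (\<lambda>t. exp (- t) * m t)" using pow[of 0] by simp
    define w where "w = (\<lambda>t. max 0 (exp (- t) - exp (- R)) * (exp (- t) * \<bar>m t\<bar>))"
    have "(\<lambda>n. LINT t|lebesgue. \<phi> n (exp (- t)) * (exp (- t) * m t)) \<longlonglongrightarrow> (LINT t|lebesgue. w t)"
    proof (rule integral_dominated_convergence[where w = "\<lambda>t. \<bar>exp (- t) * m t\<bar>"])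
      show "w \<in> borel_measurable lebesgue"
        unfolding w_def
      proof (intro borel_measurable_times)
        show "(\<lambda>t. max 0 (exp (- t) - exp (- R))) \<in> borel_measurable lebesgue"
             "(\<lambda>t :: real. exp (- t)) \<in> borel_measurable lebesgue"
          by (intro cm continuous_intros)+
        show "(\<lambda>t. \<bar>m t\<bar>) \<in> borel_measurable lebesgue" using m by simp
      qed
      show "(\<lambda>t. \<phi> n (exp (- t)) * (exp (- t) * m t)) \<in> borel_measurable lebesgue" for n
        using \<phi>meas M by auto
      show "integrable lebesgue (\<lambda>t. \<bar>exp (- t) * m t\<bar>)" using M by simp
      have b: "\<bar>\<phi> n (exp (- t))\<bar> \<le> 1" if "t > 0" for n t
      proof -
        have "\<bar>cl (G n (- ln (max (exp (- t)) (exp (- R)))))\<bar> \<le> 1" by (auto simp: cl_def)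
        moreover have "exp (- t) \<le> 1" using that by simp
        then have "\<bar>max 0 (exp (- t) - exp (- R))\<bar> \<le> 1" using exp_gt_zero[of "-R"] by linarith
        ultimately show ?thesis unfolding \<phi>_def abs_mult by (intro mult_le_one) auto
      qed
      have "norm (\<phi> n (exp (- t)) * (exp (- t) * m t)) \<le> \<bar>exp (- t) * m t\<bar>" for n t
      proof (cases "t > 0")
        case True
        have "\<bar>\<phi> n (exp (- t))\<bar> * \<bar>exp (- t) * m t\<bar> \<le> 1 * \<bar>exp (- t) * m t\<bar>"
          by (rule mult_right_mono[OF b[OF True]]) simp
        then show ?thesis by (simp add: abs_mult)
      qed (simp add: m0)
      then show "AE t in lebesgue. norm (\<phi> n (exp (- t)) * (exp (- t) * m t)) \<le> \<bar>exp (- t) * m t\<bar>" for n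
        by (intro AE_I2)
      show "AE t in lebesgue. (\<lambda>n. \<phi> n (exp (- t)) * (exp (- t) * m t)) \<longlonglongrightarrow> w t"
      proof -
        have "AE t in lebesgue. t \<notin> N" using N negligible_iff_null_sets AE_not_in by blast
        then show ?thesis
        proof eventually_elim
          case (elim t)
          show ?case
          proof (cases "t < R")
            case True
            then have mx: "max (exp (- t)) (exp (- R)) = exp (- t)" by simp
            have "isCont cl (sgn (m t))" using ccl by (simp add: continuous_on_eq_continuous_at)
            then have "(\<lambda>n. cl (G n t)) \<longlonglongrightarrow> cl (sgn (m t))" using lim[OF elim] by (rule isCont_tendsto_compose)
            also have "cl (sgn (m t)) = sgn (m t)" by (auto simp: cl_def sgn_if)
            finally have "(\<lambda>n. cl (G n t) * max 0 (exp (- t) - exp (- R)) * (exp (- t) * m t)) \<longlonglongrightarrow>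
              sgn (m t) * max 0 (exp (- t) - exp (- R)) * (exp (- t) * m t)"
              by (intro tendsto_intros)
            moreover have "sgn (m t) * max 0 (exp (- t) - exp (- R)) * (exp (- t) * m t) = w t"
              by (simp add: w_def sgn_if abs_if)
            ultimately show ?thesis unfolding \<phi>_def mx by simp
          next
            case False
            then have "max 0 (exp (- t) - exp (- R)) = 0" by simp
            then show ?thesis unfolding \<phi>_def w_def by simp
          qed
        qed
      qed
    qed
    then have "(LINT t|lebesgue. w t) = 0" unfolding z by (simp add: LIMSEQ_const_iff)
    moreover have "integrable lebesgue w"
    proof -
      have "integrable lebesgue (\<lambda>t. (max 0 (exp (- t) - exp (- R)) * exp (- t) * sgn (m t)) * m t)"
      proof (rule intb[of _ 1])
        show "(\<lambda>t. max 0 (exp (- t) - exp (- R)) * exp (- t) * sgn (m t)) \<in> borel_measurable lebesgue"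
        proof (intro borel_measurable_times)
          show "(\<lambda>t. max 0 (exp (- t) - exp (- R))) \<in> borel_measurable lebesgue"
               "(\<lambda>t :: real. exp (- t)) \<in> borel_measurable lebesgue"
            by (intro cm continuous_intros)+
          show "(\<lambda>t. sgn (m t)) \<in> borel_measurable lebesgue" using m by simp
        qed
        fix t :: real assume "t > 0"
        then have e: "exp (- t) \<le> 1" by simp
        then have "\<bar>max 0 (exp (- t) - exp (- R))\<bar> \<le> 1" using exp_gt_zero[of "-R"] by linarith
        then show "\<bar>max 0 (exp (- t) - exp (- R)) * exp (- t) * sgn (m t)\<bar> \<le> 1"
          unfolding abs_mult using e by (intro mult_le_one) (auto simp: sgn_if)
      qed
      moreover have "(max 0 (exp (- t) - exp (- R)) * exp (- t) * sgn (m t)) * m t = w t" for t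
        by (simp add: w_def sgn_if abs_if)
      ultimately show ?thesis by simp
    qed
    ultimately have "AE t in lebesgue. w t = 0"
      by (subst (asm) integral_nonneg_eq_0_iff_AE) (auto simp: w_def)
    then show ?thesis by eventually_elim (auto simp: w_def max_def split: if_splits)
  qed
  then have "AE t in lebesgue. \<forall>n::nat. t < real n \<longrightarrow> m t = 0" by (subst AE_all_countable) auto
  then show ?thesis
  proof eventually_elim
    case (elim t)
    obtain n :: nat where "t < n" using reals_Archimedean2 by blast
    then have "m t = 0" using elim by blast
    then show ?case by (auto simp: m_def)
  qed
qed

section \<open>The resolvent as a Stieltjes integral\<close>

text \<open>
  The density of the Stieltjes measure of \<open>1 / (s powr \<alpha> + l)\<close> in the
  logarithmic variable \<open>x\<close>: up to the factor \<open>exp x\<close> it is the jump of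
  the function across the negative half-axis, divided by \<open>2 \<i> pi\<close>.
\<close>

definition kap :: "real \<Rightarrow> real \<Rightarrow> real \<Rightarrow> real" where
  "kap \<alpha> l x = sin (pi * \<alpha>) / pi * exp x * exp (\<alpha> * x) /
     ((exp (\<alpha> * x))\<^sup>2 + 2 * l * exp (\<alpha> * x) * cos (pi * \<alpha>) + l\<^sup>2)"

context
  fixes \<alpha> l :: real assumes \<alpha>: "0 < \<alpha>" "\<alpha> < 1" and l: "l \<ge> 0"
begin

lemma sin_pi_alpha_pos: "sin (pi * \<alpha>) > 0"
  using \<alpha> by (intro sin_gt_zero) auto

text \<open>
  The difference of the two sides is the square of \<open>l + exp (\<alpha> x) cos (pi
  \<alpha>)\<close>.
\<close>

lemma kap_denominator_ge:
  "(exp (\<alpha> * x))\<^sup>2 + 2 * l * exp (\<alpha> * x) * cos (pi * \<alpha>) + l\<^sup>2 \<ge> (exp (\<alpha> * x) * sin (pi * \<alpha>))\<^sup>2"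
proof -
  have poly: "a\<^sup>2 * (s\<^sup>2 + c\<^sup>2) + 2 * l * a * c + l\<^sup>2 = (a * s)\<^sup>2 + (a * c + l)\<^sup>2" for a s c :: real
    by (simp add: power2_eq_square algebra_simps)
  from poly[of "exp (\<alpha> * x)" "sin (pi * \<alpha>)" "cos (pi * \<alpha>)"]
  have "(exp (\<alpha> * x))\<^sup>2 + 2 * l * exp (\<alpha> * x) * cos (pi * \<alpha>) + l\<^sup>2 =
     (exp (\<alpha> * x) * sin (pi * \<alpha>))\<^sup>2 + (exp (\<alpha> * x) * cos (pi * \<alpha>) + l)\<^sup>2" by (simp only: sin_cos_squared_add mult_1_right)
  then show ?thesis by simp
qed

lemma kap_denominator_pos:
  "(exp (\<alpha> * x))\<^sup>2 + 2 * l * exp (\<alpha> * x) * cos (pi * \<alpha>) + l\<^sup>2 > 0"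
  by (rule less_le_trans[OF _ kap_denominator_ge]) (use sin_pi_alpha_pos in simp)

lemma kap_nonneg: "kap \<alpha> l x \<ge> 0"
  unfolding kap_def using kap_denominator_pos[of x] sin_pi_alpha_pos
  by (intro divide_nonneg_pos mult_nonneg_nonneg) auto

text \<open>
  The bound does not depend on \<open>l\<close>. This is what makes the error bound uniform in the
  eigenvalues of the discrete Laplacian, and so in the mesh.
\<close>

lemma kap_le: "kap \<alpha> l x \<le> 1 / (pi * sin (pi * \<alpha>)) * exp ((1 - \<alpha>) * x)"
proof -
  have "kap \<alpha> l x \<le> sin (pi * \<alpha>) / pi * exp x * exp (\<alpha> * x) / (exp (\<alpha> * x) * sin (pi * \<alpha>))\<^sup>2"
    unfolding kap_def using kap_denominator_ge[of x] sin_pi_alpha_pos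
    by (intro divide_left_mono) (auto intro!: mult_pos_pos kap_denominator_pos)
  also have "\<dots> = 1 / (pi * sin (pi * \<alpha>)) * (exp x / exp (\<alpha> * x))"
    using sin_pi_alpha_pos by (simp add: power2_eq_square field_simps)
  also have "exp x / exp (\<alpha> * x) = exp ((1 - \<alpha>) * x)"
    by (simp add: exp_diff[symmetric] algebra_simps)
  finally show ?thesis .
qed

lemma kap_measurable[measurable]: "kap \<alpha> l \<in> borel_measurable borel"
  unfolding kap_def[abs_def] by measurable

text \<open>
  Cauchy's formula in the strip of half-width \<open>pi\<close> for \<open>1 / (exp (\<alpha> w) +
  l)\<close>, whose value at \<open>ln s\<close> is the right-hand side. As \<open>\<alpha> <
  1\<close>, it is holomorphic in a wider strip.

  Applied with the Laplace variable for \<open>s\<close> it solves the continuous problem, and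
  with \<open>(1 - \<xi>) / \<tau>\<close>, the symbol of the backward difference, it solves the
  scheme.
\<close>

theorem stieltjes_resolvent:
  assumes s: "s > 0"
  shows "integrable lborel (\<lambda>x. kap \<alpha> l x / (exp x + s))" (is ?I)
    and "(LBINT x. kap \<alpha> l x / (exp x + s)) = 1 / (s powr \<alpha> + l)" (is ?E)
proof -
  define \<Psi> where "\<Psi> = (\<lambda>w :: complex. 1 / (exp (of_real \<alpha> * w) + of_real l))"
  have nz: "exp (of_real \<alpha> * w) + of_real l \<noteq> 0" if "\<bar>Im w\<bar> < pi / \<alpha>" for w :: complex
  proof
    assume "exp (of_real \<alpha> * w) + of_real l = 0"
    then have "Re (exp (of_real \<alpha> * w)) = - l" "Im (exp (of_real \<alpha> * w)) = 0"
      by (simp_all add: complex_eq_iff eq_neg_iff_add_eq_0)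
    then have R: "exp (\<alpha> * Re w) * cos (\<alpha> * Im w) = - l" and I: "sin (\<alpha> * Im w) = 0"
      by (simp_all add: Re_exp Im_exp)
    have ab: "\<bar>\<alpha> * Im w\<bar> < pi" using that \<alpha> by (simp add: abs_mult field_simps)
    have "\<alpha> * Im w = 0"
    proof (rule ccontr)
      assume "\<alpha> * Im w \<noteq> 0"
      then have "sin \<bar>\<alpha> * Im w\<bar> > 0" using ab by (intro sin_gt_zero) auto
      then show False using I by (auto simp: abs_if split: if_splits)
    qed
    then have "cos (\<alpha> * Im w) = 1" by (simp only: cos_zero)
    then have "exp (\<alpha> * Re w) = - l" using R by simp
    then show False using l exp_gt_zero[of "\<alpha> * Re w"] by linarith
  qed
  have cospos: "cos (pi * \<alpha> / 2) > 0" using \<alpha> by (intro cos_gt_zero) auto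
  have bound: "norm (\<Psi> w) \<le> 1 / cos (pi * \<alpha> / 2) * exp (- \<alpha> * Re w)" if w: "\<bar>Im w\<bar> \<le> pi" for w
  proof -
    define q where "q = \<alpha> * Im w + pi"
    have "cis q = - cis (\<alpha> * Im w)" unfolding q_def by (simp add: complex_eq_iff)
    then have "exp (of_real \<alpha> * w) + of_real l = - (of_real (exp (\<alpha> * Re w)) * cis q - of_real l)"
      by (simp add: exp_eq_polar)
    then have "cmod (exp (of_real \<alpha> * w) + of_real l) = cmod (of_real (exp (\<alpha> * Re w)) * cis q - of_real l)"
      by (simp only: norm_minus_cancel)
    also have "\<dots> \<ge> \<bar>sin (q / 2)\<bar> * (exp (\<alpha> * Re w) + l)"
      by (rule cmod_diff_ge_sin_half) (use l in auto)
    also have "\<bar>sin (q / 2)\<bar> = \<bar>cos (\<alpha> * Im w / 2)\<bar>"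
      unfolding q_def by (simp add: add_divide_distrib sin_add)
    finally have 1: "\<bar>cos (\<alpha> * Im w / 2)\<bar> * (exp (\<alpha> * Re w) + l) \<le> cmod (exp (of_real \<alpha> * w) + of_real l)" .
    have "cos (pi * \<alpha> / 2) \<le> cos \<bar>\<alpha> * Im w / 2\<bar>"
    proof (rule cos_monotone_0_pi_le)
      have "\<bar>\<alpha> * Im w\<bar> \<le> \<alpha> * pi" unfolding abs_mult using w \<alpha> by (intro mult_mono) auto
      then show "\<bar>\<alpha> * Im w / 2\<bar> \<le> pi * \<alpha> / 2" by (simp add: mult.commute)
      show "pi * \<alpha> / 2 \<le> pi" using \<alpha> by simp
    qed simp
    then have 2: "cos (pi * \<alpha> / 2) \<le> \<bar>cos (\<alpha> * Im w / 2)\<bar>" using cos_abs_real[of "\<alpha> * Im w / 2"] by linarith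
    have "cos (pi * \<alpha> / 2) * exp (\<alpha> * Re w) \<le> \<bar>cos (\<alpha> * Im w / 2)\<bar> * (exp (\<alpha> * Re w) + l)"
      using 2 l cospos by (intro mult_mono) auto
    also note 1
    finally have 3: "cos (pi * \<alpha> / 2) * exp (\<alpha> * Re w) \<le> cmod (exp (of_real \<alpha> * w) + of_real l)" .
    have "norm (\<Psi> w) = 1 / cmod (exp (of_real \<alpha> * w) + of_real l)" by (simp add: \<Psi>_def norm_divide)
    also have "\<dots> \<le> 1 / (cos (pi * \<alpha> / 2) * exp (\<alpha> * Re w))"
      using 3 cospos by (intro divide_left_mono) (auto intro!: mult_pos_pos less_le_trans[OF _ 3])
    also have "\<dots> = 1 / cos (pi * \<alpha> / 2) * exp (- \<alpha> * Re w)" by (simp add: exp_minus field_simps)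
    finally show ?thesis .
  qed
  have "\<Psi> holomorphic_on {w. \<bar>Im w\<bar> < pi / \<alpha>}"
    unfolding \<Psi>_def using nz by (intro holomorphic_intros) auto
  moreover have "pi < pi / \<alpha>" using \<alpha> by (simp add: field_simps)
  ultimately have C: "integrable lborel (\<lambda>x. \<Psi> (Complex x (- pi)) * exp (Complex x (- pi)) / (exp (Complex x (- pi)) - of_real s))"
     "integrable lborel (\<lambda>x. \<Psi> (Complex x pi) * exp (Complex x pi) / (exp (Complex x pi) - of_real s))"
     "(LBINT x. \<Psi> (Complex x (- pi)) * exp (Complex x (- pi)) / (exp (Complex x (- pi)) - of_real s)) -
      (LBINT x. \<Psi> (Complex x pi) * exp (Complex x pi) / (exp (Complex x pi) - of_real s)) = 2 * pi * \<i> * \<Psi> (of_real (ln s))"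
    using cauchy_formula_strip[of \<Psi> "pi / \<alpha>" pi \<alpha> "1 / cos (pi * \<alpha> / 2)" s] bound s \<alpha> by auto
  have diff: "\<Psi> (Complex x (- pi)) * exp (Complex x (- pi)) / (exp (Complex x (- pi)) - of_real s) -
      \<Psi> (Complex x pi) * exp (Complex x pi) / (exp (Complex x pi) - of_real s) =
      2 * pi * \<i> * of_real (kap \<alpha> l x / (exp x + s))" for x
  proof -
    define a where "a = exp (\<alpha> * x)"
    define c where "c = cos (pi * \<alpha>)"
    define d where "d = sin (pi * \<alpha>)"
    have e1: "exp (Complex x (- pi)) = - of_real (exp x)" "exp (Complex x pi) = - of_real (exp x)"
      by (simp_all add: exp_eq_polar complex_eq_iff)
    have e2: "exp (of_real \<alpha> * Complex x (- pi)) = Complex (a * c) (- a * d)"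
             "exp (of_real \<alpha> * Complex x pi) = Complex (a * c) (a * d)"
      by (simp_all add: exp_eq_polar complex_eq_iff a_def c_def d_def mult.commute)
    have p: "\<Psi> (Complex x (- pi)) = 1 / Complex (a * c + l) (- a * d)" "\<Psi> (Complex x pi) = 1 / Complex (a * c + l) (a * d)"
    proof -
      have "Complex u v + of_real l = Complex (u + l) v" for u v by (simp add: complex_eq_iff)
      then show "\<Psi> (Complex x (- pi)) = 1 / Complex (a * c + l) (- a * d)" "\<Psi> (Complex x pi) = 1 / Complex (a * c + l) (a * d)"
        unfolding \<Psi>_def e2 by simp_all
    qed
    have D: "(a * c + l)\<^sup>2 + (a * d)\<^sup>2 = a\<^sup>2 + 2 * l * a * c + l\<^sup>2"
    proof -
      have "(a * c + l)\<^sup>2 + (a * d)\<^sup>2 = a\<^sup>2 * (d\<^sup>2 + c\<^sup>2) + 2 * l * a * c + l\<^sup>2"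
        by (simp add: power2_eq_square algebra_simps)
      also have "d\<^sup>2 + c\<^sup>2 = 1" unfolding d_def c_def by (rule sin_cos_squared_add)
      finally show ?thesis by simp
    qed
    have "\<Psi> (Complex x (- pi)) - \<Psi> (Complex x pi) = Complex 0 (2 * (a * d) / (a\<^sup>2 + 2 * l * a * c + l\<^sup>2))"
      unfolding p D[symmetric] by (simp add: complex_eq_iff Re_divide Im_divide add_divide_distrib[symmetric])
    also have "\<dots> = 2 * \<i> * of_real (a * d / (a\<^sup>2 + 2 * l * a * c + l\<^sup>2))" by (simp add: complex_eq_iff)
    finally have P: "\<Psi> (Complex x (- pi)) - \<Psi> (Complex x pi) = 2 * \<i> * of_real (a * d / (a\<^sup>2 + 2 * l * a * c + l\<^sup>2))" .
    have q: "y * (- of_real (exp x)) / (- of_real (exp x) - of_real s) = y * of_real (exp x / (exp x + s))" for y :: complex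
    proof -
      have "- complex_of_real (exp x) - of_real s = - of_real (exp x + s)" by simp
      then have "y * (- of_real (exp x)) / (- of_real (exp x) - of_real s) = (- (y * of_real (exp x))) / (- of_real (exp x + s))"
        by (simp only: mult_minus_right)
      also have "\<dots> = (y * of_real (exp x)) / of_real (exp x + s)" by (rule minus_divide_divide)
      also have "\<dots> = y * of_real (exp x / (exp x + s))" by (simp only: of_real_divide times_divide_eq_right)
      finally show ?thesis .
    qed
    have "\<Psi> (Complex x (- pi)) * exp (Complex x (- pi)) / (exp (Complex x (- pi)) - of_real s) -
      \<Psi> (Complex x pi) * exp (Complex x pi) / (exp (Complex x pi) - of_real s)
      = (\<Psi> (Complex x (- pi)) - \<Psi> (Complex x pi)) * of_real (exp x / (exp x + s))"
      unfolding e1 q left_diff_distrib by (rule refl)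
    also have "\<dots> = 2 * \<i> * of_real (a * d / (a\<^sup>2 + 2 * l * a * c + l\<^sup>2) * (exp x / (exp x + s)))"
      unfolding P by simp
    also have "a * d / (a\<^sup>2 + 2 * l * a * c + l\<^sup>2) * (exp x / (exp x + s)) = pi * (kap \<alpha> l x / (exp x + s))"
      unfolding kap_def a_def c_def d_def by simp
    finally show ?thesis by simp
  qed
  from Bochner_Integration.integrable_diff[OF C(1,2)]
  have I1: "integrable lborel (\<lambda>x. 2 * pi * \<i> * of_real (kap \<alpha> l x / (exp x + s)))" unfolding diff .
  have cancel0: "inverse c * (c * w) = w" if "c \<noteq> 0" for c w :: complex using that by simp
  have "2 * pi * \<i> \<noteq> (0 :: complex)" by simp
  note cancel = cancel0[OF this]
  have I2: "integrable lborel (\<lambda>x. complex_of_real (kap \<alpha> l x / (exp x + s)))"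
    using integrable_mult_right[OF I1, of "inverse (2 * pi * \<i>)"] unfolding cancel .
  then show ?I using integrable_Re by fastforce
  have "(LBINT x. 2 * pi * \<i> * of_real (kap \<alpha> l x / (exp x + s))) = 2 * pi * \<i> * \<Psi> (of_real (ln s))"
    using Bochner_Integration.integral_diff[OF C(1,2)] C(3) unfolding diff by simp
  then have "2 * pi * \<i> * (LBINT x. complex_of_real (kap \<alpha> l x / (exp x + s))) = 2 * pi * \<i> * \<Psi> (of_real (ln s))"
    by (subst (asm) integral_mult_right_zero)
  then have "complex_of_real (LBINT x. kap \<alpha> l x / (exp x + s)) = \<Psi> (of_real (ln s))"
    by (simp add: integral_complex_of_real[symmetric] del: integral_complex_of_real)
  also have "\<dots> = of_real (1 / (s powr \<alpha> + l))"
    using s by (simp add: \<Psi>_def powr_def exp_of_real flip: of_real_mult)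
  finally show ?E by (simp only: of_real_eq_iff)
qed

end

text \<open>
  The coefficients of the inverse of the power series \<open>((1 - \<xi>) / \<tau>) powr \<alpha>
  + l\<close>; each term of the integrand is a power of the amplification factor of backward
  Euler.
\<close>

definition glbe_density :: "real \<Rightarrow> real \<Rightarrow> real \<Rightarrow> nat \<Rightarrow> real" where
  "glbe_density \<alpha> l \<tau> n = (LBINT x. kap \<alpha> l x * (\<tau> / (1 + \<tau> * exp x) ^ Suc n))"

context
  fixes \<alpha> l \<tau> :: real assumes \<alpha>: "0 < \<alpha>" "\<alpha> < 1" and l: "l \<ge> 0" and \<tau>: "\<tau> > 0"
begin

lemma glbe_density_integrable:
  "integrable lborel (\<lambda>x. kap \<alpha> l x * (\<tau> / (1 + \<tau> * exp x) ^ Suc n))"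
proof (rule Bochner_Integration.integrable_bound)
  show "integrable lborel (\<lambda>x. kap \<alpha> l x / (exp x + 1 / \<tau>))"
    using stieltjes_resolvent(1)[OF \<alpha> l, of "1 / \<tau>"] \<tau> by simp
  show "(\<lambda>x. kap \<alpha> l x * (\<tau> / (1 + \<tau> * exp x) ^ Suc n)) \<in> borel_measurable lborel"
    using kap_measurable[OF \<alpha> l] by simp
  have "norm (kap \<alpha> l x * (\<tau> / (1 + \<tau> * exp x) ^ Suc n)) \<le> norm (kap \<alpha> l x / (exp x + 1 / \<tau>))" for x
  proof -
    have 1: "1 + \<tau> * exp x \<ge> 1" using \<tau> by simp
    have "\<tau> / (1 + \<tau> * exp x) ^ Suc n \<le> \<tau> / (1 + \<tau> * exp x) ^ 1"
      using \<tau> 1 by (intro divide_left_mono power_increasing) (auto intro!: mult_pos_pos zero_less_power add_pos_pos)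
    also have "\<dots> = 1 / (exp x + 1 / \<tau>)" using \<tau> by (simp add: field_simps)
    finally have "kap \<alpha> l x * (\<tau> / (1 + \<tau> * exp x) ^ Suc n) \<le> kap \<alpha> l x * (1 / (exp x + 1 / \<tau>))"
      by (rule mult_left_mono[OF _ kap_nonneg[OF \<alpha> l]])
    moreover have "0 \<le> kap \<alpha> l x * (\<tau> / (1 + \<tau> * exp x) ^ Suc n)"
      using kap_nonneg[OF \<alpha> l, of x] \<tau> 1 by (intro mult_nonneg_nonneg divide_nonneg_nonneg zero_le_power) auto
    moreover have "0 \<le> kap \<alpha> l x / (exp x + 1 / \<tau>)"
      using kap_nonneg[OF \<alpha> l, of x] \<tau> by (intro divide_nonneg_nonneg add_nonneg_nonneg) auto
    ultimately show ?thesis unfolding real_norm_def by (simp only: abs_of_nonneg mult_1_right times_divide_eq_right)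
  qed
  then show "AE x in lborel. norm (kap \<alpha> l x * (\<tau> / (1 + \<tau> * exp x) ^ Suc n)) \<le> norm (kap \<alpha> l x / (exp x + 1 / \<tau>))"
    by (intro AE_I2)
qed

lemma glbe_density_nonneg: "glbe_density \<alpha> l \<tau> n \<ge> 0"
  unfolding glbe_density_def
proof (intro integral_nonneg_AE AE_I2)
  fix x show "0 \<le> kap \<alpha> l x * (\<tau> / (1 + \<tau> * exp x) ^ Suc n)"
    using kap_nonneg[OF \<alpha> l, of x] \<tau>
    by (intro mult_nonneg_nonneg divide_nonneg_nonneg zero_le_power) (auto intro!: add_nonneg_nonneg)
qed

lemma glbe_density_le: "glbe_density \<alpha> l \<tau> n \<le> glbe_density \<alpha> l \<tau> 0"
  unfolding glbe_density_def
proof (intro integral_mono glbe_density_integrable mult_left_mono kap_nonneg[OF \<alpha> l])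
  fix x have 1: "1 + \<tau> * exp x \<ge> 1" using \<tau> by simp
  show "\<tau> / (1 + \<tau> * exp x) ^ Suc n \<le> \<tau> / (1 + \<tau> * exp x) ^ Suc 0"
    using \<tau> 1 by (intro divide_left_mono power_increasing) (auto intro!: mult_pos_pos zero_less_power add_pos_pos)
qed

text \<open>
  Summing a geometric series under the integral turns its integrand into that of
  \<open>stieltjes_resolvent\<close> at \<open>s = (1 - \<xi>) / \<tau>\<close>.
\<close>

lemma glbe_density_sums:
  assumes \<xi>: "\<bar>\<xi>\<bar> < 1"
  shows "(\<lambda>n. glbe_density \<alpha> l \<tau> n * \<xi> ^ n) sums (1 / (((1 - \<xi>) / \<tau>) powr \<alpha> + l))"
proof -
  define a where "a = (\<lambda>n x. kap \<alpha> l x * (\<tau> / (1 + \<tau> * exp x) ^ Suc n) * \<xi> ^ n)"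
  have point: "(\<lambda>n. a n x) sums (kap \<alpha> l x / (exp x + (1 - \<xi>) / \<tau>))" for x
  proof -
    define p where "p = 1 + \<tau> * exp x"
    have p: "p > 1" unfolding p_def using \<tau> by simp
    have "\<bar>\<xi> / p\<bar> < 1" using \<xi> p by (simp add: abs_divide divide_less_eq)
    then have "(\<lambda>n. (\<xi> / p) ^ n) sums (1 / (1 - \<xi> / p))" by (intro geometric_sums) simp
    then have "(\<lambda>n. kap \<alpha> l x * \<tau> / p * (\<xi> / p) ^ n) sums (kap \<alpha> l x * \<tau> / p * (1 / (1 - \<xi> / p)))"
      by (rule sums_mult)
    moreover have "kap \<alpha> l x * \<tau> / p * (\<xi> / p) ^ n = a n x" for n
      unfolding a_def p_def[symmetric] by (simp add: power_divide)
    moreover have "kap \<alpha> l x * \<tau> / p * (1 / (1 - \<xi> / p)) = kap \<alpha> l x / ((p - \<xi>) / \<tau>)"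
      using p \<xi> \<tau> by (simp add: field_simps)
    moreover have "(p - \<xi>) / \<tau> = exp x + (1 - \<xi>) / \<tau>"
      using \<tau> by (simp add: p_def field_simps)
    ultimately show ?thesis by simp
  qed
  have summ: "summable (\<lambda>n. glbe_density \<alpha> l \<tau> n * \<bar>\<xi>\<bar> ^ n)"
  proof (rule summable_comparison_test'[where N = 0])
    show "summable (\<lambda>n. glbe_density \<alpha> l \<tau> 0 * \<bar>\<xi>\<bar> ^ n)"
      using \<xi> by (intro summable_mult summable_geometric) auto
    show "norm (glbe_density \<alpha> l \<tau> n * \<bar>\<xi>\<bar> ^ n) \<le> glbe_density \<alpha> l \<tau> 0 * \<bar>\<xi>\<bar> ^ n" for n
      using glbe_density_nonneg[of n] glbe_density_le[of n] by (simp add: abs_mult mult_right_mono power_abs)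
  qed
  have norm_a: "norm (a n x) = kap \<alpha> l x * (\<tau> / (1 + \<tau> * exp x) ^ Suc n) * \<bar>\<xi>\<bar> ^ n" for n x
  proof -
    have "0 \<le> kap \<alpha> l x * (\<tau> / (1 + \<tau> * exp x) ^ Suc n)"
      using kap_nonneg[OF \<alpha> l, of x] \<tau>
      by (intro mult_nonneg_nonneg divide_nonneg_nonneg zero_le_power) (auto intro!: add_nonneg_nonneg)
    then show ?thesis unfolding a_def by (simp only: real_norm_def abs_mult[of _ "\<xi> ^ n"] power_abs abs_of_nonneg)
  qed
  have "(\<lambda>n. integral\<^sup>L lborel (a n)) sums (LBINT x. (\<Sum>n. a n x))"
  proof (rule sums_integral)
    show "integrable lborel (a n)" for n
      unfolding a_def by (intro integrable_mult_left glbe_density_integrable)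
    show "AE x in lborel. summable (\<lambda>n. norm (a n x))"
    proof (intro AE_I2)
      fix x
      show "summable (\<lambda>n. norm (a n x))"
      proof (rule summable_comparison_test'[where N = 0])
        show "summable (\<lambda>n. kap \<alpha> l x * \<tau> * \<bar>\<xi>\<bar> ^ n)"
          using \<xi> by (intro summable_mult summable_geometric) auto
        have "\<tau> / (1 + \<tau> * exp x) ^ Suc n \<le> \<tau> / 1 ^ Suc n" for n
          using \<tau> by (intro divide_left_mono power_mono) (auto intro!: mult_pos_pos zero_less_power add_pos_pos)
        then have "norm (a n x) \<le> kap \<alpha> l x * \<tau> * \<bar>\<xi>\<bar> ^ n" for n
          unfolding norm_a by (intro mult_right_mono mult_left_mono kap_nonneg[OF \<alpha> l]) auto
        then show "norm (norm (a n x)) \<le> kap \<alpha> l x * \<tau> * \<bar>\<xi>\<bar> ^ n" for n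
          by simp
      qed
    qed
    show "summable (\<lambda>n. LBINT x. norm (a n x))"
    proof -
      have "(LBINT x. norm (a n x)) = glbe_density \<alpha> l \<tau> n * \<bar>\<xi>\<bar> ^ n" for n
        unfolding norm_a glbe_density_def by (rule integral_mult_left_zero)
      then show ?thesis using summ by simp
    qed
  qed
  moreover have "(\<Sum>n. a n x) = kap \<alpha> l x / (exp x + (1 - \<xi>) / \<tau>)" for x
    using point by (rule sums_unique[symmetric])
  moreover have "(LBINT x. kap \<alpha> l x / (exp x + (1 - \<xi>) / \<tau>)) = 1 / (((1 - \<xi>) / \<tau>) powr \<alpha> + l)"
    using \<xi> \<tau> by (intro stieltjes_resolvent(2)[OF \<alpha> l]) auto
  moreover have "integral\<^sup>L lborel (a n) = glbe_density \<alpha> l \<tau> n * \<xi> ^ n" for n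
    unfolding a_def glbe_density_def by (rule integral_mult_left_zero)
  ultimately show ?thesis by simp
qed

text \<open>
  The generating functions of the two sequences are reciprocal, so their Cauchy product is the
  constant series 1, and coefficients of power series are unique.
\<close>

lemma glbe_density_inverse:
  fixes \<sigma> :: "nat \<Rightarrow> real"
  assumes \<sigma>: "\<And>\<xi>. \<bar>\<xi>\<bar> < 1 \<Longrightarrow> (\<lambda>j. \<sigma> j * \<xi> ^ j) sums ((1 - \<xi>) powr \<alpha>)"
  shows "(\<Sum>i\<le>n. (\<tau> powr (- \<alpha>) * \<sigma> i + l * of_bool (i = 0)) * glbe_density \<alpha> l \<tau> (n - i)) = of_bool (n = 0)"
proof -
  define a where "a = (\<lambda>i. \<tau> powr (- \<alpha>) * \<sigma> i + l * of_bool (i = 0))"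
  define q where "q = glbe_density \<alpha> l \<tau>"
  define d where "d = (\<lambda>n. \<Sum>i\<le>n. a i * q (n - i))"
  have asum: "(\<lambda>i. a i * \<xi> ^ i) sums (\<tau> powr (- \<alpha>) * (1 - \<xi>) powr \<alpha> + l)" if "\<bar>\<xi>\<bar> < 1" for \<xi>
  proof -
    have "(\<lambda>i. \<tau> powr (- \<alpha>) * (\<sigma> i * \<xi> ^ i) + (if i = 0 then l else 0)) sums (\<tau> powr (- \<alpha>) * (1 - \<xi>) powr \<alpha> + l)"
      by (intro sums_add sums_mult \<sigma>[OF that] sums_single)
    moreover have "\<tau> powr (- \<alpha>) * (\<sigma> i * \<xi> ^ i) + (if i = 0 then l else 0) = a i * \<xi> ^ i" for i
      by (simp add: a_def algebra_simps)
    ultimately show ?thesis by simp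
  qed
  have dsum: "(\<lambda>n. d n * \<xi> ^ n) sums 1" if \<xi>: "\<bar>\<xi>\<bar> < 1" for \<xi> :: real
  proof -
    obtain r where r: "\<bar>\<xi>\<bar> < r" "r < 1" using dense[OF \<xi>] by blast
    then have "\<bar>r\<bar> < 1" "\<bar>\<xi>\<bar> < \<bar>r\<bar>" by auto
    have sa: "summable (\<lambda>i. norm (a i * \<xi> ^ i))"
      using powser_insidea[of a r \<xi>] sums_summable[OF asum[OF \<open>\<bar>r\<bar> < 1\<close>]] \<open>\<bar>\<xi>\<bar> < \<bar>r\<bar>\<close> by simp
    have sq: "summable (\<lambda>i. norm (q i * \<xi> ^ i))"
      using powser_insidea[of q r \<xi>] sums_summable[OF glbe_density_sums[OF \<open>\<bar>r\<bar> < 1\<close>]] \<open>\<bar>\<xi>\<bar> < \<bar>r\<bar>\<close>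
      by (simp add: q_def)
    have "(\<lambda>k. \<Sum>i\<le>k. (a i * \<xi> ^ i) * (q (k - i) * \<xi> ^ (k - i))) sums ((\<Sum>i. a i * \<xi> ^ i) * (\<Sum>i. q i * \<xi> ^ i))"
      by (rule Cauchy_product_sums[OF sa sq])
    moreover have "(\<Sum>i\<le>k. (a i * \<xi> ^ i) * (q (k - i) * \<xi> ^ (k - i))) = d k * \<xi> ^ k" for k
      unfolding d_def sum_distrib_right
    proof (intro sum.cong refl)
      fix i assume "i \<in> {..k}"
      then have "\<xi> ^ k = \<xi> ^ i * \<xi> ^ (k - i)" by (simp flip: power_add)
      then show "a i * \<xi> ^ i * (q (k - i) * \<xi> ^ (k - i)) = a i * q (k - i) * \<xi> ^ k" by simp
    qed
    moreover have "(\<Sum>i. a i * \<xi> ^ i) * (\<Sum>i. q i * \<xi> ^ i) = 1"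
    proof -
      have "(\<Sum>i. q i * \<xi> ^ i) = 1 / (((1 - \<xi>) / \<tau>) powr \<alpha> + l)"
        unfolding q_def using glbe_density_sums[OF \<xi>] by (rule sums_unique[symmetric])
      moreover have "(\<Sum>i. a i * \<xi> ^ i) = ((1 - \<xi>) / \<tau>) powr \<alpha> + l"
        using sums_unique[OF asum[OF \<xi>]] \<tau> \<xi> by (simp add: powr_divide powr_minus field_simps)
      moreover have "((1 - \<xi>) / \<tau>) powr \<alpha> > 0" using \<xi> \<tau> by simp
      then have "((1 - \<xi>) / \<tau>) powr \<alpha> + l \<noteq> 0" using l by linarith
      ultimately show ?thesis by simp
    qed
    ultimately show ?thesis by simp
  qed
  define b where "b = (\<lambda>n. d n - of_bool (n = 0))"
  have bsum: "(\<lambda>n. b n * \<xi> ^ n) sums 0" if \<xi>: "norm \<xi> < 1" for \<xi> :: real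
  proof -
    have "(\<lambda>n. d n * \<xi> ^ n - (if n = 0 then 1 else 0)) sums (1 - 1)"
      using \<xi> by (intro sums_diff dsum sums_single) simp
    moreover have "d n * \<xi> ^ n - (if n = 0 then 1 else 0) = b n * \<xi> ^ n" for n
      by (simp add: b_def)
    ultimately show ?thesis by simp
  qed
  have b0: "b 0 = 0" using sums_unique2[OF bsum[of 0] powser_sums_zero[of b]] by simp
  have "b n = 0"
  proof (rule ccontr)
    assume "b n \<noteq> 0"
    then have "n > 0" using b0 by (cases n) auto
    have "(\<lambda>k. b k * (\<xi> - 0) ^ k) sums (\<lambda>_. 0) \<xi>" if "norm (\<xi> - 0) < 1" for \<xi> :: real
      using bsum[of \<xi>] that by simp
    from powser_0_nonzero[OF zero_less_one this refl \<open>b n \<noteq> 0\<close> \<open>n > 0\<close>]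
    obtain s where "0 < s" "\<And>z. z \<in> cball 0 s - {0} \<Longrightarrow> (\<lambda>_::real. 0::real) z \<noteq> 0"
      by metis
    from this(2)[of s] \<open>0 < s\<close> show False by auto
  qed
  then show ?thesis unfolding b_def d_def a_def q_def by simp
qed

end

section \<open>Laplace transforms of convolutions\<close>

lemma lborel_AE_iff_lebesgue: "(AE x in lebesgue. P x) \<longleftrightarrow> (AE x in lborel. P x)"
  by (rule AE_completion_iff)

lemma laplace_exp_complex:
  fixes a :: complex assumes a: "Re a > 0"
  shows "has_bochner_integral lborel (\<lambda>t. indicator {0<..} t *\<^sub>R exp (- a * of_real t)) (1 / a)"
proof -
  define f where "f = (\<lambda>t :: real. exp (- a * of_real t))"
  have cf: "continuous_on UNIV f" unfolding f_def by (intro continuous_intros)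
  have fm[measurable]: "f \<in> borel_measurable borel" by (rule borel_measurable_continuous_onI[OF cf])
  have nf: "norm (f t) = exp (- Re a * t)" for t by (simp add: f_def)
  have "(\<lambda>t. exp (- Re a * t)) absolutely_integrable_on {0..}"
    using a by (intro nonnegative_absolutely_integrable_1 integrable_on_exp_minus_to_infinity) auto
  then have "integrable lebesgue (\<lambda>x. indicator {0..} x *\<^sub>R exp (- Re a * x))"
    unfolding set_integrable_def .
  then have 1: "integrable lborel (\<lambda>x. indicator {0..} x *\<^sub>R exp (- Re a * x))"
    by (subst (asm) integrable_completion) auto
  have I: "integrable lborel (\<lambda>t. indicator {0<..} t *\<^sub>R f t)"
    by (rule Bochner_Integration.integrable_bound[OF 1]) (auto simp: nf indicator_def)
  have "(\<lambda>n::nat. LBINT t. indicator {0..real n} t *\<^sub>R f t) \<longlonglongrightarrow> (LBINT t. indicator {0<..} t *\<^sub>R f t)"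
  proof (rule integral_dominated_convergence[OF _ _ 1])
    have "AE t in lborel. t \<noteq> (0::real)" by (rule AE_lborel_singleton)
    then show "AE t in lborel. (\<lambda>n. indicator {0..real n} t *\<^sub>R f t) \<longlonglongrightarrow> indicator {0<..} t *\<^sub>R f t"
    proof eventually_elim
      case (elim t)
      obtain m :: nat where "\<bar>t\<bar> \<le> m" using real_arch_simple by blast
      then show ?case using elim
        by (intro tendsto_eventually eventually_sequentiallyI[of m]) (auto simp: indicator_def abs_le_iff)
    qed
  qed (auto simp: nf indicator_def)
  moreover have "(LBINT t. indicator {0..real n} t *\<^sub>R f t) = (1 - f n) / a" for n
  proof -
    have "(f has_integral (- f n / a) - (- f 0 / a)) {0..real n}"
    proof (rule fundamental_theorem_of_calculus)
      show "((\<lambda>t. - f t / a) has_vector_derivative f t) (at t within {0..real n})" for t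
      proof -
        have "((\<lambda>z. - exp (- a * z) / a) has_field_derivative exp (- a * of_real t)) (at (of_real t))"
          using a by (auto intro!: derivative_eq_intros)
        from has_vector_derivative_real_field[OF this] show ?thesis
          unfolding f_def by (rule has_vector_derivative_at_within)
      qed
    qed simp
    then have "integral {0..real n} f = (1 - f n) / a"
      by (intro integral_unique) (simp add: f_def diff_divide_distrib)
    moreover have "set_integrable lborel {0..real n} f"
      by (intro borel_integrable_atLeastAtMost' continuous_on_subset[OF cf]) auto
    ultimately show ?thesis
      using set_borel_integral_eq_integral(2)[of "{0..real n}" f] unfolding set_lebesgue_integral_def by simp
  qed
  moreover have "(\<lambda>n::nat. (1 - f n) / a) \<longlonglongrightarrow> (1 - 0) / a"
  proof (intro tendsto_intros)
    have "(\<lambda>n::nat. norm (f n)) \<longlonglongrightarrow> 0" unfolding nf using a by real_asymp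
    then show "(\<lambda>n::nat. f n) \<longlonglongrightarrow> 0" by (rule tendsto_norm_zero_cancel)
    show "a \<noteq> 0" using a by auto
  qed
  ultimately have "(LBINT t. indicator {0<..} t *\<^sub>R f t) = 1 / a"
    by (simp add: LIMSEQ_unique)
  then show ?thesis using I unfolding f_def by (simp add: has_bochner_integral_iff)
qed

lemma laplace_exp:
  fixes a :: real assumes a: "a > 0"
  shows "has_bochner_integral lborel (\<lambda>t. indicator {0<..} t * exp (- a * t)) (1 / a)"
proof -
  have "has_bochner_integral lborel (\<lambda>t. Re (indicator {0<..} t *\<^sub>R exp (- of_real a * of_real t))) (Re (1 / of_real a))"
    by (rule has_bochner_integral_Re[OF laplace_exp_complex]) (use a in simp)
  moreover have "Re (indicator {0<..} t *\<^sub>R exp (- of_real a * of_real t)) = indicator {0<..} t * exp (- a * t)" for t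
    by (simp add: Re_exp)
  moreover have "Re (1 / of_real a) = 1 / a" by simp
  ultimately show ?thesis by (simp only:)
qed

lemma laplace_powr:
  fixes a z :: real assumes a: "a > 0" and z: "z > 0"
  shows "has_bochner_integral lborel (\<lambda>t. indicator {0<..} t * (exp (- z * t) * t powr (a - 1))) (Gamma a * z powr (- a))"
proof -
  define f where "f = (\<lambda>t. indicator {0<..} t * (exp (- t) * t powr (a - 1)))"
  have f0: "f t \<ge> 0" for t unfolding f_def by simp
  have fm[measurable]: "f \<in> borel_measurable borel" unfolding f_def by measurable
  have G: "Gamma a > 0" using a by simp
  have "(\<integral>\<^sup>+ t. ennreal (f t) \<partial>lborel) = (\<integral>\<^sup>+ t. ennreal (indicator {0..} t * t powr (a - 1) / exp t) \<partial>lborel)"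
    by (intro nn_integral_cong arg_cong[of _ _ ennreal]) (auto simp: f_def indicator_def exp_minus field_simps)
  also have "\<dots> = ennreal (Gamma a)" using Gamma_conv_nn_integral_real[OF a] by simp
  finally have nn: "(\<integral>\<^sup>+ t. ennreal (f t) \<partial>lborel) = ennreal (Gamma a)" .
  have hb: "has_bochner_integral lborel f (Gamma a)"
    by (rule has_bochner_integral_nn_integral) (use f0 nn G in auto)
  have "integrable lborel (\<lambda>t. f (0 + z * t))" "Gamma a = \<bar>z\<bar> *\<^sub>R (LBINT t. f (0 + z * t))"
    using lborel_integrable_real_affine[of f z 0] lborel_integral_real_affine[of z f 0] hb z
    by (auto simp: has_bochner_integral_iff)
  then have "has_bochner_integral lborel (\<lambda>t. f (z * t)) (Gamma a / z)"
    using z by (simp add: has_bochner_integral_iff field_simps)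
  from has_bochner_integral_mult_right[OF this, of "z powr (1 - a)"]
  have "has_bochner_integral lborel (\<lambda>t. z powr (1 - a) * f (z * t)) (z powr (1 - a) * (Gamma a / z))" by simp
  moreover have "z powr (1 - a) * f (z * t) = indicator {0<..} t * (exp (- z * t) * t powr (a - 1))" for t
  proof (cases "t > 0")
    case True
    then have "z powr (1 - a) * (z * t) powr (a - 1) = t powr (a - 1)"
      using z by (simp add: powr_mult flip: powr_add mult.assoc)
    then show ?thesis using True z by (simp add: f_def)
  qed (use z in \<open>auto simp: f_def indicator_def zero_less_mult_iff\<close>)
  moreover have "z powr (1 - a) * (Gamma a / z) = Gamma a * z powr (- a)"
    using z by (simp add: powr_diff powr_minus field_simps)
  ultimately show ?thesis by simp
qed

definition convolve :: "(real \<Rightarrow> real) \<Rightarrow> (real \<Rightarrow> real) \<Rightarrow> real \<Rightarrow> real" where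
  "convolve f g t = (LBINT s. f (t - s) * g s)"

definition lap :: "(real \<Rightarrow> real) \<Rightarrow> real \<Rightarrow> real" where
  "lap f z = (LBINT t. exp (- z * t) * f t)"

text \<open>
  Functions supported in the positive half-line and integrable against every decaying exponential:
  closed under convolution, and determined by their Laplace transforms.
\<close>

definition causal_exp :: "(real \<Rightarrow> real) \<Rightarrow> bool" where
  "causal_exp f \<longleftrightarrow> f \<in> borel_measurable borel \<and> (\<forall>t\<le>0. f t = 0) \<and>
     (\<forall>z>0. integrable lborel (\<lambda>t. exp (- z * t) * f t))"

text \<open>
  Fubini's theorem and translation invariance.
\<close>

lemma convolve_L1:
  assumes f: "integrable lborel f" and g: "integrable lborel g"
  shows "AE t in lborel. integrable lborel (\<lambda>s. f (t - s) * g s)"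
    and "integrable lborel (convolve f g)"
    and "(LBINT t. convolve f g t) = (LBINT t. f t) * (LBINT t. g t)"
proof -
  have fm[measurable]: "f \<in> borel_measurable borel" and gm[measurable]: "g \<in> borel_measurable borel"
    using f g by auto
  have fi: "integrable lborel (\<lambda>t. f (t - s))" "(LBINT t. f (t - s)) = (LBINT t. f t)"
     "(LBINT t. \<bar>f (t - s)\<bar>) = (LBINT t. \<bar>f t\<bar>)" for s
    using lborel_integrable_real_affine[OF f, of 1 "- s"] lborel_integral_real_affine[of 1 f "- s"]
      lborel_integral_real_affine[of 1 "\<lambda>t. \<bar>f t\<bar>" "- s"] by (simp_all add: algebra_simps)
  have I: "integrable (lborel \<Otimes>\<^sub>M lborel) (case_prod (\<lambda>s t. f (t - s) * g s))"
  proof (rule lborel_pair.Fubini_integrable)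
    show "case_prod (\<lambda>s t. f (t - s) * g s) \<in> borel_measurable (lborel \<Otimes>\<^sub>M lborel)" by measurable
    have "(LBINT t. norm (case (s, t) of (s, t) \<Rightarrow> f (t - s) * g s)) = (LBINT t. \<bar>f t\<bar>) * \<bar>g s\<bar>" for s
      by (simp add: abs_mult fi)
    then show "integrable lborel (\<lambda>s. LBINT t. norm (case (s, t) of (s, t) \<Rightarrow> f (t - s) * g s))"
      using g by simp
    show "AE s in lborel. integrable lborel (\<lambda>t. case (s, t) of (s, t) \<Rightarrow> f (t - s) * g s)"
      using fi by (intro AE_I2) simp
  qed
  show "AE t in lborel. integrable lborel (\<lambda>s. f (t - s) * g s)"
    using lborel_pair.AE_integrable_snd[OF I] .
  show "integrable lborel (convolve f g)"
    using lborel_pair.integrable_snd[OF I] unfolding convolve_def[abs_def] .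
  have "(LBINT t. convolve f g t) = (LBINT s. LBINT t. f (t - s) * g s)"
    unfolding convolve_def by (rule lborel_pair.Fubini_integral[OF I])
  then show "(LBINT t. convolve f g t) = (LBINT t. f t) * (LBINT t. g t)" by (simp add: fi)
qed

lemma convolve_exp:
  "exp (- z * t) * convolve f g t = convolve (\<lambda>t. exp (- z * t) * f t) (\<lambda>t. exp (- z * t) * g t) t"
proof -
  have "exp (- z * t) * (f (t - s) * g s) = exp (- z * (t - s)) * f (t - s) * (exp (- z * s) * g s)" for s
  proof -
    have "exp (- z * t) = exp (- z * (t - s)) * exp (- z * s)" by (simp add: exp_add[symmetric] algebra_simps)
    then show ?thesis by simp
  qed
  then have "(LBINT s. exp (- z * t) * (f (t - s) * g s)) = convolve (\<lambda>t. exp (- z * t) * f t) (\<lambda>t. exp (- z * t) * g t) t"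
    unfolding convolve_def by (simp only:)
  then show ?thesis unfolding convolve_def by (simp only: integral_mult_right_zero)
qed

lemma
  assumes f: "causal_exp f" and g: "causal_exp g"
  shows causal_exp_convolve: "causal_exp (convolve f g)"
    and lap_convolve: "z > 0 \<Longrightarrow> lap (convolve f g) z = lap f z * lap g z"
    and AE_convolve_integrable: "AE t in lborel. integrable lborel (\<lambda>s. f (t - s) * g s)"
proof -
  have [measurable]: "f \<in> borel_measurable borel" "g \<in> borel_measurable borel"
    using f g unfolding causal_exp_def by auto
  show "causal_exp (convolve f g)"
    unfolding causal_exp_def
  proof (intro conjI allI impI)
    show "convolve f g \<in> borel_measurable borel"
      unfolding convolve_def[abs_def] by measurable
    fix t :: real assume t: "t \<le> 0"
    have "f (t - s) * g s = 0" for s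
    proof (cases "s \<le> 0")
      case False
      then have "t - s \<le> 0" using t by simp
      then show ?thesis using f unfolding causal_exp_def by simp
    qed (use g in \<open>simp add: causal_exp_def\<close>)
    then show "convolve f g t = 0" unfolding convolve_def by (simp only: Bochner_Integration.integral_zero)
  next
    fix z :: real assume "z > 0"
    then show "integrable lborel (\<lambda>t. exp (- z * t) * convolve f g t)"
      unfolding convolve_exp using f g unfolding causal_exp_def by (intro convolve_L1(2)) auto
  qed
  show "lap (convolve f g) z = lap f z * lap g z" if "z > 0"
    unfolding lap_def convolve_exp using f g that unfolding causal_exp_def by (intro convolve_L1(3)) auto
  have "AE t in lborel. integrable lborel (\<lambda>s. (exp (- 1 * (t - s)) * f (t - s)) * (exp (- 1 * s) * g s))"
    using f g unfolding causal_exp_def by (intro convolve_L1(1)) (auto dest: spec[of _ 1])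
  then show "AE t in lborel. integrable lborel (\<lambda>s. f (t - s) * g s)"
  proof eventually_elim
    case (elim t)
    have eq: "exp t * ((exp (- 1 * (t - s)) * f (t - s)) * (exp (- 1 * s) * g s)) = f (t - s) * g s" for s
    proof -
      have "exp t * exp (- 1 * (t - s)) * exp (- 1 * s) = 1" by (simp add: exp_add[symmetric])
      then have "f (t - s) * g s = exp t * exp (- 1 * (t - s)) * exp (- 1 * s) * (f (t - s) * g s)" by simp
      then show ?thesis by (simp only: mult_ac)
    qed
    show ?case using integrable_mult_right[OF elim, of "exp t"] unfolding eq .
  qed
qed

text \<open>
  Identities between convolutions are checked on the Laplace side, where they are algebraic; the
  price is that they hold only almost everywhere.
\<close>

lemma lap_inject:
  assumes f: "causal_exp f" and g: "causal_exp g" and eq: "\<And>z. z > 1 \<Longrightarrow> lap f z = lap g z"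
  shows "AE t in lborel. f t = g t"
proof -
  have [measurable]: "f \<in> borel_measurable borel" "g \<in> borel_measurable borel"
    using f g unfolding causal_exp_def by auto
  have f0: "f t = 0" "g t = 0" if "t \<le> 0" for t using f g that unfolding causal_exp_def by auto
  have If: "integrable lborel (\<lambda>t. exp (- z * t) * f t)" "integrable lborel (\<lambda>t. exp (- z * t) * g t)" if "z > 0" for z
    using f g that unfolding causal_exp_def by auto
  have W: "indicator {0<..} t * (exp (- z * t) * (f t - g t)) = exp (- z * t) * f t - exp (- z * t) * g t" for z t
    using f0[of t] by (auto simp: indicator_def algebra_simps)
  have "AE t in lebesgue. t > 0 \<longrightarrow> f t - g t = 0"
  proof (rule laplace_transform_unique[where \<sigma> = 1])
    show "integrable lebesgue (\<lambda>t. indicator {0<..} t * (exp (- 1 * t) * (f t - g t)))"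
      by (subst integrable_completion, simp, subst W) (intro Bochner_Integration.integrable_diff If, auto)
    fix z :: real assume z: "z > 1"
    have "(LINT t|lebesgue. indicator {0<..} t * (exp (- z * t) * (f t - g t))) = (LBINT t. exp (- z * t) * f t - exp (- z * t) * g t)"
      by (subst integral_completion, simp, subst W, rule refl)
    also have "\<dots> = lap f z - lap g z" unfolding lap_def using z by (intro Bochner_Integration.integral_diff If) auto
    finally show "(LINT t|lebesgue. indicator {0<..} t * (exp (- z * t) * (f t - g t))) = 0" using eq[OF z] by simp
  qed
  then have "AE t in lborel. t > 0 \<longrightarrow> f t - g t = 0" unfolding lborel_AE_iff_lebesgue .
  then show ?thesis
  proof eventually_elim
    case (elim t)
    then show ?case using f0[of t] by (cases "t > 0") auto
  qed
qed

text \<open>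
  If the function were positive at a point it would be positive on an interval around it, yet its
  integral over some smaller interval containing the point vanishes.
\<close>

lemma continuous_eq_0_if_AE_integral_eq_0:
  fixes d :: "real \<Rightarrow> real"
  assumes c: "continuous_on {0<..<T} d"
    and i: "\<And>t. 0 < t \<Longrightarrow> t < T \<Longrightarrow> set_integrable lborel {0<..<t} d"
    and z: "AE t in lborel. 0 < t \<and> t < T \<longrightarrow> (LBINT s:{0<..<t}. d s) = 0"
    and t0: "0 < t0" "t0 < T"
  shows "d t0 = 0"
proof -
  have contra: False if c: "continuous_on {0<..<T} d" and pos: "d t0 > 0"
    and i: "\<And>t. 0 < t \<Longrightarrow> t < T \<Longrightarrow> set_integrable lborel {0<..<t} d"
    and z: "AE t in lborel. 0 < t \<and> t < T \<longrightarrow> (LBINT s:{0<..<t}. d s) = 0" for d :: "real \<Rightarrow> real"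
  proof -
    have "isCont d t0" using c t0 by (simp add: continuous_on_eq_continuous_at)
    then have "\<forall>\<^sub>F t in at t0. d t0 / 2 < d t"
      using pos unfolding isCont_def by (intro order_tendstoD) auto
    then obtain e where e: "e > 0" "\<And>t. t \<noteq> t0 \<Longrightarrow> dist t t0 < e \<Longrightarrow> d t0 / 2 < d t"
      unfolding eventually_at by auto
    define e' where "e' = min e (min t0 (T - t0))"
    have e': "e' > 0" "e' \<le> e" "e' \<le> t0" "e' \<le> T - t0" using e t0 by (auto simp: e'_def)
    have big: "d t0 / 2 < d t" if "\<bar>t - t0\<bar> < e'" for t
      using e(2)[of t] that e' pos by (cases "t = t0") (auto simp: dist_real_def)
    have ex: "\<exists>t. a < t \<and> t < b \<and> (LBINT s:{0<..<t}. d s) = 0" if "a < b" "0 \<le> a" "b \<le> T" for a b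
    proof (rule ccontr)
      assume n: "\<not> ?thesis"
      have "AE t in lborel. \<not> (a < t \<and> t < b)"
        using z by eventually_elim (use n that in auto)
      then have "emeasure lborel {t \<in> space lborel. \<not> \<not> (a < t \<and> t < b)} = 0"
        by (subst (asm) AE_iff_measurable[OF _ refl]) auto
      moreover have "{t \<in> space lborel. \<not> \<not> (a < t \<and> t < b)} = {a<..<b}" by auto
      ultimately show False using that by simp
    qed
    obtain a where a: "t0 - e' < a" "a < t0" "(LBINT s:{0<..<a}. d s) = 0"
      using ex[of "t0 - e'" t0] e' t0 by auto
    obtain b where b: "t0 < b" "b < t0 + e'" "(LBINT s:{0<..<b}. d s) = 0"
      using ex[of t0 "t0 + e'"] e' t0 by auto
    have U: "{0<..<b} = {0<..<a} \<union> {a..<b}" using a b e' by auto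
    have ib: "set_integrable lborel {0<..<b} d" using i b t0 e' by auto
    then have iab: "set_integrable lborel {a..<b} d" by (rule set_integrable_subset) (use a e' in auto)
    have "(LBINT s:{0<..<b}. d s) = (LBINT s:{0<..<a}. d s) + (LBINT s:{a..<b}. d s)"
      unfolding U by (rule set_integral_Un) (use i[of a] iab a t0 e' in auto)
    then have 0: "(LBINT s:{a..<b}. d s) = 0" using a b by simp
    have "(LBINT s:{a..<b}. d t0 / 2) \<le> (LBINT s:{a..<b}. d s)"
    proof (rule set_integral_mono[OF _ iab])
      show "set_integrable lborel {a..<b} (\<lambda>s. d t0 / 2)"
        unfolding set_integrable_def using a b by (intro integrable_scaleR_left integrable_real_indicator) auto
      show "d t0 / 2 \<le> d s" if "s \<in> {a..<b}" for s using big[of s] that a b by (auto simp: abs_less_iff)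
    qed
    moreover have "(LBINT s:{a..<b}. d t0 / 2) = (b - a) * (d t0 / 2)"
      using a b unfolding set_lebesgue_integral_def by simp
    moreover have "(b - a) * (d t0 / 2) > 0" using a b pos by simp
    ultimately show False using 0 by simp
  qed
  have "\<not> d t0 > 0" using contra[OF c _ i z] by blast
  moreover have "\<not> - d t0 > 0"
  proof
    assume "- d t0 > 0"
    moreover have "continuous_on {0<..<T} (\<lambda>t. - d t)" using c by (rule continuous_on_minus)
    moreover have "set_integrable lborel {0<..<t} (\<lambda>t. - d t)" if "0 < t" "t < T" for t
      using i[OF that] unfolding set_integrable_def by simp
    moreover have "AE t in lborel. 0 < t \<and> t < T \<longrightarrow> (LBINT s:{0<..<t}. - d s) = 0"
      using z by eventually_elim (simp add: set_lebesgue_integral_def)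
    ultimately show False using contra[of "\<lambda>t. - d t"] by blast
  qed
  ultimately show ?thesis by simp
qed

section \<open>The scalar fractional equation\<close>

lemma integral_powr_from_0:
  fixes a t :: real assumes a: "a > -1" and t: "t > 0"
  shows "has_bochner_integral lborel (\<lambda>s. indicator {0<..<t} s * s powr a) (t powr (a + 1) / (a + 1))"
proof -
  have h: "((\<lambda>s. s powr a) has_integral (t powr (a + 1) / (a + 1))) {0..t}"
    using has_integral_powr_from_0[OF a, of t] t by simp
  have h2: "((\<lambda>s. indicator {0<..<t} s * s powr a) has_integral (t powr (a + 1) / (a + 1))) UNIV"
  proof -
    have "((\<lambda>s. s powr a) has_integral (t powr (a + 1) / (a + 1))) {0<..<t}"
      using h has_integral_open_interval[of "\<lambda>s. s powr a" _ 0 t] by (simp add: box_real)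
    then have "((\<lambda>s. if s \<in> {0<..<t} then s powr a else 0) has_integral (t powr (a + 1) / (a + 1))) UNIV"
      by (simp only: has_integral_restrict_UNIV)
    then show ?thesis by (rule has_integral_eq[rotated]) (auto simp: indicator_def)
  qed
  have nn: "(\<integral>\<^sup>+ s. ennreal (indicator {0<..<t} s * s powr a) \<partial>lborel) = ennreal (t powr (a + 1) / (a + 1))"
    by (rule nn_integral_has_integral_lborel[OF _ _ h2]) auto
  show ?thesis
    by (rule has_bochner_integral_nn_integral) (use nn a t in auto)
qed

lemma integral_powr_to_end:
  fixes a t :: real assumes a: "a > -1" and t: "t > 0"
  shows "has_bochner_integral lborel (\<lambda>s. indicator {0<..<t} s * (t - s) powr a) (t powr (a + 1) / (a + 1))"
proof -
  have "has_bochner_integral lborel (\<lambda>s. indicator {0<..<t} (t + (-1) * s) * (t + (-1) * s) powr a) (t powr (a + 1) / (a + 1))"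
    using integral_powr_from_0[OF a t] lborel_integrable_real_affine[of "\<lambda>s. indicator {0<..<t} s * s powr a" "-1" t]
      lborel_integral_real_affine[of "-1" "\<lambda>s. indicator {0<..<t} s * s powr a" t]
    by (simp add: has_bochner_integral_iff)
  moreover have "indicator {0<..<t} (t + (-1) * s) * (t + (-1) * s) powr a = indicator {0<..<t} s * (t - s) powr a" for s
    by (auto simp: indicator_def)
  ultimately show ?thesis by (simp only:)
qed

text \<open>
  \<open>1 + r (t - s) \<ge> (1 + r t) (t - s) / t\<close>.
\<close>

lemma one_plus_powr_le:
  fixes r s t \<gamma> :: real
  assumes "0 < s" "s < t" "r \<ge> 0" "0 \<le> \<gamma>"
  shows "(1 + r * (t - s)) powr (- \<gamma>) \<le> (1 + r * t) powr (- \<gamma>) * ((t - s) / t) powr (- \<gamma>)"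
proof -
  have "(1 + r * t) * ((t - s) / t) = (t - s) / t + r * (t - s)" using assms by (simp add: field_simps)
  also have "(t - s) / t \<le> 1" using assms by simp
  finally have "(1 + r * t) * ((t - s) / t) \<le> 1 + r * (t - s)" by simp
  moreover have "0 < (1 + r * t) * ((t - s) / t)" using assms by (intro mult_pos_pos add_pos_nonneg) auto
  ultimately have "(1 + r * (t - s)) powr (- \<gamma>) \<le> ((1 + r * t) * ((t - s) / t)) powr (- \<gamma>)"
    using assms by (intro powr_mono2') auto
  also have "\<dots> = (1 + r * t) powr (- \<gamma>) * ((t - s) / t) powr (- \<gamma>)"
    by (rule powr_mult)
  finally show ?thesis .
qed

lemma exp_minus_le_powr:
  fixes y \<gamma> :: real
  assumes "y \<ge> 0" "\<gamma> \<le> 1"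
  shows "exp (- y) \<le> (1 + y) powr (- \<gamma>)"
proof -
  have "exp (- y) = 1 / exp y" by (simp add: exp_minus field_simps)
  also have "\<dots> \<le> 1 / (1 + y)" using assms exp_ge_add_one_self[of y] by (intro divide_left_mono) (auto intro!: mult_pos_pos)
  also have "\<dots> = (1 + y) powr (- 1)" using assms by (simp add: powr_minus field_simps)
  also have "\<dots> \<le> (1 + y) powr (- \<gamma>)" using assms by (intro powr_mono) auto
  finally show ?thesis .
qed

text \<open>
  In the first half of \<open>(0, t)\<close> the kernel is comparable with its value at \<open>s =
  0\<close>, in the second half \<open>s powr \<mu>\<close> is comparable with \<open>t powr
  \<mu>\<close>, and \<open>one_plus_powr_le\<close> trades the kernel for a weak singularity at
  \<open>t\<close>.
\<close>

lemma kernel_power_le: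
  fixes r s t \<gamma> \<mu> :: real
  assumes s: "0 < s" "s < t" and r: "r \<ge> 0" and \<gamma>: "0 \<le> \<gamma>" "\<gamma> \<le> 1" and \<mu>: "-1 \<le> \<mu>" "\<mu> \<le> 0"
  shows "(1 + r * (t - s)) powr (- \<gamma>) * s powr \<mu> \<le>
     (1 + r * t) powr (- \<gamma>) * (2 * (s powr \<mu> + t powr (\<mu> + \<gamma>) * (t - s) powr (- \<gamma>)))"
proof -
  define q where "q = ((t - s) / t) powr (- \<gamma>)"
  have q0: "q \<ge> 0" by (simp add: q_def)
  have "q * s powr \<mu> \<le> 2 * (s powr \<mu> + t powr \<mu> * q)"
  proof (cases "s \<le> t / 2")
    case True
    then have "(t - s) / t \<ge> 1 / 2" using s by (simp add: field_simps)
    then have "q \<le> (1/2) powr (- \<gamma>)" unfolding q_def using \<gamma> by (intro powr_mono2') auto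
    also have "\<dots> = 2 powr \<gamma>" by (simp add: powr_minus powr_divide)
    also have "\<dots> \<le> 2 powr 1" using \<gamma> by (intro powr_mono) auto
    finally have "q * s powr \<mu> \<le> 2 * s powr \<mu>" by (intro mult_right_mono) auto
    also have "\<dots> \<le> 2 * (s powr \<mu> + t powr \<mu> * q)" using q0 by simp
    finally show ?thesis .
  next
    case False
    then have "s powr \<mu> \<le> (t / 2) powr \<mu>" using s \<mu> by (intro powr_mono2') auto
    also have "\<dots> = t powr \<mu> * 2 powr (- \<mu>)" using s by (simp add: powr_divide powr_minus field_simps)
    also have "\<dots> \<le> t powr \<mu> * 2 powr 1" using \<mu> by (intro mult_left_mono powr_mono) auto
    finally have "q * s powr \<mu> \<le> q * (t powr \<mu> * 2)" using q0 by (intro mult_left_mono) auto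
    also have "\<dots> \<le> 2 * (s powr \<mu> + t powr \<mu> * q)" by simp
    finally show ?thesis .
  qed
  moreover have "t powr \<mu> * q = t powr (\<mu> + \<gamma>) * (t - s) powr (- \<gamma>)"
    using s by (simp add: q_def powr_divide powr_minus powr_add field_simps)
  ultimately have 1: "q * s powr \<mu> \<le> 2 * (s powr \<mu> + t powr (\<mu> + \<gamma>) * (t - s) powr (- \<gamma>))" by simp
  have "(1 + r * (t - s)) powr (- \<gamma>) * s powr \<mu> \<le> ((1 + r * t) powr (- \<gamma>) * q) * s powr \<mu>"
    unfolding q_def using one_plus_powr_le[OF s r \<gamma>(1)] by (intro mult_right_mono) auto
  also have "\<dots> = (1 + r * t) powr (- \<gamma>) * (q * s powr \<mu>)" by simp
  also have "\<dots> \<le> (1 + r * t) powr (- \<gamma>) * (2 * (s powr \<mu> + t powr (\<mu> + \<gamma>) * (t - s) powr (- \<gamma>)))"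
    using 1 by (intro mult_left_mono) auto
  finally show ?thesis .
qed

lemma kernel_power_majorant:
  fixes t \<gamma> \<mu> :: real
  assumes t: "t > 0" and \<gamma>: "0 \<le> \<gamma>" "\<gamma> < 1" and \<mu>: "-1 < \<mu>" "\<mu> \<le> 0"
  shows "has_bochner_integral lborel
     (\<lambda>s. indicator {0<..<t} s * (2 * (s powr \<mu> + t powr (\<mu> + \<gamma>) * (t - s) powr (- \<gamma>))))
     (2 * (1 / (\<mu> + 1) + 1 / (1 - \<gamma>)) * t powr (\<mu> + 1))"
proof -
  have "has_bochner_integral lborel
     (\<lambda>s. 2 * (indicator {0<..<t} s * s powr \<mu>) + 2 * t powr (\<mu> + \<gamma>) * (indicator {0<..<t} s * (t - s) powr (- \<gamma>)))
     (2 * (t powr (\<mu> + 1) / (\<mu> + 1)) + 2 * t powr (\<mu> + \<gamma>) * (t powr (- \<gamma> + 1) / (- \<gamma> + 1)))"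
    using assms by (intro has_bochner_integral_add has_bochner_integral_mult_right
        integral_powr_from_0 integral_powr_to_end) auto
  moreover have "2 * (indicator {0<..<t} s * s powr \<mu>) + 2 * t powr (\<mu> + \<gamma>) * (indicator {0<..<t} s * (t - s) powr (- \<gamma>))
      = indicator {0<..<t} s * (2 * (s powr \<mu> + t powr (\<mu> + \<gamma>) * (t - s) powr (- \<gamma>)))" for s
    by (simp add: algebra_simps)
  moreover have "t powr (\<mu> + \<gamma>) * t powr (- \<gamma> + 1) = t powr (\<mu> + 1)" by (simp flip: powr_add)
  then have "2 * (t powr (\<mu> + 1) / (\<mu> + 1)) + 2 * t powr (\<mu> + \<gamma>) * (t powr (- \<gamma> + 1) / (- \<gamma> + 1)) =
      2 * (1 / (\<mu> + 1) + 1 / (1 - \<gamma>)) * t powr (\<mu> + 1)"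
    by (simp add: algebra_simps)
  ultimately show ?thesis by (simp only:)
qed

text \<open>
  Replacing the exponential by a power gains the factor \<open>(1 + r t) powr (-
  \<gamma>)\<close>, which is integrable against the growing weight \<open>exp ((1 - \<alpha>)
  x)\<close> when \<open>r = exp x\<close> and \<open>\<gamma> > 1 - \<alpha>\<close>.
\<close>

lemma exp_convolution_bound:
  fixes g :: "real \<Rightarrow> real"
  assumes t: "t > 0" and r: "r \<ge> 0" and \<gamma>: "0 \<le> \<gamma>" "\<gamma> < 1" and \<mu>: "-1 < \<mu>" "\<mu> \<le> 0"
    and gc: "continuous_on {0<..} g" and gA: "\<And>s. s > 0 \<Longrightarrow> \<bar>g s\<bar> \<le> A * s powr \<mu>"
  shows "integrable lborel (\<lambda>s. indicator {0<..<t} s * (exp (- r * (t - s)) * g s))" (is ?I)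
    and "(LBINT s. \<bar>indicator {0<..<t} s * (exp (- r * (t - s)) * g s)\<bar>)
           \<le> A * (2 * (1 / (\<mu> + 1) + 1 / (1 - \<gamma>)) * t powr (\<mu> + 1)) * (1 + r * t) powr (- \<gamma>)" (is ?B)
proof -
  have A0: "A \<ge> 0" using gA[of 1] by simp
  define m where "m = (\<lambda>s. indicator {0<..<t} s * (2 * (s powr \<mu> + t powr (\<mu> + \<gamma>) * (t - s) powr (- \<gamma>))))"
  have m: "has_bochner_integral lborel m (2 * (1 / (\<mu> + 1) + 1 / (1 - \<gamma>)) * t powr (\<mu> + 1))"
    unfolding m_def by (rule kernel_power_majorant[OF t \<gamma> \<mu>])
  have meas: "(\<lambda>s. indicator {0<..<t} s * (exp (- r * (t - s)) * g s)) \<in> borel_measurable borel"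
  proof -
    have "continuous_on {0<..<t} (\<lambda>s. exp (- r * (t - s)) * g s)"
      by (intro continuous_intros continuous_on_subset[OF gc]) auto
    from borel_measurable_continuous_on_indicator[OF _ this] show ?thesis by simp
  qed
  have le: "\<bar>indicator {0<..<t} s * (exp (- r * (t - s)) * g s)\<bar> \<le> (A * (1 + r * t) powr (- \<gamma>)) * m s" for s
  proof (cases "s \<in> {0<..<t}")
    case True
    then have "exp (- (r * (t - s))) \<le> (1 + r * (t - s)) powr (- \<gamma>)" using r \<gamma> by (intro exp_minus_le_powr) auto
    then have "exp (- r * (t - s)) * \<bar>g s\<bar> \<le> (1 + r * (t - s)) powr (- \<gamma>) * (A * s powr \<mu>)"
      using gA[of s] True by (intro mult_mono) auto
    also have "\<dots> = A * ((1 + r * (t - s)) powr (- \<gamma>) * s powr \<mu>)" by simp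
    also have "\<dots> \<le> A * ((1 + r * t) powr (- \<gamma>) * (2 * (s powr \<mu> + t powr (\<mu> + \<gamma>) * (t - s) powr (- \<gamma>))))"
      using True r \<gamma> \<mu> A0 by (intro mult_left_mono kernel_power_le) auto
    finally show ?thesis using True by (simp add: m_def abs_mult)
  qed (simp add: m_def)
  have Im: "integrable lborel (\<lambda>s. (A * (1 + r * t) powr (- \<gamma>)) * m s)"
    using m by (intro integrable_mult_right) (simp add: has_bochner_integral_iff)
  show I: ?I
  proof (rule Bochner_Integration.integrable_bound[OF Im])
    show "AE s in lborel. norm (indicator {0<..<t} s * (exp (- r * (t - s)) * g s)) \<le> norm ((A * (1 + r * t) powr (- \<gamma>)) * m s)"
      unfolding real_norm_def by (intro AE_I2 order_trans[OF le abs_ge_self])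
  qed (use meas in simp)
  have "(LBINT s. \<bar>indicator {0<..<t} s * (exp (- r * (t - s)) * g s)\<bar>) \<le> (LBINT s. (A * (1 + r * t) powr (- \<gamma>)) * m s)"
    using I Im le by (intro integral_mono) auto
  also have "\<dots> = (A * (1 + r * t) powr (- \<gamma>)) * (2 * (1 / (\<mu> + 1) + 1 / (1 - \<gamma>)) * t powr (\<mu> + 1))"
    using m by (simp add: has_bochner_integral_iff)
  finally show ?B by (simp only: mult_ac)
qed

text \<open>
  The translation \<open>x = y - ln t\<close> extracts the power of \<open>t\<close>.
\<close>

lemma scaled_kernel_integral:
  fixes a \<gamma> t :: real
  assumes a: "0 < a" "a < \<gamma>" and t: "t > 0"
  shows "integrable lborel (\<lambda>x. exp (a * x) * (1 + exp x * t) powr (- \<gamma>))"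
    and "(LBINT x. exp (a * x) * (1 + exp x * t) powr (- \<gamma>)) =
         t powr (- a) * (LBINT x. exp (a * x) * (1 + exp x) powr (- \<gamma>))"
proof -
  define f where "f = (\<lambda>x. exp (a * x) * (1 + exp x) powr (- \<gamma>))"
  have b: "norm (f x) \<le> 1 * exp (- min a (\<gamma> - a) * \<bar>x\<bar>)" for x
  proof (cases "x \<ge> 0")
    case True
    have "(1 + exp x) powr (- \<gamma>) \<le> exp x powr (- \<gamma>)" using a by (intro powr_mono2') auto
    also have "\<dots> = exp (- \<gamma> * x)" by (simp add: powr_def)
    finally have "f x \<le> exp (a * x) * exp (- \<gamma> * x)" unfolding f_def by (intro mult_left_mono) auto
    also have "\<dots> = exp (- (\<gamma> - a) * x)" by (simp add: exp_add[symmetric] algebra_simps)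
    also have "\<dots> \<le> exp (- min a (\<gamma> - a) * \<bar>x\<bar>)"
      using mult_right_mono[of "min a (\<gamma> - a)" "\<gamma> - a" x] True by (simp add: algebra_simps)
    finally show ?thesis by (simp add: f_def)
  next
    case False
    have "(1 + exp x) powr (- \<gamma>) \<le> 1" using a by (simp add: powr_minus inverse_le_1_iff ge_one_powr_ge_zero)
    then have "f x \<le> exp (a * x) * 1" unfolding f_def by (intro mult_left_mono) auto
    also have "\<dots> \<le> exp (- min a (\<gamma> - a) * \<bar>x\<bar>)"
      using mult_right_mono_neg[of "min a (\<gamma> - a)" a x] False by simp
    finally show ?thesis by (simp add: f_def)
  qed
  have fm[measurable]: "f \<in> borel_measurable borel" unfolding f_def by measurable
  have If: "integrable lborel f"
    using integrable_bound_exp_minus_abs[of f "min a (\<gamma> - a)" 1] b a by auto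
  have eq: "exp (a * x) * (1 + exp x * t) powr (- \<gamma>) = t powr (- a) * f (ln t + 1 * x)" for x
  proof -
    have "exp (ln t + 1 * x) = exp x * t" using t by (simp add: exp_add mult.commute)
    moreover have "exp (a * (ln t + 1 * x)) = t powr a * exp (a * x)"
      using t by (simp add: powr_def exp_add[symmetric] algebra_simps)
    ultimately show ?thesis using t by (simp add: f_def powr_minus)
  qed
  show "integrable lborel (\<lambda>x. exp (a * x) * (1 + exp x * t) powr (- \<gamma>))"
    unfolding eq by (intro integrable_mult_right lborel_integrable_real_affine If) auto
  show "(LBINT x. exp (a * x) * (1 + exp x * t) powr (- \<gamma>)) =
         t powr (- a) * (LBINT x. exp (a * x) * (1 + exp x) powr (- \<gamma>))"
    unfolding eq using lborel_integral_real_affine[of 1 f "ln t"] by (simp add: f_def)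
qed

lemma causal_exp_truncate:
  assumes "set_integrable lborel {0<..<T} f" "(\<lambda>t. indicator {0<..<T} t * f t) \<in> borel_measurable borel"
  shows "causal_exp (\<lambda>t. indicator {0<..<T} t * f t)"
  unfolding causal_exp_def
proof (intro conjI allI impI)
  fix z :: real assume z: "z > 0"
  show "integrable lborel (\<lambda>t. exp (- z * t) * (indicator {0<..<T} t * f t))"
  proof (rule Bochner_Integration.integrable_bound)
    show "integrable lborel (\<lambda>t. indicator {0<..<T} t *\<^sub>R f t)" using assms(1) unfolding set_integrable_def .
    show "(\<lambda>t. exp (- z * t) * (indicator {0<..<T} t * f t)) \<in> borel_measurable lborel"
      using assms(2) by simp
    show "AE t in lborel. norm (exp (- z * t) * (indicator {0<..<T} t * f t)) \<le> norm (indicator {0<..<T} t *\<^sub>R f t)"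
    proof (intro AE_I2)
      fix t
      show "norm (exp (- z * t) * (indicator {0<..<T} t * f t)) \<le> norm (indicator {0<..<T} t *\<^sub>R f t)"
      proof (cases "t \<in> {0<..<T}")
        case True
        then have "exp (- z * t) * \<bar>f t\<bar> \<le> 1 * \<bar>f t\<bar>" using z by (intro mult_right_mono) auto
        then show ?thesis using True by (simp add: abs_mult)
      qed simp
    qed
  qed
qed (use assms in auto)

lemma lap_one:
  shows "causal_exp (indicator {0<..})" and "z > 0 \<Longrightarrow> lap (indicator {0<..}) z = 1 / z"
proof -
  have h: "has_bochner_integral lborel (\<lambda>t. exp (- z * t) * indicator {0<..} t) (1 / z)" if "z > 0" for z :: real
    using laplace_exp[OF that] by (simp only: mult.commute)
  show "causal_exp (indicator {0<..})"
    unfolding causal_exp_def using h by (auto simp: has_bochner_integral_iff)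
  show "z > 0 \<Longrightarrow> lap (indicator {0<..}) z = 1 / z"
    unfolding lap_def using h by (simp add: has_bochner_integral_iff)
qed

text \<open>
  The kernel of the Volterra equation satisfied by a coefficient; its Laplace transform is
  \<open>(z powr \<alpha> + l) / z\<close>.
\<close>

definition caputo_kernel :: "real \<Rightarrow> real \<Rightarrow> real \<Rightarrow> real" where
  "caputo_kernel \<alpha> l t = indicator {0<..} t * (t powr (- \<alpha>) / Gamma (1 - \<alpha>) + l)"

text \<open>
  The solution of \<open>v' + exp x * v = g\<close> with \<open>v 0 = 0\<close>. The logarithmic
  parameter makes the stiffness range over the whole real line.
\<close>

definition mode :: "(real \<Rightarrow> real) \<Rightarrow> real \<Rightarrow> real \<Rightarrow> real" where
  "mode g x t = (LBINT s. indicator {0<..<t} s * (exp (- exp x * (t - s)) * g s))"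

text \<open>
  By \<open>stieltjes_resolvent\<close> its Laplace transform is \<open>1 / (z powr \<alpha> +
  l)\<close>: a superposition of decaying exponentials, expressible otherwise through
  Mittag-Leffler functions.
\<close>

definition resolvent_kernel :: "real \<Rightarrow> real \<Rightarrow> real \<Rightarrow> real" where
  "resolvent_kernel \<alpha> l t = (LBINT x. kap \<alpha> l x * (indicator {0<..} t * exp (- exp x * t)))"

context
  fixes \<alpha> l :: real assumes \<alpha>: "0 < \<alpha>" "\<alpha> < 1" and l: "l \<ge> 0"
begin

lemma caputo_kernel_lap:
  shows "causal_exp (caputo_kernel \<alpha> l)"
    and "z > 0 \<Longrightarrow> lap (caputo_kernel \<alpha> l) z = (z powr \<alpha> + l) / z"
proof -
  have G: "Gamma (1 - \<alpha>) > 0" using \<alpha> by simp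
  have h: "has_bochner_integral lborel (\<lambda>t. exp (- z * t) * caputo_kernel \<alpha> l t) ((z powr \<alpha> + l) / z)" if z: "z > 0" for z
  proof -
    have "has_bochner_integral lborel
       (\<lambda>t. 1 / Gamma (1 - \<alpha>) * (indicator {0<..} t * (exp (- z * t) * t powr (1 - \<alpha> - 1))) + l * (indicator {0<..} t * exp (- z * t)))
       (1 / Gamma (1 - \<alpha>) * (Gamma (1 - \<alpha>) * z powr (- (1 - \<alpha>))) + l * (1 / z))"
      using \<alpha> z by (intro has_bochner_integral_add has_bochner_integral_mult_right laplace_powr laplace_exp) auto
    moreover have "1 / Gamma (1 - \<alpha>) * (indicator {0<..} t * (exp (- z * t) * t powr (1 - \<alpha> - 1))) + l * (indicator {0<..} t * exp (- z * t))
        = exp (- z * t) * caputo_kernel \<alpha> l t" for t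
      by (simp add: caputo_kernel_def algebra_simps)
    moreover have "1 / Gamma (1 - \<alpha>) * (Gamma (1 - \<alpha>) * z powr (- (1 - \<alpha>))) + l * (1 / z) = (z powr \<alpha> + l) / z"
    proof -
      have "z powr (- (1 - \<alpha>)) = z powr \<alpha> / z" using z by (simp add: powr_diff)
      then show ?thesis using G by (simp add: add_divide_distrib)
    qed
    ultimately show ?thesis by (simp only:)
  qed
  have "caputo_kernel \<alpha> l \<in> borel_measurable borel" unfolding caputo_kernel_def[abs_def] by measurable
  then show "causal_exp (caputo_kernel \<alpha> l)"
    unfolding causal_exp_def using h by (auto simp: has_bochner_integral_iff caputo_kernel_def)
  show "z > 0 \<Longrightarrow> lap (caputo_kernel \<alpha> l) z = (z powr \<alpha> + l) / z"
    unfolding lap_def using h by (simp add: has_bochner_integral_iff)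
qed

lemma resolvent_kernel_lap:
  shows "causal_exp (resolvent_kernel \<alpha> l)"
    and "z > 0 \<Longrightarrow> lap (resolvent_kernel \<alpha> l) z = 1 / (z powr \<alpha> + l)"
proof -
  note [measurable] = kap_measurable[OF \<alpha> l]
  define h where "h = (\<lambda>z x t. kap \<alpha> l x * (indicator {0<..} t * exp (- (exp x + z) * t)))"
  have e: "has_bochner_integral lborel (\<lambda>t. indicator {0<..} t * exp (- (exp x + z) * t)) (1 / (exp x + z))" if "z > 0" for x z :: real
    by (rule laplace_exp) (use that in \<open>simp add: add_pos_pos\<close>)
  have hn: "norm (h z x t) = h z x t" for z x t
    unfolding h_def using kap_nonneg[OF \<alpha> l, of x] by simp
  have hi: "(LBINT t. h z x t) = kap \<alpha> l x / (exp x + z)" "integrable lborel (h z x)" if "z > 0" for x z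
    using e[OF that, of x] unfolding h_def by (auto simp: has_bochner_integral_iff)
  have I: "integrable (lborel \<Otimes>\<^sub>M lborel) (case_prod (h z))" if z: "z > 0" for z
  proof (rule lborel_pair.Fubini_integrable)
    show "case_prod (h z) \<in> borel_measurable (lborel \<Otimes>\<^sub>M lborel)" unfolding h_def by measurable
    show "integrable lborel (\<lambda>x. LBINT t. norm (case (x, t) of (x, t) \<Rightarrow> h z x t))"
      using stieltjes_resolvent(1)[OF \<alpha> l z] by (simp only: prod.case hn hi(1)[OF z])
    show "AE x in lborel. integrable lborel (\<lambda>t. case (x, t) of (x, t) \<Rightarrow> h z x t)"
      using hi(2)[OF z] by (intro AE_I2) simp
  qed
  have eq: "exp (- z * t) * resolvent_kernel \<alpha> l t = (LBINT x. h z x t)" for z t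
  proof -
    have "exp (- z * t) * (kap \<alpha> l x * (indicator {0<..} t * exp (- exp x * t))) = h z x t" for x
    proof -
      have "exp (- (exp x + z) * t) = exp (- z * t) * exp (- exp x * t)"
        by (simp add: exp_add[symmetric] algebra_simps)
      then show ?thesis by (simp add: h_def)
    qed
    then show ?thesis unfolding resolvent_kernel_def by (simp only: integral_mult_right_zero[symmetric])
  qed
  show "causal_exp (resolvent_kernel \<alpha> l)"
    unfolding causal_exp_def
  proof (intro conjI allI impI)
    show "resolvent_kernel \<alpha> l \<in> borel_measurable borel"
      unfolding resolvent_kernel_def[abs_def] by measurable
    show "resolvent_kernel \<alpha> l t = 0" if "t \<le> 0" for t
      using that by (simp add: resolvent_kernel_def)
    show "integrable lborel (\<lambda>t. exp (- z * t) * resolvent_kernel \<alpha> l t)" if "z > 0" for z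
      unfolding eq using lborel_pair.integrable_snd[OF I[OF that]] .
  qed
  show "lap (resolvent_kernel \<alpha> l) z = 1 / (z powr \<alpha> + l)" if z: "z > 0"
    unfolding lap_def eq
    using lborel_pair.Fubini_integral[OF I[OF z]] stieltjes_resolvent(2)[OF \<alpha> l z] by (simp add: hi[OF z])
qed

context
  fixes g :: "real \<Rightarrow> real" and A \<mu> :: real
  assumes \<mu>: "-1 < \<mu>" "\<mu> < 0" and gc: "continuous_on {0<..} g"
    and gA: "\<And>s. s > 0 \<Longrightarrow> \<bar>g s\<bar> \<le> A * s powr \<mu>"
begin

lemma kap_weight_integrable:
  assumes t: "t > 0"
  shows "integrable lborel (\<lambda>x. kap \<alpha> l x * (1 + exp x * t) powr (- (1 - \<alpha> / 2)))"
proof (rule Bochner_Integration.integrable_bound)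
  show "integrable lborel (\<lambda>x. 1 / (pi * sin (pi * \<alpha>)) * (exp ((1 - \<alpha>) * x) * (1 + exp x * t) powr (- (1 - \<alpha> / 2))))"
    using \<alpha> t by (intro integrable_mult_right scaled_kernel_integral(1)) auto
  show "(\<lambda>x. kap \<alpha> l x * (1 + exp x * t) powr (- (1 - \<alpha> / 2))) \<in> borel_measurable lborel"
    using kap_measurable[OF \<alpha> l] by simp
  show "AE x in lborel. norm (kap \<alpha> l x * (1 + exp x * t) powr (- (1 - \<alpha> / 2)))
     \<le> norm (1 / (pi * sin (pi * \<alpha>)) * (exp ((1 - \<alpha>) * x) * (1 + exp x * t) powr (- (1 - \<alpha> / 2))))"
  proof (intro AE_I2)
    fix x
    have "kap \<alpha> l x * (1 + exp x * t) powr (- (1 - \<alpha> / 2)) \<le> (1 / (pi * sin (pi * \<alpha>)) * exp ((1 - \<alpha>) * x)) * (1 + exp x * t) powr (- (1 - \<alpha> / 2))"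
      by (intro mult_right_mono kap_le[OF \<alpha> l]) auto
    moreover have "0 \<le> kap \<alpha> l x * (1 + exp x * t) powr (- (1 - \<alpha> / 2))" using kap_nonneg[OF \<alpha> l, of x] by simp
    ultimately show "norm (kap \<alpha> l x * (1 + exp x * t) powr (- (1 - \<alpha> / 2)))
     \<le> norm (1 / (pi * sin (pi * \<alpha>)) * (exp ((1 - \<alpha>) * x) * (1 + exp x * t) powr (- (1 - \<alpha> / 2))))"
      by (simp only: real_norm_def mult.assoc)
  qed
qed

lemma mode_bound:
  assumes t: "t > 0"
  shows "(LBINT s. \<bar>indicator {0<..<t} s * (exp (- exp x * (t - s)) * g s)\<bar>)
     \<le> A * (2 * (1 / (\<mu> + 1) + 1 / (\<alpha> / 2)) * t powr (\<mu> + 1)) * (1 + exp x * t) powr (- (1 - \<alpha> / 2))"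
  using exp_convolution_bound(2)[OF t, of "exp x" "1 - \<alpha> / 2" \<mu> g A] \<alpha> \<mu> gc gA by simp

lemma mode_integrable:
  assumes t: "t > 0"
  shows "integrable lborel (\<lambda>s. indicator {0<..<t} s * (exp (- exp x * (t - s)) * g s))"
  using exp_convolution_bound(1)[OF t, of "exp x" "1 - \<alpha> / 2" \<mu> g A] \<alpha> \<mu> gc gA by simp

lemma mode_abs_le:
  assumes t: "t > 0"
  shows "\<bar>mode g x t\<bar> \<le> A * (2 * (1 / (\<mu> + 1) + 1 / (\<alpha> / 2)) * t powr (\<mu> + 1)) * (1 + exp x * t) powr (- (1 - \<alpha> / 2))"
  unfolding mode_def using integral_abs_bound mode_bound[OF t] by (rule order_trans)

lemma g_integrable:
  assumes "t > 0" shows "set_integrable lborel {0<..<t} g"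
proof -
  have meas: "(\<lambda>s. indicator {0<..<t} s *\<^sub>R g s) \<in> borel_measurable borel"
    by (rule borel_measurable_continuous_on_indicator) (auto intro: continuous_on_subset[OF gc])
  have I: "integrable lborel (\<lambda>s. A * (indicator {0<..<t} s * s powr \<mu>))"
    using integral_powr_from_0[OF \<mu>(1) assms] by (intro integrable_mult_right) (simp add: has_bochner_integral_iff)
  show ?thesis unfolding set_integrable_def
  proof (rule Bochner_Integration.integrable_bound[OF I])
    show "AE s in lborel. norm (indicator {0<..<t} s *\<^sub>R g s) \<le> norm (A * (indicator {0<..<t} s * s powr \<mu>))"
      using gA by (intro AE_I2) (auto simp: indicator_def intro: order_trans[OF _ abs_ge_self])
  qed (use meas in simp)
qed

lemma mode_continuous:
  assumes t0: "t0 > 0" shows "isCont (mode g x) t0"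
proof -
  define h where "h = (\<lambda>s. exp (exp x * s) * g s)"
  have hi: "set_integrable lborel {0<..<2 * t0} h"
    unfolding set_integrable_def
  proof (rule Bochner_Integration.integrable_bound)
    show "integrable lborel (\<lambda>s. exp (exp x * (2 * t0)) * (indicator {0<..<2 * t0} s *\<^sub>R g s))"
      using g_integrable[of "2 * t0"] t0 unfolding set_integrable_def by (intro integrable_mult_right) auto
    have "continuous_on {0<..<2 * t0} h" unfolding h_def by (intro continuous_intros continuous_on_subset[OF gc]) auto
    from borel_measurable_continuous_on_indicator[OF _ this]
    show "(\<lambda>s. indicator {0<..<2 * t0} s *\<^sub>R h s) \<in> borel_measurable lborel" by simp
    show "AE s in lborel. norm (indicator {0<..<2 * t0} s *\<^sub>R h s) \<le> norm (exp (exp x * (2 * t0)) * (indicator {0<..<2 * t0} s *\<^sub>R g s))"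
      by (intro AE_I2) (auto simp: h_def indicator_def abs_mult intro!: mult_right_mono)
  qed
  have eq: "mode g x t = exp (- exp x * t) * integral {0..t} h" if t: "t \<in> {0<..<2 * t0}" for t
  proof -
    have "set_integrable lborel {0<..<t} h" by (rule set_integrable_subset[OF hi]) (use t in auto)
    then have "(LBINT s:{0<..<t}. h s) = integral {0<..<t} h" by (rule set_borel_integral_eq_integral)
    also have "\<dots> = integral {0..t} h" by (rule integral_open_interval_real[symmetric])
    finally have "integral {0..t} h = (LBINT s. indicator {0<..<t} s *\<^sub>R h s)" unfolding set_lebesgue_integral_def by simp
    moreover have "exp (- exp x * t) * (indicator {0<..<t} s *\<^sub>R h s) = indicator {0<..<t} s * (exp (- exp x * (t - s)) * g s)" for s
    proof -
      have "exp (- exp x * (t - s)) = exp (- exp x * t) * exp (exp x * s)"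
        by (simp add: exp_add[symmetric] algebra_simps)
      then show ?thesis by (simp add: h_def)
    qed
    ultimately show ?thesis unfolding mode_def by (simp only: integral_mult_right_zero[symmetric])
  qed
  have "h integrable_on {0<..<2 * t0}" using set_borel_integral_eq_integral(1)[OF hi] .
  then have "h integrable_on {0..2 * t0}" by (simp add: integrable_on_open_interval_real)
  then have "continuous_on {0..2 * t0} (\<lambda>t. integral {0..t} h)" by (rule indefinite_integral_continuous_1)
  then have "continuous_on {0<..<2 * t0} (\<lambda>t. exp (- exp x * t) * integral {0..t} h)"
    by (intro continuous_intros) (auto intro: continuous_on_subset)
  then have "continuous_on {0<..<2 * t0} (mode g x)" by (rule continuous_on_eq) (simp add: eq)
  then show ?thesis using t0 by (simp add: continuous_on_eq_continuous_at)
qed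

lemma mode_measurable: "(\<lambda>x. mode g x t) \<in> borel_measurable borel"
proof (cases "t > 0")
  case True
  have "(\<lambda>s. indicator {0<..<t} s *\<^sub>R g s) \<in> borel_measurable borel"
    by (rule borel_measurable_continuous_on_indicator) (auto intro: continuous_on_subset[OF gc])
  then have [measurable]: "(\<lambda>s. indicator {0<..<t} s * g s) \<in> borel_measurable borel" by simp
  have "(\<lambda>x. LBINT s. exp (- exp x * (t - s)) * (indicator {0<..<t} s * g s)) \<in> borel_measurable borel"
    by measurable
  then show ?thesis unfolding mode_def by (simp add: mult_ac)
next
  case False
  then show ?thesis unfolding mode_def by simp
qed

lemma mode_superposition_integrable:
  assumes t: "t > 0" shows "integrable lborel (\<lambda>x. kap \<alpha> l x * mode g x t)"
proof (rule Bochner_Integration.integrable_bound)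
  define B where "B = A * (2 * (1 / (\<mu> + 1) + 1 / (\<alpha> / 2)) * t powr (\<mu> + 1))"
  show "integrable lborel (\<lambda>x. B * (kap \<alpha> l x * (1 + exp x * t) powr (- (1 - \<alpha> / 2))))"
    by (intro integrable_mult_right kap_weight_integrable t)
  show "(\<lambda>x. kap \<alpha> l x * mode g x t) \<in> borel_measurable lborel"
    using kap_measurable[OF \<alpha> l] mode_measurable by simp
  show "AE x in lborel. norm (kap \<alpha> l x * mode g x t) \<le> norm (B * (kap \<alpha> l x * (1 + exp x * t) powr (- (1 - \<alpha> / 2))))"
  proof (intro AE_I2)
    fix x
    have "kap \<alpha> l x * \<bar>mode g x t\<bar> \<le> kap \<alpha> l x * (B * (1 + exp x * t) powr (- (1 - \<alpha> / 2)))"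
      unfolding B_def using kap_nonneg[OF \<alpha> l, of x] mode_abs_le[OF t, of x] by (rule mult_left_mono[rotated])
    also have "\<dots> \<le> \<bar>B * (kap \<alpha> l x * (1 + exp x * t) powr (- (1 - \<alpha> / 2)))\<bar>"
      by (simp only: mult_ac abs_ge_self)
    finally show "norm (kap \<alpha> l x * mode g x t) \<le> norm (B * (kap \<alpha> l x * (1 + exp x * t) powr (- (1 - \<alpha> / 2))))"
      using kap_nonneg[OF \<alpha> l, of x] by (simp only: real_norm_def abs_mult[of "kap \<alpha> l x" "mode g x t"] abs_of_nonneg)
  qed
qed

lemma convolve_resolvent_eq:
  assumes t: "0 < t" "t \<le> T"
  shows "convolve (resolvent_kernel \<alpha> l) (\<lambda>s. indicator {0<..<T} s * g s) t = (LBINT x. kap \<alpha> l x * mode g x t)"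
proof -
  note [measurable] = kap_measurable[OF \<alpha> l]
  have "(\<lambda>s. indicator {0<..<t} s *\<^sub>R g s) \<in> borel_measurable borel"
    by (rule borel_measurable_continuous_on_indicator) (auto intro: continuous_on_subset[OF gc])
  then have gm[measurable]: "(\<lambda>s. indicator {0<..<t} s * g s) \<in> borel_measurable borel" by simp
  define h where "h = (\<lambda>x s. kap \<alpha> l x * (exp (- exp x * (t - s)) * (indicator {0<..<t} s * g s)))"
  have h_eq: "h x s = kap \<alpha> l x * (indicator {0<..<t} s * (exp (- exp x * (t - s)) * g s))" for x s
    by (simp add: h_def)
  have I: "integrable (lborel \<Otimes>\<^sub>M lborel) (case_prod h)"
  proof (rule lborel_pair.Fubini_integrable)
    show "case_prod h \<in> borel_measurable (lborel \<Otimes>\<^sub>M lborel)" unfolding h_def by measurable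
    define B where "B = A * (2 * (1 / (\<mu> + 1) + 1 / (\<alpha> / 2)) * t powr (\<mu> + 1))"
    have nh: "(LBINT s. norm (case (x, s) of (x, s) \<Rightarrow> h x s)) = kap \<alpha> l x * (LBINT s. \<bar>indicator {0<..<t} s * (exp (- exp x * (t - s)) * g s)\<bar>)" for x
      unfolding h_eq prod.case using kap_nonneg[OF \<alpha> l, of x]
      by (simp only: real_norm_def abs_mult[of "kap \<alpha> l x"] abs_of_nonneg integral_mult_right_zero)
    show "integrable lborel (\<lambda>x. LBINT s. norm (case (x, s) of (x, s) \<Rightarrow> h x s))"
    proof (rule Bochner_Integration.integrable_bound)
      show "integrable lborel (\<lambda>x. B * (kap \<alpha> l x * (1 + exp x * t) powr (- (1 - \<alpha> / 2))))"
        by (intro integrable_mult_right kap_weight_integrable t)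
      show "(\<lambda>x. LBINT s. norm (case (x, s) of (x, s) \<Rightarrow> h x s)) \<in> borel_measurable lborel"
        unfolding h_def by measurable
      show "AE x in lborel. norm (LBINT s. norm (case (x, s) of (x, s) \<Rightarrow> h x s)) \<le> norm (B * (kap \<alpha> l x * (1 + exp x * t) powr (- (1 - \<alpha> / 2))))"
      proof (intro AE_I2)
        fix x
        have "kap \<alpha> l x * (LBINT s. \<bar>indicator {0<..<t} s * (exp (- exp x * (t - s)) * g s)\<bar>) \<le> kap \<alpha> l x * (B * (1 + exp x * t) powr (- (1 - \<alpha> / 2)))"
          unfolding B_def using kap_nonneg[OF \<alpha> l, of x] mode_bound[OF t(1), of x] by (rule mult_left_mono[rotated])
        also have "\<dots> \<le> \<bar>B * (kap \<alpha> l x * (1 + exp x * t) powr (- (1 - \<alpha> / 2)))\<bar>"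
          by (simp only: mult_ac abs_ge_self)
        finally show "norm (LBINT s. norm (case (x, s) of (x, s) \<Rightarrow> h x s)) \<le> norm (B * (kap \<alpha> l x * (1 + exp x * t) powr (- (1 - \<alpha> / 2))))"
          unfolding nh using kap_nonneg[OF \<alpha> l, of x]
          by (simp only: real_norm_def abs_mult[of "kap \<alpha> l x" "integral\<^sup>L _ _"] abs_of_nonneg abs_ge_zero integral_nonneg_AE AE_I2)
      qed
    qed
    show "AE x in lborel. integrable lborel (\<lambda>s. case (x, s) of (x, s) \<Rightarrow> h x s)"
      unfolding h_eq prod.case by (intro AE_I2 integrable_mult_right mode_integrable t)
  qed
  have "resolvent_kernel \<alpha> l (t - s) * (indicator {0<..<T} s * g s) = (LBINT x. h x s)" for s
  proof -
    have "(kap \<alpha> l x * (indicator {0<..} (t - s) * exp (- exp x * (t - s)))) * (indicator {0<..<T} s * g s) = h x s" for x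
      using t by (auto simp: h_def indicator_def)
    then show ?thesis unfolding resolvent_kernel_def by (simp only: integral_mult_left_zero[symmetric])
  qed
  then have "convolve (resolvent_kernel \<alpha> l) (\<lambda>s. indicator {0<..<T} s * g s) t = (LBINT s. LBINT x. h x s)"
    unfolding convolve_def by (simp only:)
  also have "\<dots> = (LBINT x. LBINT s. h x s)" by (rule lborel_pair.Fubini_integral[OF I])
  also have "\<dots> = (LBINT x. kap \<alpha> l x * mode g x t)"
    unfolding h_eq mode_def by (simp only: integral_mult_right_zero)
  finally show ?thesis .
qed

text \<open>
  Dominated convergence; the majorant is uniform for \<open>t\<close> near \<open>t0\<close>.
\<close>

lemma mode_superposition_continuous:
  "continuous_on {0<..} (\<lambda>t. LBINT x. kap \<alpha> l x * mode g x t)"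
proof (rule continuous_at_imp_continuous_on, intro ballI)
  fix t0 :: real assume "t0 \<in> {0<..}"
  then have t0: "t0 > 0" by simp
  have A0: "A \<ge> 0" using gA[of 1] by simp
  define K where "K = A * (2 * (1 / (\<mu> + 1) + 1 / (\<alpha> / 2)))"
  have K0: "K \<ge> 0" unfolding K_def using A0 \<mu> \<alpha> by (intro mult_nonneg_nonneg add_nonneg_nonneg) auto
  define w where "w = (\<lambda>x. K * (2 * t0) powr (\<mu> + 1) * (kap \<alpha> l x * (1 + exp x * (t0 / 2)) powr (- (1 - \<alpha> / 2))))"
  have wi: "integrable lborel w" unfolding w_def using t0 by (intro integrable_mult_right kap_weight_integrable) auto
  have dom: "\<bar>kap \<alpha> l x * mode g x t\<bar> \<le> w x" if t: "t0 / 2 < t" "t < 2 * t0" for x t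
  proof -
    have tp: "t > 0" using t t0 by simp
    have "\<bar>mode g x t\<bar> \<le> K * t powr (\<mu> + 1) * (1 + exp x * t) powr (- (1 - \<alpha> / 2))"
      using mode_abs_le[OF tp, of x] unfolding K_def by (simp only: mult.assoc)
    also have "\<dots> \<le> K * (2 * t0) powr (\<mu> + 1) * (1 + exp x * (t0 / 2)) powr (- (1 - \<alpha> / 2))"
    proof (intro mult_mono mult_left_mono)
      show "t powr (\<mu> + 1) \<le> (2 * t0) powr (\<mu> + 1)" using t tp \<mu> by (intro powr_mono2) auto
      show "(1 + exp x * t) powr (- (1 - \<alpha> / 2)) \<le> (1 + exp x * (t0 / 2)) powr (- (1 - \<alpha> / 2))"
        using t tp t0 \<alpha> by (intro powr_mono2') (auto intro!: add_pos_pos)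
    qed (use K0 in auto)
    finally have "kap \<alpha> l x * \<bar>mode g x t\<bar> \<le> kap \<alpha> l x * (K * (2 * t0) powr (\<mu> + 1) * (1 + exp x * (t0 / 2)) powr (- (1 - \<alpha> / 2)))"
      using kap_nonneg[OF \<alpha> l, of x] by (rule mult_left_mono)
    also have "\<dots> = w x" by (simp add: w_def)
    finally show ?thesis using kap_nonneg[OF \<alpha> l, of x] by (simp add: abs_mult)
  qed
  show "isCont (\<lambda>t. LBINT x. kap \<alpha> l x * mode g x t) t0"
    unfolding continuous_at_sequentially
  proof (intro allI impI)
    fix y :: "nat \<Rightarrow> real" assume y: "y \<longlonglongrightarrow> t0"
    have "\<forall>\<^sub>F n in sequentially. t0 / 2 < y n" by (rule order_tendstoD(1)[OF y]) (use t0 in simp)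
    moreover have "\<forall>\<^sub>F n in sequentially. y n < 2 * t0" by (rule order_tendstoD(2)[OF y]) (use t0 in simp)
    ultimately have "\<forall>\<^sub>F n in sequentially. t0 / 2 < y n \<and> y n < 2 * t0" by eventually_elim simp
    then obtain m where m: "\<And>n. n \<ge> m \<Longrightarrow> t0 / 2 < y n \<and> y n < 2 * t0"
      unfolding eventually_sequentially by blast
    have "(\<lambda>n. LBINT x. kap \<alpha> l x * mode g x (y (n + m))) \<longlonglongrightarrow> (LBINT x. kap \<alpha> l x * mode g x t0)"
    proof (rule integral_dominated_convergence[OF _ _ wi])
      show "AE x in lborel. (\<lambda>n. kap \<alpha> l x * mode g x (y (n + m))) \<longlonglongrightarrow> kap \<alpha> l x * mode g x t0"
        by (intro AE_I2 tendsto_mult_left isCont_tendsto_compose[OF mode_continuous[OF t0]] LIMSEQ_ignore_initial_segment y)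
      show "AE x in lborel. norm (kap \<alpha> l x * mode g x (y (n + m))) \<le> w x" for n
        unfolding real_norm_def using dom m[of "n + m"] by (intro AE_I2) auto
    qed (use kap_measurable[OF \<alpha> l] mode_measurable in auto)
    then have "(\<lambda>n. LBINT x. kap \<alpha> l x * mode g x (y n)) \<longlonglongrightarrow> (LBINT x. kap \<alpha> l x * mode g x t0)"
      by (rule LIMSEQ_offset)
    then show "((\<lambda>t. LBINT x. kap \<alpha> l x * mode g x t) \<circ> y) \<longlonglongrightarrow> (LBINT x. kap \<alpha> l x * mode g x t0)"
      by (simp add: o_def)
  qed
qed

text \<open>
  Integrated, the equation reads \<open>k * c = 1 * g\<close> with \<open>k\<close> the kernel
  \<open>caputo_kernel\<close> and \<open>*\<close> convolution. Convolution with the resolvent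
  kernel \<open>e\<close>, for which \<open>e * k = 1\<close>, gives \<open>1 * c = 1 * (e *
  g)\<close>; both \<open>c\<close> and \<open>e * g\<close> are continuous, hence equal, and by
  Fubini \<open>e * g\<close> is the superposition of the modes.

  Nothing is known about the growth of \<open>c\<close>, so the argument is carried out for the
  restrictions to a bounded interval \<open>(0, T)\<close>; causality ensures that they satisfy
  the same identities there.
\<close>

theorem volterra_solution:
  fixes c :: "real \<Rightarrow> real"
  assumes cc: "continuous_on {0<..} c" and ci: "\<And>t. 0 < t \<Longrightarrow> set_integrable lborel {0<..<t} c"
    and eq: "AE t in lborel. 0 < t \<longrightarrow>
       1 / Gamma (1 - \<alpha>) * (LBINT s:{0<..<t}. (t - s) powr (- \<alpha>) * c s) + l * (LBINT s:{0<..<t}. c s) = (LBINT s:{0<..<t}. g s)"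
    and t0: "t0 > 0"
  shows "c t0 = (LBINT x. kap \<alpha> l x * mode g x t0)"
proof -
  define T where "T = t0 + 1"
  have T: "T > 0" "t0 < T" using t0 by (auto simp: T_def)
  define cT where "cT = (\<lambda>t. indicator {0<..<T} t * c t)"
  define gT where "gT = (\<lambda>t. indicator {0<..<T} t * g t)"
  define one where "one = (indicator {0<..} :: real \<Rightarrow> real)"
  define k where "k = caputo_kernel \<alpha> l"
  define e where "e = resolvent_kernel \<alpha> l"
  have ind: "(\<lambda>t. indicator {0<..<T} t * f t) \<in> borel_measurable borel" if "continuous_on {0<..} f" for f :: "real \<Rightarrow> real"
  proof -
    have "continuous_on {0<..<T} f" by (rule continuous_on_subset[OF that]) auto
    from borel_measurable_continuous_on_indicator[OF _ this] show ?thesis by simp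
  qed
  have cT: "causal_exp cT" unfolding cT_def using ci T ind[OF cc] by (intro causal_exp_truncate) auto
  have gT: "causal_exp gT" unfolding gT_def using g_integrable[OF T(1)] ind[OF gc] by (intro causal_exp_truncate) auto
  have one: "causal_exp one" "\<And>z. z > 0 \<Longrightarrow> lap one z = 1 / z" unfolding one_def by (rule lap_one(1), rule lap_one(2))
  have k: "causal_exp k" "\<And>z. z > 0 \<Longrightarrow> lap k z = (z powr \<alpha> + l) / z" unfolding k_def by (rule caputo_kernel_lap(1), rule caputo_kernel_lap(2))
  have e: "causal_exp e" "\<And>z. z > 0 \<Longrightarrow> lap e z = 1 / (z powr \<alpha> + l)" unfolding e_def by (rule resolvent_kernel_lap(1), rule resolvent_kernel_lap(2))
  note ce = causal_exp_convolve
  have 1: "AE t in lborel. convolve e (convolve k cT) t = convolve one cT t"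
  proof (rule lap_inject)
    fix z :: real assume "z > 1"
    then have z: "z > 0" by simp
    have "z powr \<alpha> + l \<noteq> 0" using z l by (intro less_imp_neq[symmetric] add_pos_nonneg) auto
    then show "lap (convolve e (convolve k cT)) z = lap (convolve one cT) z"
      by (simp add: lap_convolve ce e k cT one z)
  qed (intro ce e k one cT)+
  have 2: "AE t in lborel. convolve e (convolve one gT) t = convolve one (convolve e gT) t"
    by (rule lap_inject) (simp_all add: lap_convolve ce e gT one)
  have one_conv: "convolve one f t = (LBINT s:{0<..<t}. f s)" if f: "\<And>s. s \<le> 0 \<Longrightarrow> f s = 0" for f t
  proof -
    have "one (t - s) * f s = indicator {0<..<t} s *\<^sub>R f s" for s
      using f[of s] by (auto simp: one_def indicator_def)
    then show ?thesis unfolding convolve_def set_lebesgue_integral_def by (simp only:)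
  qed
  have restr: "(LBINT s:{0<..<t}. indicator {0<..<T} s * f s) = (LBINT s:{0<..<t}. f s)" if "t \<le> T" for f :: "real \<Rightarrow> real" and t
    unfolding set_lebesgue_integral_def using that by (intro Bochner_Integration.integral_cong) (auto simp: indicator_def)
  have 3: "AE t in lborel. t < T \<longrightarrow> convolve k cT t = convolve one gT t"
    using AE_convolve_integrable[OF k(1) cT] eq
  proof eventually_elim
    case (elim t)
    show ?case
    proof (cases "t > 0")
      case False
      then have "convolve k cT t = 0" "convolve one gT t = 0"
        using ce[OF k(1) cT] ce[OF one(1) gT] unfolding causal_exp_def by auto
      then show ?thesis by simp
    next
      case True
      show ?thesis
      proof
        assume tT: "t < T"
        have Ic: "integrable lborel (\<lambda>s. l * (indicator {0<..<t} s * c s))"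
          using ci[OF True] unfolding set_integrable_def by simp
        have split: "k (t - s) * cT s = 1 / Gamma (1 - \<alpha>) * (indicator {0<..<t} s * ((t - s) powr (- \<alpha>) * c s)) + l * (indicator {0<..<t} s * c s)" for s
          using tT by (auto simp: k_def caputo_kernel_def cT_def indicator_def algebra_simps)
        have Ik: "integrable lborel (\<lambda>s. 1 / Gamma (1 - \<alpha>) * (indicator {0<..<t} s * ((t - s) powr (- \<alpha>) * c s)))"
          using Bochner_Integration.integrable_diff[OF elim(1) Ic] unfolding split by simp
        have "convolve k cT t = (LBINT s. 1 / Gamma (1 - \<alpha>) * (indicator {0<..<t} s * ((t - s) powr (- \<alpha>) * c s))) + (LBINT s. l * (indicator {0<..<t} s * c s))"
          unfolding convolve_def split by (rule Bochner_Integration.integral_add[OF Ik Ic])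
        also have "\<dots> = 1 / Gamma (1 - \<alpha>) * (LBINT s:{0<..<t}. (t - s) powr (- \<alpha>) * c s) + l * (LBINT s:{0<..<t}. c s)"
          by (simp only: integral_mult_right_zero set_lebesgue_integral_def real_scaleR_def)
        also have "\<dots> = (LBINT s:{0<..<t}. g s)" using elim(2) True by blast
        also have "\<dots> = convolve one gT t"
        proof -
          have "convolve one gT t = (LBINT s:{0<..<t}. gT s)" by (rule one_conv) (simp add: gT_def)
          also have "\<dots> = (LBINT s:{0<..<t}. g s)" unfolding gT_def by (rule restr) (use tT in simp)
          finally show ?thesis by simp
        qed
        finally show "convolve k cT t = convolve one gT t" .
      qed
    qed
  qed
  have 4: "convolve e (convolve k cT) t = convolve e (convolve one gT) t" if "t < T" for t
    unfolding convolve_def[of e]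
  proof (rule integral_cong_AE)
    have [measurable]: "e \<in> borel_measurable borel" "convolve k cT \<in> borel_measurable borel" "convolve one gT \<in> borel_measurable borel"
      using e(1) ce[OF k(1) cT] ce[OF one(1) gT] unfolding causal_exp_def by auto
    show "(\<lambda>s. e (t - s) * convolve k cT s) \<in> borel_measurable lborel"
         "(\<lambda>s. e (t - s) * convolve one gT s) \<in> borel_measurable lborel" by measurable
    show "AE s in lborel. e (t - s) * convolve k cT s = e (t - s) * convolve one gT s"
      using 3
    proof eventually_elim
      case (elim s)
      show ?case
      proof (cases "s < T")
        case False
        then have "e (t - s) = 0" using e(1) that unfolding causal_exp_def by simp
        then show ?thesis by simp
      qed (use elim in simp)
    qed
  qed
  define v where "v = (\<lambda>t. LBINT x. kap \<alpha> l x * mode g x t)"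
  have w: "convolve e gT t = v t" if "0 < t" "t \<le> T" for t
    unfolding e_def gT_def v_def by (rule convolve_resolvent_eq[OF that])
  have wc: "\<And>s. s \<le> 0 \<Longrightarrow> convolve e gT s = 0" using ce[OF e(1) gT] unfolding causal_exp_def by blast
  have wi: "set_integrable lborel {0<..<t} v" if "0 < t" "t < T" for t
  proof -
    have I1: "integrable lborel (\<lambda>s. exp (- 1 * s) * convolve e gT s)"
      using ce[OF e(1) gT] unfolding causal_exp_def by (metis zero_less_one)
    have vc: "continuous_on {0<..} v" unfolding v_def by (rule mode_superposition_continuous)
    show ?thesis unfolding set_integrable_def
    proof (rule Bochner_Integration.integrable_bound)
      show "integrable lborel (\<lambda>s. exp t * (exp (- 1 * s) * convolve e gT s))" using I1 by (rule integrable_mult_right)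
      show "(\<lambda>s. indicator {0<..<t} s *\<^sub>R v s) \<in> borel_measurable lborel"
      proof -
        have "continuous_on {0<..<t} v" by (rule continuous_on_subset[OF vc]) auto
        from borel_measurable_continuous_on_indicator[OF _ this] show ?thesis by simp
      qed
      show "AE s in lborel. norm (indicator {0<..<t} s *\<^sub>R v s) \<le> norm (exp t * (exp (- 1 * s) * convolve e gT s))"
      proof (intro AE_I2)
        fix s
        show "norm (indicator {0<..<t} s *\<^sub>R v s) \<le> norm (exp t * (exp (- 1 * s) * convolve e gT s))"
        proof (cases "s \<in> {0<..<t}")
          case True
          then have "exp t * exp (- 1 * s) \<ge> 1" by (simp add: exp_add[symmetric])
          then have "1 * \<bar>v s\<bar> \<le> (exp t * exp (- 1 * s)) * \<bar>v s\<bar>" by (intro mult_right_mono) auto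
          then show ?thesis using True w[of s] that by (simp add: abs_mult mult.assoc)
        qed simp
      qed
    qed
  qed
  have "c t0 - v t0 = 0"
  proof (rule continuous_eq_0_if_AE_integral_eq_0[where T = T and d = "\<lambda>t. c t - v t"])
    have "continuous_on {0<..} v" unfolding v_def by (rule mode_superposition_continuous)
    then show "continuous_on {0<..<T} (\<lambda>t. c t - v t)"
      using cc by (intro continuous_intros) (auto intro: continuous_on_subset)
    show "set_integrable lborel {0<..<t} (\<lambda>t. c t - v t)" if "0 < t" "t < T" for t
      by (rule set_integral_diff(1)[OF ci[OF that(1)] wi[OF that]])
    show "AE t in lborel. 0 < t \<and> t < T \<longrightarrow> (LBINT s:{0<..<t}. c s - v s) = 0"
      using 1 2
    proof eventually_elim
      case (elim t)
      show ?case
      proof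
        assume t: "0 < t \<and> t < T"
        have "(LBINT s:{0<..<t}. c s - v s) = (LBINT s:{0<..<t}. c s) - (LBINT s:{0<..<t}. v s)"
          using ci wi t by (intro set_integral_diff(2)) auto
        also have "(LBINT s:{0<..<t}. c s) = convolve one cT t"
          using restr[of t c] t one_conv[of cT t] by (simp add: cT_def)
        also have "(LBINT s:{0<..<t}. v s) = (LBINT s:{0<..<t}. convolve e gT s)"
          unfolding set_lebesgue_integral_def using w t
          by (intro Bochner_Integration.integral_cong) (auto simp: indicator_def)
        also have "\<dots> = convolve one (convolve e gT) t" using one_conv[OF wc] by simp
        finally show "(LBINT s:{0<..<t}. c s - v s) = 0" using elim 4[of t] t by simp
      qed
    qed
  qed (use t0 T in auto)
  then show ?thesis by (simp add: v_def)
qed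

end
end

section \<open>Backward Euler modes\<close>

lemma set_lborel_eq_integral_closed:
  fixes f :: "real \<Rightarrow> real"
  assumes "set_integrable lborel {0<..<t} f"
  shows "f integrable_on {0..t}" and "(LBINT s:{0<..<t}. f s) = integral {0..t} f"
  using set_borel_integral_eq_integral[OF assms]
  by (simp_all add: integrable_on_open_interval_real integral_open_interval_real)

text \<open>
  Near a positive time the integral is a constant plus an integral of a continuous function over a
  compact interval, so the singularity at 0 does no harm.
\<close>

lemma set_integral_has_derivative:
  fixes f :: "real \<Rightarrow> real"
  assumes c: "continuous_on {0<..} f" and i: "\<And>t. t > 0 \<Longrightarrow> set_integrable lborel {0<..<t} f" and t: "t > 0"
  shows "((\<lambda>t. LBINT s:{0<..<t}. f s) has_real_derivative f t) (at t)"
proof -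
  have "((\<lambda>u. integral {t/2..u} f) has_real_derivative f t) (at t within {t/2..2*t})"
    using t by (intro integral_has_real_derivative continuous_on_subset[OF c]) auto
  then have 1: "((\<lambda>u. integral {t/2..u} f) has_real_derivative f t) (at t)"
    using t by (simp add: at_within_Icc_at)
  have "((\<lambda>u. integral {0..t/2} f + integral {t/2..u} f) has_real_derivative f t) (at t)"
    using DERIV_add[OF DERIV_const 1] by simp
  then show ?thesis
  proof (rule has_field_derivative_transform_within_open[of _ _ _ "{t/2<..<2*t}"])
    fix u assume u: "u \<in> {t/2<..<2*t}"
    then have "u > 0" using t by auto
    have "integral {0..t/2} f + integral {t/2..u} f = integral {0..u} f"
      using u t set_lborel_eq_integral_closed(1)[OF i[OF \<open>u > 0\<close>]]
      by (intro Henstock_Kurzweil_Integration.integral_combine) auto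
    then show "integral {0..t/2} f + integral {t/2..u} f = (LBINT s:{0<..<u}. f s)"
      using set_lborel_eq_integral_closed(2)[OF i[OF \<open>u > 0\<close>]] by simp
  qed (use t in auto)
qed

lemma backward_difference_solution:
  fixes a q U F :: "nat \<Rightarrow> real"
  assumes inv: "\<And>n. (\<Sum>i\<le>n. a i * q (n - i)) = of_bool (n = 0)"
    and eq: "\<And>m. m \<le> N \<Longrightarrow> (\<Sum>i\<le>m. a i * U (m - i)) = F m"
    and n: "n \<le> N"
  shows "U n = (\<Sum>i\<le>n. q i * F (n - i))"
proof -
  define A Q W where "A = Abs_fps a" and "Q = Abs_fps q" and "W = Abs_fps U"
  have "A * Q = 1"
    by (rule fps_ext) (use inv in \<open>simp add: A_def Q_def fps_mult_nth fps_one_nth atLeast0AtMost\<close>)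
  then have W: "Q * (A * W) = W" by (simp add: mult.assoc[symmetric] mult.commute)
  have "U n = (Q * (A * W)) $ n" unfolding W by (simp add: W_def)
  also have "\<dots> = (\<Sum>i=0..n. q i * ((A * W) $ (n - i)))"
    unfolding fps_mult_nth[of Q] by (simp add: Q_def)
  also have "\<dots> = (\<Sum>i\<le>n. q i * F (n - i))"
    unfolding atLeast0AtMost
  proof (intro sum.cong refl)
    fix i assume "i \<in> {..n}"
    have "(A * W) $ (n - i) = (\<Sum>j\<le>n - i. a j * U (n - i - j))"
      by (simp add: A_def W_def fps_mult_nth atLeast0AtMost)
    also have "\<dots> = F (n - i)" using n by (intro eq) simp
    finally show "q i * (A * W) $ (n - i) = q i * F (n - i)" by simp
  qed
  finally show ?thesis .
qed

text \<open>
  Backward Euler for the equation of \<open>mode\<close>, where the integral of the source over a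
  step is \<open>F j - F (j - 1)\<close>.
\<close>

definition mode_step :: "real \<Rightarrow> (nat \<Rightarrow> real) \<Rightarrow> real \<Rightarrow> nat \<Rightarrow> real" where
  "mode_step \<tau> F x n = (\<Sum>i<n. (F (n - i) - F (n - Suc i)) / (1 + \<tau> * exp x) ^ Suc i)"

lemma mode_step_Suc: "mode_step \<tau> F x (Suc n) = (mode_step \<tau> F x n + (F (Suc n) - F n)) / (1 + \<tau> * exp x)"
  unfolding mode_step_def
  by (subst sum.lessThan_Suc_shift) (simp add: add_divide_distrib sum_divide_distrib mult.commute)

context
  fixes \<alpha> l \<tau> :: real assumes \<alpha>: "0 < \<alpha>" "\<alpha> < 1" and l: "l \<ge> 0" and \<tau>: "\<tau> > 0"
begin

text \<open>
  The convolution recurrence is inverted by \<open>glbe_density\<close>, whose entries are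
  integrals of powers of the backward Euler factor; differencing in time puts the increments of
  \<open>F\<close> in place of \<open>F\<close>.
\<close>

lemma mode_step_superposition:
  assumes F0: "F 0 = 0" and U0: "U 0 = 0"
    and \<sigma>: "\<And>\<xi>. \<bar>\<xi>\<bar> < 1 \<Longrightarrow> (\<lambda>j. \<sigma> j * \<xi> ^ j) sums ((1 - \<xi>) powr \<alpha>)"
    and eq: "\<And>m. m \<in> {1..N} \<Longrightarrow> \<tau> powr (- \<alpha>) * (\<Sum>j=0..m. \<sigma> j * U (m - j)) + l * U m = F m"
    and n: "n \<in> {1..N}"
  shows "integrable lborel (\<lambda>x. kap \<alpha> l x * mode_step \<tau> F x n)" (is ?I)
    and "(U n - U (n - 1)) / \<tau> = (LBINT x. kap \<alpha> l x * mode_step \<tau> F x n)" (is ?E)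
proof -
  define q where "q = glbe_density \<alpha> l \<tau>"
  define a where "a = (\<lambda>i. \<tau> powr (- \<alpha>) * \<sigma> i + l * of_bool (i = 0))"
  have "(\<Sum>i\<le>m. a i * U (m - i)) = F m" if "m \<le> N" for m
  proof (cases "m = 0")
    case False
    have "(\<Sum>i\<le>m. a i * U (m - i)) = \<tau> powr (- \<alpha>) * (\<Sum>j=0..m. \<sigma> j * U (m - j)) + (\<Sum>i\<le>m. if i = 0 then l * U (m - i) else 0)"
      unfolding a_def atLeast0AtMost sum_distrib_left sum.distrib[symmetric]
      by (intro sum.cong) (auto simp: algebra_simps)
    also have "(\<Sum>i\<le>m. if i = 0 then l * U (m - i) else 0) = l * U m" by simp
    finally show ?thesis using eq[of m] that False by simp
  qed (simp add: U0 F0)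
  then have U: "U m = (\<Sum>i\<le>m. q i * F (m - i))" if "m \<le> N" for m
    unfolding q_def using that glbe_density_inverse[OF \<alpha> l \<tau> \<sigma>] unfolding a_def
    by (intro backward_difference_solution[of "\<lambda>i. \<tau> powr (- \<alpha>) * \<sigma> i + l * of_bool (i = 0)" _ N]) auto
  obtain m where m: "n = Suc m" using n by (cases n) auto
  have "U n = (\<Sum>i\<le>m. q i * F (n - i))"
    using U[of n] n unfolding m by (simp add: F0)
  moreover have "U (n - 1) = (\<Sum>i\<le>m. q i * F (n - Suc i))"
    using U[of "n - 1"] n unfolding m by simp
  ultimately have D: "U n - U (n - 1) = (\<Sum>i<n. q i * (F (n - i) - F (n - Suc i)))"
    unfolding m lessThan_Suc_atMost by (simp add: sum_subtractf right_diff_distrib)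
  have eqk: "kap \<alpha> l x * mode_step \<tau> F x n = (\<Sum>i<n. (F (n - i) - F (n - Suc i)) / \<tau> * (kap \<alpha> l x * (\<tau> / (1 + \<tau> * exp x) ^ Suc i)))" for x
    unfolding mode_step_def sum_distrib_left using \<tau> by (intro sum.cong) auto
  show ?I unfolding eqk
    by (intro Bochner_Integration.integrable_sum integrable_mult_right glbe_density_integrable[OF \<alpha> l \<tau>])
  have "(LBINT x. kap \<alpha> l x * mode_step \<tau> F x n) = (\<Sum>i<n. (F (n - i) - F (n - Suc i)) / \<tau> * q i)"
    unfolding eqk q_def glbe_density_def
    by (subst Bochner_Integration.integral_sum, intro integrable_mult_right glbe_density_integrable[OF \<alpha> l \<tau>])
       (simp only: integral_mult_right_zero)
  also have "\<dots> = (U n - U (n - 1)) / \<tau>" unfolding D sum_divide_distrib by (intro sum.cong) auto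
  finally show ?E by simp
qed

end

context
  fixes g g' :: "real \<Rightarrow> real" and A \<mu> x :: real
  assumes \<mu>: "-1 < \<mu>" "\<mu> < 0"
    and gd: "\<And>s. s > 0 \<Longrightarrow> (g has_real_derivative g' s) (at s)"
    and gA: "\<And>s. s > 0 \<Longrightarrow> \<bar>g s\<bar> \<le> A * s powr \<mu>"
    and gA': "\<And>s. s > 0 \<Longrightarrow> \<bar>g' s\<bar> \<le> A * s powr (\<mu> - 1)"
begin

lemma source_continuous: "continuous_on {0<..} g"
  using gd by (intro continuous_at_imp_continuous_on) (auto intro: DERIV_isCont)

lemma A_nonneg: "A \<ge> 0" using gA[of 1] by simp

lemma source_integrable: "t > 0 \<Longrightarrow> set_integrable lborel {0<..<t} g"
  using g_integrable[of "1/2" 0 \<mu> g A t] \<mu> source_continuous gA by simp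

lemma exp_source_integrable: "t > 0 \<Longrightarrow> set_integrable lborel {0<..<t} (\<lambda>s. exp (exp x * s) * g s)"
proof -
  assume t: "t > 0"
  have "integrable lborel (\<lambda>s. indicator {0<..<t} s * (exp (- exp x * (t - s)) * g s))"
    using mode_integrable[of "1/2" 0 \<mu> g A t x] \<mu> source_continuous gA t by simp
  then have "integrable lborel (\<lambda>s. exp (exp x * t) * (indicator {0<..<t} s * (exp (- exp x * (t - s)) * g s)))"
    by (rule integrable_mult_right)
  moreover have "exp (exp x * t) * (indicator {0<..<t} s * (exp (- exp x * (t - s)) * g s)) = indicator {0<..<t} s *\<^sub>R (exp (exp x * s) * g s)" for s
  proof -
    have "exp (exp x * t) * exp (- exp x * (t - s)) = exp (exp x * s)" by (simp add: exp_add[symmetric] algebra_simps)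
    then show ?thesis by (simp add: mult_ac)
  qed
  ultimately show ?thesis unfolding set_integrable_def by (simp only:)
qed

lemma mode_eq: "mode g x t = exp (- exp x * t) * (LBINT s:{0<..<t}. exp (exp x * s) * g s)"
proof -
  have "indicator {0<..<t} s * (exp (- exp x * (t - s)) * g s) = exp (- exp x * t) * (indicator {0<..<t} s *\<^sub>R (exp (exp x * s) * g s))" for s
  proof -
    have "exp (- exp x * (t - s)) = exp (- exp x * t) * exp (exp x * s)" by (simp add: exp_add[symmetric] algebra_simps)
    then show ?thesis by (simp add: mult_ac)
  qed
  then show ?thesis unfolding mode_def set_lebesgue_integral_def by (simp only: integral_mult_right_zero)
qed

lemma mode_has_derivative:
  assumes t: "t > 0"
  shows "((\<lambda>t. mode g x t) has_real_derivative (g t - exp x * mode g x t)) (at t)"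
proof -
  have "continuous_on {0<..} (\<lambda>s. exp (exp x * s) * g s)"
    by (intro continuous_intros source_continuous)
  note d = set_integral_has_derivative[OF this exp_source_integrable t]
  have "((\<lambda>t. exp (- exp x * t)) has_real_derivative - exp x * exp (- exp x * t)) (at t)"
    by (auto intro!: derivative_eq_intros)
  from DERIV_mult[OF this d]
  have "(mode g x has_real_derivative
      (- exp x * exp (- exp x * t)) * (LBINT s:{0<..<t}. exp (exp x * s) * g s) + exp (exp x * t) * g t * exp (- exp x * t)) (at t)"
    by (simp only: mode_eq[abs_def])
  moreover have "(- exp x * exp (- exp x * t)) * (LBINT s:{0<..<t}. exp (exp x * s) * g s) + exp (exp x * t) * g t * exp (- exp x * t)
     = g t - exp x * mode g x t"
    unfolding mode_eq by (simp add: exp_minus)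
  ultimately show ?thesis by (simp only:)
qed

lemma mode_continuous_closed: "continuous_on {0..t} (mode g x)"
proof (cases "t > 0")
  case True
  let ?h = "\<lambda>s. exp (exp x * s) * g s"
  have "continuous_on {0..t} (\<lambda>u. exp (- exp x * u) * integral {0..u} ?h)"
    using set_lborel_eq_integral_closed(1)[OF exp_source_integrable[OF True]]
    by (intro continuous_intros indefinite_integral_continuous_1)
  moreover have "exp (- exp x * u) * integral {0..u} ?h = mode g x u" if "u \<in> {0..t}" for u
    unfolding mode_eq using set_lborel_eq_integral_closed(2)[OF exp_source_integrable, of u] that
    by (cases "u = 0") (auto simp: set_lebesgue_integral_def)
  ultimately show ?thesis by (rule continuous_on_eq)
next
  case False
  then have "{0..t} \<subseteq> {0}" by auto
  then show ?thesis using continuous_on_subset continuous_on_sing by blast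
qed

lemma mode_abs_le_power:
  assumes t: "t > 0"
  shows "\<bar>mode g x t\<bar> \<le> A / (\<mu> + 1) * t powr (\<mu> + 1)"
proof -
  have I: "integrable lborel (\<lambda>s. A * (indicator {0<..<t} s * s powr \<mu>))"
    using integral_powr_from_0[OF \<mu>(1) t] by (intro integrable_mult_right) (simp add: has_bochner_integral_iff)
  have "\<bar>mode g x t\<bar> \<le> (LBINT s. \<bar>indicator {0<..<t} s * (exp (- exp x * (t - s)) * g s)\<bar>)"
    unfolding mode_def by (rule integral_abs_bound)
  also have "\<dots> \<le> (LBINT s. A * (indicator {0<..<t} s * s powr \<mu>))"
  proof (rule integral_mono[OF _ I])
    show "integrable lborel (\<lambda>s. \<bar>indicator {0<..<t} s * (exp (- exp x * (t - s)) * g s)\<bar>)"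
      using mode_integrable[of "1/2" 0 \<mu> g A t x] \<mu> source_continuous gA t by simp
    show "\<bar>indicator {0<..<t} s * (exp (- exp x * (t - s)) * g s)\<bar> \<le> A * (indicator {0<..<t} s * s powr \<mu>)" for s
    proof (cases "s \<in> {0<..<t}")
      case True
      then have "exp (- exp x * (t - s)) * \<bar>g s\<bar> \<le> 1 * (A * s powr \<mu>)"
        using gA[of s] by (intro mult_mono) (auto intro: mult_nonneg_nonneg)
      then show ?thesis using True by (simp add: abs_mult)
    qed simp
  qed
  also have "\<dots> = A / (\<mu> + 1) * t powr (\<mu> + 1)"
    using integral_powr_from_0[OF \<mu>(1) t] by (simp add: has_bochner_integral_iff)
  finally show ?thesis .
qed

text \<open>
  The differential equation integrated over a time step; this is the form to which backward Euler
  is compared.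
\<close>

lemma mode_cell:
  assumes ab: "0 \<le> a" "a < b"
  shows "mode g x b - mode g x a = integral {a..b} g - exp x * integral {a..b} (mode g x)"
    and "mode g x integrable_on {a..b}" and "g integrable_on {a..b}"
proof -
  have b: "b > 0" using ab by simp
  have gi: "g integrable_on {0..b}" by (rule set_lborel_eq_integral_closed(1)[OF source_integrable[OF b]])
  show gi': "g integrable_on {a..b}" by (rule integrable_subinterval_real[OF gi]) (use ab in auto)
  have mc: "continuous_on {a..b} (mode g x)"
    by (rule continuous_on_subset[OF mode_continuous_closed[of b]]) (use ab in auto)
  then show mi: "mode g x integrable_on {a..b}" by (rule integrable_continuous_real)
  have "((\<lambda>t. g t - exp x * mode g x t) has_integral (mode g x b - mode g x a)) {a..b}"
  proof (rule fundamental_theorem_of_calculus_interior)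
    show "((mode g x) has_vector_derivative g t - exp x * mode g x t) (at t)" if "t \<in> {a<..<b}" for t
      using mode_has_derivative[of t] that ab by (simp add: has_real_derivative_iff_has_vector_derivative)
  qed (use ab mc in auto)
  moreover have "((\<lambda>t. g t - exp x * mode g x t) has_integral (integral {a..b} g - exp x * integral {a..b} (mode g x))) {a..b}"
    using gi' mi by (intro has_integral_diff has_integral_mult_right integrable_integral)
  ultimately show "mode g x b - mode g x a = integral {a..b} g - exp x * integral {a..b} (mode g x)"
    by (rule has_integral_unique)
qed

text \<open>
  The derivative \<open>w = g - exp x * v\<close> of the mode solves \<open>w' + exp x * w =
  g'\<close>. Started at \<open>t / 2\<close>, where it is bounded by the sizes of
  \<open>g\<close> and \<open>v\<close>, it is damped by \<open>exp (- exp x * t / 2)\<close>, and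
  the source \<open>g'\<close> on \<open>(t / 2, t)\<close> contributes at most its size divided
  by \<open>exp x\<close>. Both contributions decay like \<open>1 / (1 + exp x * t)\<close>.
\<close>

lemma mode_derivative_le:
  assumes t: "t > 0"
  shows "\<bar>g t - exp x * mode g x t\<bar> \<le> 8 * (1 / (\<mu> + 1) + 1) * A * t powr \<mu> / (1 + exp x * t)"
proof -
  define r where "r = exp x"
  have r: "r > 0" by (simp add: r_def)
  define h where "h = t / 2"
  have h: "h > 0" "t = 2 * h" using t by (auto simp: h_def)
  define w where "w = (\<lambda>s. g s - r * mode g x s)"
  \<comment> \<open>The integrating factor; \<open>M\<close> is a primitive of the bound of its
  derivative, so that the bound needs monotonicity only.\<close>
  define \<psi> where "\<psi> = (\<lambda>s. exp (- r * (t - s)) * w s)"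
  define M where "M = (\<lambda>s. A * h powr (\<mu> - 1) * exp (- r * (t - s)) / r)"
  have dw: "(w has_real_derivative (g' s - r * w s)) (at s)" if "s > 0" for s
    unfolding w_def r_def using gd[OF that] mode_has_derivative[OF that] by (auto intro!: derivative_eq_intros)
  have d\<psi>: "(\<psi> has_real_derivative exp (- r * (t - s)) * g' s) (at s)" if "s > 0" for s
    unfolding \<psi>_def using dw[OF that] by (auto intro!: derivative_eq_intros simp: algebra_simps)
  have dM: "(M has_real_derivative A * h powr (\<mu> - 1) * exp (- r * (t - s))) (at s)" for s
    unfolding M_def using r by (auto intro!: derivative_eq_intros)
  have le: "\<bar>exp (- r * (t - s)) * g' s\<bar> \<le> A * h powr (\<mu> - 1) * exp (- r * (t - s))" if "h \<le> s" for s
  proof -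
    have "\<bar>g' s\<bar> \<le> A * s powr (\<mu> - 1)" using gA'[of s] that h by simp
    also have "\<dots> \<le> A * h powr (\<mu> - 1)" using that h \<mu> A_nonneg by (intro mult_left_mono powr_mono2') auto
    finally show ?thesis by (simp add: abs_mult mult.commute)
  qed
  have "M h - \<psi> h \<le> M t - \<psi> t"
  proof (rule DERIV_nonneg_imp_nondecreasing[of h t "\<lambda>s. M s - \<psi> s"])
    fix s assume s: "h \<le> s" "s \<le> t"
    then have "((\<lambda>s. M s - \<psi> s) has_real_derivative (A * h powr (\<mu> - 1) * exp (- r * (t - s)) - exp (- r * (t - s)) * g' s)) (at s)"
      using h by (intro DERIV_diff dM d\<psi>) auto
    moreover have "0 \<le> A * h powr (\<mu> - 1) * exp (- r * (t - s)) - exp (- r * (t - s)) * g' s"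
      using le[OF s(1)] by linarith
    ultimately show "\<exists>y. ((\<lambda>s. M s - \<psi> s) has_real_derivative y) (at s) \<and> 0 \<le> y" by blast
  qed (use h in simp)
  moreover have "M h + \<psi> h \<le> M t + \<psi> t"
  proof (rule DERIV_nonneg_imp_nondecreasing[of h t "\<lambda>s. M s + \<psi> s"])
    fix s assume s: "h \<le> s" "s \<le> t"
    then have "((\<lambda>s. M s + \<psi> s) has_real_derivative (A * h powr (\<mu> - 1) * exp (- r * (t - s)) + exp (- r * (t - s)) * g' s)) (at s)"
      using h by (intro DERIV_add dM d\<psi>) auto
    moreover have "0 \<le> A * h powr (\<mu> - 1) * exp (- r * (t - s)) + exp (- r * (t - s)) * g' s"
      using le[OF s(1)] by linarith
    ultimately show "\<exists>y. ((\<lambda>s. M s + \<psi> s) has_real_derivative y) (at s) \<and> 0 \<le> y" by blast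
  qed (use h in simp)
  ultimately have "\<bar>\<psi> t\<bar> \<le> \<bar>\<psi> h\<bar> + (M t - M h)" by linarith
  moreover have "t - h = h" using h by simp
  then have "M t - M h = A * h powr (\<mu> - 1) * (1 - exp (- r * h)) / r" "\<bar>\<psi> h\<bar> = exp (- r * h) * \<bar>w h\<bar>"
    by (simp_all add: \<psi>_def M_def abs_mult diff_divide_distrib right_diff_distrib)
  moreover have "\<psi> t = w t" by (simp add: \<psi>_def)
  ultimately have 1: "\<bar>w t\<bar> \<le> exp (- r * h) * \<bar>w h\<bar> + A * h powr (\<mu> - 1) * (1 - exp (- r * h)) / r"
    by simp
  define z where "z = r * h"
  have z: "z > 0" using r h by (simp add: z_def)
  have "\<bar>w h\<bar> \<le> A * h powr \<mu> + r * (A / (\<mu> + 1) * h powr (\<mu> + 1))"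
  proof -
    have "\<bar>w h\<bar> \<le> \<bar>g h\<bar> + r * \<bar>mode g x h\<bar>"
      unfolding w_def using r by (metis abs_mult abs_of_pos abs_triangle_ineq4)
    also have "\<dots> \<le> A * h powr \<mu> + r * (A / (\<mu> + 1) * h powr (\<mu> + 1))"
      using gA[OF h(1)] mode_abs_le_power[OF h(1)] r by (intro add_mono mult_left_mono) auto
    finally show ?thesis .
  qed
  also have "\<dots> = A * h powr \<mu> * (1 + z / (\<mu> + 1))"
    using h by (simp add: z_def powr_add algebra_simps)
  also have "\<dots> \<le> A * h powr \<mu> * ((1 + z) * (1 / (\<mu> + 1)))"
  proof (intro mult_left_mono)
    have "1 \<le> 1 / (\<mu> + 1)" using \<mu> by simp
    moreover have "(1 + z) * (1 / (\<mu> + 1)) = 1 / (\<mu> + 1) + z / (\<mu> + 1)" by (simp add: add_divide_distrib)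
    ultimately show "1 + z / (\<mu> + 1) \<le> (1 + z) * (1 / (\<mu> + 1))" by linarith
  qed (use A_nonneg in auto)
  finally have wh: "\<bar>w h\<bar> \<le> A * h powr \<mu> * ((1 + z) * (1 / (\<mu> + 1)))" .
  have ez: "exp (- z) * (1 + z) \<le> 2 / (1 + z)"
  proof -
    have "1 + z + z\<^sup>2 / 2 \<le> exp z" using exp_lower_Taylor_quadratic[of z] z by simp
    then have "(1 + z) * (1 + z) \<le> 2 * exp z" using z by (simp add: power2_eq_square algebra_simps)
    then show ?thesis using z by (simp add: exp_minus field_simps)
  qed
  have e1: "(1 - exp (- z)) / z \<le> 2 / (1 + z)"
  proof (cases "z \<le> 1")
    case True
    have "1 - exp (- z) \<le> z" using exp_ge_add_one_self[of "- z"] by linarith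
    then have "(1 - exp (- z)) / z \<le> 1" using z by (simp add: field_simps)
    also have "1 \<le> 2 / (1 + z)" using True z by (simp add: field_simps)
    finally show ?thesis .
  next
    case False
    have "(1 - exp (- z)) / z \<le> 1 / z" using z by (intro divide_right_mono) auto
    also have "1 / z \<le> 2 / (1 + z)" using False by (simp add: field_simps)
    finally show ?thesis .
  qed
  have "exp (- r * h) * \<bar>w h\<bar> \<le> exp (- z) * (A * h powr \<mu> * ((1 + z) * (1 / (\<mu> + 1))))"
  proof -
    have "exp (- r * h) = exp (- z)" by (simp add: z_def)
    then show ?thesis using mult_left_mono[OF wh, of "exp (- z)"] by (simp only: exp_ge_zero)
  qed
  also have "\<dots> = A * h powr \<mu> * (1 / (\<mu> + 1)) * (exp (- z) * (1 + z))" by simp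
  also have "\<dots> \<le> A * h powr \<mu> * (1 / (\<mu> + 1)) * (2 / (1 + z))"
    using ez A_nonneg \<mu> by (intro mult_left_mono mult_nonneg_nonneg) auto
  finally have T1: "exp (- r * h) * \<bar>w h\<bar> \<le> A * h powr \<mu> * (1 / (\<mu> + 1)) * (2 / (1 + z))" .
  have "A * h powr (\<mu> - 1) * (1 - exp (- r * h)) / r = A * h powr \<mu> * ((1 - exp (- z)) / z)"
    using h r by (simp add: z_def powr_diff)
  also have "\<dots> \<le> A * h powr \<mu> * (2 / (1 + z))"
    using e1 A_nonneg by (intro mult_left_mono) auto
  finally have T2: "A * h powr (\<mu> - 1) * (1 - exp (- r * h)) / r \<le> A * h powr \<mu> * (2 / (1 + z))" .
  have "\<bar>w t\<bar> \<le> A * h powr \<mu> * (1 / (\<mu> + 1) + 1) * (2 / (1 + z))"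
    using 1 T1 T2 by (simp add: algebra_simps)
  also have "\<dots> \<le> A * (2 * t powr \<mu>) * (1 / (\<mu> + 1) + 1) * (4 / (1 + r * t))"
  proof -
    have "h powr \<mu> = t powr \<mu> * 2 powr (- \<mu>)" using t by (simp add: h_def powr_divide powr_minus field_simps)
    also have "\<dots> \<le> t powr \<mu> * 2 powr 1" using \<mu> by (intro mult_left_mono powr_mono) auto
    finally have hp: "h powr \<mu> \<le> 2 * t powr \<mu>" by simp
    have "2 / (1 + z) = 4 / (2 * (1 + z))" using z by (simp add: divide_eq_eq)
    also have "\<dots> \<le> 4 / (1 + 2 * z)" using z by (intro divide_left_mono mult_pos_pos) auto
    also have "2 * z = r * t" by (simp add: z_def h)
    finally have zp: "2 / (1 + z) \<le> 4 / (1 + r * t)" .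
    show ?thesis
      using A_nonneg \<mu> z r t by (intro mult_mono mult_left_mono hp zp mult_nonneg_nonneg add_nonneg_nonneg) auto
  qed
  finally have "\<bar>w t\<bar> \<le> A * (2 * t powr \<mu>) * (1 / (\<mu> + 1) + 1) * (4 / (1 + r * t))" .
  moreover have "a * (2 * b) * m * (4 / d) = 8 * m * a * b / d" for a b m d :: real by simp
  ultimately show ?thesis unfolding w_def r_def by (simp only:)
qed

text \<open>
  The error of backward Euler for one mode, uniformly in the stiffness \<open>r = exp x\<close>.
  The local error \<open>\<rho> j\<close> is \<open>r\<close> times the difference between the
  integral of the mode over the step and its right-endpoint rule, hence at most \<open>r
  \<tau>^2\<close> times the derivative of the mode. It reaches the time \<open>t n\<close> damped
  by the power \<open>n + 1 - j\<close> of \<open>1 / (1 + \<tau> r)\<close>.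

  Steps in the first half are damped by a multiple of \<open>1 / (1 + r t n)^2\<close>, which
  leaves a sum over \<open>t j powr \<mu>\<close>. In the second half \<open>t j\<close> is
  comparable with \<open>t n\<close> and the damping factors form a geometric series. The first
  step, where the derivative is not bounded, is estimated by the size of the mode itself.

  The exponent \<open>\<gamma>\<close> enters through the case \<open>n = 1\<close>, where the
  mode and its approximation are bounded separately.
\<close>

lemma mode_error:
  fixes \<gamma> \<tau> :: real and n :: nat and F :: "nat \<Rightarrow> real"
  assumes \<gamma>: "0 \<le> \<gamma>" "\<gamma> < 1" and \<tau>: "\<tau> > 0" and n: "n \<ge> 1"
    and F: "\<And>j. F j = (LBINT s:{0<..<real j * \<tau>}. g s)"
  shows "\<bar>mode g x (real n * \<tau>) - mode_step \<tau> F x n\<bar> \<le>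
     (1152 * (1 / (\<mu> + 1) + 1) * (1 / (\<mu> + 1)) + 128 * (1 / (\<mu> + 1) + 1) + 2 * (1 / (\<mu> + 1) + 1 / (1 - \<gamma>)) + 1 / (\<mu> + 1)) * A
       * (\<tau> * (real n * \<tau>) powr \<mu> * (1 + exp x * (real n * \<tau>)) powr (- \<gamma>))"
proof -
  define r where "r = exp x"
  have r: "r > 0" by (simp add: r_def)
  define t where "t = (\<lambda>j::nat. real j * \<tau>)"
  define v where "v = mode g x"
  define y where "y = r * t n"
  define M where "M = 1 / (\<mu> + 1)"
  have M: "M \<ge> 1" unfolding M_def using \<mu> by simp
  note A0 = A_nonneg
  define B where "B = A * (\<tau> * t n powr \<mu> * (1 + y) powr (- \<gamma>))"
  have B0: "B \<ge> 0" unfolding B_def using A0 \<tau> by simp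
  have tn: "t n > 0" unfolding t_def using n \<tau> by simp
  have y: "y > 0" unfolding y_def using r tn by simp
  have F1: "\<bar>F 1\<bar> \<le> A * M * \<tau> powr (\<mu> + 1)"
  proof -
    have I: "integrable lborel (\<lambda>s. A * (indicator {0<..<\<tau>} s * s powr \<mu>))"
      using integral_powr_from_0[OF \<mu>(1) \<tau>] by (intro integrable_mult_right) (simp add: has_bochner_integral_iff)
    have "\<bar>F 1\<bar> \<le> (LBINT s. \<bar>indicator {0<..<\<tau>} s *\<^sub>R g s\<bar>)"
      unfolding F set_lebesgue_integral_def using integral_abs_bound[of lborel "\<lambda>s. indicator {0<..<\<tau>} s *\<^sub>R g s"] by simp
    also have "\<dots> \<le> (LBINT s. A * (indicator {0<..<\<tau>} s * s powr \<mu>))"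
      using source_integrable[OF \<tau>] gA unfolding set_integrable_def
      by (intro integral_mono I) (auto simp: indicator_def)
    also have "\<dots> = A * M * \<tau> powr (\<mu> + 1)"
      using integral_powr_from_0[OF \<mu>(1) \<tau>] by (simp add: has_bochner_integral_iff M_def)
    finally show ?thesis .
  qed
  show ?thesis
  proof (cases "n = 1")
    case True
    have "\<bar>v \<tau>\<bar> \<le> (LBINT s. \<bar>indicator {0<..<\<tau>} s * (exp (- exp x * (\<tau> - s)) * g s)\<bar>)"
      unfolding v_def mode_def by (rule integral_abs_bound)
    also have "\<dots> \<le> A * (2 * (1 / (\<mu> + 1) + 1 / (1 - \<gamma>)) * \<tau> powr (\<mu> + 1)) * (1 + r * \<tau>) powr (- \<gamma>)"
      using exp_convolution_bound(2)[OF \<tau>, of r \<gamma> \<mu> g A] \<gamma> \<mu> source_continuous gA r by (simp add: r_def)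
    also have "\<dots> = 2 * (1 / (\<mu> + 1) + 1 / (1 - \<gamma>)) * B"
      using True \<tau> by (simp add: B_def y_def t_def powr_add mult_ac)
    finally have 1: "\<bar>v \<tau>\<bar> \<le> 2 * (1 / (\<mu> + 1) + 1 / (1 - \<gamma>)) * B" .
    have "mode_step \<tau> F x 1 = F 1 / (1 + \<tau> * exp x)" by (simp add: mode_step_def F set_lebesgue_integral_def)
    then have "\<bar>mode_step \<tau> F x 1\<bar> = \<bar>F 1\<bar> / (1 + y)"
      using True \<tau> by (simp add: y_def t_def r_def mult.commute abs_divide add_pos_pos)
    also have "\<dots> = \<bar>F 1\<bar> * (1 + y) powr (- 1)" using y by (simp add: powr_minus divide_inverse)
    also have "\<dots> \<le> (A * M * \<tau> powr (\<mu> + 1)) * (1 + y) powr (- \<gamma>)"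
      using F1 y \<gamma> A0 M by (intro mult_mono powr_mono mult_nonneg_nonneg) auto
    also have "\<dots> = M * B" using True \<tau> by (simp add: B_def t_def powr_add mult_ac)
    finally have 2: "\<bar>mode_step \<tau> F x 1\<bar> \<le> M * B" .
    have 3: "0 \<le> 1152 * (M + 1) * M + 128 * (M + 1)" using M by simp
    have "\<bar>v (t n) - mode_step \<tau> F x n\<bar> \<le> 2 * (1 / (\<mu> + 1) + 1 / (1 - \<gamma>)) * B + M * B"
      using 1 2 True by (simp add: t_def)
    also have "\<dots> \<le> (1152 * (M + 1) * M + 128 * (M + 1)) * B + (2 * (1 / (\<mu> + 1) + 1 / (1 - \<gamma>)) * B + M * B)"
      using mult_nonneg_nonneg[OF 3 B0] by linarith
    also have "\<dots> = (1152 * (M + 1) * M + 128 * (M + 1) + 2 * (1 / (\<mu> + 1) + 1 / (1 - \<gamma>)) + M) * B"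
      by (simp only: distrib_right add.assoc)
    finally show ?thesis unfolding B_def y_def r_def t_def v_def M_def by (simp only: mult.assoc)
  next
    case False
    then have n2: "n \<ge> 2" using n by simp
    define p where "p = 1 + \<tau> * r"
    have p: "p > 1" unfolding p_def using \<tau> r by simp
    define e where "e = (\<lambda>j. v (t j) - mode_step \<tau> F x j)"
    define \<rho> where "\<rho> = (\<lambda>j. r * (\<tau> * v (t j) - integral {t (j - 1)..t j} v))"
    have v0: "v 0 = 0" by (simp add: v_def mode_def)
    have e0: "e 0 = 0" by (simp add: e_def t_def mode_step_def v0)
    have Fd: "F (Suc j) - F j = integral {t j..t (Suc j)} g" for j
    proof -
      have Fi: "F i = integral {0..t i} g" for i
      proof (cases "i = 0")
        case False
        then have "t i > 0" using \<tau> by (simp add: t_def)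
        then show ?thesis using set_lborel_eq_integral_closed(2)[OF source_integrable] by (simp add: F t_def)
      qed (simp add: F t_def set_lebesgue_integral_def)
      have tp: "t (Suc j) > 0" using \<tau> by (simp add: t_def)
      have "integral {0..t j} g + integral {t j..t (Suc j)} g = integral {0..t (Suc j)} g"
        by (rule Henstock_Kurzweil_Integration.integral_combine)
           (use set_lborel_eq_integral_closed(1)[OF source_integrable[OF tp]] \<tau> in \<open>auto simp: t_def mult_right_mono\<close>)
      then show ?thesis by (simp add: Fi)
    qed
    have tS: "0 \<le> t j" "t j < t (Suc j)" "t (Suc j) - t j = \<tau>" for j
      using \<tau> by (auto simp: t_def algebra_simps)
    have rec: "e (Suc j) = (e j + \<rho> (Suc j)) / p" for j
    proof -
      have "v (t (Suc j)) - v (t j) = (F (Suc j) - F j) - r * integral {t j..t (Suc j)} v"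
        using mode_cell(1)[OF tS(1,2)[of j]] unfolding Fd v_def r_def .
      then have "e j + \<rho> (Suc j) = p * v (t (Suc j)) - (mode_step \<tau> F x j + (F (Suc j) - F j))"
        unfolding e_def \<rho>_def p_def by (simp add: algebra_simps)
      then have "(e j + \<rho> (Suc j)) / p = v (t (Suc j)) - (mode_step \<tau> F x j + (F (Suc j) - F j)) / p"
        using p by (simp add: diff_divide_distrib)
      moreover have "mode_step \<tau> F x (Suc j) = (mode_step \<tau> F x j + (F (Suc j) - F j)) / p"
        by (simp add: mode_step_Suc p_def r_def)
      moreover have "e (Suc j) = v (t (Suc j)) - mode_step \<tau> F x (Suc j)" by (simp add: e_def)
      ultimately show ?thesis by (simp only:)
    qed
    have esum: "\<bar>e m\<bar> \<le> (\<Sum>j=1..m. \<bar>\<rho> j\<bar> / p ^ (m + 1 - j))" for m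
    proof (induction m)
      case (Suc m)
      have "\<bar>e (Suc m)\<bar> \<le> (\<bar>e m\<bar> + \<bar>\<rho> (Suc m)\<bar>) / p"
        unfolding rec using p by (simp add: abs_divide divide_right_mono)
      also have "\<dots> \<le> ((\<Sum>j=1..m. \<bar>\<rho> j\<bar> / p ^ (m + 1 - j)) + \<bar>\<rho> (Suc m)\<bar>) / p"
        using Suc p by (intro divide_right_mono add_mono) auto
      also have "\<dots> = (\<Sum>j=1..m. \<bar>\<rho> j\<bar> / p ^ (Suc m + 1 - j)) + \<bar>\<rho> (Suc m)\<bar> / p ^ (Suc m + 1 - Suc m)"
        unfolding add_divide_distrib sum_divide_distrib
        by (intro arg_cong2[of _ _ _ _ "(+)"] sum.cong) (auto simp: Suc_diff_le mult.commute)
      also have "\<dots> = (\<Sum>j=1..Suc m. \<bar>\<rho> j\<bar> / p ^ (Suc m + 1 - j))" by simp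
      finally show ?case .
    qed (simp add: e0)
    have \<rho>_le: "\<bar>\<rho> (Suc j)\<bar> \<le> r * (\<tau> * D)" if D: "\<And>s. s \<in> {t j..t (Suc j)} \<Longrightarrow> \<bar>v (t (Suc j)) - v s\<bar> \<le> D" for j D
    proof -
      have vc: "continuous_on {t j..t (Suc j)} v"
        unfolding v_def by (rule continuous_on_subset[OF mode_continuous_closed[of "t (Suc j)"]]) (use tS in auto)
      have "integral {t j..t (Suc j)} (\<lambda>s. v (t (Suc j)) - v s) = \<tau> * v (t (Suc j)) - integral {t j..t (Suc j)} v"
        using integrable_continuous_real[OF vc] tS[of j]
        by (subst Henstock_Kurzweil_Integration.integral_diff) auto
      moreover have "norm (integral {t j..t (Suc j)} (\<lambda>s. v (t (Suc j)) - v s)) \<le> D * (t (Suc j) - t j)"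
        using tS[of j] D by (intro integral_bound continuous_intros vc) auto
      ultimately have "\<bar>\<tau> * v (t (Suc j)) - integral {t j..t (Suc j)} v\<bar> \<le> \<tau> * D"
        using tS(3)[of j] by (simp add: mult.commute)
      then show ?thesis unfolding \<rho>_def abs_mult using r by simp
    qed
    define P where "P = 32 * (M + 1) * A"
    have P0: "P \<ge> 0" unfolding P_def using M A0 by simp
    have \<rho>2: "\<bar>\<rho> j\<bar> \<le> P * (r * \<tau> * (\<tau> * t j powr \<mu>)) / (1 + r * t j)" if j: "j \<ge> 2" for j
    proof -
      obtain i where i: "j = Suc i" "i \<ge> 1" using j by (cases j) auto
      have ti: "t i > 0" using i \<tau> by (simp add: t_def)
      have half: "t (Suc i) \<le> 2 * t i" using i \<tau> by (simp add: t_def)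
      define D where "D = 8 * (M + 1) * A * t i powr \<mu> / (1 + r * t i)"
      have "\<bar>v (t (Suc i)) - v s\<bar> \<le> \<tau> * D" if s: "s \<in> {t i..t (Suc i)}" for s
      proof (cases "s = t (Suc i)")
        case True
        then show ?thesis unfolding D_def using \<tau> M A0 r ti by simp
      next
        case False
        then have s': "s < t (Suc i)" using s by simp
        have "\<exists>z. s < z \<and> z < t (Suc i) \<and> v (t (Suc i)) - v s = (t (Suc i) - s) * (g z - r * v z)"
          unfolding v_def r_def using s ti by (intro MVT2[OF s'[unfolded v_def]] mode_has_derivative) auto
        then obtain z where z: "s < z" "z < t (Suc i)" "v (t (Suc i)) - v s = (t (Suc i) - s) * (g z - r * v z)" by blast
        have zi: "z > t i" "z > 0" using z s ti by auto
        have "\<bar>g z - r * v z\<bar> \<le> 8 * (M + 1) * A * z powr \<mu> / (1 + r * z)"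
          using mode_derivative_le[OF zi(2)] by (simp add: r_def v_def M_def)
        also have "\<dots> \<le> D" unfolding D_def
          using zi ti r \<mu> M A0 by (intro frac_le mult_left_mono powr_mono2') (auto intro!: add_pos_pos mult_nonneg_nonneg)
        finally have "\<bar>v (t (Suc i)) - v s\<bar> \<le> (t (Suc i) - s) * D"
          unfolding z(3) abs_mult using s' by simp
        also have "\<dots> \<le> \<tau> * D"
          using s tS(3)[of i] M A0 r ti by (intro mult_right_mono) (auto simp: D_def)
        finally show ?thesis .
      qed
      from \<rho>_le[OF this] have "\<bar>\<rho> j\<bar> \<le> r * (\<tau> * (\<tau> * D))" unfolding i .
      also have "D \<le> 8 * (M + 1) * A * (2 * t j powr \<mu>) * (2 / (1 + r * t j))"
      proof -
        have "t i powr \<mu> \<le> (t j / 2) powr \<mu>" using half ti \<mu> tS[of i] unfolding i by (intro powr_mono2') auto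
        also have "\<dots> = t j powr \<mu> * 2 powr (- \<mu>)" using i \<tau> by (simp add: t_def powr_divide powr_minus field_simps)
        also have "\<dots> \<le> t j powr \<mu> * 2 powr 1" using \<mu> by (intro mult_left_mono powr_mono) auto
        finally have a: "t i powr \<mu> \<le> 2 * t j powr \<mu>" by simp
        have "r * t j \<le> r * (2 * t i)" unfolding i using half r by (intro mult_left_mono) auto
        then have "1 + r * t j \<le> 2 * (1 + r * t i)" by simp
        moreover have "0 < 1 + r * t i" "0 < 1 + r * t j" using r ti tS[of i] i by (auto intro!: add_pos_nonneg)
        ultimately have b: "1 / (1 + r * t i) \<le> 2 / (1 + r * t j)" by (simp add: field_simps)
        have "D = 8 * (M + 1) * A * t i powr \<mu> * (1 / (1 + r * t i))" by (simp add: D_def)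
        also have "\<dots> \<le> 8 * (M + 1) * A * (2 * t j powr \<mu>) * (2 / (1 + r * t j))"
          using a b M A0 r ti by (intro mult_mono mult_left_mono) auto
        finally show ?thesis .
      qed
      finally have "\<bar>\<rho> j\<bar> \<le> r * (\<tau> * (\<tau> * (8 * (M + 1) * A * (2 * t j powr \<mu>) * (2 / (1 + r * t j)))))"
        using r \<tau> by (simp add: mult_left_mono)
      moreover have "r * (\<tau> * (\<tau> * (8 * m * A * (2 * b) * (2 / d)))) = 32 * m * A * (r * \<tau> * (\<tau> * b)) / d" for m b d :: real
        by simp
      ultimately show ?thesis unfolding P_def by (simp only:)
    qed
    have \<rho>1: "\<bar>\<rho> j\<bar> \<le> P * (r * \<tau> * (\<tau> * t j powr \<mu>))" if j: "j \<ge> 1" for j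
    proof (cases "j = 1")
      case True
      have b: "\<bar>v s\<bar> \<le> A * M * \<tau> powr (\<mu> + 1)" if "s \<in> {0..\<tau>}" for s
      proof (cases "s = 0")
        case False
        then have "\<bar>v s\<bar> \<le> A * M * s powr (\<mu> + 1)"
          using mode_abs_le_power[of s] that by (simp add: v_def M_def)
        also have "\<dots> \<le> A * M * \<tau> powr (\<mu> + 1)"
          using that A0 M \<mu> by (intro mult_left_mono powr_mono2) auto
        finally show ?thesis .
      qed (use v0 A0 M in simp)
      have "\<bar>v (t (Suc 0)) - v s\<bar> \<le> 2 * (A * M * \<tau> powr (\<mu> + 1))" if "s \<in> {t 0..t (Suc 0)}" for s
        using b[of "t (Suc 0)"] b[of s] that \<tau> by (simp add: t_def)
      from \<rho>_le[OF this] have "\<bar>\<rho> j\<bar> \<le> r * (\<tau> * (2 * (A * M * \<tau> powr (\<mu> + 1))))" unfolding True by simp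
      also have "\<dots> = (2 * M * A) * (r * \<tau> * (\<tau> * t j powr \<mu>))"
        using \<tau> True by (simp add: t_def powr_add)
      also have "\<dots> \<le> P * (r * \<tau> * (\<tau> * t j powr \<mu>))"
        using r \<tau> A0 M by (intro mult_right_mono) (auto simp: P_def intro!: mult_right_mono)
      finally show ?thesis .
    next
      case False
      then have "\<bar>\<rho> j\<bar> \<le> P * (r * \<tau> * (\<tau> * t j powr \<mu>)) / (1 + r * t j)" using j by (intro \<rho>2) simp
      also have "\<dots> \<le> P * (r * \<tau> * (\<tau> * t j powr \<mu>)) / 1"
        using P0 r \<tau> by (intro divide_left_mono mult_nonneg_nonneg) (auto simp: t_def intro!: add_pos_nonneg)
      finally show ?thesis by simp
    qed
    \<comment> \<open>A right-endpoint sum of a decreasing function is below its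
    integral.\<close>
    have powsum: "(\<Sum>j=1..m. \<tau> * t j powr \<mu>) \<le> M * t m powr (\<mu> + 1)" for m
    proof (induction m)
      case (Suc m)
      have "\<tau> * t (Suc m) powr \<mu> \<le> M * (t (Suc m) powr (\<mu> + 1) - t m powr (\<mu> + 1))"
      proof (cases "m = 0")
        case True
        have "1 * (\<tau> * \<tau> powr \<mu>) \<le> M * (\<tau> * \<tau> powr \<mu>)" using M \<tau> by (intro mult_right_mono) auto
        then show ?thesis using True \<tau> \<mu> by (simp add: t_def powr_add)
      next
        case False
        then have tm: "t m > 0" using \<tau> by (simp add: t_def)
        have "\<exists>z. t m < z \<and> z < t (Suc m) \<and> t (Suc m) powr (\<mu> + 1) - t m powr (\<mu> + 1) = (t (Suc m) - t m) * ((\<mu> + 1) * z powr \<mu>)"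
          using tm by (intro MVT2 tS) (auto intro!: derivative_eq_intros)
        then obtain z where z: "t m < z" "z < t (Suc m)" "t (Suc m) powr (\<mu> + 1) - t m powr (\<mu> + 1) = (t (Suc m) - t m) * ((\<mu> + 1) * z powr \<mu>)" by blast
        have "t (Suc m) powr \<mu> \<le> z powr \<mu>" using z tm \<mu> by (intro powr_mono2') auto
        moreover have "M * (t (Suc m) powr (\<mu> + 1) - t m powr (\<mu> + 1)) = \<tau> * z powr \<mu>"
          unfolding z(3) tS(3) M_def using \<mu> by simp
        ultimately show ?thesis using \<tau> by simp
      qed
      then show ?case using Suc by (simp add: right_diff_distrib)
    qed (use M in \<open>simp add: t_def\<close>)
    \<comment> \<open>As \<open>\<tau> r = p - 1\<close>, the sum telescopes.\<close>
    have geo: "(\<Sum>j=1..m. (\<tau> * r) / p ^ (m + 1 - j)) = 1 - 1 / p ^ m" for m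
    proof (induction m)
      case (Suc m)
      have "(\<Sum>j=1..Suc m. (\<tau> * r) / p ^ (Suc m + 1 - j)) = (\<Sum>j=1..m. (\<tau> * r) / p ^ (m + 1 - j)) / p + (\<tau> * r) / p"
      proof -
        have "(\<Sum>j=1..m. (\<tau> * r) / p ^ (Suc m + 1 - j)) = (\<Sum>j=1..m. (\<tau> * r) / p ^ (m + 1 - j)) / p"
          unfolding sum_divide_distrib by (intro sum.cong) (auto simp: Suc_diff_le mult.commute)
        then show ?thesis by simp
      qed
      also have "\<dots> = (1 - 1 / p ^ m) / p + (p - 1) / p" unfolding Suc by (simp add: p_def)
      also have "\<dots> = 1 - 1 / p ^ Suc m" using p by (simp add: field_simps)
      finally show ?case .
    qed simp
    \<comment> \<open>The exponent is at least half of \<open>n\<close>; splitting it into two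
    equal powers and applying Bernoulli's inequality to each gives decay of second
    order.\<close>
    have far: "1 / p ^ (n + 1 - j) \<le> 36 / (1 + y)\<^sup>2" if j: "2 * j \<le> n" for j
    proof -
      define k where "k = (n + 1 - j) div 2"
      have "n + 1 - j = 2 * k + (n + 1 - j) mod 2" "(n + 1 - j) mod 2 < 2" unfolding k_def by simp_all
      then have k: "n \<le> 6 * k" "2 * k \<le> n + 1 - j" using j by linarith+
      have "1 + real k * (\<tau> * r) \<le> p ^ k" unfolding p_def using \<tau> r by (intro Bernoulli_inequality) (auto intro: order_trans[of _ 0])
      moreover have "(1 + y) / 6 \<le> 1 + real k * (\<tau> * r)"
      proof -
        have "real n * (\<tau> * r) \<le> real (6 * k) * (\<tau> * r)" using k \<tau> r by (intro mult_right_mono) (auto simp flip: of_nat_mult)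
        then show ?thesis by (simp add: y_def t_def mult_ac)
      qed
      ultimately have "(1 + y) / 6 \<le> p ^ k" by linarith
      then have "((1 + y) / 6)\<^sup>2 \<le> (p ^ k)\<^sup>2" using y by (intro power_mono) auto
      also have "\<dots> = p ^ (2 * k)" by (simp add: power_mult mult.commute flip: power_mult)
      also have "\<dots> \<le> p ^ (n + 1 - j)" using k p by (intro power_increasing) auto
      finally have "(1 + y)\<^sup>2 / 36 \<le> p ^ (n + 1 - j)" by (simp add: power_divide)
      then have "1 / p ^ (n + 1 - j) \<le> 1 / ((1 + y)\<^sup>2 / 36)" using y by (intro divide_left_mono) (auto intro!: mult_pos_pos zero_less_power p order.strict_trans[OF zero_less_one p])
      then show ?thesis by simp
    qed
    \<comment> \<open>The target of both halves, up to constants.\<close>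
    define Y where "Y = \<tau> * t n powr \<mu> / (1 + y)"
    have Y0: "Y \<ge> 0" unfolding Y_def using \<tau> y by simp
    have S1: "(\<Sum>j\<in>{j\<in>{1..n}. 2 * j \<le> n}. \<bar>\<rho> j\<bar> / p ^ (n + 1 - j)) \<le> 36 * P * M * Y"
    proof -
      have "(\<Sum>j\<in>{j\<in>{1..n}. 2 * j \<le> n}. \<bar>\<rho> j\<bar> / p ^ (n + 1 - j))
         \<le> (\<Sum>j\<in>{j\<in>{1..n}. 2 * j \<le> n}. P * (r * \<tau>) * (36 / (1 + y)\<^sup>2) * (\<tau> * t j powr \<mu>))"
      proof (rule sum_mono)
        fix j assume "j \<in> {j \<in> {1..n}. 2 * j \<le> n}"
        then have "\<bar>\<rho> j\<bar> * (1 / p ^ (n + 1 - j)) \<le> (P * (r * \<tau> * (\<tau> * t j powr \<mu>))) * (36 / (1 + y)\<^sup>2)"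
          using P0 r \<tau> p by (intro mult_mono \<rho>1 far mult_nonneg_nonneg) auto
        then show "\<bar>\<rho> j\<bar> / p ^ (n + 1 - j) \<le> P * (r * \<tau>) * (36 / (1 + y)\<^sup>2) * (\<tau> * t j powr \<mu>)" by (simp add: mult_ac)
      qed
      also have "\<dots> \<le> (\<Sum>j=1..n. P * (r * \<tau>) * (36 / (1 + y)\<^sup>2) * (\<tau> * t j powr \<mu>))"
        using P0 r \<tau> by (intro sum_mono2) auto
      also have "\<dots> = P * (r * \<tau>) * (36 / (1 + y)\<^sup>2) * (\<Sum>j=1..n. \<tau> * t j powr \<mu>)" by (simp only: sum_distrib_left)
      also have "\<dots> \<le> P * (r * \<tau>) * (36 / (1 + y)\<^sup>2) * (M * t n powr (\<mu> + 1))"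
        using P0 r \<tau> by (intro mult_left_mono powsum) auto
      also have "\<dots> = 36 * P * M * (\<tau> * t n powr \<mu>) * (y / (1 + y)\<^sup>2)"
        using tn by (simp add: y_def powr_add)
      also have "\<dots> \<le> 36 * P * M * (\<tau> * t n powr \<mu>) * (1 / (1 + y))"
      proof (intro mult_left_mono)
        have "y / (1 + y)\<^sup>2 = y / (1 + y) * (1 / (1 + y))" by (simp add: power2_eq_square)
        also have "\<dots> \<le> 1 * (1 / (1 + y))" using y by (intro mult_right_mono) auto
        finally show "y / (1 + y)\<^sup>2 \<le> 1 / (1 + y)" by simp
      qed (use P0 M \<tau> in auto)
      finally show ?thesis by (simp add: Y_def)
    qed
    have S2: "(\<Sum>j\<in>{j\<in>{1..n}. \<not> 2 * j \<le> n}. \<bar>\<rho> j\<bar> / p ^ (n + 1 - j)) \<le> 4 * P * Y"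
    proof -
      have "(\<Sum>j\<in>{j\<in>{1..n}. \<not> 2 * j \<le> n}. \<bar>\<rho> j\<bar> / p ^ (n + 1 - j))
         \<le> (\<Sum>j\<in>{j\<in>{1..n}. \<not> 2 * j \<le> n}. 4 * P * Y * ((\<tau> * r) / p ^ (n + 1 - j)))"
      proof (rule sum_mono)
        fix j assume "j \<in> {j \<in> {1..n}. \<not> 2 * j \<le> n}"
        then have j: "2 \<le> j" "real n \<le> 2 * real j" using n2 by auto
        then have "real n * \<tau> \<le> 2 * real j * \<tau>" using \<tau> by (intro mult_right_mono) auto
        then have half: "t n / 2 \<le> t j" by (simp add: t_def)
        have tj: "t j > 0" using half tn by simp
        have "t j powr \<mu> \<le> (t n / 2) powr \<mu>" using half tn \<mu> by (intro powr_mono2') auto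
        also have "\<dots> = t n powr \<mu> * 2 powr (- \<mu>)" using tn by (simp add: powr_divide powr_minus field_simps)
        also have "\<dots> \<le> t n powr \<mu> * 2 powr 1" using \<mu> by (intro mult_left_mono powr_mono) auto
        finally have a: "t j powr \<mu> \<le> 2 * t n powr \<mu>" by simp
        have "r * t n \<le> r * (2 * t j)" using half r by (intro mult_left_mono) auto
        then have "1 + y \<le> 2 * (1 + r * t j)" by (simp add: y_def)
        moreover have "0 < 1 + r * t j" using r tj by (simp add: add_pos_pos)
        ultimately have b: "1 / (1 + r * t j) \<le> 2 / (1 + y)" using y by (simp add: field_simps)
        have "\<bar>\<rho> j\<bar> \<le> P * (r * \<tau> * (\<tau> * t j powr \<mu>)) * (1 / (1 + r * t j))" using \<rho>2[OF j(1)] by simp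
        also have "\<dots> \<le> P * (r * \<tau> * (\<tau> * (2 * t n powr \<mu>))) * (2 / (1 + y))"
          using a b P0 r \<tau> tj by (intro mult_mono mult_left_mono mult_nonneg_nonneg) (auto intro!: add_nonneg_nonneg)
        also have "\<dots> = 4 * P * Y * (\<tau> * r)" by (simp add: Y_def)
        finally have "\<bar>\<rho> j\<bar> / p ^ (n + 1 - j) \<le> (4 * P * Y * (\<tau> * r)) / p ^ (n + 1 - j)"
          using p by (intro divide_right_mono) auto
        then show "\<bar>\<rho> j\<bar> / p ^ (n + 1 - j) \<le> 4 * P * Y * ((\<tau> * r) / p ^ (n + 1 - j))" by simp
      qed
      also have "\<dots> \<le> (\<Sum>j=1..n. 4 * P * Y * ((\<tau> * r) / p ^ (n + 1 - j)))"
        using P0 r \<tau> Y0 p by (intro sum_mono2) auto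
      also have "\<dots> = 4 * P * Y * (1 - 1 / p ^ n)" unfolding sum_distrib_left[symmetric] geo ..
      also have "\<dots> \<le> 4 * P * Y * 1" using P0 Y0 p by (intro mult_left_mono) auto
      finally show ?thesis by simp
    qed
    have "\<bar>e n\<bar> \<le> (\<Sum>j=1..n. \<bar>\<rho> j\<bar> / p ^ (n + 1 - j))" by (rule esum)
    also have "\<dots> = (\<Sum>j\<in>{j\<in>{1..n}. 2 * j \<le> n}. \<bar>\<rho> j\<bar> / p ^ (n + 1 - j)) + (\<Sum>j\<in>{j\<in>{1..n}. \<not> 2 * j \<le> n}. \<bar>\<rho> j\<bar> / p ^ (n + 1 - j))"
      by (subst sum.union_disjoint[symmetric]) (auto intro!: sum.cong)
    also have "\<dots> \<le> 36 * P * M * Y + 4 * P * Y" by (intro add_mono S1 S2)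
    also have "\<dots> = (1152 * (M + 1) * M + 128 * (M + 1)) * (A * Y)" by (simp add: P_def algebra_simps)
    also have "\<dots> \<le> (1152 * (M + 1) * M + 128 * (M + 1)) * B"
    proof (intro mult_left_mono)
      have "1 / (1 + y) = (1 + y) powr (- 1)" using y by (simp add: powr_minus field_simps)
      also have "\<dots> \<le> (1 + y) powr (- \<gamma>)" using y \<gamma> by (intro powr_mono) auto
      finally have "(\<tau> * t n powr \<mu>) * (1 / (1 + y)) \<le> (\<tau> * t n powr \<mu>) * (1 + y) powr (- \<gamma>)"
        using \<tau> by (intro mult_left_mono) auto
      then show "A * Y \<le> B" unfolding B_def Y_def using A0 by (intro mult_left_mono) auto
    qed (use M in auto)
    also have "\<dots> \<le> (1152 * (M + 1) * M + 128 * (M + 1)) * B + (2 * (1 / (\<mu> + 1) + 1 / (1 - \<gamma>)) * B + M * B)"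
      using B0 M \<gamma> \<mu> by (simp add: add_nonneg_nonneg mult_nonneg_nonneg)
    also have "\<dots> = (1152 * (M + 1) * M + 128 * (M + 1) + 2 * (1 / (\<mu> + 1) + 1 / (1 - \<gamma>)) + M) * B"
      by (simp only: distrib_right add.assoc)
    finally show ?thesis unfolding e_def B_def y_def r_def t_def v_def M_def by (simp only: mult.assoc)
  qed
qed

end

section \<open>Inversion of the Laplace transform on rays\<close>

text \<open>
  The power 3 exceeds the orders \<open>- \<mu>\<close> and \<open>1 - \<mu>\<close> of the
  moments that bound the inversion integral and its derivative.
\<close>

lemma exp_minus_le_cubic:
  fixes y :: real assumes "y \<ge> 0"
  shows "exp (- y) \<le> (1 + y / 3) powr (- 3)"
proof -
  have "exp (- (y / 3)) \<le> (1 + y / 3) powr (- 1)" using assms by (intro exp_minus_le_powr) auto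
  then have "exp (- (y / 3)) ^ 3 \<le> ((1 + y / 3) powr (- 1)) ^ 3" by (intro power_mono) auto
  also have "exp (- (y / 3)) ^ 3 = exp (- y)" by (simp add: exp_of_nat_mult[symmetric])
  also have "((1 + y / 3) powr (- 1)) ^ 3 = (1 + y / 3) powr (- 3)"
    unfolding power3_eq_cube powr_add[symmetric] by simp
  finally show ?thesis .
qed

definition ray_moment :: "real \<Rightarrow> real" where
  "ray_moment a = (LBINT x. exp (a * x) * (1 + exp x) powr (- 3))"

lemma ray_moment_nonneg: "ray_moment a \<ge> 0"
  unfolding ray_moment_def by (intro integral_nonneg_AE AE_I2) auto

lemma exponential_moment:
  assumes a: "0 < a" "a < 3" and k: "k > 0"
  shows "integrable lborel (\<lambda>x. exp (a * x) * exp (- k * exp x))"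
    and "(LBINT x. exp (a * x) * exp (- k * exp x)) \<le> (k / 3) powr (- a) * ray_moment a"
proof -
  have I: "integrable lborel (\<lambda>x. exp (a * x) * (1 + exp x * (k / 3)) powr (- 3))"
    using a k by (intro scaled_kernel_integral(1)) auto
  have le: "exp (a * x) * exp (- k * exp x) \<le> exp (a * x) * (1 + exp x * (k / 3)) powr (- 3)" for x
  proof (intro mult_left_mono)
    have "exp (- (k * exp x)) \<le> (1 + (k * exp x) / 3) powr (- 3)" using k by (intro exp_minus_le_cubic) auto
    then show "exp (- k * exp x) \<le> (1 + exp x * (k / 3)) powr (- 3)" by (simp add: mult.commute)
  qed auto
  show J: "integrable lborel (\<lambda>x. exp (a * x) * exp (- k * exp x))"
  proof (rule Bochner_Integration.integrable_bound[OF I])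
    show "AE x in lborel. norm (exp (a * x) * exp (- k * exp x)) \<le> norm (exp (a * x) * (1 + exp x * (k / 3)) powr (- 3))"
      using le by (intro AE_I2) simp
  qed simp
  have "(LBINT x. exp (a * x) * exp (- k * exp x)) \<le> (LBINT x. exp (a * x) * (1 + exp x * (k / 3)) powr (- 3))"
    by (intro integral_mono J I le)
  also have "\<dots> = (k / 3) powr (- a) * ray_moment a"
    unfolding ray_moment_def using a k by (intro scaled_kernel_integral(2)) auto
  finally show "(LBINT x. exp (a * x) * exp (- k * exp x)) \<le> (k / 3) powr (- a) * ray_moment a" .
qed

context
  fixes P E :: "real \<Rightarrow> complex" and M \<mu> \<kappa> :: real
  assumes Pm: "P \<in> borel_measurable borel" and Em: "E \<in> borel_measurable borel"
    and PM: "\<And>x. cmod (P x) \<le> M * exp (- \<mu> * x)"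
    and E: "\<And>x. Re (E x) = - \<kappa> * exp x" "\<And>x. cmod (E x) = exp x"
    and \<kappa>: "\<kappa> > 0" and \<mu>: "-1 < \<mu>" "\<mu> < 0"
begin

lemma ray_integrand_le:
  assumes t: "t > 0"
  shows "cmod (P x * E x ^ k * exp (E x * of_real t)) \<le> M * (exp ((real k - \<mu>) * x) * exp (- (\<kappa> * t) * exp x))"
proof -
  have "cmod (P x * E x ^ k * exp (E x * of_real t)) = cmod (P x) * exp x ^ k * exp (Re (E x * of_real t))"
    by (simp add: norm_mult norm_power E(2))
  also have "\<dots> \<le> (M * exp (- \<mu> * x)) * exp x ^ k * exp (Re (E x * of_real t))"
    using PM by (intro mult_right_mono) auto
  also have "\<dots> = M * ((exp (- \<mu> * x) * exp x ^ k) * exp (- (\<kappa> * t) * exp x))" using E(1)[of x] by (simp add: mult_ac)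
  also have "exp (- \<mu> * x) * exp x ^ k = exp ((real k - \<mu>) * x)"
    by (simp add: exp_of_nat_mult[symmetric] exp_add[symmetric] algebra_simps)
  finally show ?thesis .
qed

lemma ray_integral:
  assumes t: "t > 0" and k: "k \<le> 2"
  shows "integrable lborel (\<lambda>x. P x * E x ^ k * exp (E x * of_real t))"
    and "cmod (LBINT x. P x * E x ^ k * exp (E x * of_real t)) \<le> M * ((\<kappa> * t / 3) powr (\<mu> - real k) * ray_moment (real k - \<mu>))"
proof -
  note [measurable] = Pm Em
  have a: "0 < real k - \<mu>" "real k - \<mu> < 3" using k \<mu> by auto
  have kt: "\<kappa> * t > 0" using \<kappa> t by simp
  have M: "M \<ge> 0" using PM[of 0] norm_ge_zero[of "P 0"] by (simp del: norm_ge_zero)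
  note I = integrable_mult_right[OF exponential_moment(1)[OF a kt], of M]
  show J: "integrable lborel (\<lambda>x. P x * E x ^ k * exp (E x * of_real t))"
    by (rule Bochner_Integration.integrable_bound[OF I])
       (use ray_integrand_le[OF t] in \<open>auto intro!: AE_I2 intro: order_trans[OF _ abs_ge_self]\<close>)
  have "cmod (LBINT x. P x * E x ^ k * exp (E x * of_real t)) \<le> (LBINT x. cmod (P x * E x ^ k * exp (E x * of_real t)))"
    by (rule integral_norm_bound)
  also have "\<dots> \<le> (LBINT x. M * (exp ((real k - \<mu>) * x) * exp (- (\<kappa> * t) * exp x)))"
    by (intro integral_mono ray_integrand_le[OF t] I integrable_norm J)
  also have "\<dots> = M * (LBINT x. exp ((real k - \<mu>) * x) * exp (- (\<kappa> * t) * exp x))" by (rule integral_mult_right_zero)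
  also have "\<dots> \<le> M * ((\<kappa> * t / 3) powr (- (real k - \<mu>)) * ray_moment (real k - \<mu>))"
    by (intro mult_left_mono exponential_moment(2)[OF a kt] M)
  finally show "cmod (LBINT x. P x * E x ^ k * exp (E x * of_real t)) \<le> M * ((\<kappa> * t / 3) powr (\<mu> - real k) * ray_moment (real k - \<mu>))"
    by simp
qed

lemma exp_difference_quotient_le:
  assumes t: "t > 0" and u: "u \<ge> t / 2" "u \<noteq> t"
  shows "cmod ((exp (E x * of_real u) - exp (E x * of_real t)) / (of_real u - of_real t)) \<le> exp x * exp (- (\<kappa> * (t / 2)) * exp x)"
proof -
  have "norm (exp (E x * of_real u) - exp (E x * of_real t)) \<le> (exp x * exp (- (\<kappa> * (t / 2)) * exp x)) * norm (complex_of_real u - of_real t)"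
  proof (rule field_differentiable_bound[where f = "\<lambda>z. exp (E x * z)" and f' = "\<lambda>z. E x * exp (E x * z)" and S = "closed_segment (complex_of_real u) (of_real t)"])
    show "((\<lambda>z. exp (E x * z)) has_field_derivative E x * exp (E x * z)) (at z within closed_segment (complex_of_real u) (of_real t))" for z
      by (auto intro!: derivative_eq_intros)
    show "norm (E x * exp (E x * z)) \<le> exp x * exp (- (\<kappa> * (t / 2)) * exp x)"
      if z: "z \<in> closed_segment (complex_of_real u) (of_real t)" for z
    proof -
      obtain v where v: "z = of_real v" "v \<in> closed_segment u t"
        using z unfolding closed_segment_of_real by blast
      then have "v \<ge> t / 2" using u t by (auto simp: closed_segment_eq_real_ivl split: if_splits)
      then have "\<kappa> * exp x * (t / 2) \<le> \<kappa> * exp x * v" using \<kappa> by (intro mult_left_mono) auto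
      then have "Re (E x * z) \<le> - (\<kappa> * (t / 2)) * exp x" using v E(1)[of x] by (simp add: mult_ac)
      then show ?thesis by (simp add: norm_mult E(2))
    qed
  qed auto
  moreover have "norm (complex_of_real u - of_real t) > 0" using u by simp
  ultimately show ?thesis by (simp add: norm_divide divide_le_eq)
qed

text \<open>
  Differentiation under the integral. Convergence is tested along sequences approaching
  \<open>t\<close>; a dominating function is available for times above \<open>t / 2\<close>.
\<close>

lemma ray_has_derivative:
  assumes t: "t > 0"
  shows "((\<lambda>u. ((LBINT x. P x * exp (E x * of_real u)) - (LBINT x. P x * exp (E x * of_real t))) /\<^sub>R (u - t))
     \<longlongrightarrow> (LBINT x. P x * E x * exp (E x * of_real t))) (at t)"
proof -
  note [measurable] = Pm Em
  have M: "M \<ge> 0" using PM[of 0] norm_ge_zero[of "P 0"] by (simp del: norm_ge_zero)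
  have I0: "integrable lborel (\<lambda>x. P x * exp (E x * of_real u))" if "u > 0" for u
    using ray_integral(1)[OF that, of 0] by simp
  define J where "J = (\<lambda>t. LBINT x. P x * exp (E x * of_real t))"
  define w where "w = (\<lambda>x. M * (exp ((1 - \<mu>) * x) * exp (- (\<kappa> * (t / 2)) * exp x)))"
  have wi: "integrable lborel w" unfolding w_def using \<mu> \<kappa> t by (intro integrable_mult_right exponential_moment(1)) auto
  have "((\<lambda>u. (J u - J t) /\<^sub>R (u - t)) \<longlongrightarrow> (LBINT x. P x * E x * exp (E x * of_real t))) (at t)"
    unfolding tendsto_at_iff_sequentially
  proof (intro allI impI)
    fix X :: "nat \<Rightarrow> real" assume X: "\<forall>i. X i \<in> UNIV - {t}" "X \<longlonglongrightarrow> t"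
    have "\<forall>\<^sub>F n in sequentially. t / 2 < X n" by (rule order_tendstoD(1)[OF X(2)]) (use t in simp)
    then obtain m where m: "\<And>n. n \<ge> m \<Longrightarrow> t / 2 < X n" unfolding eventually_sequentially by blast
    define Y where "Y = (\<lambda>n. X (n + m))"
    have Y: "Y \<longlonglongrightarrow> t" "\<And>n. Y n > t / 2" "\<And>n. Y n \<noteq> t"
      using X m by (auto simp: Y_def intro: LIMSEQ_ignore_initial_segment)
    have eq: "(J (Y n) - J t) /\<^sub>R (Y n - t) = (LBINT x. P x * ((exp (E x * of_real (Y n)) - exp (E x * of_real t)) / (of_real (Y n) - of_real t)))" for n
    proof -
      have "Y n > 0" using Y(2)[of n] t by linarith
      have "J (Y n) - J t = (LBINT x. P x * exp (E x * of_real (Y n)) - P x * exp (E x * of_real t))"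
        unfolding J_def by (rule Bochner_Integration.integral_diff[symmetric, OF I0[OF \<open>Y n > 0\<close>] I0[OF t]])
      then have "(J (Y n) - J t) /\<^sub>R (Y n - t) = (LBINT x. (P x * exp (E x * of_real (Y n)) - P x * exp (E x * of_real t)) /\<^sub>R (Y n - t))"
        by (simp only: integral_scaleR_right)
      also have "\<dots> = (LBINT x. P x * ((exp (E x * of_real (Y n)) - exp (E x * of_real t)) / (of_real (Y n) - of_real t)))"
        by (intro Bochner_Integration.integral_cong refl)
           (simp add: scaleR_conv_of_real divide_inverse algebra_simps)
      finally show ?thesis .
    qed
    have "(\<lambda>n. (J (Y n) - J t) /\<^sub>R (Y n - t)) \<longlonglongrightarrow> (LBINT x. P x * E x * exp (E x * of_real t))"
      unfolding eq
    proof (rule integral_dominated_convergence[OF _ _ wi])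
      show "AE x in lborel. (\<lambda>n. P x * ((exp (E x * of_real (Y n)) - exp (E x * of_real t)) / (of_real (Y n) - of_real t))) \<longlonglongrightarrow> P x * E x * exp (E x * of_real t)"
      proof (intro AE_I2)
        fix x
        have "((\<lambda>z. exp (E x * z)) has_field_derivative E x * exp (E x * of_real t)) (at (of_real t))"
          by (auto intro!: derivative_eq_intros)
        then have "((\<lambda>z. (exp (E x * z) - exp (E x * of_real t)) / (z - of_real t)) \<longlongrightarrow> E x * exp (E x * of_real t)) (at (of_real t))"
          unfolding has_field_derivative_iff .
        moreover have "filterlim (\<lambda>n. complex_of_real (Y n)) (at (of_real t)) sequentially"
          unfolding filterlim_at using Y by (auto intro!: tendsto_of_real always_eventually)
        ultimately have "(\<lambda>n. (exp (E x * of_real (Y n)) - exp (E x * of_real t)) / (of_real (Y n) - of_real t)) \<longlonglongrightarrow> E x * exp (E x * of_real t)"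
          by (rule filterlim_compose)
        then show "(\<lambda>n. P x * ((exp (E x * of_real (Y n)) - exp (E x * of_real t)) / (of_real (Y n) - of_real t))) \<longlonglongrightarrow> P x * E x * exp (E x * of_real t)"
          unfolding mult.assoc by (rule tendsto_mult_left)
      qed
      show "AE x in lborel. norm (P x * ((exp (E x * of_real (Y n)) - exp (E x * of_real t)) / (of_real (Y n) - of_real t))) \<le> w x" for n
      proof (intro AE_I2)
        fix x
        have "norm (P x * ((exp (E x * of_real (Y n)) - exp (E x * of_real t)) / (of_real (Y n) - of_real t)))
           \<le> (M * exp (- \<mu> * x)) * (exp x * exp (- (\<kappa> * (t / 2)) * exp x))"
          unfolding norm_mult using Y(2,3)[of n] t M
          by (intro mult_mono PM exp_difference_quotient_le) auto
        also have "\<dots> = M * ((exp (- \<mu> * x) * exp x) * exp (- (\<kappa> * (t / 2)) * exp x))" by simp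
        also have "exp (- \<mu> * x) * exp x = exp ((1 - \<mu>) * x)" by (simp add: exp_add[symmetric] algebra_simps)
        finally show "norm (P x * ((exp (E x * of_real (Y n)) - exp (E x * of_real t)) / (of_real (Y n) - of_real t))) \<le> w x"
          unfolding w_def .
      qed
    qed auto
    then have "(\<lambda>n. (J (X n) - J t) /\<^sub>R (X n - t)) \<longlonglongrightarrow> (LBINT x. P x * E x * exp (E x * of_real t))"
      unfolding Y_def by (rule LIMSEQ_offset)
    then show "((\<lambda>u. (J u - J t) /\<^sub>R (u - t)) \<circ> X) \<longlonglongrightarrow> (LBINT x. P x * E x * exp (E x * of_real t))"
      by (simp add: o_def)
  qed
  then show ?thesis unfolding J_def .
qed

text \<open>
  Fubini's theorem. The exponent has negative real part on the ray, so the Laplace transform of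
  each exponential is elementary.
\<close>

lemma ray_laplace:
  assumes s: "s > 0"
  shows "integrable lborel (\<lambda>t. indicator {0<..} t *\<^sub>R (exp (- of_real (s * t)) * (LBINT x. P x * exp (E x * of_real t))))" (is ?I)
    and "(LBINT t. indicator {0<..} t *\<^sub>R (exp (- of_real (s * t)) * (LBINT x. P x * exp (E x * of_real t)))) = (LBINT x. P x / (of_real s - E x))" (is ?E)
proof -
  note [measurable] = Pm Em
  have M: "M \<ge> 0" using PM[of 0] norm_ge_zero[of "P 0"] by (simp del: norm_ge_zero)
  define h where "h = (\<lambda>x t :: real. indicator {0<..} t *\<^sub>R (P x * exp (- (of_real s - E x) * of_real t)))"
  have Re0: "Re (of_real s - E x) = s + \<kappa> * exp x" for x using E(1)[of x] by simp
  have pos: "s + \<kappa> * exp x > 0" for x using s \<kappa> by (simp add: add_pos_pos)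
  have hb: "has_bochner_integral lborel (h x) (P x / (of_real s - E x))" for x
  proof -
    have "has_bochner_integral lborel (\<lambda>t. P x * (indicator {0<..} t *\<^sub>R exp (- (of_real s - E x) * of_real t))) (P x * (1 / (of_real s - E x)))"
    proof (intro has_bochner_integral_mult_right laplace_exp_complex)
      show "0 < Re (of_real s - E x)" unfolding Re0 by (rule pos)
    qed
    then show ?thesis unfolding h_def by simp
  qed
  have hn: "(LBINT t. norm (h x t)) = cmod (P x) * (1 / (s + \<kappa> * exp x))" for x
  proof -
    have "norm (h x t) = cmod (P x) * (indicator {0<..} t * exp (- (s + \<kappa> * exp x) * t))" for t
    proof -
      have "Re (- (of_real s - E x) * of_real t) = - (s + \<kappa> * exp x) * t" using Re0[of x] by simp
      then show ?thesis unfolding h_def by (simp add: norm_mult)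
    qed
    then have "(LBINT t. norm (h x t)) = cmod (P x) * (LBINT t. indicator {0<..} t * exp (- (s + \<kappa> * exp x) * t))"
      by (simp only: integral_mult_right_zero)
    then show ?thesis using laplace_exp[OF pos] by (simp add: has_bochner_integral_iff)
  qed
  have I: "integrable (lborel \<Otimes>\<^sub>M lborel) (case_prod h)"
  proof (rule lborel_pair.Fubini_integrable)
    show "case_prod h \<in> borel_measurable (lborel \<Otimes>\<^sub>M lborel)" unfolding h_def by measurable
    show "integrable lborel (\<lambda>x. LBINT t. norm (case (x, t) of (x, t) \<Rightarrow> h x t))"
      unfolding prod.case hn
    proof (rule Bochner_Integration.integrable_bound)
      show "integrable lborel (\<lambda>x. M / s * (exp (- \<mu> * x) * (1 + exp x * (\<kappa> / s)) powr (- 1)))"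
        using \<mu> \<kappa> s by (intro integrable_mult_right scaled_kernel_integral(1)) auto
      show "AE x in lborel. norm (cmod (P x) * (1 / (s + \<kappa> * exp x))) \<le> norm (M / s * (exp (- \<mu> * x) * (1 + exp x * (\<kappa> / s)) powr (- 1)))"
      proof (intro AE_I2)
        fix x
        have "cmod (P x) * (1 / (s + \<kappa> * exp x)) \<le> (M * exp (- \<mu> * x)) * (1 / (s + \<kappa> * exp x))"
          using pos[of x] by (intro mult_right_mono PM) auto
        moreover have "1 / (s + \<kappa> * exp x) = 1 / s * (1 + exp x * (\<kappa> / s)) powr (- 1)"
          using s \<kappa> pos[of x] by (simp add: powr_minus field_simps)
        then have "(M * exp (- \<mu> * x)) * (1 / (s + \<kappa> * exp x)) = M / s * (exp (- \<mu> * x) * (1 + exp x * (\<kappa> / s)) powr (- 1))" by simp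
        ultimately have "cmod (P x) * (1 / (s + \<kappa> * exp x)) \<le> M / s * (exp (- \<mu> * x) * (1 + exp x * (\<kappa> / s)) powr (- 1))"
          by (simp only:)
        moreover have "0 \<le> cmod (P x) * (1 / (s + \<kappa> * exp x))" using pos[of x] by simp
        ultimately show "norm (cmod (P x) * (1 / (s + \<kappa> * exp x))) \<le> norm (M / s * (exp (- \<mu> * x) * (1 + exp x * (\<kappa> / s)) powr (- 1)))"
          unfolding real_norm_def by linarith
      qed
    qed auto
    show "AE x in lborel. integrable lborel (\<lambda>t. case (x, t) of (x, t) \<Rightarrow> h x t)"
      unfolding prod.case using hb by (intro AE_I2) (simp add: has_bochner_integral_iff)
  qed
  have eq: "indicator {0<..} t *\<^sub>R (exp (- of_real (s * t)) * (LBINT x. P x * exp (E x * of_real t))) = (LBINT x. h x t)" for t :: real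
  proof -
    have "indicator {0<..} t *\<^sub>R (exp (- of_real (s * t)) * (P x * exp (E x * of_real t))) = h x t" for x
    proof -
      have "exp (- (of_real s - E x) * of_real t) = exp (- of_real (s * t)) * exp (E x * of_real t)"
        by (simp add: exp_add[symmetric] algebra_simps)
      then show ?thesis unfolding h_def by simp
    qed
    then have "(LBINT x. h x t) = (LBINT x. indicator {0<..} t *\<^sub>R (exp (- of_real (s * t)) * (P x * exp (E x * of_real t))))"
      by (simp only:)
    then show ?thesis by (simp only: integral_scaleR_right integral_mult_right_zero)
  qed
  show ?I unfolding eq using lborel_pair.integrable_snd[OF I] .
  show ?E unfolding eq using lborel_pair.Fubini_integral[OF I] hb by (simp add: has_bochner_integral_iff)
qed

end

lemma Re_of_real_mult: "Re (of_real a * z) = a * Re z" by simp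

text \<open>
  The two terms bound the inversion integral and its derivative on a ray whose angle is midway
  between \<open>pi / 2\<close> and \<open>\<theta>\<close>.
\<close>

definition source_constant :: "real \<Rightarrow> real \<Rightarrow> real" where
  "source_constant \<theta> \<mu> = (let k = - cos ((pi / 2 + \<theta>) / 2) / 3 in
     k powr \<mu> * ray_moment (- \<mu>) + k powr (\<mu> - 1) * ray_moment (1 - \<mu>))"

text \<open>
  The inverse Laplace transform along the two rays of angle \<open>p\<close>, with \<open>pi / 2 <
  p < \<theta>\<close>. On them \<open>exp (z t)\<close> decays, so the integral \<open>g\<close>
  is differentiable for positive times, and scaling gives the powers of \<open>s\<close> in the
  bounds.

  That \<open>g\<close> is a representative of \<open>f\<close> follows from the uniqueness of the
  Laplace transform: integrating the transform of \<open>g\<close> first in time leaves the Cauchy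
  integral of \<open>\<Phi>\<close> over the boundary of the sector, which equals
  \<open>\<Phi>\<close> by \<open>cauchy_formula_strip\<close>.
\<close>

theorem inverse_laplace_sectorial:
  fixes f :: "real \<Rightarrow> real" and \<Phi> :: "complex \<Rightarrow> complex"
  assumes \<theta>: "pi / 2 < \<theta>" "\<theta> < pi" and \<mu>: "-1 < \<mu>" "\<mu> < 0" and \<omega>: "\<omega> \<ge> 0"
    and int: "integrable lebesgue (\<lambda>t. indicator {0<..} t * (exp (- \<omega> * t) * f t))"
    and holo: "\<Phi> holomorphic_on {z. z \<noteq> 0 \<and> \<bar>Arg z\<bar> < \<theta>}"
    and bound: "\<And>z. z \<noteq> 0 \<Longrightarrow> \<bar>Arg z\<bar> < \<theta> \<Longrightarrow> cmod (\<Phi> z) \<le> M * cmod z powr (- \<mu> - 1)"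
    and lapl: "\<And>s. s > \<omega> \<Longrightarrow> \<Phi> (of_real s) = of_real (LINT t|lebesgue. indicator {0<..} t * (exp (- s * t) * f t))"
  obtains g g' where
    "\<And>s. s > 0 \<Longrightarrow> (g has_real_derivative g' s) (at s)"
    "\<And>s. s > 0 \<Longrightarrow> \<bar>g s\<bar> \<le> source_constant \<theta> \<mu> * M * s powr \<mu>"
    "\<And>s. s > 0 \<Longrightarrow> \<bar>g' s\<bar> \<le> source_constant \<theta> \<mu> * M * s powr (\<mu> - 1)"
    "AE t in lebesgue. t > 0 \<longrightarrow> f t = g t"
proof -
  define p where "p = (pi / 2 + \<theta>) / 2"
  have p: "pi / 2 < p" "p < \<theta>" "p \<le> pi" "0 < p" using \<theta> pi_gt_zero by (auto simp: p_def)
  define \<kappa> where "\<kappa> = - cos p"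
  have \<kappa>: "\<kappa> > 0"
  proof -
    have "cos p < cos (pi / 2)" using p by (intro cos_monotone_0_pi) auto
    then show ?thesis by (simp add: \<kappa>_def)
  qed
  \<comment> \<open>In the logarithmic variable the sector is a strip, and the bound of
  \<open>\<Phi>\<close> becomes exponential with rate \<open>\<mu> + 1\<close> in \<open>(0,
  1)\<close>.\<close>
  define \<Psi> where "\<Psi> = (\<lambda>w. \<Phi> (exp w))"
  have Arge: "Arg (exp w) = Im w" if "\<bar>Im w\<bar> < \<theta>" for w
    using that \<theta> by (intro Arg_exp) auto
  have holo': "\<Psi> holomorphic_on {w. \<bar>Im w\<bar> < \<theta>}"
  proof -
    have "(\<Phi> \<circ> exp) holomorphic_on {w. \<bar>Im w\<bar> < \<theta>}"
      by (rule holomorphic_on_compose_gen[OF _ holo]) (auto intro!: holomorphic_intros simp: Arge)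
    then show ?thesis by (simp add: \<Psi>_def o_def)
  qed
  have bound': "cmod (\<Psi> w) \<le> M * exp (- (\<mu> + 1) * Re w)" if "\<bar>Im w\<bar> \<le> p" for w
  proof -
    have "\<bar>Im w\<bar> < \<theta>" using that p by simp
    then have "cmod (\<Psi> w) \<le> M * cmod (exp w) powr (- \<mu> - 1)"
      unfolding \<Psi>_def by (intro bound) (auto simp: Arge)
    also have "cmod (exp w) powr (- \<mu> - 1) = exp (- (\<mu> + 1) * Re w)" by (simp add: powr_def algebra_simps)
    finally show ?thesis .
  qed
  define E where "E = (\<lambda>q x. exp (Complex x q))"
  define P where "P = (\<lambda>q x. \<Psi> (Complex x q) * E q x)"
  have Ecis: "E q x = of_real (exp x) * cis q" for q x by (simp add: E_def exp_eq_polar)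
  have Em: "E q \<in> borel_measurable borel" for q
    unfolding E_def by (intro borel_measurable_continuous_onI continuous_intros)
  have Pm: "P q \<in> borel_measurable borel" if "\<bar>q\<bar> = p" for q
    unfolding P_def E_def
    by (intro borel_measurable_continuous_onI continuous_intros
        continuous_on_compose2[OF holomorphic_on_imp_continuous_on[OF holo']])
       (use that p in auto)
  have EP: "Re (E q x) = - \<kappa> * exp x" "cmod (E q x) = exp x" "cmod (P q x) \<le> M * exp (- \<mu> * x)" if q: "\<bar>q\<bar> = p" for q x
  proof -
    have "cos q = cos p" using q cos_abs_real[of q] by simp
    then show "Re (E q x) = - \<kappa> * exp x" by (simp add: Ecis \<kappa>_def)
    show 1: "cmod (E q x) = exp x" by (simp add: Ecis norm_mult)
    have "cmod (P q x) \<le> (M * exp (- (\<mu> + 1) * x)) * exp x"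
      unfolding P_def norm_mult 1 using bound'[of "Complex x q"] q by (intro mult_right_mono) auto
    also have "\<dots> = M * exp (- \<mu> * x)" by (simp add: mult.assoc exp_add[symmetric] algebra_simps)
    finally show "cmod (P q x) \<le> M * exp (- \<mu> * x)" .
  qed
  define J where "J = (\<lambda>q t. LBINT x. P q x * exp (E q x * of_real t))"
  define J1 where "J1 = (\<lambda>q t. LBINT x. P q x * E q x * exp (E q x * of_real t))"
  define g where "g = (\<lambda>t. Re ((J p t - J (- p) t) / (2 * pi * \<i>)))"
  define g' where "g' = (\<lambda>t. Re ((J1 p t - J1 (- p) t) / (2 * pi * \<i>)))"
  have pm: "\<bar>p\<bar> = p" "\<bar>- p\<bar> = p" using p by auto
  note ray = ray_integral[OF Pm Em EP(3) EP(1) EP(2) \<kappa> \<mu>]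
  have Re_le: "\<bar>Re ((a - b) / (2 * pi * \<i>))\<bar> \<le> B" if "cmod a \<le> B" "cmod b \<le> B" for a b B
  proof -
    have "\<bar>Re ((a - b) / (2 * pi * \<i>))\<bar> \<le> cmod ((a - b) / (2 * pi * \<i>))" by (rule abs_Re_le_cmod)
    also have "\<dots> = cmod (a - b) / (2 * pi)" by (simp add: norm_divide norm_mult)
    also have "\<dots> \<le> (B + B) / (2 * pi)"
      using that norm_triangle_ineq4[of a b] by (intro divide_right_mono) auto
    also have "\<dots> \<le> B / 1"
    proof -
      have "0 \<le> B" using that(1) norm_ge_zero[of a] by linarith
      then show ?thesis using pi_ge_two by (simp add: divide_le_eq mult_le_cancel_left1)
    qed
    finally show ?thesis by simp
  qed
  have M: "M \<ge> 0" using EP(3)[OF pm(1), of 0] norm_ge_zero[of "P p 0"] by (simp del: norm_ge_zero)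
  define k where "k = \<kappa> / 3"
  have k: "k > 0" using \<kappa> by (simp add: k_def)
  have sc: "source_constant \<theta> \<mu> = k powr \<mu> * ray_moment (- \<mu>) + k powr (\<mu> - 1) * ray_moment (1 - \<mu>)"
    unfolding source_constant_def Let_def k_def \<kappa>_def p_def ..
  have "\<bar>g s\<bar> \<le> source_constant \<theta> \<mu> * M * s powr \<mu>" if s: "s > 0" for s
  proof -
    have ks: "(\<kappa> * s / 3) powr (\<mu> - real 0) = k powr \<mu> * s powr \<mu>" using k s by (simp add: k_def powr_mult[symmetric])
    have "cmod (J q s) \<le> M * ((\<kappa> * s / 3) powr (\<mu> - real 0) * ray_moment (real 0 - \<mu>))" if "\<bar>q\<bar> = p" for q
      using ray(2)[OF that that that that s, of 0] unfolding J_def by simp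
    then have "\<bar>g s\<bar> \<le> M * ((\<kappa> * s / 3) powr (\<mu> - real 0) * ray_moment (real 0 - \<mu>))"
      unfolding g_def using pm by (intro Re_le) auto
    also have "\<dots> = (k powr \<mu> * ray_moment (- \<mu>)) * (M * s powr \<mu>)" unfolding ks by simp
    also have "\<dots> \<le> source_constant \<theta> \<mu> * (M * s powr \<mu>)"
      unfolding sc using M by (intro mult_right_mono) (auto simp: ray_moment_nonneg)
    finally show ?thesis by (simp add: mult.assoc)
  qed
  moreover have "\<bar>g' s\<bar> \<le> source_constant \<theta> \<mu> * M * s powr (\<mu> - 1)" if s: "s > 0" for s
  proof -
    have ks: "(\<kappa> * s / 3) powr (\<mu> - real 1) = k powr (\<mu> - 1) * s powr (\<mu> - 1)" using k s by (simp add: k_def powr_mult[symmetric])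
    have "cmod (J1 q s) \<le> M * ((\<kappa> * s / 3) powr (\<mu> - real 1) * ray_moment (real 1 - \<mu>))" if "\<bar>q\<bar> = p" for q
      using ray(2)[OF that that that that s, of 1] unfolding J1_def by simp
    then have "\<bar>g' s\<bar> \<le> M * ((\<kappa> * s / 3) powr (\<mu> - real 1) * ray_moment (real 1 - \<mu>))"
      unfolding g'_def using pm by (intro Re_le) auto
    also have "\<dots> = (k powr (\<mu> - 1) * ray_moment (1 - \<mu>)) * (M * s powr (\<mu> - 1))" unfolding ks by simp
    also have "\<dots> \<le> source_constant \<theta> \<mu> * (M * s powr (\<mu> - 1))"
      unfolding sc using M by (intro mult_right_mono) (auto simp: ray_moment_nonneg)
    finally show ?thesis by (simp add: mult.assoc)
  qed
  moreover have "(g has_real_derivative g' s) (at s)" if s: "s > 0" for s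
  proof -
    note rd = ray_has_derivative[OF Pm Em EP(3) EP(1) EP(2) \<kappa> \<mu>]
    have "((\<lambda>u. (J q u - J q s) /\<^sub>R (u - s)) \<longlongrightarrow> J1 q s) (at s)" if "\<bar>q\<bar> = p" for q
      unfolding J_def J1_def by (rule rd[OF that that that that s])
    from this[OF pm(1)] this[OF pm(2)]
    have "((\<lambda>u. Re (((J p u - J p s) /\<^sub>R (u - s) - (J (- p) u - J (- p) s) /\<^sub>R (u - s)) / (2 * pi * \<i>))) \<longlongrightarrow> g' s) (at s)"
      unfolding g'_def by (intro tendsto_intros) auto
    moreover have "Re (((J p u - J p s) /\<^sub>R (u - s) - (J (- p) u - J (- p) s) /\<^sub>R (u - s)) / (2 * pi * \<i>)) = (g u - g s) / (u - s)" for u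
    proof -
      have quot: "Re (((a - b) /\<^sub>R h - (c - d) /\<^sub>R h) / e) = (Re ((a - c) / e) - Re ((b - d) / e)) / h" for a b c d e :: complex and h :: real
      proof -
        have "((a - b) /\<^sub>R h - (c - d) /\<^sub>R h) / e = ((a - c) / e - (b - d) / e) /\<^sub>R h"
          by (simp add: scaleR_conv_of_real divide_inverse algebra_simps)
        then show ?thesis by (simp only: scaleR_complex.sel minus_complex.sel divide_inverse mult.commute)
      qed
      show ?thesis unfolding g_def by (rule quot)
    qed
    ultimately show ?thesis unfolding has_field_derivative_iff by simp
  qed
  moreover have "AE t in lebesgue. t > 0 \<longrightarrow> f t = g t"
  proof -
    note rl = ray_laplace[OF Pm Em EP(3) EP(1) EP(2) \<kappa> \<mu>]
    define L where "L = (\<lambda>q s t. indicator {0<..} t *\<^sub>R (exp (- of_real (s * t)) * J q t))"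
    have LI: "integrable lborel (L q s)" "(LBINT t. L q s t) = (LBINT x. P q x / (of_real s - E q x))" if "s > 0" "\<bar>q\<bar> = p" for q s
      using rl[OF that(2) that(2) that(2) that(2) that(1)] unfolding L_def J_def by auto
    have Lg: "indicator {0<..} t * (exp (- s * t) * g t) = Re ((L p s t - L (- p) s t) / (2 * pi * \<i>))" for s t :: real
    proof -
      have "(L p s t - L (- p) s t) / (2 * pi * \<i>) = of_real (indicator {0<..} t * exp (- s * t)) * ((J p t - J (- p) t) / (2 * pi * \<i>))"
      proof -
        have lin: "(c *\<^sub>R (d * a) - c *\<^sub>R (d * b)) / e = of_real c * d * ((a - b) / e)" for a b d e :: complex and c :: real
          by (simp add: scaleR_conv_of_real diff_divide_distrib right_diff_distrib mult.assoc)
        have "complex_of_real (indicator {0<..} t * exp (- s * t)) = of_real (indicator {0<..} t) * exp (- of_real (s * t))"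
          by (simp add: exp_of_real[symmetric])
        then show ?thesis unfolding L_def lin by (simp only:)
      qed
      then show ?thesis by (simp only: g_def Re_of_real_mult mult.assoc)
    qed
    have gI: "integrable lborel (\<lambda>t. indicator {0<..} t * (exp (- s * t) * g t))" if "s > 0" for s
      unfolding Lg using LI(1)[OF that pm(1)] LI(1)[OF that pm(2)]
      by (intro integrable_Re integrable_divide_zero Bochner_Integration.integrable_diff)
    have gL: "(LBINT t. indicator {0<..} t * (exp (- s * t) * g t)) = Re (\<Phi> (of_real s))" if s: "s > 0" for s
    proof -
      have I: "integrable lborel (\<lambda>t. (L p s t - L (- p) s t) / (2 * pi * \<i>))"
        using LI(1)[OF s pm(1)] LI(1)[OF s pm(2)]
        by (intro integrable_divide_zero Bochner_Integration.integrable_diff)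
      have "(LBINT t. indicator {0<..} t * (exp (- s * t) * g t)) = Re (LBINT t. (L p s t - L (- p) s t) / (2 * pi * \<i>))"
        unfolding Lg by (rule integral_Re[OF I])
      also have "(LBINT t. (L p s t - L (- p) s t) / (2 * pi * \<i>)) = (LBINT t. L p s t - L (- p) s t) / (2 * pi * \<i>)"
        by (rule integral_divide_zero)
      also have "(LBINT t. L p s t - L (- p) s t) = (LBINT t. L p s t) - (LBINT t. L (- p) s t)"
        by (rule Bochner_Integration.integral_diff[OF LI(1)[OF s pm(1)] LI(1)[OF s pm(2)]])
      also have "\<dots> = (LBINT x. P p x / (of_real s - E p x)) - (LBINT x. P (- p) x / (of_real s - E (- p) x))"
        by (simp only: LI(2)[OF s pm(1)] LI(2)[OF s pm(2)])
      also have "\<dots> = (LBINT x. P (- p) x / (E (- p) x - of_real s)) - (LBINT x. P p x / (E p x - of_real s))"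
      proof -
        have n: "(LBINT x. P q x / (of_real s - E q x)) = - (LBINT x. P q x / (E q x - of_real s))" for q
        proof -
          have "P q x / (of_real s - E q x) = - (P q x / (E q x - of_real s))" for x
            by (metis minus_diff_eq minus_divide_right)
          then show ?thesis by (simp only: integral_minus)
        qed
        show ?thesis unfolding n by simp
      qed
      also have "\<dots> = 2 * pi * \<i> * \<Psi> (of_real (ln s))"
        unfolding P_def E_def
        by (rule cauchy_formula_strip(3)[OF holo' p(4) p(3) p(2) _ _ bound' s]) (use \<mu> in auto)
      also have "\<Psi> (of_real (ln s)) = \<Phi> (of_real s)" using s by (simp add: \<Psi>_def exp_of_real)
      finally show ?thesis by simp
    qed
    have fI: "integrable lebesgue (\<lambda>t. indicator {0<..} t * (exp (- s * t) * f t))" if s: "s \<ge> \<omega>" for s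
    proof (rule Bochner_Integration.integrable_bound[OF int])
      have "(\<lambda>t. exp (- (s - \<omega>) * t) * (indicator {0<..} t * (exp (- \<omega> * t) * f t))) \<in> borel_measurable lebesgue"
      proof (rule borel_measurable_times[OF _ borel_measurable_integrable[OF int]])
        have "(\<lambda>t :: real. exp (- (s - \<omega>) * t)) \<in> borel_measurable lborel" by simp
        then show "(\<lambda>t :: real. exp (- (s - \<omega>) * t)) \<in> borel_measurable lebesgue" by (rule measurable_completion)
      qed
      moreover have "exp (- (s - \<omega>) * t) * (indicator {0<..} t * (exp (- \<omega> * t) * f t)) = indicator {0<..} t * (exp (- s * t) * f t)" for t
      proof -
        have "exp (- s * t) = exp (- (s - \<omega>) * t) * exp (- \<omega> * t)" by (simp add: exp_add[symmetric] algebra_simps)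
        then show ?thesis by simp
      qed
      ultimately show "(\<lambda>t. indicator {0<..} t * (exp (- s * t) * f t)) \<in> borel_measurable lebesgue" by (simp only:)
      show "AE t in lebesgue. norm (indicator {0<..} t * (exp (- s * t) * f t)) \<le> norm (indicator {0<..} t * (exp (- \<omega> * t) * f t))"
      proof (intro AE_I2)
        fix t
        show "norm (indicator {0<..} t * (exp (- s * t) * f t)) \<le> norm (indicator {0<..} t * (exp (- \<omega> * t) * f t))"
        proof (cases "t > 0")
          case True
          then have "exp (- s * t) * \<bar>f t\<bar> \<le> exp (- \<omega> * t) * \<bar>f t\<bar>" using s by (intro mult_right_mono) auto
          then show ?thesis using True by (simp add: abs_mult)
        qed simp
      qed
    qed
    have "AE t in lebesgue. t > 0 \<longrightarrow> f t - g t = 0"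
    proof (rule laplace_transform_unique[where \<sigma> = "\<omega> + 1"])
      have gI': "integrable lebesgue (\<lambda>t. indicator {0<..} t * (exp (- s * t) * g t))"
        "(LINT t|lebesgue. indicator {0<..} t * (exp (- s * t) * g t)) = Re (\<Phi> (of_real s))" if "s > 0" for s
        using gI[OF that] gL[OF that] by (auto simp: integrable_completion integral_completion borel_measurable_integrable)
      have split: "indicator {0<..} t * (exp (- s * t) * (f t - g t)) = indicator {0<..} t * (exp (- s * t) * f t) - indicator {0<..} t * (exp (- s * t) * g t)" for s t
        by (simp add: algebra_simps)
      show "integrable lebesgue (\<lambda>t. indicator {0<..} t * (exp (- (\<omega> + 1) * t) * (f t - g t)))"
        unfolding split using \<omega> by (intro Bochner_Integration.integrable_diff fI gI') auto
      fix z assume z: "z > \<omega> + 1"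
      have "(LINT t|lebesgue. indicator {0<..} t * (exp (- z * t) * (f t - g t))) =
         (LINT t|lebesgue. indicator {0<..} t * (exp (- z * t) * f t)) - (LINT t|lebesgue. indicator {0<..} t * (exp (- z * t) * g t))"
        unfolding split using \<omega> z by (intro Bochner_Integration.integral_diff fI gI') auto
      also have "\<dots> = 0" using gI'(2)[of z] lapl[of z] \<omega> z by simp
      finally show "(LINT t|lebesgue. indicator {0<..} t * (exp (- z * t) * (f t - g t))) = 0" .
    qed
    then show ?thesis by eventually_elim auto
  qed
  ultimately show ?thesis using that by blast
qed

section \<open>The finite element space and its discrete Laplacian\<close>

lemma borel_measurable_spike:
  fixes f g :: "'a::euclidean_space \<Rightarrow> 'b::euclidean_space"
  assumes S: "S \<in> sets lebesgue" and f: "f \<in> borel_measurable (lebesgue_on S)"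
    and N: "negligible N" "\<And>x. x \<in> S - N \<Longrightarrow> g x = f x"
  shows "g \<in> borel_measurable (lebesgue_on S)"
proof -
  have "f measurable_on S" using f measurable_on_iff_borel_measurable[OF S] by blast
  then have "g measurable_on S" by (rule measurable_on_spike[OF _ N(1)]) (use N(2) in auto)
  then show ?thesis using measurable_on_iff_borel_measurable[OF S] by blast
qed

context
  fixes \<Omega> :: "'a::euclidean_space set"
begin

lemma norm_mult_le_squares: "norm a * norm b \<le> (norm a)\<^sup>2 + (norm b)\<^sup>2" for a :: "'c::real_normed_vector" and b :: "'d::real_normed_vector"
proof -
  have "0 \<le> (norm a - norm b)\<^sup>2" by simp
  then have "2 * (norm a * norm b) \<le> (norm a)\<^sup>2 + (norm b)\<^sup>2" by (simp add: power2_diff)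
  moreover have "0 \<le> norm a * norm b" by simp
  ultimately show ?thesis by linarith
qed

lemma L2_norm_product_integrable:
  fixes u :: "'a \<Rightarrow> 'b::euclidean_space" and v :: "'a \<Rightarrow> 'c::euclidean_space"
  assumes "u \<in> L2 \<Omega>" "v \<in> L2 \<Omega>"
  shows "integrable (lebesgue_on \<Omega>) (\<lambda>x. norm (u x) * norm (v x))"
proof (rule Bochner_Integration.integrable_bound)
  show "integrable (lebesgue_on \<Omega>) (\<lambda>x. (norm (u x))\<^sup>2 + (norm (v x))\<^sup>2)"
    using assms unfolding L2_def by auto
  show "(\<lambda>x. norm (u x) * norm (v x)) \<in> borel_measurable (lebesgue_on \<Omega>)"
    using assms unfolding L2_def by auto
  show "AE x in lebesgue_on \<Omega>. norm (norm (u x) * norm (v x)) \<le> norm ((norm (u x))\<^sup>2 + (norm (v x))\<^sup>2)"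
    using norm_mult_le_squares by (intro AE_I2) (auto intro: order_trans)
qed

lemma L2_inner_integrable:
  fixes u v :: "'a \<Rightarrow> 'b::euclidean_space"
  assumes "u \<in> L2 \<Omega>" "v \<in> L2 \<Omega>"
  shows "integrable (lebesgue_on \<Omega>) (\<lambda>x. u x \<bullet> v x)"
proof (rule Bochner_Integration.integrable_bound[OF L2_norm_product_integrable[OF assms]])
  show "(\<lambda>x. u x \<bullet> v x) \<in> borel_measurable (lebesgue_on \<Omega>)"
    using assms unfolding L2_def by auto
  show "AE x in lebesgue_on \<Omega>. norm (u x \<bullet> v x) \<le> norm (norm (u x) * norm (v x))"
    by (intro AE_I2) (simp add: Cauchy_Schwarz_ineq2)
qed

lemma L2_combination:
  fixes u v :: "'a \<Rightarrow> 'b::euclidean_space"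
  assumes "u \<in> L2 \<Omega>" "v \<in> L2 \<Omega>"
  shows "(\<lambda>x. u x + c *\<^sub>R v x) \<in> L2 \<Omega>"
proof -
  have m: "(\<lambda>x. u x + c *\<^sub>R v x) \<in> borel_measurable (lebesgue_on \<Omega>)"
    using assms unfolding L2_def by auto
  have e: "(norm (u x + c *\<^sub>R v x))\<^sup>2 = (norm (u x))\<^sup>2 + 2 * c * (u x \<bullet> v x) + c\<^sup>2 * (norm (v x))\<^sup>2" for x
    unfolding power2_norm_eq_inner by (simp add: inner_add_left inner_add_right inner_commute power2_eq_square algebra_simps)
  have "integrable (lebesgue_on \<Omega>) (\<lambda>x. (norm (u x + c *\<^sub>R v x))\<^sup>2)"
    unfolding e using assms L2_inner_integrable[OF assms] unfolding L2_def by auto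
  then show ?thesis using m unfolding L2_def by simp
qed

text \<open>
  The inequality of Cauchy and Schwarz, from that of the arithmetic and geometric mean with
  optimal weights; the shift by \<open>e\<close> keeps the weights finite when a norm vanishes.
\<close>

lemma L2_norm_product_le:
  fixes u :: "'a \<Rightarrow> 'b::euclidean_space" and v :: "'a \<Rightarrow> 'c::euclidean_space"
  assumes u: "u \<in> L2 \<Omega>" and v: "v \<in> L2 \<Omega>"
  shows "(LINT x|lebesgue_on \<Omega>. norm (u x) * norm (v x)) \<le> l2_norm \<Omega> u * l2_norm \<Omega> v"
proof -
  define a b m where "a = (LINT x|lebesgue_on \<Omega>. (norm (u x))\<^sup>2)" and "b = (LINT x|lebesgue_on \<Omega>. (norm (v x))\<^sup>2)"
    and "m = (LINT x|lebesgue_on \<Omega>. norm (u x) * norm (v x))"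
  have a0: "a \<ge> 0" and b0: "b \<ge> 0" unfolding a_def b_def by simp_all
  have Iu: "integrable (lebesgue_on \<Omega>) (\<lambda>x. (norm (u x))\<^sup>2)" and Iv: "integrable (lebesgue_on \<Omega>) (\<lambda>x. (norm (v x))\<^sup>2)"
    using u v unfolding L2_def by auto
  have le: "m \<le> (sqrt a + e) * (sqrt b + e)" if e: "e > 0" for e
  proof -
    define p q where "p = sqrt a + e" and "q = sqrt b + e"
    have p: "p > 0" "a \<le> p\<^sup>2" and q: "q > 0" "b \<le> q\<^sup>2"
      using e a0 b0 by (auto simp: p_def q_def power2_sum add_nonneg_pos)
    have pt: "norm (u x) * norm (v x) \<le> (q / p / 2) * (norm (u x))\<^sup>2 + (p / q / 2) * (norm (v x))\<^sup>2" for x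
    proof -
      have "0 \<le> (q * norm (u x) - p * norm (v x))\<^sup>2" by simp
      then have "2 * p * q * (norm (u x) * norm (v x)) \<le> q\<^sup>2 * (norm (u x))\<^sup>2 + p\<^sup>2 * (norm (v x))\<^sup>2"
        by (simp add: power2_diff power_mult_distrib mult_ac)
      then have "norm (u x) * norm (v x) \<le> (q\<^sup>2 * (norm (u x))\<^sup>2 + p\<^sup>2 * (norm (v x))\<^sup>2) / (2 * p * q)"
        using p q by (simp add: pos_le_divide_eq mult_ac)
      also have "\<dots> = (q / p / 2) * (norm (u x))\<^sup>2 + (p / q / 2) * (norm (v x))\<^sup>2"
        using p q by (simp add: power2_eq_square add_divide_distrib)
      finally show ?thesis .
    qed
    have "m \<le> (LINT x|lebesgue_on \<Omega>. (q / p / 2) * (norm (u x))\<^sup>2 + (p / q / 2) * (norm (v x))\<^sup>2)"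
      unfolding m_def using pt Iu Iv
      by (intro integral_mono L2_norm_product_integrable[OF u v]) auto
    also have "\<dots> = (q / p / 2) * a + (p / q / 2) * b" using Iu Iv by (simp add: a_def b_def)
    also have "\<dots> \<le> (q / p / 2) * p\<^sup>2 + (p / q / 2) * q\<^sup>2"
      using p q by (intro add_mono mult_left_mono) auto
    also have "\<dots> = p * q" using p q by (simp add: power2_eq_square)
    finally show ?thesis by (simp add: p_def q_def)
  qed
  have "(\<lambda>n. (sqrt a + 1 / real (Suc n)) * (sqrt b + 1 / real (Suc n))) \<longlonglongrightarrow> (sqrt a + 0) * (sqrt b + 0)"
    by (intro tendsto_intros LIMSEQ_Suc[OF lim_1_over_n])
  then have "m \<le> (sqrt a + 0) * (sqrt b + 0)"
    by (rule LIMSEQ_le_const) (use le in auto)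
  then show ?thesis unfolding m_def a_def b_def l2_norm_def by simp
qed

lemma l2_norm_combination_le:
  fixes u v :: "'a \<Rightarrow> 'b::euclidean_space"
  assumes u: "u \<in> L2 \<Omega>" and v: "v \<in> L2 \<Omega>"
  shows "l2_norm \<Omega> (\<lambda>x. u x + c *\<^sub>R v x) \<le> sqrt (2 * (l2_norm \<Omega> u)\<^sup>2 + 2 * c\<^sup>2 * (l2_norm \<Omega> v)\<^sup>2)"
proof -
  have Iu: "integrable (lebesgue_on \<Omega>) (\<lambda>x. (norm (u x))\<^sup>2)" and Iv: "integrable (lebesgue_on \<Omega>) (\<lambda>x. (norm (v x))\<^sup>2)"
    using u v unfolding L2_def by auto
  have pt: "(norm (u x + c *\<^sub>R v x))\<^sup>2 \<le> 2 * (norm (u x))\<^sup>2 + 2 * c\<^sup>2 * (norm (v x))\<^sup>2" for x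
  proof -
    have "0 \<le> (norm (u x - c *\<^sub>R v x))\<^sup>2" by simp
    moreover have "(norm (u x + c *\<^sub>R v x))\<^sup>2 + (norm (u x - c *\<^sub>R v x))\<^sup>2 = 2 * (norm (u x))\<^sup>2 + 2 * c\<^sup>2 * (norm (v x))\<^sup>2"
      unfolding power2_norm_eq_inner
      by (simp add: inner_add_left inner_add_right inner_diff_left inner_diff_right inner_commute power2_eq_square algebra_simps)
    ultimately show ?thesis by linarith
  qed
  have "(LINT x|lebesgue_on \<Omega>. (norm (u x + c *\<^sub>R v x))\<^sup>2) \<le> (LINT x|lebesgue_on \<Omega>. 2 * (norm (u x))\<^sup>2 + 2 * c\<^sup>2 * (norm (v x))\<^sup>2)"
    using L2_combination[OF u v, of c] Iu Iv pt unfolding L2_def by (intro integral_mono) auto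
  also have "\<dots> = 2 * (l2_norm \<Omega> u)\<^sup>2 + 2 * c\<^sup>2 * (l2_norm \<Omega> v)\<^sup>2"
    using Iu Iv by (simp add: l2_norm_def)
  finally show ?thesis unfolding l2_norm_def[of _ "\<lambda>x. u x + c *\<^sub>R v x"] by (rule real_sqrt_le_mono)
qed

lemma l2_norm_combination_tendsto:
  fixes u v :: "nat \<Rightarrow> 'a \<Rightarrow> 'b::euclidean_space"
  assumes "\<And>k. u k \<in> L2 \<Omega>" "\<And>k. v k \<in> L2 \<Omega>"
    and "(\<lambda>k. l2_norm \<Omega> (u k)) \<longlonglongrightarrow> 0" "(\<lambda>k. l2_norm \<Omega> (v k)) \<longlonglongrightarrow> 0"
  shows "(\<lambda>k. l2_norm \<Omega> (\<lambda>x. u k x + c *\<^sub>R v k x)) \<longlonglongrightarrow> 0"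
proof (rule Lim_null_comparison)
  have "(\<lambda>k. sqrt (2 * (l2_norm \<Omega> (u k))\<^sup>2 + 2 * c\<^sup>2 * (l2_norm \<Omega> (v k))\<^sup>2)) \<longlonglongrightarrow> sqrt (2 * 0\<^sup>2 + 2 * c\<^sup>2 * 0\<^sup>2)"
    by (intro tendsto_intros assms)
  then show "(\<lambda>k. sqrt (2 * (l2_norm \<Omega> (u k))\<^sup>2 + 2 * c\<^sup>2 * (l2_norm \<Omega> (v k))\<^sup>2)) \<longlonglongrightarrow> 0" by simp
  show "\<forall>\<^sub>F k in sequentially. norm (l2_norm \<Omega> (\<lambda>x. u k x + c *\<^sub>R v k x)) \<le> sqrt (2 * (l2_norm \<Omega> (u k))\<^sup>2 + 2 * c\<^sup>2 * (l2_norm \<Omega> (v k))\<^sup>2)"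
    using l2_norm_combination_le[OF assms(1,2)]
    by (intro always_eventually allI) (simp add: l2_norm_def)
qed

end

lemma gderiv_unique:
  assumes "GDERIV v x :> D" "GDERIV v x :> D'"
  shows "D = D'"
proof -
  have "(\<lambda>h. h \<bullet> D) = (\<lambda>h. h \<bullet> D')"
    using assms unfolding gderiv_def by (rule has_derivative_unique)
  then have "(D - D') \<bullet> (D - D') = 0" by (metis inner_diff_right right_minus_eq)
  then show ?thesis by simp
qed

lemma grad_eq: "GDERIV v x :> D \<Longrightarrow> grad v x = D"
  unfolding grad_def by (rule the_equality) (auto intro: gderiv_unique)

lemma gderiv_combination:
  assumes "GDERIV u x :> D" "GDERIV v x :> D'"
  shows "GDERIV (\<lambda>x. u x + c * v x) x :> D + c *\<^sub>R D'"
proof -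
  have "((\<lambda>x. u x + c * v x) has_derivative (\<lambda>h. h \<bullet> D + c * (h \<bullet> D'))) (at x)"
    using assms unfolding gderiv_def by (intro has_derivative_add has_derivative_mult_right)
  then show ?thesis unfolding gderiv_def by (simp add: inner_add_right)
qed

lemma Ck_combination: "Ck k u \<Longrightarrow> Ck k v \<Longrightarrow> Ck k (\<lambda>x. u x + c * v x)"
proof (induction k arbitrary: u v)
  case 0
  then show ?case by (auto intro!: continuous_intros)
next
  case (Suc k)
  have d: "u differentiable (at x)" "v differentiable (at x)" for x
    using Suc.prems by (auto simp: differentiable_on_def)
  have hd: "((\<lambda>x. u x + c * v x) has_derivative (\<lambda>h. frechet_derivative u (at x) h + c * frechet_derivative v (at x) h)) (at x)" for x
    using d[of x] unfolding frechet_derivative_works by (intro has_derivative_add has_derivative_mult_right)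
  have fd: "frechet_derivative (\<lambda>x. u x + c * v x) (at x) = (\<lambda>h. frechet_derivative u (at x) h + c * frechet_derivative v (at x) h)" for x
    using frechet_derivative_at[OF hd[of x]] by simp
  have "(\<lambda>x. u x + c * v x) differentiable_on UNIV"
    using hd unfolding differentiable_on_def differentiable_def by auto
  moreover have "Ck k (\<lambda>x. frechet_derivative (\<lambda>x. u x + c * v x) (at x) b)" if "b \<in> Basis" for b
    unfolding fd using Suc.prems that by (intro Suc.IH) auto
  ultimately show ?case by simp
qed

lemma Ck_zero: "Ck k (\<lambda>x. 0)"
proof (induction k)
  case (Suc k)
  have "frechet_derivative (\<lambda>x::'a. 0::real) (at x) = (\<lambda>h. 0)" for x
    by (rule frechet_derivative_at[symmetric]) (rule has_derivative_const)
  then show ?case using Suc by simp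
qed simp

lemma test_functions_combination:
  assumes "\<phi> \<in> test_functions \<Omega>" "\<psi> \<in> test_functions \<Omega>"
  shows "(\<lambda>x. \<phi> x + c * \<psi> x) \<in> test_functions \<Omega>"
proof -
  obtain K K' where K: "compact K" "K \<subseteq> \<Omega>" "\<And>x. x \<notin> K \<Longrightarrow> \<phi> x = 0"
    and K': "compact K'" "K' \<subseteq> \<Omega>" "\<And>x. x \<notin> K' \<Longrightarrow> \<psi> x = 0"
    using assms unfolding test_functions_def by auto
  have "\<exists>K. compact K \<and> K \<subseteq> \<Omega> \<and> (\<forall>x. x \<notin> K \<longrightarrow> \<phi> x + c * \<psi> x = 0)"
    using K K' by (intro exI[of _ "K \<union> K'"]) (auto intro: compact_Un)
  then show ?thesis using assms Ck_combination unfolding test_functions_def by blast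
qed

lemma test_functions_zero: "(\<lambda>x. 0) \<in> test_functions \<Omega>"
  unfolding test_functions_def
proof (intro CollectI conjI allI exI)
  show "Ck k (\<lambda>x. 0)" for k by (rule Ck_zero)
  show "compact {}" "{} \<subseteq> \<Omega>" by auto
qed simp

lemma test_function_gderiv:
  assumes "\<phi> \<in> test_functions \<Omega>"
  shows "GDERIV \<phi> x :> grad \<phi> x"
    and "grad \<phi> x = (\<Sum>b\<in>Basis. frechet_derivative \<phi> (at x) b *\<^sub>R b)"
proof -
  have "Ck (Suc 0) \<phi>" using assms unfolding test_functions_def by blast
  then have "\<phi> differentiable (at x)" by (simp add: differentiable_on_def)
  then have hd: "(\<phi> has_derivative frechet_derivative \<phi> (at x)) (at x)" by (simp add: frechet_derivative_works)
  have "frechet_derivative \<phi> (at x) h = h \<bullet> (\<Sum>b\<in>Basis. frechet_derivative \<phi> (at x) b *\<^sub>R b)" for h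
  proof -
    have "linear (frechet_derivative \<phi> (at x))" using hd by (rule has_derivative_linear)
    then have "frechet_derivative \<phi> (at x) (\<Sum>b\<in>Basis. (h \<bullet> b) *\<^sub>R b) = (\<Sum>b\<in>Basis. (h \<bullet> b) *\<^sub>R frechet_derivative \<phi> (at x) b)"
      by (simp add: linear_sum linear_scale)
    then show ?thesis by (simp add: euclidean_representation inner_sum_right mult.commute)
  qed
  then have "GDERIV \<phi> x :> (\<Sum>b\<in>Basis. frechet_derivative \<phi> (at x) b *\<^sub>R b)"
    using hd unfolding gderiv_def by (metis (no_types, lifting) ext)
  then show "GDERIV \<phi> x :> grad \<phi> x"  "grad \<phi> x = (\<Sum>b\<in>Basis. frechet_derivative \<phi> (at x) b *\<^sub>R b)"
    using grad_eq by metis+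
qed

lemma bounded_borel_in_L2:
  fixes f :: "'a::euclidean_space \<Rightarrow> 'b::euclidean_space"
  assumes \<Omega>: "bounded \<Omega>" "\<Omega> \<in> sets lebesgue" and f: "f \<in> borel_measurable (lebesgue_on \<Omega>)" and B: "\<And>x. norm (f x) \<le> B"
  shows "f \<in> L2 \<Omega>"
proof -
  interpret finite_measure "lebesgue_on \<Omega>"
    by (rule finite_measure_lebesgue_on) (use \<Omega> bounded_set_imp_lmeasurable in blast)
  have "integrable (lebesgue_on \<Omega>) (\<lambda>x. (norm (f x))\<^sup>2)"
  proof (rule integrable_const_bound[where B = "B\<^sup>2"])
    show "AE x in lebesgue_on \<Omega>. norm ((norm (f x))\<^sup>2) \<le> B\<^sup>2"
      using B by (intro AE_I2) (simp add: power_mono)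
  qed (use f in measurable)
  then show ?thesis using f unfolding L2_def by simp
qed

lemma continuous_compact_support_in_L2:
  fixes f :: "'a::euclidean_space \<Rightarrow> 'b::euclidean_space"
  assumes \<Omega>: "bounded \<Omega>" "\<Omega> \<in> sets lebesgue" and f: "continuous_on UNIV f" and K: "compact K" "\<And>x. x \<notin> K \<Longrightarrow> f x = 0"
  shows "f \<in> L2 \<Omega>"
proof -
  have "bounded (f ` K)" using K f by (intro compact_imp_bounded compact_continuous_image) (auto intro: continuous_on_subset)
  then obtain B where B: "\<And>x. x \<in> K \<Longrightarrow> norm (f x) \<le> B" unfolding bounded_iff by blast
  have "norm (f x) \<le> max B 0" for x using B[of x] K(2)[of x] by (cases "x \<in> K") auto
  moreover have "f \<in> borel_measurable borel" using f by (rule borel_measurable_continuous_onI)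
  then have "f \<in> borel_measurable (lebesgue_on \<Omega>)" by (simp add: measurable_completion measurable_restrict_space1)
  ultimately show ?thesis by (rule bounded_borel_in_L2[OF \<Omega>, rotated])
qed

lemma test_function_L2:
  assumes \<Omega>: "bounded \<Omega>" "\<Omega> \<in> sets lebesgue" and \<phi>: "\<phi> \<in> test_functions \<Omega>"
  shows "\<phi> \<in> L2 \<Omega>" and "grad \<phi> \<in> L2 \<Omega>"
proof -
  obtain K where K: "compact K" "\<And>x. x \<notin> K \<Longrightarrow> \<phi> x = 0" using \<phi> unfolding test_functions_def by auto
  have "Ck 0 \<phi>" "Ck (Suc 0) \<phi>" using \<phi> unfolding test_functions_def by blast+
  then have c: "continuous_on UNIV \<phi>" "\<And>b. b \<in> Basis \<Longrightarrow> continuous_on UNIV (\<lambda>x. frechet_derivative \<phi> (at x) b)" by auto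
  show "\<phi> \<in> L2 \<Omega>" by (rule continuous_compact_support_in_L2[OF \<Omega> c(1) K])
  show "grad \<phi> \<in> L2 \<Omega>"
  proof (rule continuous_compact_support_in_L2[OF \<Omega> _ K(1)])
    have "grad \<phi> = (\<lambda>x. \<Sum>b\<in>Basis. frechet_derivative \<phi> (at x) b *\<^sub>R b)"
      using test_function_gderiv(2)[OF \<phi>] by blast
    then show "continuous_on UNIV (grad \<phi>)" using c(2) by (auto intro!: continuous_intros)
    fix x assume x: "x \<notin> K"
    have "open (- K)" using K(1) compact_imp_closed by blast
    have "((\<lambda>x. 0) has_derivative (\<lambda>h. h \<bullet> 0)) (at x)" by simp
    then have "GDERIV \<phi> x :> 0" unfolding gderiv_def
      by (rule has_derivative_transform_within_open[OF _ \<open>open (- K)\<close>]) (use x K(2) in auto)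
    then show "grad \<phi> x = 0" by (rule grad_eq)
  qed
qed

text \<open>
  For test functions the gradient is a classical one, so the approximating sequences can be
  combined.
\<close>

lemma H10_combination:
  assumes \<Omega>: "bounded \<Omega>" "\<Omega> \<in> sets lebesgue" and v: "v \<in> H10 \<Omega>" and w: "w \<in> H10 \<Omega>"
  shows "(\<lambda>x. v x + c * w x) \<in> H10 \<Omega>"
proof -
  obtain \<phi> g where v2: "v \<in> L2 \<Omega>" "g \<in> L2 \<Omega>" "\<And>k. \<phi> k \<in> test_functions \<Omega>"
    "(\<lambda>k::nat. l2_norm \<Omega> (\<lambda>x. \<phi> k x - v x)) \<longlonglongrightarrow> 0" "(\<lambda>k. l2_norm \<Omega> (\<lambda>x. grad (\<phi> k) x - g x)) \<longlonglongrightarrow> 0"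
    using v unfolding H10_def by blast
  obtain \<psi> k where w2: "w \<in> L2 \<Omega>" "k \<in> L2 \<Omega>" "\<And>k. \<psi> k \<in> test_functions \<Omega>"
    "(\<lambda>k::nat. l2_norm \<Omega> (\<lambda>x. \<psi> k x - w x)) \<longlonglongrightarrow> 0" "(\<lambda>i. l2_norm \<Omega> (\<lambda>x. grad (\<psi> i) x - k x)) \<longlonglongrightarrow> 0"
    using w unfolding H10_def by blast
  have d: "(\<lambda>x. a x - b x) \<in> L2 \<Omega>" if "a \<in> L2 \<Omega>" "b \<in> L2 \<Omega>" for a b :: "'a \<Rightarrow> 'c::euclidean_space"
    using L2_combination[OF that, of "-1"] by simp
  have 1: "(\<lambda>x. v x + c * w x) \<in> L2 \<Omega>" "(\<lambda>x. g x + c *\<^sub>R k x) \<in> L2 \<Omega>"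
    using L2_combination[OF v2(1) w2(1), of c] L2_combination[OF v2(2) w2(2), of c] by auto
  have 2: "(\<lambda>x. \<phi> i x + c * \<psi> i x) \<in> test_functions \<Omega>" for i by (intro test_functions_combination v2 w2)
  have "(\<lambda>i. l2_norm \<Omega> (\<lambda>x. (\<phi> i x - v x) + c *\<^sub>R (\<psi> i x - w x))) \<longlonglongrightarrow> 0"
    by (intro l2_norm_combination_tendsto d test_function_L2[OF \<Omega>] v2 w2)
  moreover have "(\<phi> i x - v x) + c *\<^sub>R (\<psi> i x - w x) = (\<phi> i x + c * \<psi> i x) - (v x + c * w x)" for i x
    by (simp add: algebra_simps)
  ultimately have 3: "(\<lambda>i. l2_norm \<Omega> (\<lambda>x. (\<phi> i x + c * \<psi> i x) - (v x + c * w x))) \<longlonglongrightarrow> 0" by (simp only:)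
  have "(\<lambda>i. l2_norm \<Omega> (\<lambda>x. (grad (\<phi> i) x - g x) + c *\<^sub>R (grad (\<psi> i) x - k x))) \<longlonglongrightarrow> 0"
    by (intro l2_norm_combination_tendsto d test_function_L2[OF \<Omega>] v2 w2)
  moreover have "(grad (\<phi> i) x - g x) + c *\<^sub>R (grad (\<psi> i) x - k x) = grad (\<lambda>x. \<phi> i x + c * \<psi> i x) x - (g x + c *\<^sub>R k x)" for i x
    using grad_eq[OF gderiv_combination[OF test_function_gderiv(1)[OF v2(3)] test_function_gderiv(1)[OF w2(3)]], of i c i x]
    by (simp add: algebra_simps)
  ultimately have 4: "(\<lambda>i. l2_norm \<Omega> (\<lambda>x. grad (\<lambda>x. \<phi> i x + c * \<psi> i x) x - (g x + c *\<^sub>R k x))) \<longlonglongrightarrow> 0" by (simp only:)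
  show ?thesis unfolding H10_def using 1 2 3 4
    by (intro CollectI conjI exI[of _ "\<lambda>i x. \<phi> i x + c * \<psi> i x"] bexI[of _ "\<lambda>x. g x + c *\<^sub>R k x"] allI)
qed

lemma L2_zero: "(\<lambda>x. 0) \<in> L2 \<Omega>" unfolding L2_def by simp

lemma H10_zero: "(\<lambda>x. 0) \<in> H10 \<Omega>"
proof -
  have "GDERIV (\<lambda>x. 0::real) x :> 0" for x :: 'a unfolding gderiv_def by simp
  then have "grad (\<lambda>x. 0) x = 0" for x :: 'a by (rule grad_eq)
  note g0 = this
  show ?thesis unfolding H10_def
  proof (intro CollectI conjI exI[of _ "\<lambda>i x. 0"] bexI[of _ "\<lambda>x. 0"] allI)
    show "(\<lambda>x. 0) \<in> L2 \<Omega>" by (rule L2_zero)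
    show "(\<lambda>x. 0) \<in> L2 \<Omega>" by (rule L2_zero)
    show "(\<lambda>x. 0) \<in> test_functions \<Omega>" by (rule test_functions_zero)
  qed (simp_all add: g0 l2_norm_def)
qed

context
  fixes \<Omega> :: "'a::euclidean_space set" and \<T> :: "'a set set" and \<kappa> h :: real
  assumes \<Omega>: "open \<Omega>" and T: "regular_triangulation \<kappa> \<Omega> h \<T>"
begin

lemma finite_triangulation: "finite \<T>"
  using T unfolding regular_triangulation_def triangulation_def by blast

lemma simplex_vertices: "K \<in> \<T> \<Longrightarrow> \<exists>C. finite C \<and> K = convex hull C"
proof -
  assume "K \<in> \<T>"
  then have "int DIM('a) simplex K" using T unfolding regular_triangulation_def by simp
  then obtain C where "\<not> affine_dependent C" "K = convex hull C" unfolding simplex_def by auto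
  then show ?thesis using aff_independent_finite by auto
qed

lemma simplex_convex: "K \<in> \<T> \<Longrightarrow> convex K"
proof -
  assume "K \<in> \<T>"
  then obtain C where "K = convex hull C" using simplex_vertices by auto
  then show ?thesis by simp
qed

lemma union_triangulation: "\<Union>\<T> = closure \<Omega>"
  using T unfolding regular_triangulation_def by blast

lemma bounded_domain: "bounded \<Omega>"
proof -
  have "bounded K" if K: "K \<in> \<T>" for K
  proof -
    obtain C where "finite C" "K = convex hull C" using simplex_vertices[OF K] by auto
    then show ?thesis by (simp add: bounded_convex_hull finite_imp_bounded)
  qed
  then have "bounded (\<Union>\<T>)" using finite_triangulation by (intro bounded_Union) auto
  then show ?thesis unfolding union_triangulation by (rule bounded_subset) (rule closure_subset)
qed

lemma lebesgue_domain: "\<Omega> \<in> sets lebesgue"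
  using \<Omega> by simp

lemma Xh_L2: "v \<in> Xh \<Omega> \<T> \<Longrightarrow> v \<in> L2 \<Omega>"
  unfolding Xh_def H10_def by blast

lemma Xh_combination:
  assumes v: "v \<in> Xh \<Omega> \<T>" and w: "w \<in> Xh \<Omega> \<T>"
  shows "(\<lambda>x. v x + c * w x) \<in> Xh \<Omega> \<T>"
proof -
  have "\<exists>a b. \<forall>x\<in>K. v x + c * w x = a \<bullet> x + b" if "K \<in> \<T>" for K
  proof -
    have "\<exists>a b. \<forall>x\<in>K. v x = a \<bullet> x + b" "\<exists>a b. \<forall>x\<in>K. w x = a \<bullet> x + b" using v w that unfolding Xh_def by blast+
    then obtain a b a' b' where "\<forall>x\<in>K. v x = a \<bullet> x + b" "\<forall>x\<in>K. w x = a' \<bullet> x + b'" by metis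
    then show ?thesis
      by (intro exI[of _ "a + c *\<^sub>R a'"] exI[of _ "b + c * b'"]) (simp add: inner_add_left algebra_simps)
  qed
  moreover have "continuous_on (closure \<Omega>) (\<lambda>x. v x + c * w x)"
    using v w unfolding Xh_def by (auto intro!: continuous_intros)
  ultimately show ?thesis
    using v w H10_combination[OF bounded_domain lebesgue_domain, of v w c] unfolding Xh_def by simp
qed

lemma Xh_zero: "(\<lambda>x. 0) \<in> Xh \<Omega> \<T>"
  unfolding Xh_def
proof (intro CollectI conjI ballI allI impI)
  show "(\<lambda>x. 0) \<in> H10 \<Omega>" by (rule H10_zero)
  show "\<exists>a b. \<forall>x\<in>K. 0 = a \<bullet> x + b" for K :: "'a set" by (intro exI[of _ 0]) simp
qed auto

text \<open>
  A continuous function that vanishes almost everywhere on an open set vanishes on its closure.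
\<close>

lemma Xh_definite:
  assumes v: "v \<in> Xh \<Omega> \<T>" and 0: "l2_inner \<Omega> v v = 0"
  shows "v = (\<lambda>x. 0)"
proof -
  have c: "continuous_on (closure \<Omega>) v" and out: "\<And>x. x \<notin> closure \<Omega> \<Longrightarrow> v x = 0"
    using v unfolding Xh_def by auto
  have "AE x in lebesgue_on \<Omega>. v x \<bullet> v x = 0"
    using 0 L2_inner_integrable[OF Xh_L2[OF v] Xh_L2[OF v]] unfolding l2_inner_def
    by (subst (asm) integral_nonneg_eq_0_iff_AE) auto
  then have "AE x in lebesgue. x \<in> \<Omega> \<longrightarrow> v x = 0"
    using lebesgue_domain by (simp add: AE_restrict_space_iff)
  moreover have op: "open {x \<in> \<Omega>. v x \<noteq> 0}"
  proof -
    have "open (\<Omega> \<inter> v -` (- {0}))"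
      using c closure_subset \<Omega> by (intro continuous_open_preimage) (auto intro: continuous_on_subset)
    then show ?thesis by (simp add: vimage_def Int_def)
  qed
  ultimately have "AE x in lebesgue. x \<notin> {x \<in> \<Omega>. v x \<noteq> 0}" by simp
  moreover have "{x \<in> \<Omega>. v x \<noteq> 0} \<in> sets lebesgue" using op by simp
  ultimately have "{x \<in> \<Omega>. v x \<noteq> 0} \<in> null_sets lebesgue" by (simp add: AE_iff_null_sets)
  then have "negligible {x \<in> \<Omega>. v x \<noteq> 0}" by (simp add: negligible_iff_null_sets)
  then have "{x \<in> \<Omega>. v x \<noteq> 0} = {}" using op open_not_negligible by blast
  then have z: "\<And>x. x \<in> \<Omega> \<Longrightarrow> v x = 0" by blast
  have "v x = 0" if "x \<in> closure \<Omega>" for x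
    using continuous_constant_on_closure[OF c z that] .
  then show ?thesis using out by blast
qed

text \<open>
  Any finite sets spanning the elements as convex hulls would do; they are only used to determine
  affine functions.
\<close>

definition vertices :: "'a set" where
  "vertices = (\<Union>K\<in>\<T>. SOME C. finite C \<and> K = convex hull C)"

lemma vertices_of: "K \<in> \<T> \<Longrightarrow> finite (SOME C. finite C \<and> K = convex hull C) \<and> K = convex hull (SOME C. finite C \<and> K = convex hull C)"
  using someI_ex[OF simplex_vertices] .

lemma finite_vertices: "finite vertices"
  unfolding vertices_def using finite_triangulation vertices_of by blast

text \<open>
  An affine function that vanishes at the vertices of a simplex vanishes on their convex hull.
\<close>

lemma vertices_separate:
  assumes v: "v \<in> Xh \<Omega> \<T>" and 0: "\<And>p. p \<in> vertices \<Longrightarrow> v p = 0"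
  shows "v = (\<lambda>x. 0)"
proof
  fix x
  show "v x = 0"
  proof (cases "x \<in> closure \<Omega>")
    case True
    then obtain K where K: "K \<in> \<T>" "x \<in> K" using union_triangulation by blast
    define C where "C = (SOME C. finite C \<and> K = convex hull C)"
    have C: "K = convex hull C" "C \<subseteq> vertices" using vertices_of[OF K(1)] K(1) unfolding C_def vertices_def by auto
    obtain a b where ab: "\<forall>x\<in>K. v x = a \<bullet> x + b" using v K(1) unfolding Xh_def by blast
    have "C \<subseteq> {x. a \<bullet> x = - b}"
    proof
      fix y assume y: "y \<in> C"
      then have "y \<in> K" unfolding C(1) by (rule hull_inc)
      then have "a \<bullet> y + b = 0" using ab 0 y C(2) by (metis subsetD)
      then show "y \<in> {x. a \<bullet> x = - b}" by simp
    qed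
    then have "convex hull C \<subseteq> {x. a \<bullet> x = - b}" by (rule hull_minimal) (rule convex_hyperplane)
    then show ?thesis using ab K C(1) by auto
  qed (use v in \<open>simp add: Xh_def\<close>)
qed

lemma l2_inner_combination:
  fixes u v w :: "'a \<Rightarrow> 'b::euclidean_space"
  assumes "u \<in> L2 \<Omega>" "v \<in> L2 \<Omega>" "w \<in> L2 \<Omega>"
  shows "l2_inner \<Omega> (\<lambda>x. u x + c *\<^sub>R v x) w = l2_inner \<Omega> u w + c * l2_inner \<Omega> v w"
  unfolding l2_inner_def inner_add_left inner_scaleR_left
  using L2_inner_integrable[OF assms(1,3)] L2_inner_integrable[OF assms(2,3)] by simp

lemma l2_inner_commute: "l2_inner \<Omega> u v = l2_inner \<Omega> v u"
  unfolding l2_inner_def by (simp add: inner_commute)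

lemma Xh_inner_product: "inner_product_functions (Xh \<Omega> \<T>) (l2_inner \<Omega>) vertices"
proof unfold_locales
  show "l2_inner \<Omega> (\<lambda>x. u x + c * v x) w = l2_inner \<Omega> u w + c * l2_inner \<Omega> v w"
    if "u \<in> Xh \<Omega> \<T>" "v \<in> Xh \<Omega> \<T>" "w \<in> Xh \<Omega> \<T>" for u v w :: "'a \<Rightarrow> real" and c
    using l2_inner_combination[of u v w c] that Xh_L2 by simp
  show "0 \<le> l2_inner \<Omega> v v" for v :: "'a \<Rightarrow> real" unfolding l2_inner_def by simp
  show "finite vertices" by (rule finite_vertices)
  show "(\<lambda>x. 0) \<in> Xh \<Omega> \<T>" by (rule Xh_zero)
  show "(\<lambda>x. u x + c * v x) \<in> Xh \<Omega> \<T>" if "u \<in> Xh \<Omega> \<T>" "v \<in> Xh \<Omega> \<T>" for u v c using that by (rule Xh_combination)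
  show "l2_inner \<Omega> u v = l2_inner \<Omega> v u" for u v :: "'a \<Rightarrow> real" by (rule l2_inner_commute)
  show "v = (\<lambda>x. 0)" if "v \<in> Xh \<Omega> \<T>" "l2_inner \<Omega> v v = 0" for v using that by (rule Xh_definite)
  show "v = (\<lambda>x. 0)" if "v \<in> Xh \<Omega> \<T>" "\<And>p. p \<in> vertices \<Longrightarrow> v p = 0" for v using that by (rule vertices_separate)
qed

definition elements_interior :: "'a set" where
  "elements_interior = (\<Union>K\<in>\<T>. interior K)"

text \<open>
  The boundary of a convex set has measure zero. Outside the boundaries the gradient of a finite
  element function is constant on each element.
\<close>

lemma negligible_element_boundaries: "negligible (\<Omega> - elements_interior)"
proof -
  have "\<Omega> - elements_interior \<subseteq> (\<Union>K\<in>\<T>. frontier K)"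
  proof
    fix x assume x: "x \<in> \<Omega> - elements_interior"
    then obtain K where "K \<in> \<T>" "x \<in> K" using union_triangulation closure_subset[of \<Omega>] by blast
    then show "x \<in> (\<Union>K\<in>\<T>. frontier K)" using x closure_subset[of K] unfolding elements_interior_def frontier_def by blast
  qed
  moreover have "negligible (\<Union>K\<in>\<T>. frontier K)"
    using finite_triangulation simplex_convex by (intro negligible_Union) (auto intro: negligible_convex_frontier)
  ultimately show ?thesis by (rule negligible_subset[rotated])
qed

lemma Xh_piecewise_gradient:
  assumes v: "v \<in> Xh \<Omega> \<T>"
  obtains a where "\<And>K x. K \<in> \<T> \<Longrightarrow> x \<in> interior K \<Longrightarrow> GDERIV v x :> a K"
proof -
  have "\<forall>K\<in>\<T>. \<exists>a. \<exists>b. \<forall>x\<in>K. v x = a \<bullet> x + b" using v unfolding Xh_def by blast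
  then obtain a where a: "\<And>K. K \<in> \<T> \<Longrightarrow> \<exists>b. \<forall>x\<in>K. v x = a K \<bullet> x + b" by metis
  show ?thesis
  proof
    fix K x assume K: "K \<in> \<T>" and x: "x \<in> interior K"
    obtain b where b: "\<forall>x\<in>K. v x = a K \<bullet> x + b" using a[OF K] by blast
    have "((\<lambda>x. a K \<bullet> x + b) has_derivative (\<lambda>h. h \<bullet> a K)) (at x)"
      by (auto intro!: derivative_eq_intros simp: inner_commute)
    then show "GDERIV v x :> a K" unfolding gderiv_def
      by (rule has_derivative_transform_within_open[OF _ open_interior x]) (use b interior_subset[of K] in \<open>auto dest!: subsetD\<close>)
  qed
qed

text \<open>
  Up to a null set the gradient is a simple function.
\<close>

lemma Xh_gradient_L2:
  assumes v: "v \<in> Xh \<Omega> \<T>" shows "grad v \<in> L2 \<Omega>"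
proof -
  obtain a where a: "\<And>K x. K \<in> \<T> \<Longrightarrow> x \<in> interior K \<Longrightarrow> GDERIV v x :> a K"
    using Xh_piecewise_gradient[OF v] by blast
  define s where "s = (\<lambda>x. if x \<in> elements_interior then grad v x else 0)"
  have sK: "s x = a K" if "K \<in> \<T>" "x \<in> interior K" for K x
    using that grad_eq[OF a[OF that]] by (auto simp: s_def elements_interior_def)
  have s0: "s x = 0" if "x \<notin> elements_interior" for x using that by (simp add: s_def)
  have rng: "s x \<in> insert 0 (a ` \<T>)" for x
    using sK s0 by (cases "x \<in> elements_interior") (auto simp: elements_interior_def)
  have op: "open elements_interior" unfolding elements_interior_def by auto
  have "simple_function borel s"
    unfolding simple_function_def
  proof (intro conjI ballI)
    show "finite (s ` space borel)"
      by (rule finite_subset[of _ "insert 0 (a ` \<T>)"]) (use rng finite_triangulation in auto)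
    fix y
    have "s -` {y} = (\<Union>K\<in>{K\<in>\<T>. a K = y}. interior K) \<union> (if y = 0 then - elements_interior else {})"
    proof (intro equalityI subsetI)
      fix x assume "x \<in> s -` {y}"
      then have sx: "s x = y" by simp
      show "x \<in> (\<Union>K\<in>{K\<in>\<T>. a K = y}. interior K) \<union> (if y = 0 then - elements_interior else {})"
      proof (cases "x \<in> elements_interior")
        case True
        then obtain K where "K \<in> \<T>" "x \<in> interior K" unfolding elements_interior_def by blast
        then show ?thesis using sK sx by auto
      qed (use s0 sx in auto)
    qed (use sK s0 in \<open>auto split: if_splits\<close>)
    moreover have "(\<Union>K\<in>{K\<in>\<T>. a K = y}. interior K) \<in> sets borel" by (intro borel_open) auto
    moreover have "(if y = 0 then - elements_interior else {}) \<in> sets borel" using op by auto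
    ultimately show "s -` {y} \<inter> space borel \<in> sets borel" by auto
  qed
  then have "s \<in> borel_measurable borel" by (rule borel_measurable_simple_function)
  then have sm: "s \<in> borel_measurable (lebesgue_on \<Omega>)" by (simp add: measurable_completion measurable_restrict_space1)
  have "bounded (insert 0 (a ` \<T>))" using finite_triangulation by (intro finite_imp_bounded) auto
  then obtain B where B: "\<And>y. y \<in> insert 0 (a ` \<T>) \<Longrightarrow> norm y \<le> B" unfolding bounded_iff by blast
  have s2: "s \<in> L2 \<Omega>" by (rule bounded_borel_in_L2[OF bounded_domain lebesgue_domain sm B[OF rng]])
  have gm: "grad v \<in> borel_measurable (lebesgue_on \<Omega>)"
    by (rule borel_measurable_spike[OF lebesgue_domain sm negligible_element_boundaries]) (auto simp: s_def)
  have ae: "AE x in lebesgue_on \<Omega>. grad v x = s x"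
  proof -
    have "AE x in lebesgue. x \<notin> \<Omega> - elements_interior"
      using negligible_element_boundaries unfolding negligible_iff_null_sets by (rule AE_not_in)
    then have "AE x in lebesgue. x \<in> \<Omega> \<longrightarrow> grad v x = s x" by eventually_elim (auto simp: s_def)
    then show ?thesis using lebesgue_domain by (simp add: AE_restrict_space_iff)
  qed
  have "integrable (lebesgue_on \<Omega>) (\<lambda>x. (norm (s x))\<^sup>2)" using s2 unfolding L2_def by simp
  then have "integrable (lebesgue_on \<Omega>) (\<lambda>x. (norm (grad v x))\<^sup>2)"
    by (rule integrable_cong_AE_imp) (use gm ae in auto)
  then show ?thesis using gm unfolding L2_def by simp
qed

lemma energy_form_bilinear:
  "bilinear_form_on (Xh \<Omega> \<T>) (\<lambda>v w. l2_inner \<Omega> (grad v) (grad w))"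
  unfolding bilinear_form_on_def
proof (intro conjI ballI allI)
  fix u v w :: "'a \<Rightarrow> real" and c assume u: "u \<in> Xh \<Omega> \<T>" and v: "v \<in> Xh \<Omega> \<T>" and w: "w \<in> Xh \<Omega> \<T>"
  obtain a where a: "\<And>K x. K \<in> \<T> \<Longrightarrow> x \<in> interior K \<Longrightarrow> GDERIV u x :> a K" using Xh_piecewise_gradient[OF u] by blast
  obtain b where b: "\<And>K x. K \<in> \<T> \<Longrightarrow> x \<in> interior K \<Longrightarrow> GDERIV v x :> b K" using Xh_piecewise_gradient[OF v] by blast
  have eq: "grad (\<lambda>x. u x + c * v x) x = grad u x + c *\<^sub>R grad v x" if "x \<in> elements_interior" for x
  proof -
    obtain K where K: "K \<in> \<T>" "x \<in> interior K" using \<open>x \<in> elements_interior\<close> unfolding elements_interior_def by blast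
    show ?thesis using grad_eq[OF gderiv_combination[OF a[OF K] b[OF K]]] grad_eq[OF a[OF K]] grad_eq[OF b[OF K]] by simp
  qed
  have "l2_inner \<Omega> (grad (\<lambda>x. u x + c * v x)) (grad w) = l2_inner \<Omega> (\<lambda>x. grad u x + c *\<^sub>R grad v x) (grad w)"
    unfolding l2_inner_def
  proof (rule integral_cong_AE)
    show "(\<lambda>x. grad (\<lambda>x. u x + c * v x) x \<bullet> grad w x) \<in> borel_measurable (lebesgue_on \<Omega>)"
      using L2_inner_integrable[OF Xh_gradient_L2[OF Xh_combination[OF u v]] Xh_gradient_L2[OF w]] by (rule borel_measurable_integrable)
    show "(\<lambda>x. (grad u x + c *\<^sub>R grad v x) \<bullet> grad w x) \<in> borel_measurable (lebesgue_on \<Omega>)"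
      using L2_inner_integrable[OF L2_combination[OF Xh_gradient_L2[OF u] Xh_gradient_L2[OF v]] Xh_gradient_L2[OF w]] by (rule borel_measurable_integrable)
    have "AE x in lebesgue. x \<notin> \<Omega> - elements_interior"
      using negligible_element_boundaries unfolding negligible_iff_null_sets by (rule AE_not_in)
    then have "AE x in lebesgue. x \<in> \<Omega> \<longrightarrow> grad (\<lambda>x. u x + c * v x) x \<bullet> grad w x = (grad u x + c *\<^sub>R grad v x) \<bullet> grad w x"
      by eventually_elim (auto simp: eq)
    then show "AE x in lebesgue_on \<Omega>. grad (\<lambda>x. u x + c * v x) x \<bullet> grad w x = (grad u x + c *\<^sub>R grad v x) \<bullet> grad w x"
      using lebesgue_domain by (simp add: AE_restrict_space_iff)
  qed
  also have "\<dots> = l2_inner \<Omega> (grad u) (grad w) + c * l2_inner \<Omega> (grad v) (grad w)"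
    by (intro l2_inner_combination Xh_gradient_L2 u v w)
  finally show "l2_inner \<Omega> (grad (\<lambda>x. u x + c * v x)) (grad w) = l2_inner \<Omega> (grad u) (grad w) + c * l2_inner \<Omega> (grad v) (grad w)" .
qed (rule l2_inner_commute)

text \<open>
  The eigenbasis of the energy form diagonalizes \<open>Laph\<close>. It also shows that the
  descriptions by which \<open>Ph\<close> and \<open>Laph\<close> are defined denote: in
  coordinates, the projection and the discrete Laplacian are the sums below, and an element of the
  space is determined by its inner products.
\<close>

theorem discrete_laplacian_eigenbasis:
  obtains B ev where
    "finite B" "B \<subseteq> Xh \<Omega> \<T>" "\<And>b. b \<in> B \<Longrightarrow> ev b \<ge> 0"
    "\<And>v. v \<in> Xh \<Omega> \<T> \<Longrightarrow> (\<lambda>x. \<Sum>b\<in>B. l2_inner \<Omega> v b * b x) = v"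
    "\<And>k. (\<lambda>x. \<Sum>b\<in>B. k b * b x) \<in> Xh \<Omega> \<T>"
    "\<And>k b. b \<in> B \<Longrightarrow> l2_inner \<Omega> (\<lambda>x. \<Sum>b\<in>B. k b * b x) b = k b"
    "\<And>k. l2_norm \<Omega> (\<lambda>x. \<Sum>b\<in>B. k b * b x) = sqrt (\<Sum>b\<in>B. (k b)\<^sup>2)"
    "\<And>g. g \<in> L2 \<Omega> \<Longrightarrow> Ph \<Omega> \<T> g = (\<lambda>x. \<Sum>b\<in>B. l2_inner \<Omega> g b * b x)"
    "\<And>v. v \<in> Xh \<Omega> \<T> \<Longrightarrow> Laph \<Omega> \<T> v = (\<lambda>x. \<Sum>b\<in>B. - (ev b * l2_inner \<Omega> v b) * b x)"
proof -
  define a where "a = (\<lambda>v w :: 'a \<Rightarrow> real. l2_inner \<Omega> (grad v) (grad w))"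
  interpret inner_product_functions "Xh \<Omega> \<T>" "l2_inner \<Omega>" vertices by (rule Xh_inner_product)
  have ba: "bilinear_form_on (Xh \<Omega> \<T>) a" unfolding a_def by (rule energy_form_bilinear)
  obtain B where B: "onb (Xh \<Omega> \<T>) (l2_inner \<Omega>) B"
    and eig: "\<And>b v. b \<in> B \<Longrightarrow> v \<in> Xh \<Omega> \<T> \<Longrightarrow> a b v = a b b * l2_inner \<Omega> b v"
    using exists_eigenbasis[OF ba] by blast
  have fB: "finite B" "B \<subseteq> Xh \<Omega> \<T>" and Bo: "\<And>b b'. b \<in> B \<Longrightarrow> b' \<in> B \<Longrightarrow> l2_inner \<Omega> b b' = of_bool (b = b')"
    using B unfolding onb_def by auto
  note ex = onb_expand[OF B]
  have comb: "(\<lambda>x. \<Sum>b\<in>B. k b * b x) \<in> Xh \<Omega> \<T>" for k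
    using sum_mem[OF fB(1), of "\<lambda>b. b" k] fB(2) by auto
  have coef: "l2_inner \<Omega> (\<lambda>x. \<Sum>b\<in>B. k b * b x) c = k c" if c: "c \<in> B" for k c
  proof -
    have "l2_inner \<Omega> (\<lambda>x. \<Sum>b\<in>B. k b * b x) c = (\<Sum>b\<in>B. k b * l2_inner \<Omega> b c)"
      using form_sum[OF bilinear_ip fB(1), of "\<lambda>b. b" c k] fB(2) c by auto
    also have "\<dots> = (\<Sum>b\<in>B. if b = c then k b else 0)" using Bo c by (intro sum.cong) auto
    finally show ?thesis using c fB by simp
  qed
  have inner_comb: "l2_inner \<Omega> (\<lambda>x. \<Sum>b\<in>B. k b * b x) \<psi> = (\<Sum>b\<in>B. k b * l2_inner \<Omega> b \<psi>)" if "\<psi> \<in> Xh \<Omega> \<T>" for k \<psi>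
    using form_sum[OF bilinear_ip fB(1), of "\<lambda>b. b" \<psi> k] fB(2) that by auto
  have norm_comb: "l2_norm \<Omega> (\<lambda>x. \<Sum>b\<in>B. k b * b x) = sqrt (\<Sum>b\<in>B. (k b)\<^sup>2)" for k
  proof -
    define v where "v = (\<lambda>x. \<Sum>b\<in>B. k b * b x)"
    have "l2_inner \<Omega> v v = (\<Sum>b\<in>B. k b * l2_inner \<Omega> b v)" using inner_comb[OF comb[of k], of k] unfolding v_def .
    also have "\<dots> = (\<Sum>b\<in>B. (k b)\<^sup>2)"
    proof (intro sum.cong refl)
      fix b assume "b \<in> B"
      then have "l2_inner \<Omega> b v = k b" using coef[of b k] unfolding l2_inner_commute[of b] v_def by simp
      then show "k b * l2_inner \<Omega> b v = (k b)\<^sup>2" by (simp add: power2_eq_square)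
    qed
    finally show ?thesis unfolding v_def[symmetric] by (simp add: l2_norm_def l2_inner_def power2_eq_square)
  qed
  have uniq: "v = w" if "v \<in> Xh \<Omega> \<T>" "w \<in> Xh \<Omega> \<T>" "\<And>\<psi>. \<psi> \<in> Xh \<Omega> \<T> \<Longrightarrow> l2_inner \<Omega> v \<psi> = l2_inner \<Omega> w \<psi>" for v w
  proof -
    have "(\<lambda>x. \<Sum>b\<in>B. l2_inner \<Omega> v b * b x) = (\<lambda>x. \<Sum>b\<in>B. l2_inner \<Omega> w b * b x)"
      using that(3) fB(2) by (intro ext sum.cong refl arg_cong2[where f = "(*)"]) auto
    then show ?thesis using ex[OF that(1)] ex[OF that(2)] by simp
  qed
  have P: "Ph \<Omega> \<T> g = (\<lambda>x. \<Sum>b\<in>B. l2_inner \<Omega> g b * b x)" if g: "g \<in> L2 \<Omega>" for g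
  proof -
    define w where "w = (\<lambda>x. \<Sum>b\<in>B. l2_inner \<Omega> g b * b x)"
    have w: "w \<in> Xh \<Omega> \<T>" unfolding w_def by (rule comb)
    have lin: "l2_inner \<Omega> g (\<lambda>x. \<Sum>b\<in>C. k b * b x) = (\<Sum>b\<in>C. k b * l2_inner \<Omega> g b)" if "C \<subseteq> B" for C k
    proof -
      have "integrable (lebesgue_on \<Omega>) (\<lambda>x. k b * (g x \<bullet> b x))" if "b \<in> C" for b
        using L2_inner_integrable[OF g Xh_L2, of b] that \<open>C \<subseteq> B\<close> fB by auto
      then have "(LINT x|lebesgue_on \<Omega>. (\<Sum>b\<in>C. k b * (g x \<bullet> b x))) = (\<Sum>b\<in>C. LINT x|lebesgue_on \<Omega>. k b * (g x \<bullet> b x))"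
        by (rule Bochner_Integration.integral_sum)
      moreover have "g x \<bullet> (\<Sum>b\<in>C. k b * b x) = (\<Sum>b\<in>C. k b * (g x \<bullet> b x))" for x
        by (simp add: sum_distrib_left mult.left_commute)
      ultimately show ?thesis unfolding l2_inner_def by (simp only: integral_mult_right_zero)
    qed
    have wi: "l2_inner \<Omega> w \<psi> = l2_inner \<Omega> g \<psi>" if \<psi>: "\<psi> \<in> Xh \<Omega> \<T>" for \<psi>
    proof -
      have "l2_inner \<Omega> g \<psi> = l2_inner \<Omega> g (\<lambda>x. \<Sum>b\<in>B. l2_inner \<Omega> \<psi> b * b x)" by (simp only: ex[OF \<psi>])
      also have "\<dots> = (\<Sum>b\<in>B. l2_inner \<Omega> \<psi> b * l2_inner \<Omega> g b)" by (rule lin) simp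
      also have "\<dots> = l2_inner \<Omega> w \<psi>" unfolding w_def inner_comb[OF \<psi>]
        by (simp only: l2_inner_commute[of \<psi>] mult.commute)
      finally show ?thesis by simp
    qed
    show ?thesis unfolding Ph_def w_def[symmetric]
    proof (rule the_equality)
      show "w \<in> Xh \<Omega> \<T> \<and> (\<forall>\<psi>\<in>Xh \<Omega> \<T>. l2_inner \<Omega> w \<psi> = l2_inner \<Omega> g \<psi>)" using w wi by blast
      show "v = w" if "v \<in> Xh \<Omega> \<T> \<and> (\<forall>\<psi>\<in>Xh \<Omega> \<T>. l2_inner \<Omega> v \<psi> = l2_inner \<Omega> g \<psi>)" for v
        using that w wi by (intro uniq) auto
    qed
  qed
  have L: "Laph \<Omega> \<T> \<phi> = (\<lambda>x. \<Sum>b\<in>B. - (a b b * l2_inner \<Omega> \<phi> b) * b x)" if \<phi>: "\<phi> \<in> Xh \<Omega> \<T>" for \<phi>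
  proof -
    define w where "w = (\<lambda>x. \<Sum>b\<in>B. - (a b b * l2_inner \<Omega> \<phi> b) * b x)"
    have w: "w \<in> Xh \<Omega> \<T>" unfolding w_def by (rule comb)
    have wi: "- l2_inner \<Omega> w \<psi> = a \<phi> \<psi>" if \<psi>: "\<psi> \<in> Xh \<Omega> \<T>" for \<psi>
    proof -
      have "a \<phi> \<psi> = a (\<lambda>x. \<Sum>b\<in>B. l2_inner \<Omega> \<phi> b * b x) \<psi>" by (simp only: ex[OF \<phi>])
      also have "\<dots> = (\<Sum>b\<in>B. l2_inner \<Omega> \<phi> b * a b \<psi>)"
        using form_sum[OF ba fB(1), of "\<lambda>b. b" \<psi> "\<lambda>b. l2_inner \<Omega> \<phi> b"] fB(2) \<psi> by auto
      also have "\<dots> = (\<Sum>b\<in>B. a b b * l2_inner \<Omega> \<phi> b * l2_inner \<Omega> b \<psi>)"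
      proof (intro sum.cong refl)
        fix b assume "b \<in> B"
        then show "l2_inner \<Omega> \<phi> b * a b \<psi> = a b b * l2_inner \<Omega> \<phi> b * l2_inner \<Omega> b \<psi>" using eig[OF _ \<psi>, of b] by simp
      qed
      also have "\<dots> = - l2_inner \<Omega> w \<psi>" unfolding w_def inner_comb[OF \<psi>] by (simp add: sum_negf)
      finally show ?thesis by simp
    qed
    show ?thesis unfolding Laph_def w_def[symmetric]
    proof (rule the_equality)
      show "w \<in> Xh \<Omega> \<T> \<and> (\<forall>\<psi>\<in>Xh \<Omega> \<T>. - l2_inner \<Omega> w \<psi> = l2_inner \<Omega> (grad \<phi>) (grad \<psi>))" using w wi unfolding a_def by blast
      show "v = w" if v: "v \<in> Xh \<Omega> \<T> \<and> (\<forall>\<psi>\<in>Xh \<Omega> \<T>. - l2_inner \<Omega> v \<psi> = l2_inner \<Omega> (grad \<phi>) (grad \<psi>))" for v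
      proof (rule uniq)
        fix \<psi> assume "\<psi> \<in> Xh \<Omega> \<T>"
        then have "- l2_inner \<Omega> v \<psi> = - l2_inner \<Omega> w \<psi>" using v wi unfolding a_def by simp
        then show "l2_inner \<Omega> v \<psi> = l2_inner \<Omega> w \<psi>" by simp
      qed (use v w in auto)
    qed
  qed
  have "a b b \<ge> 0" for b unfolding a_def l2_inner_def by simp
  then show ?thesis using that[OF fB(1,2) _ ex comb coef norm_comb P L] by blast
qed

end

section \<open>The source term tested with square-integrable functions\<close>

text \<open>
  Integrals of a function known only up to null sets, with respect to the complete measure, are
  reduced to integrals of a Borel representative.
\<close>

lemma lebesgue_integral_eq_LBINT:
  fixes f g :: "real \<Rightarrow> real"
  assumes S: "S \<in> sets borel" and ae: "AE s in lebesgue. s \<in> S \<longrightarrow> f s = g s" and g: "set_integrable lborel S g"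
  shows "integrable (lebesgue_on S) f" and "(LINT s|lebesgue_on S. f s) = (LBINT s:S. g s)"
proof -
  have Sl: "S \<in> sets lebesgue" using S by simp
  have gm: "(\<lambda>s. indicator S s *\<^sub>R g s) \<in> borel_measurable lborel"
    using g unfolding set_integrable_def by (rule borel_measurable_integrable)
  have gi: "integrable (lebesgue_on S) g"
    using g S gm unfolding set_integrable_def by (simp add: integrable_restrict_space integrable_completion)
  obtain N where N: "N \<in> null_sets lebesgue" "{s. \<not> (s \<in> S \<longrightarrow> f s = g s)} \<subseteq> N"
    using ae by (auto simp: eventually_ae_filter)
  have fm: "f \<in> borel_measurable (lebesgue_on S)"
  proof (rule borel_measurable_spike[OF Sl borel_measurable_integrable[OF gi]])
    show "negligible N" using N(1) by (simp add: negligible_iff_null_sets)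
    show "f x = g x" if "x \<in> S - N" for x using that N(2) by auto
  qed
  have ae': "AE s in lebesgue_on S. g s = f s" "AE s in lebesgue_on S. f s = g s"
    using ae Sl by (auto simp: AE_restrict_space_iff elim: eventually_mono)
  show "integrable (lebesgue_on S) f" by (rule integrable_cong_AE_imp[OF gi fm ae'(1)])
  have "(LINT s|lebesgue_on S. f s) = (LINT s|lebesgue_on S. g s)"
    by (rule integral_cong_AE[OF fm _ ae'(2)]) (use gi in auto)
  also have "\<dots> = (LBINT s:S. g s)"
    using S gm unfolding set_lebesgue_integral_def by (simp add: integral_restrict_space integral_completion)
  finally show "(LINT s|lebesgue_on S. f s) = (LBINT s:S. g s)" .
qed

lemma set_integrable_continuous_lborel:
  fixes f :: "real \<Rightarrow> real"
  assumes f: "continuous_on {0<..} f" and i: "integrable (lebesgue_on {0<..<t}) f"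
  shows "set_integrable lborel {0<..<t} f"
proof -
  have "continuous_on {0<..<t} f" by (rule continuous_on_subset[OF f]) auto
  from borel_measurable_continuous_on_indicator[OF _ this]
  have m: "(\<lambda>s. indicator {0<..<t} s *\<^sub>R f s) \<in> borel_measurable borel" by simp
  have "integrable lebesgue (\<lambda>s. indicator {0<..<t} s *\<^sub>R f s)"
    using i by (simp add: integrable_restrict_space)
  then show ?thesis unfolding set_integrable_def using m by (simp add: integrable_completion)
qed

lemma AE_positive_lborel: "(AE x in lebesgue_on {0<..}. P x) \<longleftrightarrow> (AE x in lborel. 0 < (x::real) \<longrightarrow> P x)"
  by (simp add: AE_restrict_space_iff lborel_AE_iff_lebesgue)

lemma sigma_finite_lebesgue: "sigma_finite_measure (lebesgue :: 'a::euclidean_space measure)"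
proof
  have "\<Union> (range (\<lambda>n::nat. ball (0::'a) (real n))) = UNIV"
  proof (intro equalityI subsetI)
    fix x :: 'a
    obtain n :: nat where "norm x < real n" using reals_Archimedean2 by blast
    then show "x \<in> \<Union> (range (\<lambda>n::nat. ball 0 (real n)))" by auto
  qed auto
  moreover have "emeasure lebesgue (ball (0::'a) (real n)) \<noteq> \<infinity>" for n
    using fmeasurableD2[OF lmeasurable_ball[of "0::'a" "real n"]] by simp
  ultimately show "\<exists>A::'a set set. countable A \<and> A \<subseteq> sets lebesgue \<and> \<Union>A = space lebesgue \<and> (\<forall>a\<in>A. emeasure lebesgue a \<noteq> \<infinity>)"
    by (intro exI[of _ "range (\<lambda>n::nat. ball 0 (real n))"]) auto
qed

lemma L2_scale_complex:
  fixes u :: "'a::euclidean_space \<Rightarrow> complex"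
  assumes "u \<in> L2 \<Omega>" shows "(\<lambda>x. a * u x) \<in> L2 \<Omega>"
  using assms unfolding L2_def by (auto simp: norm_mult power_mult_distrib)

lemma L2_paired:
  fixes u :: "'a::euclidean_space \<Rightarrow> complex" and \<phi> :: "'a \<Rightarrow> real"
  assumes u: "u \<in> L2 \<Omega>" and \<phi>: "\<phi> \<in> L2 \<Omega>"
  shows "integrable (lebesgue_on \<Omega>) (\<lambda>x. u x * of_real (\<phi> x))"
    and "cmod (LINT x|lebesgue_on \<Omega>. u x * of_real (\<phi> x)) \<le> l2_norm \<Omega> u * l2_norm \<Omega> \<phi>"
proof -
  have m: "(\<lambda>x. u x * of_real (\<phi> x)) \<in> borel_measurable (lebesgue_on \<Omega>)"
    using u \<phi> unfolding L2_def by auto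
  show i: "integrable (lebesgue_on \<Omega>) (\<lambda>x. u x * of_real (\<phi> x))"
    by (rule Bochner_Integration.integrable_bound[OF L2_norm_product_integrable[OF u \<phi>] m]) (simp add: norm_mult)
  have "cmod (LINT x|lebesgue_on \<Omega>. u x * of_real (\<phi> x)) \<le> (LINT x|lebesgue_on \<Omega>. cmod (u x * of_real (\<phi> x)))"
    by (rule integral_norm_bound)
  also have "\<dots> \<le> l2_norm \<Omega> u * l2_norm \<Omega> \<phi>"
    using L2_norm_product_le[OF u \<phi>] by (simp add: norm_mult)
  finally show "cmod (LINT x|lebesgue_on \<Omega>. u x * of_real (\<phi> x)) \<le> l2_norm \<Omega> u * l2_norm \<Omega> \<phi>" .
qed

text \<open>
  By Cauchy-Schwarz, difference quotients that converge in norm converge after testing.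
\<close>

lemma L2_analytic_paired_holomorphic:
  fixes G :: "complex \<Rightarrow> 'a::euclidean_space \<Rightarrow> complex"
  assumes G: "L2_analytic_on \<Omega> G S" and \<phi>: "\<phi> \<in> L2 \<Omega>"
  shows "(\<lambda>z. LINT x|lebesgue_on \<Omega>. G z x * of_real (\<phi> x)) holomorphic_on S"
  unfolding holomorphic_on_def
proof
  define \<Phi> where "\<Phi> = (\<lambda>z. LINT x|lebesgue_on \<Omega>. G z x * of_real (\<phi> x))"
  fix s assume s: "s \<in> S"
  then obtain D where D: "D \<in> L2 \<Omega>"
    "((\<lambda>w. l2_norm \<Omega> (\<lambda>x. (G w x - G s x) / (w - s) - D x)) \<longlongrightarrow> 0) (at s)"
    using G unfolding L2_analytic_on_def by blast
  define d where "d = (LINT x|lebesgue_on \<Omega>. D x * of_real (\<phi> x))"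
  have GL: "G w \<in> L2 \<Omega>" if "w \<in> S" for w using G that unfolding L2_analytic_on_def by blast
  have le: "cmod ((\<Phi> w - \<Phi> s) / (w - s) - d) \<le> l2_norm \<Omega> (\<lambda>x. (G w x - G s x) / (w - s) - D x) * l2_norm \<Omega> \<phi>"
    if w: "w \<in> S" for w
  proof -
    define u where "u = (\<lambda>x. (G w x - G s x) / (w - s) - D x)"
    have "(\<lambda>x. (1 / (w - s)) * (G w x + (-1) *\<^sub>R G s x) + (-1) *\<^sub>R D x) \<in> L2 \<Omega>"
      by (intro L2_combination L2_scale_complex GL w s D)
    then have u: "u \<in> L2 \<Omega>" by (simp add: u_def)
    have "(LINT x|lebesgue_on \<Omega>. u x * of_real (\<phi> x)) =
       (LINT x|lebesgue_on \<Omega>. (1 / (w - s)) * (G w x * of_real (\<phi> x)) - (1 / (w - s)) * (G s x * of_real (\<phi> x)) - D x * of_real (\<phi> x))"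
      by (rule arg_cong[where f = "integral\<^sup>L (lebesgue_on \<Omega>)"]) (auto simp: u_def algebra_simps diff_divide_distrib)
    also have "\<dots> = (1 / (w - s)) * \<Phi> w - (1 / (w - s)) * \<Phi> s - d"
      unfolding \<Phi>_def d_def
      using L2_paired(1)[OF GL[OF w] \<phi>] L2_paired(1)[OF GL[OF s] \<phi>] L2_paired(1)[OF D(1) \<phi>] by simp
    also have "\<dots> = (\<Phi> w - \<Phi> s) / (w - s) - d" by (simp add: diff_divide_distrib)
    finally show ?thesis using L2_paired(2)[OF u \<phi>] unfolding u_def by simp
  qed
  have "((\<lambda>w. l2_norm \<Omega> (\<lambda>x. (G w x - G s x) / (w - s) - D x) * l2_norm \<Omega> \<phi>) \<longlongrightarrow> 0 * l2_norm \<Omega> \<phi>) (at s within S)"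
    using D(2) by (intro tendsto_mult tendsto_const) (rule tendsto_within_subset, auto)
  then have lim0: "((\<lambda>w. l2_norm \<Omega> (\<lambda>x. (G w x - G s x) / (w - s) - D x) * l2_norm \<Omega> \<phi>) \<longlongrightarrow> 0) (at s within S)" by simp
  have "((\<lambda>w. (\<Phi> w - \<Phi> s) / (w - s) - d) \<longlongrightarrow> 0) (at s within S)"
  proof (rule Lim_null_comparison[OF _ lim0])
    show "\<forall>\<^sub>F w in at s within S. cmod ((\<Phi> w - \<Phi> s) / (w - s) - d)
        \<le> l2_norm \<Omega> (\<lambda>x. (G w x - G s x) / (w - s) - D x) * l2_norm \<Omega> \<phi>"
      unfolding eventually_at_filter using le by (intro always_eventually) auto
  qed
  then have "(\<Phi> has_field_derivative d) (at s within S)"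
    unfolding has_field_derivative_iff by (simp add: LIM_zero_iff)
  then show "\<Phi> field_differentiable (at s within S)" unfolding field_differentiable_def by blast
qed

text \<open>
  Testing with \<open>\<phi>\<close> commutes with the Laplace transform by Fubini, so the tested
  source has the sectorial transform \<open>s \<mapsto> (G s, \<phi>)\<close>, bounded by \<open>c
  * l2_norm \<Omega> \<phi>\<close>. The bound is linear in the norm of \<open>\<phi>\<close>,
  which makes it usable with test functions depending on the error.
\<close>

lemma tested_source:
  fixes \<Omega> :: "'a::euclidean_space set" and \<mu> \<theta> c T :: real
  assumes \<Omega>: "open \<Omega>" and \<mu>: "-1 < \<mu>" "\<mu> < 0" and \<theta>: "pi / 2 < \<theta>" "\<theta> < pi"
    and A: "assumption_A \<Omega> T \<mu> \<theta> c f" and \<phi>: "\<phi> \<in> L2 \<Omega>"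
  obtains g g' where
    "\<And>s. s > 0 \<Longrightarrow> (g has_real_derivative g' s) (at s)"
    "\<And>s. s > 0 \<Longrightarrow> \<bar>g s\<bar> \<le> source_constant \<theta> \<mu> * (c * l2_norm \<Omega> \<phi>) * s powr \<mu>"
    "\<And>s. s > 0 \<Longrightarrow> \<bar>g' s\<bar> \<le> source_constant \<theta> \<mu> * (c * l2_norm \<Omega> \<phi>) * s powr (\<mu> - 1)"
    "AE t in lborel. t > 0 \<longrightarrow> l2_inner \<Omega> (f t) \<phi> = g t"
proof -
  obtain \<omega> G where \<omega>: "\<omega> \<ge> 0" and F0: "(\<lambda>t x. exp (- \<omega> * t) * f t x) \<in> L1_L2 {0<..} \<Omega>"
    and lapG: "\<And>s. Re s > \<omega> \<Longrightarrow> AE x in lebesgue_on \<Omega>. G s x = laplace f s x"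
    and G: "L2_analytic_on \<Omega> G (sector \<theta>)"
    and Gb: "\<And>s. s \<in> sector \<theta> \<Longrightarrow> l2_norm \<Omega> (G s) \<le> c * cmod s powr (- \<mu> - 1)"
    using A unfolding assumption_A_def by blast
  define I where "I = lebesgue_on {(0::real)<..}"
  define M where "M = lebesgue_on \<Omega>"
  define F where "F = (\<lambda>t x. exp (- \<omega> * t) * f t x)"
  define \<Phi> where "\<Phi> = (\<lambda>z. LINT x|lebesgue_on \<Omega>. G z x * of_real (\<phi> x))"
  have sI: "sigma_finite_measure I" unfolding I_def
    by (rule sigma_finite_measure_restrict_space[OF sigma_finite_lebesgue]) simp
  have sM: "sigma_finite_measure M" unfolding M_def
    by (rule sigma_finite_measure_restrict_space[OF sigma_finite_lebesgue]) (use \<Omega> in simp)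
  interpret pair_sigma_finite I M using sI sM by (simp add: pair_sigma_finite_def)
  have Fm: "(\<lambda>(t, x). F t x) \<in> borel_measurable (I \<Otimes>\<^sub>M M)" and FL: "AE t in I. F t \<in> L2 \<Omega>"
    and Fi: "integrable I (\<lambda>t. l2_norm \<Omega> (F t))"
    using F0 unfolding L1_L2_def F_def I_def M_def by auto
  have \<phi>m: "\<phi> \<in> borel_measurable M" using \<phi> unfolding L2_def M_def by simp
  have Em: "(\<lambda>t. exp (- a * t)) \<in> borel_measurable I" for a
    unfolding I_def by (intro measurable_restrict_space1 measurable_completion) simp
  \<comment> \<open>Integrability on the product, also after further damping, which is the form
  needed for real \<open>s > \<omega>\<close>.\<close>
  have J: "integrable (I \<Otimes>\<^sub>M M) (case_prod (\<lambda>t x. exp (- a * t) * F t x * \<phi> x))" if a: "a \<ge> 0" for a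
  proof (rule Fubini_integrable)
    have [measurable]: "(\<lambda>p. F (fst p) (snd p)) \<in> borel_measurable (I \<Otimes>\<^sub>M M)"
      using Fm by (simp add: case_prod_unfold)
    note [measurable] = \<phi>m Em[of a]
    show m: "case_prod (\<lambda>t x. exp (- a * t) * F t x * \<phi> x) \<in> borel_measurable (I \<Otimes>\<^sub>M M)"
      unfolding case_prod_unfold by measurable
    show "AE t in I. integrable M (\<lambda>x. case (t, x) of (t, x) \<Rightarrow> exp (- a * t) * F t x * \<phi> x)"
      using FL
    proof eventually_elim
      case (elim t)
      have "integrable M (\<lambda>x. exp (- a * t) * (F t x * \<phi> x))"
        using L2_inner_integrable[OF elim \<phi>] unfolding M_def by simp
      then show ?case by (simp add: mult.assoc)
    qed
    have nm: "(\<lambda>t. LINT x|M. norm (case (t, x) of (t, x) \<Rightarrow> exp (- a * t) * F t x * \<phi> x)) \<in> borel_measurable I"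
      using m by measurable
    show "integrable I (\<lambda>t. LINT x|M. norm (case (t, x) of (t, x) \<Rightarrow> exp (- a * t) * F t x * \<phi> x))"
    proof (rule Bochner_Integration.integrable_bound[OF _ nm])
      show "integrable I (\<lambda>t. l2_norm \<Omega> (F t) * l2_norm \<Omega> \<phi>)" using Fi by simp
      have "AE t in I. t > 0" unfolding I_def by (simp add: AE_restrict_space_iff)
      with FL show "AE t in I. norm (LINT x|M. norm (case (t, x) of (t, x) \<Rightarrow> exp (- a * t) * F t x * \<phi> x)) \<le> norm (l2_norm \<Omega> (F t) * l2_norm \<Omega> \<phi>)"
      proof eventually_elim
        case (elim t)
        have "(LINT x|M. norm (case (t, x) of (t, x) \<Rightarrow> exp (- a * t) * F t x * \<phi> x)) = exp (- a * t) * (LINT x|M. norm (F t x) * norm (\<phi> x))"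
          by (simp add: abs_mult mult.assoc)
        also have "\<dots> \<le> 1 * (LINT x|M. norm (F t x) * norm (\<phi> x))"
          using elim(2) a by (intro mult_right_mono) auto
        also have "\<dots> \<le> l2_norm \<Omega> (F t) * l2_norm \<Omega> \<phi>" using L2_norm_product_le[OF elim(1) \<phi>] unfolding M_def by simp
        finally have "(LINT x|M. norm (case (t, x) of (t, x) \<Rightarrow> exp (- a * t) * F t x * \<phi> x)) \<le> l2_norm \<Omega> (F t) * l2_norm \<Omega> \<phi>" .
        moreover have "0 \<le> (LINT x|M. norm (case (t, x) of (t, x) \<Rightarrow> exp (- a * t) * F t x * \<phi> x))" by simp
        ultimately show ?case by (simp only: real_norm_def abs_of_nonneg)
      qed
    qed
  qed
  have eF: "(LINT x|M. exp (- a * t) * F t x * \<phi> x) = exp (- (a + \<omega>) * t) * l2_inner \<Omega> (f t) \<phi>" for a t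
  proof -
    have "exp (- a * t) * F t x * \<phi> x = exp (- (a + \<omega>) * t) * (f t x * \<phi> x)" for x
      unfolding F_def by (simp add: distrib_right exp_diff exp_minus field_simps exp_add)
    then show ?thesis unfolding l2_inner_def M_def by (simp only: integral_mult_right_zero inner_real_def)
  qed
  have tI: "integrable I (\<lambda>t. exp (- (a + \<omega>) * t) * l2_inner \<Omega> (f t) \<phi>)" if "a \<ge> 0" for a
    using integrable_fst[OF J[OF that]] unfolding eF .
  obtain g g' where "\<And>s. s > 0 \<Longrightarrow> (g has_real_derivative g' s) (at s)"
    "\<And>s. s > 0 \<Longrightarrow> \<bar>g s\<bar> \<le> source_constant \<theta> \<mu> * (c * l2_norm \<Omega> \<phi>) * s powr \<mu>"
    "\<And>s. s > 0 \<Longrightarrow> \<bar>g' s\<bar> \<le> source_constant \<theta> \<mu> * (c * l2_norm \<Omega> \<phi>) * s powr (\<mu> - 1)"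
    "AE t in lebesgue. t > 0 \<longrightarrow> l2_inner \<Omega> (f t) \<phi> = g t"
  proof (rule inverse_laplace_sectorial[OF \<theta> \<mu> \<omega>, of "\<lambda>t. l2_inner \<Omega> (f t) \<phi>" \<Phi> "c * l2_norm \<Omega> \<phi>"])
    show "integrable lebesgue (\<lambda>t. indicator {0<..} t * (exp (- \<omega> * t) * l2_inner \<Omega> (f t) \<phi>))"
      using tI[of 0] unfolding I_def by (simp add: integrable_restrict_space)
    show "\<Phi> holomorphic_on {z. z \<noteq> 0 \<and> \<bar>Arg z\<bar> < \<theta>}"
      using L2_analytic_paired_holomorphic[OF G \<phi>] unfolding \<Phi>_def sector_def .
    show "cmod (\<Phi> z) \<le> c * l2_norm \<Omega> \<phi> * cmod z powr (- \<mu> - 1)" if "z \<noteq> 0" "\<bar>Arg z\<bar> < \<theta>" for z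
    proof -
      have z: "z \<in> sector \<theta>" using that by (simp add: sector_def)
      then have "G z \<in> L2 \<Omega>" using G unfolding L2_analytic_on_def by blast
      from L2_paired(2)[OF this \<phi>] have "cmod (\<Phi> z) \<le> l2_norm \<Omega> (G z) * l2_norm \<Omega> \<phi>" unfolding \<Phi>_def .
      also have "\<dots> \<le> (c * cmod z powr (- \<mu> - 1)) * l2_norm \<Omega> \<phi>"
        by (intro mult_right_mono Gb z) (simp add: l2_norm_def)
      finally show ?thesis by (simp add: mult_ac)
    qed
    fix s assume s: "s > \<omega>"
    define a where "a = s - \<omega>"
    have a: "a \<ge> 0" "s = a + \<omega>" using s by (auto simp: a_def)
    have lf: "laplace f (of_real s) x = of_real (LINT t|I. exp (- a * t) * F t x)" for x
    proof -
      have "exp (- complex_of_real s * of_real t) * of_real (f t x) = of_real (exp (- a * t) * F t x)" for t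
      proof -
        have "exp (- a * t) * F t x = exp (- s * t) * f t x" unfolding F_def a(2) by (simp add: distrib_right exp_diff exp_minus field_simps exp_add)
        then show ?thesis by (simp add: exp_of_real[symmetric])
      qed
      then show ?thesis unfolding laplace_def I_def by (simp only: integral_complex_of_real)
    qed
    have sr: "of_real s \<in> sector \<theta>" using s \<omega> \<theta> by (simp add: sector_def Arg_of_real)
    then have GL: "G (of_real s) \<in> L2 \<Omega>" using G unfolding L2_analytic_on_def by blast
    have xi: "integrable M (\<lambda>x. LINT t|I. exp (- a * t) * F t x * \<phi> x)" using integrable_snd[OF J[OF a(1)]] .
    have swap: "(LINT x|M. LINT t|I. exp (- a * t) * F t x * \<phi> x) = (LINT t|I. LINT x|M. exp (- a * t) * F t x * \<phi> x)"
      using Fubini_integral[OF J[OF a(1)]] .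
    have "\<Phi> (of_real s) = (LINT x|M. of_real (LINT t|I. exp (- a * t) * F t x * \<phi> x))"
      unfolding \<Phi>_def M_def[symmetric]
    proof (rule integral_cong_AE)
      show "(\<lambda>x. G (of_real s) x * of_real (\<phi> x)) \<in> borel_measurable M"
        using L2_paired(1)[OF GL \<phi>] unfolding M_def by (rule borel_measurable_integrable)
      show "(\<lambda>x. complex_of_real (LINT t|I. exp (- a * t) * F t x * \<phi> x)) \<in> borel_measurable M"
        using borel_measurable_integrable[OF integrable_of_real[OF xi]] .
      have "AE x in M. G (of_real s) x = laplace f (of_real s) x" using lapG[of "of_real s"] s unfolding M_def by simp
      then show "AE x in M. G (of_real s) x * of_real (\<phi> x) = of_real (LINT t|I. exp (- a * t) * F t x * \<phi> x)"
        by eventually_elim (simp add: lf)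
    qed
    also have "\<dots> = of_real (LINT x|M. LINT t|I. exp (- a * t) * F t x * \<phi> x)" by (rule integral_complex_of_real)
    also have "\<dots> = of_real (LINT t|I. exp (- s * t) * l2_inner \<Omega> (f t) \<phi>)" unfolding swap eF a(2) ..
    finally show "\<Phi> (of_real s) = of_real (LINT t|lebesgue. indicator {0<..} t * (exp (- s * t) * l2_inner \<Omega> (f t) \<phi>))"
      unfolding I_def by (simp add: integral_restrict_space)
  qed blast
  then show ?thesis using that unfolding lborel_AE_iff_lebesgue by blast
qed

lemma assumption_A_pointwise_L2:
  fixes \<Omega> :: "'a::euclidean_space set"
  assumes A: "assumption_A \<Omega> T \<mu> \<theta> c f"
  shows "AE t in lborel. 0 < t \<longrightarrow> f t \<in> L2 \<Omega>"
proof -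
  obtain \<omega> where "(\<lambda>t x. exp (- \<omega> * t) * f t x) \<in> L1_L2 {0<..} \<Omega>"
    using A unfolding assumption_A_def by blast
  then have "AE t in lebesgue_on {0<..}. (\<lambda>x. exp (- \<omega> * t) * f t x) \<in> L2 \<Omega>" unfolding L1_L2_def by simp
  then show ?thesis unfolding AE_positive_lborel
  proof eventually_elim
    case (elim t)
    show ?case
    proof
      assume "0 < t"
      then have "(\<lambda>x. 0 + exp (\<omega> * t) *\<^sub>R (exp (- \<omega> * t) * f t x)) \<in> L2 \<Omega>"
        using elim by (intro L2_combination) (auto simp: L2_zero)
      moreover have "0 + exp (\<omega> * t) *\<^sub>R (exp (- \<omega> * t) * f t x) = f t x" for x
        by (simp add: exp_minus)
      ultimately show "f t \<in> L2 \<Omega>" by (simp only:)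
    qed
  qed
qed

lemma assumption_A_constant_nonneg:
  fixes \<Omega> :: "'a::euclidean_space set"
  assumes A: "assumption_A \<Omega> T \<mu> \<theta> c f" and \<theta>: "pi / 2 < \<theta>"
  shows "c \<ge> 0"
proof -
  have "0 < \<theta>" using \<theta> pi_gt_zero by linarith
  then have "1 \<in> sector \<theta>" unfolding sector_def by simp
  moreover obtain G :: "complex \<Rightarrow> 'a \<Rightarrow> complex" where "\<forall>s\<in>sector \<theta>. l2_norm \<Omega> (G s) \<le> c * cmod s powr (- \<mu> - 1)"
    using A unfolding assumption_A_def by blast
  ultimately have "l2_norm \<Omega> (G 1) \<le> c * cmod 1 powr (- \<mu> - 1)" by blast
  moreover have "l2_norm \<Omega> (G 1) \<ge> 0" by (simp add: l2_norm_def)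
  ultimately show ?thesis by simp
qed

section \<open>From scalar errors to the norm of the error\<close>

lemma set_integral_weighted_sum:
  fixes h :: "'i \<Rightarrow> real \<Rightarrow> real"
  assumes "finite B" and h: "\<And>b. b \<in> B \<Longrightarrow> set_integrable lborel A (h b)"
  shows "set_integrable lborel A (\<lambda>s. \<Sum>b\<in>B. k b * h b s)"
    and "(LBINT s:A. (\<Sum>b\<in>B. k b * h b s)) = (\<Sum>b\<in>B. k b * (LBINT s:A. h b s))"
proof -
  have e: "indicator A s *\<^sub>R (\<Sum>b\<in>B. k b * h b s) = (\<Sum>b\<in>B. k b * (indicator A s *\<^sub>R h b s))" for s
    by (simp add: sum_distrib_left mult.left_commute)
  have i: "integrable lborel (\<lambda>s. k b * (indicator A s *\<^sub>R h b s))" if "b \<in> B" for b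
    using h[OF that] unfolding set_integrable_def by (rule integrable_mult_right)
  show "set_integrable lborel A (\<lambda>s. \<Sum>b\<in>B. k b * h b s)"
    unfolding set_integrable_def e by (rule Bochner_Integration.integrable_sum) (rule i)
  show "(LBINT s:A. (\<Sum>b\<in>B. k b * h b s)) = (\<Sum>b\<in>B. k b * (LBINT s:A. h b s))"
    unfolding set_lebesgue_integral_def e by (subst Bochner_Integration.integral_sum[OF i]) (auto simp only: integral_mult_right_zero)
qed

lemma indefinite_set_integral:
  fixes f c :: "real \<Rightarrow> real"
  assumes f: "\<And>t. t > 0 \<Longrightarrow> set_integrable lborel {0<..<t} f"
    and c: "\<And>t. t > 0 \<Longrightarrow> c t = (LBINT s:{0<..<t}. f s)"
  shows "continuous_on {0<..} c" and "\<And>t. t > 0 \<Longrightarrow> set_integrable lborel {0<..<t} c"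
proof -
  define H where "H = (\<lambda>t. integral {0..t} f)"
  have Hc: "continuous_on {0..t} H" if "t > 0" for t
    unfolding H_def using set_lborel_eq_integral_closed(1)[OF f[OF that]] by (rule indefinite_integral_continuous_1)
  have cH: "c t = H t" if "t > 0" for t
    unfolding H_def c[OF that] by (rule set_lborel_eq_integral_closed(2)[OF f[OF that]])
  show "continuous_on {0<..} c"
  proof (rule continuous_at_imp_continuous_on, intro ballI)
    fix t :: real assume t: "t \<in> {0<..}"
    have "continuous_on {0<..<t + 1} H" using Hc[of "t + 1"] t by (auto intro: continuous_on_subset)
    then have "continuous_on {0<..<t + 1} c" by (rule continuous_on_eq) (simp add: cH)
    then show "isCont c t" using t by (auto simp: continuous_on_eq_continuous_at)
  qed
  fix t :: real assume t: "t > 0"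
  have "set_integrable lborel {0..t} H" by (rule borel_integrable_atLeastAtMost'[OF Hc[OF t]])
  then have "set_integrable lborel {0<..<t} H" by (rule set_integrable_subset) auto
  moreover have "(\<lambda>s. indicator {0<..<t} s *\<^sub>R H s) = (\<lambda>s. indicator {0<..<t} s *\<^sub>R c s)"
    by (auto simp: indicator_def cH)
  ultimately show "set_integrable lborel {0<..<t} c" unfolding set_integrable_def by simp
qed

lemma caputo_kernel_convolve:
  "caputo_kernel \<alpha> 0 (t - s) * (indicator {0<..<T} s * f s)
     = 1 / Gamma (1 - \<alpha>) * (indicator {0<..<t} s *\<^sub>R ((t - s) powr (- \<alpha>) * f s))" if "t < T" for f :: "real \<Rightarrow> real"
  using that by (auto simp: caputo_kernel_def indicator_def)

text \<open>
  The convolution of two integrable functions is finite almost everywhere; restriction to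
  intervals \<open>(0, N)\<close> reduces the claim to this.
\<close>

lemma AE_singular_convolution_integrable:
  fixes f :: "real \<Rightarrow> real"
  assumes \<alpha>: "0 < \<alpha>" "\<alpha> < 1" and f: "\<And>t. t > 0 \<Longrightarrow> set_integrable lborel {0<..<t} f"
  shows "AE t in lborel. 0 < t \<longrightarrow> set_integrable lborel {0<..<t} (\<lambda>s. (t - s) powr (- \<alpha>) * f s)"
proof -
  have G: "Gamma (1 - \<alpha>) > 0" using \<alpha> by simp
  have "AE t in lborel. integrable lborel (\<lambda>s. caputo_kernel \<alpha> 0 (t - s) * (indicator {0<..<real (Suc N)} s * f s))" for N
  proof (rule AE_convolve_integrable)
    show "causal_exp (caputo_kernel \<alpha> 0)" using caputo_kernel_lap(1)[OF \<alpha>, of 0] by simp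
    have "set_integrable lborel {0<..<real (Suc N)} f" by (rule f) simp
    then show "causal_exp (\<lambda>s. indicator {0<..<real (Suc N)} s * f s)"
      by (intro causal_exp_truncate) (auto simp: set_integrable_def dest: borel_measurable_integrable)
  qed
  then have "AE t in lborel. \<forall>N. integrable lborel (\<lambda>s. caputo_kernel \<alpha> 0 (t - s) * (indicator {0<..<real (Suc N)} s * f s))"
    by (simp only: AE_all_countable) blast
  then show ?thesis
  proof eventually_elim
    case (elim t)
    obtain N where N: "t < real (Suc N)" using reals_Archimedean2[of t] less_trans[OF _ lessI[THEN of_nat_less_iff[THEN iffD2]]] by blast
    have "integrable lborel (\<lambda>s. 1 / Gamma (1 - \<alpha>) * (indicator {0<..<t} s *\<^sub>R ((t - s) powr (- \<alpha>) * f s)))"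
      using elim[rule_format, of N] unfolding caputo_kernel_convolve[OF N] .
    from integrable_mult_right[OF this, of "Gamma (1 - \<alpha>)"] show ?case
      unfolding set_integrable_def using G by simp
  qed
qed

text \<open>
  Integrating the equation for \<open>c\<close> in time gives the one of
  \<open>volterra_solution\<close>, because the integral of the fractional integral of
  \<open>c'\<close> is the fractional integral of \<open>c\<close>: convolutions commute, which is
  checked by Laplace transforms.
\<close>

lemma volterra_solution_differentiated:
  fixes c c' g :: "real \<Rightarrow> real"
  assumes \<alpha>: "0 < \<alpha>" "\<alpha> < 1" and l: "l \<ge> 0" and \<mu>: "-1 < \<mu>" "\<mu> < 0" and gc: "continuous_on {0<..} g"
    and gA: "\<And>s. s > 0 \<Longrightarrow> \<bar>g s\<bar> \<le> A * s powr \<mu>"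
    and c': "\<And>t. t > 0 \<Longrightarrow> set_integrable lborel {0<..<t} c'"
    and c: "\<And>t. t > 0 \<Longrightarrow> c t = (LBINT s:{0<..<t}. c' s)"
    and eq: "AE t in lborel. 0 < t \<longrightarrow> 1 / Gamma (1 - \<alpha>) * (LBINT s:{0<..<t}. (t - s) powr (- \<alpha>) * c' s) + l * c t = g t"
    and t0: "t0 > 0"
  shows "c t0 = (LBINT x. kap \<alpha> l x * mode g x t0)"
proof (rule volterra_solution[OF \<alpha> l \<mu> gc gA _ _ _ t0])
  show "continuous_on {0<..} c" using c' c by (rule indefinite_set_integral(1)[where f = c'])
  have ci: "set_integrable lborel {0<..<t} c" if "t > 0" for t
    using c' c that by (rule indefinite_set_integral(2)[where f = c' and c = c])
  then show "set_integrable lborel {0<..<t} c" if "t > 0" for t using that by blast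
  have gi: "set_integrable lborel {0<..<t} g" if "t > 0" for t
    by (rule g_integrable[OF \<alpha> l \<mu> gc gA that])
  have E: "AE t in lborel. 0 < t \<and> t < T \<longrightarrow>
     1 / Gamma (1 - \<alpha>) * (LBINT s:{0<..<t}. (t - s) powr (- \<alpha>) * c s) + l * (LBINT s:{0<..<t}. c s) = (LBINT s:{0<..<t}. g s)" if T: "T > 0" for T
  proof -
    define k where "k = caputo_kernel \<alpha> 0"
    define one where "one = (indicator {0<..} :: real \<Rightarrow> real)"
    define d where "d = (\<lambda>s. indicator {0<..<T} s * c' s)"
    have k: "causal_exp k" unfolding k_def using caputo_kernel_lap(1)[OF \<alpha>, of 0] by simp
    have one: "causal_exp one" unfolding one_def by (rule lap_one(1))
    have d: "causal_exp d" unfolding d_def using c'[OF T]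
      by (intro causal_exp_truncate) (auto simp: set_integrable_def dest: borel_measurable_integrable)
    note ce = causal_exp_convolve
    have swap: "AE t in lborel. convolve one (convolve k d) t = convolve k (convolve one d) t"
      by (rule lap_inject) (simp_all add: lap_convolve ce k one d)
    have one_conv: "convolve one f t = (LBINT s:{0<..<t}. f s)" if f: "causal_exp f" for f t
    proof -
      have "one (t - s) * f s = indicator {0<..<t} s *\<^sub>R f s" for s
        using f by (auto simp: one_def indicator_def causal_exp_def)
      then show ?thesis unfolding convolve_def set_lebesgue_integral_def by (simp only:)
    qed
    have cd: "convolve one d t = c t" if "0 < t" "t < T" for t
    proof -
      have "convolve one d t = (LBINT s:{0<..<t}. d s)" by (rule one_conv[OF d])
      also have "\<dots> = c t" unfolding c[OF that(1)] d_def set_lebesgue_integral_def using that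
        by (intro Bochner_Integration.integral_cong) (auto simp: indicator_def)
      finally show ?thesis .
    qed
    have kd: "convolve k d t = 1 / Gamma (1 - \<alpha>) * (LBINT s:{0<..<t}. (t - s) powr (- \<alpha>) * c' s)" if "t < T" for t
      unfolding convolve_def k_def d_def caputo_kernel_convolve[OF that] set_lebesgue_integral_def
      by (simp only: integral_mult_right_zero)
    have kc: "convolve k (convolve one d) t = 1 / Gamma (1 - \<alpha>) * (LBINT s:{0<..<t}. (t - s) powr (- \<alpha>) * c s)" if t: "t < T" for t
    proof -
      have "k (t - s) * convolve one d s = 1 / Gamma (1 - \<alpha>) * (indicator {0<..<t} s *\<^sub>R ((t - s) powr (- \<alpha>) * c s))" for s
      proof (cases "0 < s \<and> s < t")
        case True
        then show ?thesis using cd[of s] t by (simp add: k_def caputo_kernel_def)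
      next
        case False
        then have "k (t - s) * convolve one d s = 0" using k ce[OF one d] unfolding causal_exp_def by auto
        then show ?thesis using False by auto
      qed
      then show ?thesis unfolding convolve_def[of k "convolve one d"] set_lebesgue_integral_def
        by (simp only: integral_mult_right_zero)
    qed
    show ?thesis using swap
    proof eventually_elim
      case (elim t)
      show ?case
      proof
        assume t: "0 < t \<and> t < T"
        have "1 / Gamma (1 - \<alpha>) * (LBINT s:{0<..<t}. (t - s) powr (- \<alpha>) * c s) = (LBINT s:{0<..<t}. convolve k d s)"
          using elim kc[of t] t one_conv[OF ce[OF k d]] by simp
        also have "\<dots> = (LBINT s:{0<..<t}. g s - l * c s)"
          unfolding set_lebesgue_integral_def
        proof (rule integral_cong_AE)
          have [measurable]: "convolve k d \<in> borel_measurable borel" using ce[OF k d] unfolding causal_exp_def by blast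
          show "(\<lambda>s. indicator {0<..<t} s *\<^sub>R convolve k d s) \<in> borel_measurable lborel" by measurable
          show "(\<lambda>s. indicator {0<..<t} s *\<^sub>R (g s - l * c s)) \<in> borel_measurable lborel"
          proof -
            have "set_integrable lborel {0<..<t} (\<lambda>s. g s - l * c s)" using gi ci t by (intro set_integral_diff(1)) auto
            then show ?thesis unfolding set_integrable_def by (rule borel_measurable_integrable)
          qed
          show "AE s in lborel. indicator {0<..<t} s *\<^sub>R convolve k d s = indicator {0<..<t} s *\<^sub>R (g s - l * c s)"
            using eq
          proof eventually_elim
            case (elim s)
            show ?case
            proof (cases "s \<in> {0<..<t}")
              case True
              then show ?thesis using elim kd[of s] t by auto
            qed simp
          qed
        qed
        also have "\<dots> = (LBINT s:{0<..<t}. g s) - l * (LBINT s:{0<..<t}. c s)"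
          using gi ci t by (subst set_integral_diff(2)) auto
        finally show "1 / Gamma (1 - \<alpha>) * (LBINT s:{0<..<t}. (t - s) powr (- \<alpha>) * c s) + l * (LBINT s:{0<..<t}. c s) = (LBINT s:{0<..<t}. g s)"
          by simp
      qed
    qed
  qed
  have "AE t in lborel. \<forall>N. 0 < t \<and> t < real (Suc N) \<longrightarrow>
     1 / Gamma (1 - \<alpha>) * (LBINT s:{0<..<t}. (t - s) powr (- \<alpha>) * c s) + l * (LBINT s:{0<..<t}. c s) = (LBINT s:{0<..<t}. g s)"
    unfolding AE_all_countable using E by simp
  then show "AE t in lborel. 0 < t \<longrightarrow>
     1 / Gamma (1 - \<alpha>) * (LBINT s:{0<..<t}. (t - s) powr (- \<alpha>) * c s) + l * (LBINT s:{0<..<t}. c s) = (LBINT s:{0<..<t}. g s)"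
  proof eventually_elim
    case (elim t)
    obtain N where "t < real N" using reals_Archimedean2 by blast
    then have "t < real (Suc N)" by simp
    then show ?case using elim by blast
  qed
qed

text \<open>
  The duality argument that makes the bound independent of the number of modes. Estimating each
  \<open>e b\<close> separately would lose the orthogonality of the source components. Instead the
  sum of \<open>(e b)\<^sup>2\<close> is written as the integral over \<open>x\<close> of the
  combination of the \<open>err b x\<close> with weights \<open>e b * kap \<alpha> (ev b)
  x\<close>. For each \<open>x\<close> the hypothesis bounds this combination by the Euclidean
  norm of the weights, which is at most a multiple of \<open>exp ((1 - \<alpha>) x)\<close> times
  the norm of \<open>e\<close>. Dividing by the norm of \<open>e\<close> gives the claim.
\<close>

lemma superposition_norm_le:
  fixes err :: "'i \<Rightarrow> real \<Rightarrow> real" and e ev :: "'i \<Rightarrow> real"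
  assumes \<alpha>: "0 < \<alpha>" "\<alpha> < 1" and B: "finite B" and ev: "\<And>b. b \<in> B \<Longrightarrow> ev b \<ge> 0"
    and int: "\<And>b. b \<in> B \<Longrightarrow> integrable lborel (\<lambda>x. kap \<alpha> (ev b) x * err b x)"
    and e: "\<And>b. b \<in> B \<Longrightarrow> e b = (LBINT x. kap \<alpha> (ev b) x * err b x)"
    and K: "K \<ge> 0" and W: "\<And>x. W x \<ge> 0" and Wi: "integrable lborel (\<lambda>x. exp ((1 - \<alpha>) * x) * W x)"
    and bound: "\<And>k x. \<bar>\<Sum>b\<in>B. k b * err b x\<bar> \<le> K * sqrt (\<Sum>b\<in>B. (k b)\<^sup>2) * W x"
  shows "sqrt (\<Sum>b\<in>B. (e b)\<^sup>2) \<le> K / (pi * sin (pi * \<alpha>)) * (LBINT x. exp ((1 - \<alpha>) * x) * W x)"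
proof -
  define S where "S = sqrt (\<Sum>b\<in>B. (e b)\<^sup>2)"
  define q where "q = 1 / (pi * sin (pi * \<alpha>))"
  have S0: "S \<ge> 0" unfolding S_def by (simp add: sum_nonneg)
  have q: "q \<ge> 0" unfolding q_def using \<alpha> by (intro divide_nonneg_nonneg mult_nonneg_nonneg sin_ge_zero) auto
  have pt: "(\<Sum>b\<in>B. e b * (kap \<alpha> (ev b) x * err b x)) \<le> (K * S * q) * (exp ((1 - \<alpha>) * x) * W x)" for x
  proof -
    define m where "m = q * exp ((1 - \<alpha>) * x)"
    have m: "m \<ge> 0" unfolding m_def using q by simp
    have "(\<Sum>b\<in>B. e b * (kap \<alpha> (ev b) x * err b x)) = (\<Sum>b\<in>B. (e b * kap \<alpha> (ev b) x) * err b x)" by (simp only: mult.assoc)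
    also have "\<dots> \<le> K * sqrt (\<Sum>b\<in>B. (e b * kap \<alpha> (ev b) x)\<^sup>2) * W x" using bound[of "\<lambda>b. e b * kap \<alpha> (ev b) x" x] by linarith
    also have "\<dots> \<le> K * (S * m) * W x"
    proof (intro mult_right_mono mult_left_mono K W)
      have "(\<Sum>b\<in>B. (e b * kap \<alpha> (ev b) x)\<^sup>2) \<le> (\<Sum>b\<in>B. (e b)\<^sup>2 * m\<^sup>2)"
      proof (rule sum_mono)
        fix b assume b: "b \<in> B"
        have "kap \<alpha> (ev b) x \<le> m" unfolding m_def q_def using kap_le[OF \<alpha> ev[OF b], of x] by simp
        then have "(kap \<alpha> (ev b) x)\<^sup>2 \<le> m\<^sup>2" using kap_nonneg[OF \<alpha> ev[OF b], of x] by (rule power_mono)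
        then show "(e b * kap \<alpha> (ev b) x)\<^sup>2 \<le> (e b)\<^sup>2 * m\<^sup>2" unfolding power_mult_distrib by (rule mult_left_mono) simp
      qed
      then have "sqrt (\<Sum>b\<in>B. (e b * kap \<alpha> (ev b) x)\<^sup>2) \<le> sqrt ((\<Sum>b\<in>B. (e b)\<^sup>2) * m\<^sup>2)"
        unfolding sum_distrib_right by (rule real_sqrt_le_mono)
      also have "\<dots> = S * m" using m by (simp add: real_sqrt_mult S_def)
      finally show "sqrt (\<Sum>b\<in>B. (e b * kap \<alpha> (ev b) x)\<^sup>2) \<le> S * m" .
    qed
    finally show ?thesis unfolding m_def by (simp add: mult_ac)
  qed
  have Ii: "integrable lborel (\<lambda>x. e b * (kap \<alpha> (ev b) x * err b x))" if "b \<in> B" for b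
    using int[OF that] by (rule integrable_mult_right)
  have "(\<Sum>b\<in>B. (e b)\<^sup>2) = (\<Sum>b\<in>B. (LBINT x. e b * (kap \<alpha> (ev b) x * err b x)))"
  proof (intro sum.cong refl)
    fix b assume "b \<in> B"
    from e[OF this] show "(e b)\<^sup>2 = (LBINT x. e b * (kap \<alpha> (ev b) x * err b x))"
      by (simp only: integral_mult_right_zero power2_eq_square)
  qed
  also have "\<dots> = (LBINT x. (\<Sum>b\<in>B. e b * (kap \<alpha> (ev b) x * err b x)))"
    by (rule Bochner_Integration.integral_sum[symmetric]) (rule Ii)
  also have "\<dots> \<le> (LBINT x. (K * S * q) * (exp ((1 - \<alpha>) * x) * W x))"
    by (intro integral_mono Bochner_Integration.integrable_sum Ii integrable_mult_right Wi pt)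
  also have "\<dots> = S * (K * q * (LBINT x. exp ((1 - \<alpha>) * x) * W x))"
    unfolding integral_mult_right_zero by (simp add: mult_ac)
  finally have SS: "S * S \<le> S * (K * q * (LBINT x. exp ((1 - \<alpha>) * x) * W x))"
    unfolding S_def by (simp add: sum_nonneg)
  have "S \<le> K * q * (LBINT x. exp ((1 - \<alpha>) * x) * W x)"
  proof (cases "S = 0")
    case True
    have "0 \<le> (LBINT x. exp ((1 - \<alpha>) * x) * W x)" by (rule integral_nonneg_AE) (simp add: W)
    then show ?thesis using True K q by simp
  qed (use SS S0 in simp)
  then show ?thesis unfolding S_def q_def by simp
qed

lemma mode_cong: "(\<And>s. 0 < s \<Longrightarrow> s < t \<Longrightarrow> g s = h s) \<Longrightarrow> mode g x t = mode h x t"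
  unfolding mode_def by (intro Bochner_Integration.integral_cong refl) (auto simp: indicator_def)

lemma mode_weighted_sum:
  assumes "finite B" and i: "\<And>b. b \<in> B \<Longrightarrow> integrable lborel (\<lambda>s. indicator {0<..<t} s * (exp (- exp x * (t - s)) * g b s))"
  shows "mode (\<lambda>s. \<Sum>b\<in>B. k b * g b s) x t = (\<Sum>b\<in>B. k b * mode (g b) x t)"
proof -
  have e: "indicator {0<..<t} s * (exp (- exp x * (t - s)) * (\<Sum>b\<in>B. k b * g b s))
     = (\<Sum>b\<in>B. k b * (indicator {0<..<t} s * (exp (- exp x * (t - s)) * g b s)))" for s
    by (simp add: sum_distrib_left mult.left_commute)
  show ?thesis unfolding mode_def e
    by (subst Bochner_Integration.integral_sum[OF integrable_mult_right[OF i]]) (auto simp only: integral_mult_right_zero)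
qed

lemma mode_step_weighted_sum:
  "mode_step \<tau> (\<lambda>j. \<Sum>b\<in>B. k b * F b j) x n = (\<Sum>b\<in>B. k b * mode_step \<tau> (F b) x n)"
proof -
  have "(\<Sum>b\<in>B. k b * mode_step \<tau> (F b) x n) = (\<Sum>i<n. \<Sum>b\<in>B. k b * ((F b (n - i) - F b (n - Suc i)) / (1 + \<tau> * exp x) ^ Suc i))"
    unfolding mode_step_def sum_distrib_left by (rule sum.swap)
  also have "\<dots> = mode_step \<tau> (\<lambda>j. \<Sum>b\<in>B. k b * F b j) x n"
    unfolding mode_step_def sum_subtractf[symmetric] right_diff_distrib[symmetric] sum_divide_distrib by simp
  finally show ?thesis by simp
qed

text \<open>
  Representatives of the tested source are fixed only up to null sets; continuity makes them
  depend linearly on the test function at every positive time.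
\<close>

lemma AE_eq_continuous_imp_eq:
  fixes g h :: "real \<Rightarrow> real"
  assumes g: "continuous_on {0<..} g" "\<And>t. t > 0 \<Longrightarrow> set_integrable lborel {0<..<t} g"
    and h: "continuous_on {0<..} h" "\<And>t. t > 0 \<Longrightarrow> set_integrable lborel {0<..<t} h"
    and ae: "AE t in lborel. 0 < t \<longrightarrow> g t = h t" and s: "s > 0"
  shows "g s = h s"
proof -
  have "g s - h s = 0"
  proof (rule continuous_eq_0_if_AE_integral_eq_0[where T = "s + 1" and d = "\<lambda>t. g t - h t"])
    show "continuous_on {0<..<s + 1} (\<lambda>t. g t - h t)"
      using g(1) h(1) by (intro continuous_intros) (auto intro: continuous_on_subset)
    show "set_integrable lborel {0<..<t} (\<lambda>t. g t - h t)" if "0 < t" for t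
      by (rule set_integral_diff(1)[OF g(2)[OF that] h(2)[OF that]])
    have "(LBINT r:{0<..<t}. g r - h r) = 0" for t
      unfolding set_lebesgue_integral_def
      by (rule integral_eq_zero_AE) (use ae in \<open>eventually_elim, auto simp: indicator_def\<close>)
    then show "AE t in lborel. 0 < t \<and> t < s + 1 \<longrightarrow> (LBINT r:{0<..<t}. g r - h r) = 0" by simp
  qed (use s in auto)
  then show ?thesis by simp
qed

section \<open>The error of the scheme\<close>

text \<open>
  The time derivative in the classical formulation is only Lebesgue measurable, while convolutions
  are treated for Borel functions.
\<close>

lemma borel_representative:
  fixes d :: "real \<Rightarrow> real"
  assumes d: "\<And>t. t > 0 \<Longrightarrow> integrable (lebesgue_on {0<..<t}) d"
  obtains d' where "AE s in lebesgue. 0 < s \<longrightarrow> d s = d' s" "\<And>t. t > 0 \<Longrightarrow> set_integrable lborel {0<..<t} d'"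
proof -
  define D where "D = (\<lambda>s. indicator {0<..} s * d s)"
  have i: "integrable lebesgue (\<lambda>s. indicator {0<..<t} s *\<^sub>R d s)" if "t > 0" for t
    using d[OF that] by (simp add: integrable_restrict_space)
  have "D \<in> borel_measurable lebesgue"
  proof (rule borel_measurable_LIMSEQ_real)
    show "(\<lambda>s. indicator {0<..<real (Suc n)} s *\<^sub>R d s) \<in> borel_measurable lebesgue" for n
      using i[of "real (Suc n)"] by (intro borel_measurable_integrable) simp
    fix s :: real
    obtain N where N: "s < real N" using reals_Archimedean2 by blast
    have "\<forall>\<^sub>F n in sequentially. indicator {0<..<real (Suc n)} s *\<^sub>R d s = D s"
      using eventually_ge_at_top[of N]
    proof eventually_elim
      case (elim n)
      then have "s < real (Suc n)" using N by linarith
      then show ?case by (simp add: D_def indicator_def)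
    qed
    then show "(\<lambda>n. indicator {0<..<real (Suc n)} s *\<^sub>R d s) \<longlonglongrightarrow> D s" by (rule tendsto_eventually)
  qed
  from completion_ex_borel_measurable_real[OF this] obtain d' where d': "d' \<in> borel_measurable lborel" "AE s in lborel. D s = d' s" by blast
  have ae: "AE s in lebesgue. D s = d' s" using d'(2) unfolding lborel_AE_iff_lebesgue .
  show ?thesis
  proof
    show "AE s in lebesgue. 0 < s \<longrightarrow> d s = d' s" using ae by eventually_elim (auto simp: D_def)
    fix t :: real assume t: "t > 0"
    have m: "(\<lambda>s. indicator {0<..<t} s *\<^sub>R d' s) \<in> borel_measurable lborel" using d'(1) by simp
    have "integrable lebesgue (\<lambda>s. indicator {0<..<t} s *\<^sub>R d' s)"
    proof (rule integrable_cong_AE_imp[OF i[OF t]])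
      show "(\<lambda>s. indicator {0<..<t} s *\<^sub>R d' s) \<in> borel_measurable lebesgue" using m by (rule measurable_completion)
      show "AE s in lebesgue. indicator {0<..<t} s *\<^sub>R d s = indicator {0<..<t} s *\<^sub>R d' s"
        using ae by eventually_elim (auto simp: D_def indicator_def)
    qed
    then show "set_integrable lborel {0<..<t} d'" unfolding set_integrable_def using m by (simp add: integrable_completion)
  qed
qed

text \<open>
  The constant of \<open>mode_error\<close> for \<open>\<gamma> = 1 - \<alpha> / 2\<close>. Any
  exponent strictly between \<open>1 - \<alpha>\<close> and \<open>1\<close> would do: the lower
  end is needed for the integral over \<open>x\<close> to converge, the upper one for the first
  time step.
\<close>

definition error_constant :: "real \<Rightarrow> real \<Rightarrow> real" where
  "error_constant \<alpha> \<mu> = (1152 * (1 / (\<mu> + 1) + 1) * (1 / (\<mu> + 1)) + 128 * (1 / (\<mu> + 1) + 1)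
     + 2 * (1 / (\<mu> + 1) + 1 / (1 - (1 - \<alpha> / 2))) + 1 / (\<mu> + 1))"

definition kernel_mass :: "real \<Rightarrow> real" where
  "kernel_mass \<alpha> = (LBINT x. exp ((1 - \<alpha>) * x) * (1 + exp x) powr (- (1 - \<alpha> / 2)))"

text \<open>
  The semidiscrete setting in coordinates: an orthonormal eigenbasis \<open>B\<close> of the
  discrete Laplacian with eigenvalues \<open>ev\<close>, coefficients \<open>w\<close> of point
  values, and for each basis function the continuous representative \<open>g b\<close> of the
  tested source.
\<close>

locale spectral_semidiscretization =
  fixes \<Omega> :: "'a::euclidean_space set" and \<T> :: "'a set set" and B :: "('a \<Rightarrow> real) set"
    and ev :: "('a \<Rightarrow> real) \<Rightarrow> real" and P :: "'a set" and w :: "('a \<Rightarrow> real) \<Rightarrow> 'a \<Rightarrow> real"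
    and f :: "real \<Rightarrow> 'a \<Rightarrow> real" and g :: "('a \<Rightarrow> real) \<Rightarrow> real \<Rightarrow> real" and A :: "('a \<Rightarrow> real) \<Rightarrow> real" and \<mu> :: real
  assumes basis: "finite B" "\<And>b. b \<in> B \<Longrightarrow> ev b \<ge> 0"
    and expand: "\<And>v. v \<in> Xh \<Omega> \<T> \<Longrightarrow> (\<lambda>x. \<Sum>b\<in>B. l2_inner \<Omega> v b * b x) = v"
    and combination: "\<And>k. (\<lambda>x. \<Sum>b\<in>B. k b * b x) \<in> Xh \<Omega> \<T>"
    and coefficient: "\<And>k b. b \<in> B \<Longrightarrow> l2_inner \<Omega> (\<lambda>x. \<Sum>b\<in>B. k b * b x) b = k b"
    and combination_norm: "\<And>k. l2_norm \<Omega> (\<lambda>x. \<Sum>b\<in>B. k b * b x) = sqrt (\<Sum>b\<in>B. (k b)\<^sup>2)"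
    and projection: "\<And>g. g \<in> L2 \<Omega> \<Longrightarrow> Ph \<Omega> \<T> g = (\<lambda>x. \<Sum>b\<in>B. l2_inner \<Omega> g b * b x)"
    and laplacian: "\<And>v. v \<in> Xh \<Omega> \<T> \<Longrightarrow> Laph \<Omega> \<T> v = (\<lambda>x. \<Sum>b\<in>B. - (ev b * l2_inner \<Omega> v b) * b x)"
    and point_values: "finite P" "\<And>v b. v \<in> Xh \<Omega> \<T> \<Longrightarrow> b \<in> B \<Longrightarrow> l2_inner \<Omega> v b = (\<Sum>p\<in>P. w b p * v p)"
    and \<mu>: "-1 < \<mu>" "\<mu> < 0"
    and source: "\<And>b. b \<in> B \<Longrightarrow> continuous_on {0<..} (g b)" "\<And>b s. b \<in> B \<Longrightarrow> s > 0 \<Longrightarrow> \<bar>g b s\<bar> \<le> A b * s powr \<mu>"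
    and source_L2: "AE t in lborel. 0 < t \<longrightarrow> f t \<in> L2 \<Omega>"
    and source_coefficient: "\<And>b. b \<in> B \<Longrightarrow> AE t in lborel. 0 < t \<longrightarrow> l2_inner \<Omega> (f t) b = g b t"
begin

lemma source_set_integrable: "b \<in> B \<Longrightarrow> t > 0 \<Longrightarrow> set_integrable lborel {0<..<t} (g b)"
  using g_integrable[of "1/2" 0 \<mu> "g b" "A b" t] \<mu> source by simp

lemma AE_source_expansion:
  "AE t in lborel. 0 < t \<longrightarrow> Ph \<Omega> \<T> (f t) = (\<lambda>x. \<Sum>b\<in>B. g b t * b x)"
proof -
  have "AE t in lborel. \<forall>b\<in>B. 0 < t \<longrightarrow> l2_inner \<Omega> (f t) b = g b t"
    by (rule AE_finite_all[OF basis(1), THEN iffD2]) (use source_coefficient in blast)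
  with source_L2 show ?thesis
  proof eventually_elim
    case (elim t)
    show ?case
    proof
      assume "0 < t"
      then show "Ph \<Omega> \<T> (f t) = (\<lambda>x. \<Sum>b\<in>B. g b t * b x)"
        using elim projection[of "f t"] by (simp cong: sum.cong)
    qed
  qed
qed

lemma coefficients_unique:
  assumes "\<And>x. (\<Sum>b\<in>B. k b * b x) = (\<Sum>b\<in>B. k' b * b x)" "b \<in> B"
  shows "k b = k' b"
proof -
  have "(\<lambda>x. \<Sum>b\<in>B. k b * b x) = (\<lambda>x. \<Sum>b\<in>B. k' b * b x)" using assms(1) by (rule ext)
  then show ?thesis using coefficient[OF assms(2), of k] coefficient[OF assms(2), of k'] by simp
qed

text \<open>
  The equations of the problem hold pointwise in space. Combining them over the vertices extracts
  the equation of a single coefficient.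
\<close>

lemma coefficient_from_point_values:
  assumes "\<And>p. Q p = (\<Sum>b\<in>B. k b * b p)" "b \<in> B"
  shows "(\<Sum>p\<in>P. w b p * Q p) = k b"
  using point_values(2)[OF combination assms(2), of k] coefficient[OF assms(2), of k] unfolding assms(1) by simp

text \<open>
  At times where the source is not square-integrable the projection has no meaning, but these form
  a null set.
\<close>

lemma projected_source_integral:
  assumes t: "t > 0"
  shows "time_integral (\<lambda>s. Ph \<Omega> \<T> (f s)) t x = (\<Sum>b\<in>B. (LBINT s:{0<..<t}. g b s) * b x)"
proof -
  have "AE s in lebesgue. s \<in> {0<..<t} \<longrightarrow> Ph \<Omega> \<T> (f s) x = (\<Sum>b\<in>B. b x * g b s)"
    unfolding lborel_AE_iff_lebesgue using AE_source_expansion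
    by eventually_elim (auto simp: mult.commute)
  moreover note s = set_integral_weighted_sum[where h = g and k = "\<lambda>b. b x", OF basis(1) source_set_integrable[OF _ t]]
  ultimately have "(LINT s|lebesgue_on {0<..<t}. Ph \<Omega> \<T> (f s) x) = (LBINT s:{0<..<t}. (\<Sum>b\<in>B. b x * g b s))"
    by (intro lebesgue_integral_eq_LBINT(2)) auto
  then show ?thesis using s(2) unfolding time_integral_def by (simp add: mult.commute)
qed

text \<open>
  The coefficient is a combination of point values, so it is the integral of the same combination
  of their time derivatives, and it satisfies the scalar fractional equation for almost every
  time.
\<close>

lemma classical_coefficient:
  assumes \<alpha>: "0 < \<alpha>" "\<alpha> < 1" and u0: "Ph \<Omega> \<T> u0 = (\<lambda>x. 0)"
    and u: "Ph_classical \<Omega> \<T> \<alpha> f u0 u" and b: "b \<in> B" and t0: "t0 > 0"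
  shows "l2_inner \<Omega> (u t0) b = (LBINT x. kap \<alpha> (ev b) x * mode (g b) x t0)"
proof -
  define d where "d = (\<lambda>p s. deriv (\<lambda>s. u s p) s)"
  have uX: "u t \<in> Xh \<Omega> \<T>" if "t \<ge> 0" for t using u that unfolding Ph_classical_def by blast
  have di: "integrable (lebesgue_on {0<..<t}) (d p)" if "t > 0" for t p
    using u that unfolding Ph_classical_def d_def by blast
  have ud: "u t p = (LINT s|lebesgue_on {0<..<t}. d p s)" if "t > 0" for t p
    using u that u0 unfolding Ph_classical_def d_def by auto
  have "AE t in lebesgue_on {0<..}. \<forall>x. caputo \<alpha> (\<lambda>s. u s x) t - Laph \<Omega> \<T> (u t) x = Ph \<Omega> \<T> (f t) x"
    using u unfolding Ph_classical_def by blast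
  then have eq: "AE t in lborel. 0 < t \<longrightarrow> (\<forall>x. caputo \<alpha> (\<lambda>s. u s x) t - Laph \<Omega> \<T> (u t) x = Ph \<Omega> \<T> (f t) x)"
    unfolding AE_positive_lborel .
  have "\<exists>d'. (AE s in lebesgue. 0 < s \<longrightarrow> d p s = d' s) \<and> (\<forall>t>0. set_integrable lborel {0<..<t} d')" for p
    using borel_representative[OF di, of p] by metis
  then obtain d' where d': "\<And>p. AE s in lebesgue. 0 < s \<longrightarrow> d p s = d' p s" "\<And>p t. t > 0 \<Longrightarrow> set_integrable lborel {0<..<t} (d' p)"
    by metis
  define c' where "c' = (\<lambda>s. \<Sum>p\<in>P. w b p * d' p s)"
  define c where "c = (\<lambda>t. l2_inner \<Omega> (u t) b)"
  have "c t0 = (LBINT x. kap \<alpha> (ev b) x * mode (g b) x t0)"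
  proof (rule volterra_solution_differentiated[OF \<alpha> basis(2)[OF b] \<mu> source(1)[OF b] source(2)[OF b] _ _ _ t0])
    show "set_integrable lborel {0<..<t} c'" if "t > 0" for t
      unfolding c'_def by (rule set_integral_weighted_sum(1)[where h = d' and k = "w b", OF point_values(1) d'(2)[OF that]])
    show "c t = (LBINT s:{0<..<t}. c' s)" if t: "t > 0" for t
    proof -
      have "u t p = (LBINT s:{0<..<t}. d' p s)" for p
      proof -
        have "AE s in lebesgue. s \<in> {0<..<t} \<longrightarrow> d p s = d' p s" using d'(1)[of p] by eventually_elim auto
        from lebesgue_integral_eq_LBINT(2)[OF _ this d'(2)[OF t]] show ?thesis unfolding ud[OF t] by simp
      qed
      then have "c t = (\<Sum>p\<in>P. w b p * (LBINT s:{0<..<t}. d' p s))"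
        unfolding c_def using point_values(2)[OF uX b, of t] t by simp
      then show ?thesis unfolding c'_def using set_integral_weighted_sum(2)[where h = d' and k = "w b", OF point_values(1) d'(2)[OF t]] by simp
    qed
    have "AE t in lborel. \<forall>p\<in>P. 0 < t \<longrightarrow> set_integrable lborel {0<..<t} (\<lambda>s. (t - s) powr (- \<alpha>) * d' p s)"
      by (rule AE_finite_all[OF point_values(1), THEN iffD2]) (use AE_singular_convolution_integrable[OF \<alpha> d'(2)] in blast)
    with eq AE_source_expansion
    show "AE t in lborel. 0 < t \<longrightarrow> 1 / Gamma (1 - \<alpha>) * (LBINT s:{0<..<t}. (t - s) powr (- \<alpha>) * c' s) + ev b * c t = g b t"
    proof eventually_elim
      case (elim t)
      show ?case
      proof
        assume t: "0 < t"
        define Q where "Q = (\<lambda>x. caputo \<alpha> (\<lambda>s. u s x) t)"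
        have si: "set_integrable lborel {0<..<t} (\<lambda>s. (t - s) powr (- \<alpha>) * d' p s)" if "p \<in> P" for p
          using elim(3) t that by blast
        have Q: "Q x = (\<Sum>b\<in>B. (g b t - ev b * l2_inner \<Omega> (u t) b) * b x)" for x
        proof -
          have "Q x = Laph \<Omega> \<T> (u t) x + Ph \<Omega> \<T> (f t) x" using elim(1) t unfolding Q_def by (simp add: algebra_simps)
          also have "\<dots> = (\<Sum>b\<in>B. - (ev b * l2_inner \<Omega> (u t) b) * b x) + (\<Sum>b\<in>B. g b t * b x)"
            using laplacian[OF uX, of t] elim(2) t by simp
          finally show ?thesis by (simp add: sum.distrib[symmetric] algebra_simps)
        qed
        have "Q p = 1 / Gamma (1 - \<alpha>) * (LBINT s:{0<..<t}. (t - s) powr (- \<alpha>) * d' p s)" if p: "p \<in> P" for p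
        proof -
          have "AE s in lebesgue. s \<in> {0<..<t} \<longrightarrow> (t - s) powr (- \<alpha>) * d p s = (t - s) powr (- \<alpha>) * d' p s"
            using d'(1)[of p] by eventually_elim auto
          from lebesgue_integral_eq_LBINT(2)[OF _ this si[OF p]]
          show ?thesis unfolding Q_def caputo_def d_def by simp
        qed
        then have "(\<Sum>p\<in>P. w b p * Q p) = 1 / Gamma (1 - \<alpha>) * (\<Sum>p\<in>P. w b p * (LBINT s:{0<..<t}. (t - s) powr (- \<alpha>) * d' p s))"
          by (simp add: sum_distrib_left mult.left_commute)
        also have "(\<Sum>p\<in>P. w b p * (LBINT s:{0<..<t}. (t - s) powr (- \<alpha>) * d' p s))
            = (LBINT s:{0<..<t}. (\<Sum>p\<in>P. w b p * ((t - s) powr (- \<alpha>) * d' p s)))"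
          by (rule set_integral_weighted_sum(2)[where h = "\<lambda>p s. (t - s) powr (- \<alpha>) * d' p s" and k = "w b", OF point_values(1) si, symmetric])
        also have "(\<lambda>s. \<Sum>p\<in>P. w b p * ((t - s) powr (- \<alpha>) * d' p s)) = (\<lambda>s. (t - s) powr (- \<alpha>) * c' s)"
          unfolding c'_def by (simp add: sum_distrib_left mult.left_commute)
        finally have "1 / Gamma (1 - \<alpha>) * (LBINT s:{0<..<t}. (t - s) powr (- \<alpha>) * c' s) = g b t - ev b * c t"
          using coefficient_from_point_values[OF Q b] unfolding c_def by simp
        then show "1 / Gamma (1 - \<alpha>) * (LBINT s:{0<..<t}. (t - s) powr (- \<alpha>) * c' s) + ev b * c t = g b t" by simp
      qed
    qed
  qed
  then show ?thesis unfolding c_def .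
qed

text \<open>
  By continuity of the solution the time integral is differentiable, so its Caputo derivative is
  the fractional integral of the solution itself; the coefficient satisfies the scalar equation in
  integrated form.
\<close>

lemma integrated_coefficient:
  assumes \<alpha>: "0 < \<alpha>" "\<alpha> < 1" and u0: "Ph \<Omega> \<T> u0 = (\<lambda>x. 0)"
    and u: "Ph_integrated \<Omega> \<T> \<alpha> f u0 u" and b: "b \<in> B" and t0: "t0 > 0"
  shows "l2_inner \<Omega> (u t0) b = (LBINT x. kap \<alpha> (ev b) x * mode (g b) x t0)"
proof -
  have uX: "u t \<in> Xh \<Omega> \<T>" if "t \<ge> 0" for t using u that unfolding Ph_integrated_def by blast
  have uc: "continuous_on {0<..} (\<lambda>s. u s p)" for p using u unfolding Ph_integrated_def by blast
  have ui: "set_integrable lborel {0<..<t} (\<lambda>s. u s p)" if "t > 0" for t p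
    using u that unfolding Ph_integrated_def by (intro set_integrable_continuous_lborel[OF uc]) blast
  define c where "c = (\<lambda>b t. l2_inner \<Omega> (u t) b)"
  have cP: "c b t = (\<Sum>p\<in>P. w b p * u t p)" if "t > 0" "b \<in> B" for t b
    unfolding c_def using point_values(2)[OF uX that(2), of t] that by simp
  have cc: "continuous_on {0<..} (c b)" if "b \<in> B" for b
  proof -
    have "continuous_on {0<..} (\<lambda>t. \<Sum>p\<in>P. w b p * u t p)" by (intro continuous_intros uc)
    then show ?thesis by (rule continuous_on_eq) (simp add: cP that)
  qed
  have cI: "set_integrable lborel {0<..<t} (c b) \<and> (LBINT s:{0<..<t}. c b s) = (\<Sum>p\<in>P. w b p * (LBINT s:{0<..<t}. u s p))" if "t > 0" "b \<in> B" for t b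
  proof -
    have e: "(\<lambda>s. indicator {0<..<t} s *\<^sub>R c b s) = (\<lambda>s. indicator {0<..<t} s *\<^sub>R (\<Sum>p\<in>P. w b p * u s p))"
      using cP that by (auto simp: indicator_def)
    show ?thesis
      using set_integral_weighted_sum[where h = "\<lambda>p s. u s p" and k = "w b", OF point_values(1) ui[OF that(1)]]
      unfolding set_integrable_def set_lebesgue_integral_def e by blast
  qed
  have U: "time_integral u t x = (LBINT s:{0<..<t}. u s x)" if "t > 0" for t x
    unfolding time_integral_def by (rule lebesgue_integral_eq_LBINT(2)) (use ui that in auto)
  have Ub: "time_integral u t = (\<lambda>x. \<Sum>b\<in>B. (LBINT s:{0<..<t}. c b s) * b x)" if t: "t > 0" for t
  proof
    fix x
    have e: "(\<lambda>s. indicator {0<..<t} s *\<^sub>R u s x) = (\<lambda>s. indicator {0<..<t} s *\<^sub>R (\<Sum>b\<in>B. b x * c b s))"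
    proof
      fix s
      show "indicator {0<..<t} s *\<^sub>R u s x = indicator {0<..<t} s *\<^sub>R (\<Sum>b\<in>B. b x * c b s)"
      proof (cases "s \<in> {0<..<t}")
        case True
        then have "u s x = (\<Sum>b\<in>B. l2_inner \<Omega> (u s) b * b x)" using fun_cong[OF expand[OF uX, of s], of x] by simp
        then show ?thesis by (simp add: c_def mult.commute)
      qed simp
    qed
    show "time_integral u t x = (\<Sum>b\<in>B. (LBINT s:{0<..<t}. c b s) * b x)"
      unfolding U[OF t] set_lebesgue_integral_def e
      using set_integral_weighted_sum(2)[where h = c and k = "\<lambda>b. b x", OF basis(1) cI[OF t, THEN conjunct1]]
      unfolding set_lebesgue_integral_def by (simp add: mult.commute)
  qed
  have eq: "caputo \<alpha> (\<lambda>s. time_integral u s x) t - Laph \<Omega> \<T> (time_integral u t) x = time_integral (\<lambda>s. Ph \<Omega> \<T> (f s)) t x" if "t > 0" for t x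
    using u that u0 unfolding Ph_integrated_def by simp
  have dU: "deriv (\<lambda>s. time_integral u s p) s = u s p" if s: "s > 0" for s p
  proof (rule DERIV_imp_deriv)
    show "((\<lambda>s. time_integral u s p) has_field_derivative u s p) (at s)"
      by (rule has_field_derivative_transform_within_open[OF set_integral_has_derivative[OF uc ui s], of "{0<..}"])
         (use s in \<open>auto simp: U\<close>)
  qed
  have "c b t0 = (LBINT x. kap \<alpha> (ev b) x * mode (g b) x t0)"
  proof (rule volterra_solution[OF \<alpha> basis(2)[OF b] \<mu> source(1)[OF b] source(2)[OF b] _ _ _ t0])
    show "continuous_on {0<..} (c b)" by (rule cc[OF b])
    show "set_integrable lborel {0<..<t} (c b)" if "t > 0" for t using cI[OF that b] by blast
    have "AE t in lborel. \<forall>p\<in>P. 0 < t \<longrightarrow> set_integrable lborel {0<..<t} (\<lambda>s. (t - s) powr (- \<alpha>) * u s p)"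
      by (rule AE_finite_all[OF point_values(1), THEN iffD2]) (use AE_singular_convolution_integrable[OF \<alpha> ui] in blast)
    then show "AE t in lborel. 0 < t \<longrightarrow> 1 / Gamma (1 - \<alpha>) * (LBINT s:{0<..<t}. (t - s) powr (- \<alpha>) * c b s)
        + ev b * (LBINT s:{0<..<t}. c b s) = (LBINT s:{0<..<t}. g b s)"
    proof eventually_elim
      case (elim t)
      show ?case
      proof
        assume t: "0 < t"
        define Q where "Q = (\<lambda>x. caputo \<alpha> (\<lambda>s. time_integral u s x) t)"
        have si: "set_integrable lborel {0<..<t} (\<lambda>s. (t - s) powr (- \<alpha>) * u s p)" if "p \<in> P" for p
          using elim t that by blast
        have Q: "Q x = (\<Sum>b\<in>B. ((LBINT s:{0<..<t}. g b s) - ev b * (LBINT s:{0<..<t}. c b s)) * b x)" for x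
        proof -
          have "Q x = Laph \<Omega> \<T> (time_integral u t) x + time_integral (\<lambda>s. Ph \<Omega> \<T> (f s)) t x"
            using eq[OF t, of x] unfolding Q_def by simp
          also have "Laph \<Omega> \<T> (time_integral u t) x = (\<Sum>b\<in>B. - (ev b * (LBINT s:{0<..<t}. c b s)) * b x)"
            unfolding Ub[OF t] laplacian[OF combination] by (intro sum.cong refl) (simp add: coefficient)
          also have "time_integral (\<lambda>s. Ph \<Omega> \<T> (f s)) t x = (\<Sum>b\<in>B. (LBINT s:{0<..<t}. g b s) * b x)"
            by (rule projected_source_integral[OF t])
          finally show ?thesis by (simp add: sum.distrib[symmetric] algebra_simps)
        qed
        have "Q p = 1 / Gamma (1 - \<alpha>) * (LBINT s:{0<..<t}. (t - s) powr (- \<alpha>) * u s p)" if p: "p \<in> P" for p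
        proof -
          have "AE s in lebesgue. s \<in> {0<..<t} \<longrightarrow> (t - s) powr (- \<alpha>) * deriv (\<lambda>s. time_integral u s p) s = (t - s) powr (- \<alpha>) * u s p"
            using dU by (intro AE_I2) auto
          from lebesgue_integral_eq_LBINT(2)[OF _ this si[OF p]]
          show ?thesis unfolding Q_def caputo_def by simp
        qed
        then have "(\<Sum>p\<in>P. w b p * Q p) = 1 / Gamma (1 - \<alpha>) * (\<Sum>p\<in>P. w b p * (LBINT s:{0<..<t}. (t - s) powr (- \<alpha>) * u s p))"
          by (simp add: sum_distrib_left mult.left_commute)
        also have "(\<Sum>p\<in>P. w b p * (LBINT s:{0<..<t}. (t - s) powr (- \<alpha>) * u s p))
            = (LBINT s:{0<..<t}. (\<Sum>p\<in>P. w b p * ((t - s) powr (- \<alpha>) * u s p)))"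
          by (rule set_integral_weighted_sum(2)[where h = "\<lambda>p s. (t - s) powr (- \<alpha>) * u s p" and k = "w b", OF point_values(1) si, symmetric])
        also have "\<dots> = (LBINT s:{0<..<t}. (t - s) powr (- \<alpha>) * c b s)"
          unfolding set_lebesgue_integral_def
        proof (intro Bochner_Integration.integral_cong refl)
          fix s
          show "indicator {0<..<t} s *\<^sub>R (\<Sum>p\<in>P. w b p * ((t - s) powr (- \<alpha>) * u s p)) = indicator {0<..<t} s *\<^sub>R ((t - s) powr (- \<alpha>) * c b s)"
            using cP[OF _ b, of s] by (auto simp: indicator_def sum_distrib_left mult.left_commute)
        qed
        finally have "1 / Gamma (1 - \<alpha>) * (LBINT s:{0<..<t}. (t - s) powr (- \<alpha>) * c b s) = (LBINT s:{0<..<t}. g b s) - ev b * (LBINT s:{0<..<t}. c b s)"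
          using coefficient_from_point_values[OF Q b] by simp
        then show "1 / Gamma (1 - \<alpha>) * (LBINT s:{0<..<t}. (t - s) powr (- \<alpha>) * c b s)
          + ev b * (LBINT s:{0<..<t}. c b s) = (LBINT s:{0<..<t}. g b s)" by simp
      qed
    qed
  qed
  then show ?thesis unfolding c_def .
qed

text \<open>
  Comparing coefficients in the scheme yields a scalar recurrence for each basis function.
\<close>

lemma scheme_coefficient:
  assumes \<alpha>: "0 < \<alpha>" "\<alpha> < 1" and u0: "Ph \<Omega> \<T> u0 = (\<lambda>x. 0)" and T: "T > 0" and N: "N \<ge> 1"
    and s: "glbe_scheme \<Omega> \<T> \<alpha> T N f u0 U u" and b: "b \<in> B" and n: "n \<in> {1..N}" and \<tau>: "\<tau> = T / real N"
  shows "u n \<in> Xh \<Omega> \<T>"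
    and "integrable lborel (\<lambda>x. kap \<alpha> (ev b) x * mode_step \<tau> (\<lambda>j. LBINT s:{0<..<real j * \<tau>}. g b s) x n)"
    and "l2_inner \<Omega> (u n) b = (LBINT x. kap \<alpha> (ev b) x * mode_step \<tau> (\<lambda>j. LBINT s:{0<..<real j * \<tau>}. g b s) x n)"
proof -
  have \<tau>0: "\<tau> > 0" unfolding \<tau> using T N by simp
  define c where "c = (\<lambda>b m. l2_inner \<Omega> (U m) b)"
  have U0: "U 0 = (\<lambda>x. 0)" using s unfolding glbe_scheme_def Let_def by blast
  have UX: "U m \<in> Xh \<Omega> \<T>" if "m \<in> {1..N}" for m using s that unfolding glbe_scheme_def Let_def by blast
  show uX: "u n \<in> Xh \<Omega> \<T>" using s n unfolding glbe_scheme_def Let_def by blast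
  have eq: "\<tau> powr (- \<alpha>) * (\<Sum>j=0..m. glbe_weight \<alpha> j * U (m - j) x) =
      Laph \<Omega> \<T> (U m) x + time_integral (\<lambda>s. Ph \<Omega> \<T> (f s)) (real m * \<tau>) x" if "m \<in> {1..N}" for m x
    using s that u0 unfolding glbe_scheme_def Let_def \<tau> by simp
  have un: "u n x = (U n x - U (n - 1) x) / \<tau>" for x using s n unfolding glbe_scheme_def Let_def \<tau> by blast
  have c0: "c b 0 = 0" for b unfolding c_def U0 l2_inner_def by simp
  have Ue: "U m x = (\<Sum>b\<in>B. c b m * b x)" if "m \<le> N" for m x
  proof (cases "m = 0")
    case False
    then show ?thesis using fun_cong[OF expand[OF UX, of m], of x] that unfolding c_def by simp
  qed (simp add: U0 c0)
  have ceq: "\<tau> powr (- \<alpha>) * (\<Sum>j=0..m. glbe_weight \<alpha> j * c b (m - j)) + ev b * c b m = (LBINT s:{0<..<real m * \<tau>}. g b s)"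
    if m: "m \<in> {1..N}" for m
  proof -
    have tm: "real m * \<tau> > 0" using m \<tau>0 by simp
    have "\<tau> powr (- \<alpha>) * (\<Sum>j=0..m. glbe_weight \<alpha> j * c b (m - j)) = - (ev b * c b m) + (LBINT s:{0<..<real m * \<tau>}. g b s)"
    proof (rule coefficients_unique[OF _ b])
      fix x
      have "(\<Sum>b\<in>B. \<tau> powr (- \<alpha>) * (\<Sum>j=0..m. glbe_weight \<alpha> j * c b (m - j)) * b x)
          = \<tau> powr (- \<alpha>) * (\<Sum>j=0..m. \<Sum>b\<in>B. glbe_weight \<alpha> j * (c b (m - j) * b x))"
        unfolding sum.swap[of _ B] by (simp add: sum_distrib_left sum_distrib_right mult_ac)
      also have "\<dots> = \<tau> powr (- \<alpha>) * (\<Sum>j=0..m. glbe_weight \<alpha> j * U (m - j) x)"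
      proof (intro arg_cong[where f = "\<lambda>z. \<tau> powr (- \<alpha>) * z"] sum.cong refl)
        fix j
        have "m - j \<le> N" using m by auto
        from Ue[OF this, of x] show "(\<Sum>b\<in>B. glbe_weight \<alpha> j * (c b (m - j) * b x)) = glbe_weight \<alpha> j * U (m - j) x"
          by (simp only: sum_distrib_left)
      qed
      also have "\<dots> = Laph \<Omega> \<T> (U m) x + time_integral (\<lambda>s. Ph \<Omega> \<T> (f s)) (real m * \<tau>) x" by (rule eq[OF m])
      also have "\<dots> = (\<Sum>b\<in>B. - (ev b * c b m) * b x) + (\<Sum>b\<in>B. (LBINT s:{0<..<real m * \<tau>}. g b s) * b x)"
        unfolding laplacian[OF UX[OF m]] projected_source_integral[OF tm] c_def ..
      also have "\<dots> = (\<Sum>b\<in>B. (- (ev b * c b m) + (LBINT s:{0<..<real m * \<tau>}. g b s)) * b x)"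
        by (simp only: sum.distrib[symmetric] distrib_right)
      finally show "(\<Sum>b\<in>B. \<tau> powr (- \<alpha>) * (\<Sum>j=0..m. glbe_weight \<alpha> j * c b (m - j)) * b x)
          = (\<Sum>b\<in>B. (- (ev b * c b m) + (LBINT s:{0<..<real m * \<tau>}. g b s)) * b x)" .
    qed
    then show ?thesis by simp
  qed
  have F0: "(LBINT s:{0<..<real 0 * \<tau>}. g b s) = 0" by (simp add: set_lebesgue_integral_def)
  note M = mode_step_superposition[OF \<alpha> basis(2)[OF b] \<tau>0, of "\<lambda>j. LBINT s:{0<..<real j * \<tau>}. g b s" "c b" "glbe_weight \<alpha>", OF F0 c0 glbe_weight_sums ceq n]
  show "integrable lborel (\<lambda>x. kap \<alpha> (ev b) x * mode_step \<tau> (\<lambda>j. LBINT s:{0<..<real j * \<tau>}. g b s) x n)" by (rule M(1))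
  have "l2_inner \<Omega> (u n) b = (c b n - c b (n - 1)) / \<tau>"
  proof (rule coefficients_unique[OF _ b])
    fix x
    have "(\<Sum>b\<in>B. l2_inner \<Omega> (u n) b * b x) = u n x" using fun_cong[OF expand[OF uX], of x] .
    also have "\<dots> = (\<Sum>b\<in>B. (c b n - c b (n - 1)) / \<tau> * b x)"
    proof -
      have "n \<le> N" "n - 1 \<le> N" using n by auto
      then show ?thesis unfolding un by (simp add: Ue sum_subtractf[symmetric] sum_divide_distrib left_diff_distrib diff_divide_distrib)
    qed
    finally show "(\<Sum>b\<in>B. l2_inner \<Omega> (u n) b * b x) = (\<Sum>b\<in>B. (c b n - c b (n - 1)) / \<tau> * b x)" .
  qed
  then show "l2_inner \<Omega> (u n) b = (LBINT x. kap \<alpha> (ev b) x * mode_step \<tau> (\<lambda>j. LBINT s:{0<..<real j * \<tau>}. g b s) x n)"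
    using M(2) by simp
qed

text \<open>
  The error coefficient belonging to \<open>b\<close> is the superposition over \<open>x\<close>,
  with weight \<open>kap \<alpha> (ev b) x\<close>, of the backward Euler errors \<open>err b
  x\<close>. These are linear in the source, so a combination of them is the backward Euler error
  for the source tested with the combined function, and \<open>mode_error\<close> applies to it
  with the constant \<open>M\<close> times the norm of that function. The duality argument
  concludes, and the integral over \<open>x\<close> contributes \<open>t powr (\<alpha> -
  1)\<close>.
\<close>

lemma error_le:
  assumes \<alpha>: "0 < \<alpha>" "\<alpha> < 1" and u0: "Ph \<Omega> \<T> u0 = (\<lambda>x. 0)" and T: "T > 0" and N: "N \<ge> 1"
    and uh: "Ph_solution \<Omega> \<T> \<alpha> f u0 uh" and s: "glbe_scheme \<Omega> \<T> \<alpha> T N f u0 U u"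
    and n: "n \<in> {1..N}" and \<tau>: "\<tau> = T / real N" and t: "t = real n * \<tau>" and M: "M \<ge> 0"
    and regular: "\<And>k. \<exists>G G'. (\<forall>s>0. (G has_real_derivative G' s) (at s)) \<and>
        (\<forall>s>0. \<bar>G s\<bar> \<le> M * sqrt (\<Sum>b\<in>B. (k b)\<^sup>2) * s powr \<mu>) \<and>
        (\<forall>s>0. \<bar>G' s\<bar> \<le> M * sqrt (\<Sum>b\<in>B. (k b)\<^sup>2) * s powr (\<mu> - 1)) \<and>
        (\<forall>s>0. G s = (\<Sum>b\<in>B. k b * g b s))"
  shows "l2_norm \<Omega> (\<lambda>x. uh t x - u n x)
     \<le> error_constant \<alpha> \<mu> * M / (pi * sin (pi * \<alpha>)) * kernel_mass \<alpha> * (t powr (\<alpha> + \<mu> - 1) * \<tau>)"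
proof -
  have \<tau>0: "\<tau> > 0" unfolding \<tau> using T N by simp
  have t0: "t > 0" unfolding t using n \<tau>0 by simp
  define F where "F = (\<lambda>b j. LBINT s:{0<..<real j * \<tau>}. g b s)"
  define err where "err = (\<lambda>b x. mode (g b) x t - mode_step \<tau> (F b) x n)"
  define e where "e = (\<lambda>b. l2_inner \<Omega> (uh t) b - l2_inner \<Omega> (u n) b)"
  define W where "W = (\<lambda>x. (1 + exp x * t) powr (- (1 - \<alpha> / 2)))"
  have uhX: "uh t \<in> Xh \<Omega> \<T>" using uh t0 unfolding Ph_solution_def Ph_classical_def Ph_integrated_def by auto
  have unX: "u n \<in> Xh \<Omega> \<T>"
    using s n unfolding glbe_scheme_def Let_def by blast
  note uc = scheme_coefficient[OF \<alpha> u0 T N s _ n \<tau>]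
  have uhc: "l2_inner \<Omega> (uh t) b = (LBINT x. kap \<alpha> (ev b) x * mode (g b) x t)" if "b \<in> B" for b
    using uh classical_coefficient[OF \<alpha> u0 _ that t0] integrated_coefficient[OF \<alpha> u0 _ that t0] unfolding Ph_solution_def by blast
  have modeI: "integrable lborel (\<lambda>x. kap \<alpha> (ev b) x * mode (g b) x t)" if b: "b \<in> B" for b
    by (rule mode_superposition_integrable[OF \<alpha> basis(2)[OF b] \<mu> source(1)[OF b] source(2)[OF b] t0])
  have errI: "integrable lborel (\<lambda>x. kap \<alpha> (ev b) x * err b x)" and errE: "e b = (LBINT x. kap \<alpha> (ev b) x * err b x)" if b: "b \<in> B" for b
    using modeI[OF b] uc(2)[OF b] uhc[OF b] uc(3)[OF b] unfolding err_def F_def e_def right_diff_distrib by simp_all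
  have bound: "\<bar>\<Sum>b\<in>B. k b * err b x\<bar> \<le> (error_constant \<alpha> \<mu> * M * (\<tau> * t powr \<mu>)) * sqrt (\<Sum>b\<in>B. (k b)\<^sup>2) * W x" for k x
  proof -
    obtain G G' where G: "\<And>s. s > 0 \<Longrightarrow> (G has_real_derivative G' s) (at s)"
        "\<And>s. s > 0 \<Longrightarrow> \<bar>G s\<bar> \<le> M * sqrt (\<Sum>b\<in>B. (k b)\<^sup>2) * s powr \<mu>"
        "\<And>s. s > 0 \<Longrightarrow> \<bar>G' s\<bar> \<le> M * sqrt (\<Sum>b\<in>B. (k b)\<^sup>2) * s powr (\<mu> - 1)"
      and Gs: "\<And>s. s > 0 \<Longrightarrow> G s = (\<Sum>b\<in>B. k b * g b s)"
      using regular[of k] by blast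
    have "mode G x t = mode (\<lambda>s. \<Sum>b\<in>B. k b * g b s) x t" by (rule mode_cong) (rule Gs)
    also have "\<dots> = (\<Sum>b\<in>B. k b * mode (g b) x t)"
      by (rule mode_weighted_sum[OF basis(1)])
         (rule mode_integrable[OF \<alpha> order_refl \<mu> source(1) source(2) t0])
    finally have mG: "mode G x t = (\<Sum>b\<in>B. k b * mode (g b) x t)" .
    have FG: "(\<Sum>b\<in>B. k b * F b j) = (LBINT s:{0<..<real j * \<tau>}. G s)" for j
    proof -
      have "set_integrable lborel {0<..<real j * \<tau>} (g b)" if "b \<in> B" for b
        using source_set_integrable[OF that, of "real j * \<tau>"] \<tau>0 by (cases "j = 0") (auto simp: set_integrable_def)
      from set_integral_weighted_sum(2)[where h = g and k = k, OF basis(1) this]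
      have "(\<Sum>b\<in>B. k b * F b j) = (LBINT s:{0<..<real j * \<tau>}. (\<Sum>b\<in>B. k b * g b s))" unfolding F_def by simp
      also have "\<dots> = (LBINT s:{0<..<real j * \<tau>}. G s)"
        unfolding set_lebesgue_integral_def by (intro Bochner_Integration.integral_cong refl) (auto simp: indicator_def Gs)
      finally show ?thesis .
    qed
    have "(\<Sum>b\<in>B. k b * err b x) = mode G x (real n * \<tau>) - mode_step \<tau> (\<lambda>j. \<Sum>b\<in>B. k b * F b j) x n"
      unfolding err_def mode_step_weighted_sum right_diff_distrib sum_subtractf mG[unfolded t, symmetric] t ..
    also have "\<bar>\<dots>\<bar> \<le> error_constant \<alpha> \<mu> * (M * sqrt (\<Sum>b\<in>B. (k b)\<^sup>2))
       * (\<tau> * (real n * \<tau>) powr \<mu> * (1 + exp x * (real n * \<tau>)) powr (- (1 - \<alpha> / 2)))"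
      unfolding error_constant_def
      by (rule mode_error[OF \<mu> G _ _ \<tau>0 _ FG]) (use \<alpha> n in auto)
    finally show ?thesis unfolding W_def t by (simp add: mult_ac)
  qed
  have K: "error_constant \<alpha> \<mu> * M * (\<tau> * t powr \<mu>) \<ge> 0"
    unfolding error_constant_def using \<alpha> \<mu> M \<tau>0
    by (intro mult_nonneg_nonneg add_nonneg_nonneg) auto
  have a: "0 < 1 - \<alpha>" "1 - \<alpha> < 1 - \<alpha> / 2" using \<alpha> by auto
  have "(\<lambda>x. uh t x - u n x) = (\<lambda>x. \<Sum>b\<in>B. e b * b x)"
  proof
    fix x
    have "uh t x = (\<Sum>b\<in>B. l2_inner \<Omega> (uh t) b * b x)" "u n x = (\<Sum>b\<in>B. l2_inner \<Omega> (u n) b * b x)"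
      using fun_cong[OF expand[OF uhX], of x] fun_cong[OF expand[OF unX], of x] by simp_all
    then show "uh t x - u n x = (\<Sum>b\<in>B. e b * b x)"
      unfolding e_def left_diff_distrib sum_subtractf by simp
  qed
  then have "l2_norm \<Omega> (\<lambda>x. uh t x - u n x) = sqrt (\<Sum>b\<in>B. (e b)\<^sup>2)" by (simp only: combination_norm)
  also have "\<dots> \<le> error_constant \<alpha> \<mu> * M * (\<tau> * t powr \<mu>) / (pi * sin (pi * \<alpha>)) * (LBINT x. exp ((1 - \<alpha>) * x) * W x)"
  proof (rule superposition_norm_le[OF \<alpha> basis errI errE K _ _ bound])
    show "W x \<ge> 0" for x unfolding W_def by simp
    show "integrable lborel (\<lambda>x. exp ((1 - \<alpha>) * x) * W x)" unfolding W_def by (rule scaled_kernel_integral(1)[OF a t0])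
  qed
  also have "(LBINT x. exp ((1 - \<alpha>) * x) * W x) = t powr (- (1 - \<alpha>)) * kernel_mass \<alpha>"
    unfolding W_def kernel_mass_def by (rule scaled_kernel_integral(2)[OF a t0])
  also have "error_constant \<alpha> \<mu> * M * (\<tau> * t powr \<mu>) / (pi * sin (pi * \<alpha>)) * (t powr (- (1 - \<alpha>)) * kernel_mass \<alpha>)
     = error_constant \<alpha> \<mu> * M / (pi * sin (pi * \<alpha>)) * kernel_mass \<alpha> * (t powr (\<mu> + - (1 - \<alpha>)) * \<tau>)"
    unfolding powr_add by simp
  also have "\<mu> + - (1 - \<alpha>) = \<alpha> + \<mu> - 1" by simp
  finally show ?thesis .
qed

end

theorem theorem4p1:
  fixes \<Omega> :: "'a::euclidean_space set"
    and \<alpha> \<mu> \<theta> T c\<^sub>f \<kappa> :: real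
    and f :: "real \<Rightarrow> 'a \<Rightarrow> real" and u0 :: "'a \<Rightarrow> real"
  assumes "DIM('a) = 1 \<or> DIM('a) = 2" and "open \<Omega>" and "T > 0"
    and "0 < \<alpha>" "\<alpha> < 1" and "-1 < \<mu>" "\<mu> < 0"
    and "pi / 2 < \<theta>" "\<theta> < pi"
    and "\<forall>x\<in>\<Omega>. u0 x = 0"
    and "assumption_A \<Omega> T \<mu> \<theta> c\<^sub>f f"
  shows "\<exists>c>0. \<forall>h \<T> N uh U u n.
           regular_triangulation \<kappa> \<Omega> h \<T> \<and> N \<ge> 1 \<and>
           Ph_solution \<Omega> \<T> \<alpha> f u0 uh \<and>
           glbe_scheme \<Omega> \<T> \<alpha> T N f u0 U u \<and>
           1 \<le> n \<and> n \<le> N \<longrightarrow>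
           (let \<tau> = T / real N; t = real n * \<tau> in
              l2_norm \<Omega> (\<lambda>x. uh t x - u n x) \<le>
                c * (t powr (\<alpha> + \<mu> - 1) * \<tau> + t powr (\<alpha> - 2) * \<tau> powr (2 + \<mu>)))"
proof -
  note \<alpha> = assms(4,5) and \<mu> = assms(6,7) and \<theta> = assms(8,9) and A = assms(11)
  \<comment> \<open>A representative of the tested source is chosen once for every test
  function, before any mesh is fixed.\<close>
  define Q where "Q = (\<lambda>\<phi> g g'. (\<forall>s>0. (g has_real_derivative g' s) (at s)) \<and>
      (\<forall>s>0. \<bar>g s\<bar> \<le> source_constant \<theta> \<mu> * (c\<^sub>f * l2_norm \<Omega> \<phi>) * s powr \<mu>) \<and>
      (\<forall>s>0. \<bar>g' s\<bar> \<le> source_constant \<theta> \<mu> * (c\<^sub>f * l2_norm \<Omega> \<phi>) * s powr (\<mu> - 1)) \<and>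
      (AE t in lborel. 0 < t \<longrightarrow> l2_inner \<Omega> (f t) \<phi> = g t))"
  have "\<exists>g g'. Q \<phi> g g'" if \<phi>: "\<phi> \<in> L2 \<Omega>" for \<phi>
  proof (rule tested_source[OF assms(2) \<mu> \<theta> A \<phi>])
    fix g g' assume "\<And>s. s > 0 \<Longrightarrow> (g has_real_derivative g' s) (at s)"
      "\<And>s. s > 0 \<Longrightarrow> \<bar>g s\<bar> \<le> source_constant \<theta> \<mu> * (c\<^sub>f * l2_norm \<Omega> \<phi>) * s powr \<mu>"
      "\<And>s. s > 0 \<Longrightarrow> \<bar>g' s\<bar> \<le> source_constant \<theta> \<mu> * (c\<^sub>f * l2_norm \<Omega> \<phi>) * s powr (\<mu> - 1)"
      "AE t in lborel. t > 0 \<longrightarrow> l2_inner \<Omega> (f t) \<phi> = g t"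
    then have "Q \<phi> g g'" unfolding Q_def by blast
    then show "\<exists>g g'. Q \<phi> g g'" by blast
  qed
  then obtain g g' where Q: "\<And>\<phi>. \<phi> \<in> L2 \<Omega> \<Longrightarrow> Q \<phi> (g \<phi>) (g' \<phi>)" by metis
  have gd: "(g \<phi> has_real_derivative g' \<phi> s) (at s)"
    and gA: "\<bar>g \<phi> s\<bar> \<le> source_constant \<theta> \<mu> * (c\<^sub>f * l2_norm \<Omega> \<phi>) * s powr \<mu>"
    and gA': "\<bar>g' \<phi> s\<bar> \<le> source_constant \<theta> \<mu> * (c\<^sub>f * l2_norm \<Omega> \<phi>) * s powr (\<mu> - 1)"
    if "\<phi> \<in> L2 \<Omega>" "s > 0" for \<phi> s using Q[OF that(1)] that(2) unfolding Q_def by blast+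
  have gae: "AE t in lborel. 0 < t \<longrightarrow> l2_inner \<Omega> (f t) \<phi> = g \<phi> t" if "\<phi> \<in> L2 \<Omega>" for \<phi>
    using Q[OF that] unfolding Q_def by blast
  have gc: "continuous_on {0<..} (g \<phi>)" if "\<phi> \<in> L2 \<Omega>" for \<phi>
    using gd[OF that] by (intro continuous_at_imp_continuous_on) (auto intro: DERIV_isCont)
  have gi: "set_integrable lborel {0<..<t} (g \<phi>)" if "\<phi> \<in> L2 \<Omega>" "t > 0" for \<phi> t
    by (rule g_integrable[OF \<alpha> order_refl \<mu> gc[OF that(1)] gA[OF that(1)] that(2)])
  have fL2: "AE t in lborel. 0 < t \<longrightarrow> f t \<in> L2 \<Omega>" by (rule assumption_A_pointwise_L2[OF A])
  have c0: "c\<^sub>f \<ge> 0" by (rule assumption_A_constant_nonneg[OF A \<theta>(1)])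
  define M where "M = source_constant \<theta> \<mu> * c\<^sub>f"
  have M0: "M \<ge> 0" unfolding M_def source_constant_def Let_def
    using c0 ray_moment_nonneg by (intro mult_nonneg_nonneg add_nonneg_nonneg) auto
  define C where "C = error_constant \<alpha> \<mu> * M / (pi * sin (pi * \<alpha>)) * kernel_mass \<alpha>"
  have C0: "C \<ge> 0"
  proof -
    have "error_constant \<alpha> \<mu> \<ge> 0" unfolding error_constant_def using \<alpha> \<mu>
      by (intro mult_nonneg_nonneg add_nonneg_nonneg) auto
    moreover have "kernel_mass \<alpha> \<ge> 0" unfolding kernel_mass_def by (rule integral_nonneg_AE) simp
    moreover have "sin (pi * \<alpha>) \<ge> 0" using \<alpha> by (intro sin_ge_zero) auto
    ultimately show ?thesis unfolding C_def using M0 by simp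
  qed
  show ?thesis
  proof (intro exI[of _ "C + 1"] conjI allI impI)
    show "C + 1 > 0" using C0 by simp
    fix h \<T> N uh U u n
    assume H: "regular_triangulation \<kappa> \<Omega> h \<T> \<and> N \<ge> 1 \<and> Ph_solution \<Omega> \<T> \<alpha> f u0 uh \<and>
      glbe_scheme \<Omega> \<T> \<alpha> T N f u0 U u \<and> 1 \<le> n \<and> n \<le> N"
    then have tri: "regular_triangulation \<kappa> \<Omega> h \<T>" by blast
    show "let \<tau> = T / real N; t = real n * \<tau> in
        l2_norm \<Omega> (\<lambda>x. uh t x - u n x) \<le> (C + 1) * (t powr (\<alpha> + \<mu> - 1) * \<tau> + t powr (\<alpha> - 2) * \<tau> powr (2 + \<mu>))"
    proof (rule discrete_laplacian_eigenbasis[OF assms(2) tri])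
      fix B ev assume B: "finite B" "B \<subseteq> Xh \<Omega> \<T>" "\<And>b. b \<in> B \<Longrightarrow> ev b \<ge> 0"
        and E:
        "\<And>v. v \<in> Xh \<Omega> \<T> \<Longrightarrow> (\<lambda>x. \<Sum>b\<in>B. l2_inner \<Omega> v b * b x) = v"
        "\<And>k. (\<lambda>x. \<Sum>b\<in>B. k b * b x) \<in> Xh \<Omega> \<T>"
        "\<And>k b. b \<in> B \<Longrightarrow> l2_inner \<Omega> (\<lambda>x. \<Sum>b\<in>B. k b * b x) b = k b"
        "\<And>k. l2_norm \<Omega> (\<lambda>x. \<Sum>b\<in>B. k b * b x) = sqrt (\<Sum>b\<in>B. (k b)\<^sup>2)"
        "\<And>g. g \<in> L2 \<Omega> \<Longrightarrow> Ph \<Omega> \<T> g = (\<lambda>x. \<Sum>b\<in>B. l2_inner \<Omega> g b * b x)"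
        "\<And>v. v \<in> Xh \<Omega> \<T> \<Longrightarrow> Laph \<Omega> \<T> v = (\<lambda>x. \<Sum>b\<in>B. - (ev b * l2_inner \<Omega> v b) * b x)"
      have XL: "v \<in> L2 \<Omega>" if "v \<in> Xh \<Omega> \<T>" for v by (rule Xh_L2[OF assms(2) tri that])
      interpret ips: inner_product_functions "Xh \<Omega> \<T>" "l2_inner \<Omega>" "vertices \<T>"
        by (rule Xh_inner_product[OF assms(2) tri])
      have "\<exists>w. \<forall>v\<in>Xh \<Omega> \<T>. l2_inner \<Omega> v b = (\<Sum>p\<in>vertices \<T>. w p * v p)" if "b \<in> B" for b
      proof -
        have "l2_inner \<Omega> (\<lambda>x. u x + c * v x) b = l2_inner \<Omega> u b + c * l2_inner \<Omega> v b" if "u \<in> Xh \<Omega> \<T>" "v \<in> Xh \<Omega> \<T>" for u v c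
          using ips.ip_left[OF that, of b c] \<open>b \<in> B\<close> B(2) by blast
        from this show ?thesis
        proof (rule ips.functional_eq_point_values[of "\<lambda>v. l2_inner \<Omega> v b"])
          fix w assume "\<And>v. v \<in> Xh \<Omega> \<T> \<Longrightarrow> l2_inner \<Omega> v b = (\<Sum>p\<in>vertices \<T>. w p * v p)"
          then show "\<exists>w. \<forall>v\<in>Xh \<Omega> \<T>. l2_inner \<Omega> v b = (\<Sum>p\<in>vertices \<T>. w p * v p)" by blast
        qed
      qed
      then obtain w where w: "\<And>b v. b \<in> B \<Longrightarrow> v \<in> Xh \<Omega> \<T> \<Longrightarrow> l2_inner \<Omega> v b = (\<Sum>p\<in>vertices \<T>. w b p * v p)" by metis
      have BL: "b \<in> L2 \<Omega>" if "b \<in> B" for b using XL B(2) that by blast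
      interpret spectral_semidiscretization \<Omega> \<T> B ev "vertices \<T>" w f g "\<lambda>\<phi>. source_constant \<theta> \<mu> * (c\<^sub>f * l2_norm \<Omega> \<phi>)" \<mu>
      proof
        show "\<bar>g b s\<bar> \<le> source_constant \<theta> \<mu> * (c\<^sub>f * l2_norm \<Omega> b) * s powr \<mu>" if "b \<in> B" "s > 0" for b s
          by (rule gA[OF BL[OF that(1)] that(2)])
        show "l2_inner \<Omega> v b = (\<Sum>p\<in>vertices \<T>. w b p * v p)" if "v \<in> Xh \<Omega> \<T>" "b \<in> B" for v b
          using that(2,1) by (rule w)
      qed (fact B(1), fact B(3), fact E(1), fact E(2), fact E(3), fact E(4), fact E(5), fact E(6), fact ips.finite_points, fact \<mu>(1), fact \<mu>(2),
          rule gc[OF BL], assumption, fact fL2, rule gae[OF BL], assumption)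
      define \<tau> where "\<tau> = T / real N"
      define t where "t = real n * \<tau>"
      \<comment> \<open>The initial value vanishes on the domain, hence so does its projection
      everywhere.\<close>
      have u0: "Ph \<Omega> \<T> u0 = (\<lambda>x. 0)"
      proof -
        have z: "l2_inner \<Omega> u0 b = 0" for b
          unfolding l2_inner_def using assms(10) by (intro integral_eq_zero_AE AE_I2) simp
        have "u0 \<in> L2 \<Omega>"
        proof -
          have "(\<lambda>x. 0) \<in> borel_measurable (lebesgue_on \<Omega>)" by simp
          then have "u0 \<in> borel_measurable (lebesgue_on \<Omega>)" by (rule measurable_cong[THEN iffD2, rotated]) (use assms(10) in simp)
          moreover have "integrable (lebesgue_on \<Omega>) (\<lambda>x. (norm (u0 x))\<^sup>2) = integrable (lebesgue_on \<Omega>) (\<lambda>x. 0 :: real)"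
            using assms(10) by (intro Bochner_Integration.integrable_cong refl) simp
          ultimately show ?thesis unfolding L2_def by simp
        qed
        from projection[OF this] show ?thesis by (simp add: z)
      qed
      have "l2_norm \<Omega> (\<lambda>x. uh t x - u n x) \<le> C * (t powr (\<alpha> + \<mu> - 1) * \<tau>)"
        unfolding C_def
      proof (rule error_le[OF \<alpha> u0 assms(3) _ _ _ _ \<tau>_def t_def M0])
        fix k
        define \<psi> where "\<psi> = (\<lambda>x. \<Sum>b\<in>B. k b * b x)"
        have \<psi>: "\<psi> \<in> L2 \<Omega>" unfolding \<psi>_def by (rule XL[OF combination])
        have n\<psi>: "source_constant \<theta> \<mu> * (c\<^sub>f * l2_norm \<Omega> \<psi>) = M * sqrt (\<Sum>b\<in>B. (k b)\<^sup>2)"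
          unfolding \<psi>_def combination_norm M_def by simp
        \<comment> \<open>The chosen representatives need not depend linearly on the test function
        by construction; they do almost everywhere, and then by continuity.\<close>
        have ae: "AE t in lborel. 0 < t \<longrightarrow> g \<psi> t = (\<Sum>b\<in>B. k b * g b t)"
        proof -
          have "AE t in lborel. \<forall>b\<in>B. 0 < t \<longrightarrow> l2_inner \<Omega> (f t) b = g b t"
            by (rule AE_finite_all[OF B(1), THEN iffD2]) (use gae[OF BL] in blast)
          with fL2 gae[OF \<psi>] show ?thesis
          proof eventually_elim
            case (elim t)
            show ?case
            proof
              assume t: "0 < t"
              have "g \<psi> t = l2_inner \<Omega> (f t) \<psi>" using elim(2) t by simp
              also have "\<dots> = (\<Sum>b\<in>B. k b * l2_inner \<Omega> (f t) b)"
              proof -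
                have i: "integrable (lebesgue_on \<Omega>) (\<lambda>x. k b * (f t x \<bullet> b x))" if "b \<in> B" for b
                  using L2_inner_integrable[OF _ BL[OF that], of "f t"] elim(1) t by simp
                have "f t x \<bullet> \<psi> x = (\<Sum>b\<in>B. k b * (f t x \<bullet> b x))" for x
                  unfolding \<psi>_def by (simp add: sum_distrib_left mult.left_commute)
                then show ?thesis unfolding l2_inner_def
                  using Bochner_Integration.integral_sum[of B "lebesgue_on \<Omega>", OF i] by (simp only: integral_mult_right_zero)
              qed
              also have "\<dots> = (\<Sum>b\<in>B. k b * g b t)" using elim(3) t by simp
              finally show "g \<psi> t = (\<Sum>b\<in>B. k b * g b t)" .
            qed
          qed
        qed
        have eq: "g \<psi> s = (\<Sum>b\<in>B. k b * g b s)" if "s > 0" for s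
        proof (rule AE_eq_continuous_imp_eq[OF gc[OF \<psi>] gi[OF \<psi>] _ _ ae that])
          show "continuous_on {0<..} (\<lambda>s. \<Sum>b\<in>B. k b * g b s)" using gc[OF BL] by (intro continuous_intros) auto
          show "set_integrable lborel {0<..<t} (\<lambda>s. \<Sum>b\<in>B. k b * g b s)" if "t > 0" for t
            by (rule set_integral_weighted_sum(1)[where h = g and k = k, OF B(1) gi[OF BL that]])
        qed
        show "\<exists>G G'. (\<forall>s>0. (G has_real_derivative G' s) (at s)) \<and>
          (\<forall>s>0. \<bar>G s\<bar> \<le> M * sqrt (\<Sum>b\<in>B. (k b)\<^sup>2) * s powr \<mu>) \<and>
          (\<forall>s>0. \<bar>G' s\<bar> \<le> M * sqrt (\<Sum>b\<in>B. (k b)\<^sup>2) * s powr (\<mu> - 1)) \<and>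
          (\<forall>s>0. G s = (\<Sum>b\<in>B. k b * g b s))"
          using gd[OF \<psi>] gA[OF \<psi>] gA'[OF \<psi>] eq unfolding n\<psi> by (intro exI[of _ "g \<psi>"] exI[of _ "g' \<psi>"]) simp
      qed (use H in auto)
      also have "\<dots> \<le> (C + 1) * (t powr (\<alpha> + \<mu> - 1) * \<tau> + t powr (\<alpha> - 2) * \<tau> powr (2 + \<mu>))"
        using C0 assms(3) unfolding \<tau>_def by (intro mult_mono) auto
      finally show "let \<tau> = T / real N; t = real n * \<tau> in
          l2_norm \<Omega> (\<lambda>x. uh t x - u n x) \<le> (C + 1) * (t powr (\<alpha> + \<mu> - 1) * \<tau> + t powr (\<alpha> - 2) * \<tau> powr (2 + \<mu>))"
        unfolding Let_def t_def \<tau>_def .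
    qed
  qed
qed

end
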